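(* Let $s\ge4$ and $\nu\ge2$, and let $\mathbb{X}=\{P_1,\dots,P_s\}\subseteq\mathbb{P}^2$ be a set of $s$ distinct $K$-rational points which lie on a non-singular conic $\mathcal{C}=\mathcal{Z}^+(C)$. Let $\mathcal{B}_1=\{C,G_1,\dots,G_t\}$ be a minimal homogeneous system of generators of $I_{\mathbb{X}}$, let $d_j=\deg(G_j)$ for $j=1,\dots,t$, and suppose $d_1\le\cdots\le d_t$. Then we have $$\mathrm{HF}_{\Omega^3_{R_{\nu\mathbb{X}}/K}}(i)=\begin{cases}s\binom{\nu}{2}+h_i+\delta_i&\text{if }i\ge\lfloor\frac{s(\nu-1)}{2}\rfloor+3,\\\mathrm{HF}_{\nu\mathbb{X}}(i-1)-2i+1+h_i+\delta_i&\text{if }2<i<\lfloor\frac{s(\nu-1)}{2}\rfloor+3,\\0&\text{if }i\le2.\end{cases}$$ Here $h_i=\#\{G\in\mathcal{B}_1\mid\deg(G)=i+1-2\nu\}$, and $\delta_i$ is defined as follows. (a) If $s=4$ then $\delta_i=\nu-2$ if $i=2\nu+1$ and $\delta_i=0$ otherwise. (b) If $s=5$ then $$\delta_i=\begin{cases}1&\text{if }i=2\nu+2,\\3&\text{if }\nu\text{ is odd and }2\nu+3\le i\le\frac{5\nu+1}{2},\\3&\text{if }\nu\text{ is even and }2\nu+3\le i<\frac{5\nu+2}{2},\\2&\text{if }\nu\text{ is even and }i=\frac{5\nu+2}{2},\\0&\text{otherwise.}\end{cases}$$ (c) If $s\ge6$ then $$\delta_i=\begin{cases}1&\text{if }s\text{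 is even and }i=2\nu-2k+\frac{ks}{2}+1\text{ for some }2\le k\le\nu-1,\\1&\text{if }s\text{ is odd and }i=2\nu+k(s-4)+1\text{ for some }1\le k\le\lfloor\frac{\nu-1}{2}\rfloor,\\2&\text{if }s\text{ is odd and }i=2\nu+k(s-4)+\frac{s+1}{2}-1\text{ for some }1\le k\le\lfloor\frac{\nu-2}{2}\rfloor,\\0&\text{otherwise.}\end{cases}$$
   Context: $K$ is a field of characteristic zero, $S=K[X_0,X_1,X_2]$ with the standard grading is the homogeneous coordinate ring of $\mathbb{P}^2$ over $K$, and $C\in S$ is a quadratic form whose zero locus $\mathcal{Z}^+(C)$ is a non-singular conic. Coordinates are chosen so that no $P_j$ lies on $X_0=0$. With $\wp_j\subseteq S$ the homogeneous vanishing ideal of $P_j$ and $k\ge1$, the fat point scheme $k\mathbb{X}$ has homogeneous vanishing ideal $I_{k\mathbb{X}}=\wp_1^k\cap\cdots\cap\wp_s^k$ and coordinate ring $R_{k\mathbb{X}}=S/I_{k\mathbb{X}}$ with Hilbert function $\mathrm{HF}_{k\mathbb{X}}(i)=\dim_K(R_{k\mathbb{X}})_i$; $I_{\mathbb{X}}=I_{1\mathbb{X}}$. $\Omega^1_{R_{\nu\mathbb{X}}/K}$ is the module of Kähler differentials of $R_{\nu\mathbb{X}}/K$, graded with $\deg(dx_i)=1$ where $x_i$ is the image of $X_i$, and $\Omega^3_{R_{\nu\mathbb{X}}/K}=\bigwedge^3_{R_{\nu\mathbb{X}}}\Omega^1_{R_{\nu\mathbb{X}}/K}$; $\mathrm{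HF}_M(i)=\dim_KM_i$.
   Formalization: In (b), for s = 5 and ν = 2, the rows "1 if i = 2ν+2" and "2 if ν is even and i = (5ν+2)/2" both apply at i = 6 and both give a wrong Hilbert function value; here δ_i = 0 for all i when s = 5 and ν = 2. *)

theory Defs
  imports
    "HOL-Library.Poly_Mapping"
    "HOL-Library.Numeral_Type"
    "HOL-Algebra.Ideal_Product"
    "HOL-Algebra.QuotRing"
    "HOL-Algebra.Algebraic_Closure_Type"
    "Jordan_Normal_Form.VS_Connect"
begin

hide_const (open) Multiset.mult Polynomial.smult Modules.module

section \<open>The polynomial ring \<open>S = K[X\<^sub>0, X\<^sub>1, X\<^sub>2]\<close>\<close>

text \<open>
  The variables are indexed by the three-element type \<open>3\<close>, whose elements are \<open>0, 1, 2\<close>.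
  A polynomial maps exponent vectors to coefficients.
\<close>

type_synonym 'k poly3 = "(3 \<Rightarrow>\<^sub>0 nat) \<Rightarrow>\<^sub>0 'k"

abbreviation poly_ring3 :: "'k::field poly3 ring" where
  "poly_ring3 \<equiv> class_ring"

definition const3 :: "'k::field \<Rightarrow> 'k poly3" where
  "const3 c = Poly_Mapping.single 0 c"

definition var3 :: "3 \<Rightarrow> 'k::field poly3" where
  "var3 j = Poly_Mapping.single (Poly_Mapping.single j 1) 1"

definition mdeg :: "(3 \<Rightarrow>\<^sub>0 nat) \<Rightarrow> nat" where
  "mdeg m = (\<Sum>j\<in>UNIV. Poly_Mapping.lookup m j)"

text \<open>The zero polynomial gets degree \<open>0\<close>.\<close>

definition pdeg :: "'k::field poly3 \<Rightarrow> nat" where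
  "pdeg f = Max (insert 0 (mdeg ` Poly_Mapping.keys f))"

text \<open>\<open>forms d\<close> is the homogeneous component \<open>S\<^sub>d\<close>; it contains \<open>0\<close>, and it is \<open>{0}\<close> for \<open>d < 0\<close>.\<close>

definition forms :: "int \<Rightarrow> 'k::field poly3 set" where
  "forms d = {f. \<forall>m\<in>Poly_Mapping.keys f. int (mdeg m) = d}"

text \<open>Evaluation at a vector over an extension field, into which \<open>\<phi>\<close> maps the coefficients.\<close>

definition eval3 :: "('k::field \<Rightarrow> 'l::field) \<Rightarrow> 'k poly3 \<Rightarrow> (3 \<Rightarrow> 'l) \<Rightarrow> 'l" where
  "eval3 \<phi> f v = (\<Sum>m\<in>Poly_Mapping.keys f. \<phi> (Poly_Mapping.lookup f m) * (\<Prod>j\<in>UNIV. v j ^ Poly_Mapping.lookup m j))"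

definition pderiv3 :: "3 \<Rightarrow> 'k::field poly3 \<Rightarrow> 'k poly3" where
  "pderiv3 j f = (\<Sum>m\<in>Poly_Mapping.keys f.
     Poly_Mapping.single (m - Poly_Mapping.single j 1) (of_nat (Poly_Mapping.lookup m j) * Poly_Mapping.lookup f m))"

section \<open>Points, conics and fat point schemes in the projective plane\<close>

text \<open>A \<open>K\<close>-rational point is the set of all its vectors of homogeneous coordinates.\<close>

definition proj_plane :: "(3 \<Rightarrow> 'k::field) set set" where
  "proj_plane = {{(\<lambda>j. c * v j) | c. c \<noteq> 0} | v. v \<noteq> (\<lambda>_. 0)}"

definition vanishes_at :: "'k::field poly3 \<Rightarrow> (3 \<Rightarrow> 'k) set \<Rightarrow> bool" where
  "vanishes_at f P \<longleftrightarrow> (\<forall>v\<in>P. eval3 id f v = 0)"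

text \<open>
  Non-singularity is the Jacobian criterion at the geometric points of the curve, i.e. at its points
  over the algebraic closure of \<open>K\<close>. It excludes \<open>C = 0\<close>.
\<close>

definition nonsingular_conic :: "'k::field poly3 \<Rightarrow> bool" where
  "nonsingular_conic C \<longleftrightarrow> C \<in> forms 2 \<and>
     (\<forall>v :: 3 \<Rightarrow> 'k alg_closure. v \<noteq> (\<lambda>_. 0) \<and> eval3 to_ac C v = 0 \<longrightarrow>
        (\<exists>j. eval3 to_ac (pderiv3 j C) v \<noteq> 0))"

definition point_ideal :: "(3 \<Rightarrow> 'k::field) set \<Rightarrow> 'k poly3 set" where
  "point_ideal P = Idl\<^bsub>poly_ring3\<^esub> {f. (\<exists>d. f \<in> forms d) \<and> vanishes_at f P}"

text \<open>The power is the power of ideals: \<open>ideals_set S\<close> has the product of ideals as multiplication.\<close>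

definition fat_ideal :: "nat \<Rightarrow> (3 \<Rightarrow> 'k::field) set set \<Rightarrow> 'k poly3 set" where
  "fat_ideal k \<X> = (\<Inter>P\<in>\<X>. point_ideal P [^]\<^bsub>ideals_set poly_ring3\<^esub> k)"

definition minimal_homogeneous_generators :: "'k::field poly3 set \<Rightarrow> 'k poly3 set \<Rightarrow> bool" where
  "minimal_homogeneous_generators I B \<longleftrightarrow>
     (\<forall>f\<in>B. \<exists>d. f \<in> forms d) \<and> Idl\<^bsub>poly_ring3\<^esub> B = I \<and>
     (\<forall>B'. B' \<subset> B \<longrightarrow> Idl\<^bsub>poly_ring3\<^esub> B' \<noteq> I)"

section \<open>Modules given by generators and relations\<close>

text \<open>
  In the module records below the fields \<open>mult\<close> and \<open>one\<close>, which the record type inherits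
  from rings, play no role.
\<close>

definition free_module :: "('r, 'x) ring_scheme \<Rightarrow> 'b set \<Rightarrow> ('r, 'b \<Rightarrow> 'r) module" where
  "free_module R B =
     \<lparr>carrier = {f. (\<forall>b. f b \<in> carrier R) \<and> (\<forall>b. b \<notin> B \<longrightarrow> f b = \<zero>\<^bsub>R\<^esub>) \<and> finite {b. f b \<noteq> \<zero>\<^bsub>R\<^esub>}},
      mult = undefined, one = undefined,
      zero = (\<lambda>_. \<zero>\<^bsub>R\<^esub>), add = (\<lambda>f g b. f b \<oplus>\<^bsub>R\<^esub> g b),
      smult = (\<lambda>r f b. r \<otimes>\<^bsub>R\<^esub> f b)\<rparr>"

definition free_gen :: "('r, 'x) ring_scheme \<Rightarrow> 'b \<Rightarrow> 'b \<Rightarrow> 'r" where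
  "free_gen R b = (\<lambda>x. if x = b then \<one>\<^bsub>R\<^esub> else \<zero>\<^bsub>R\<^esub>)"

definition quotient_module :: "('r, 'm, 'x) module_scheme \<Rightarrow> 'm set \<Rightarrow> ('r, 'm set) module" where
  "quotient_module M N =
     \<lparr>carrier = a_rcosets\<^bsub>M\<^esub> N,
      mult = undefined, one = undefined,
      zero = N, add = (<+>\<^bsub>M\<^esub>),
      smult = (\<lambda>r A. \<Union>a\<in>A. N +>\<^bsub>M\<^esub> (r \<odot>\<^bsub>M\<^esub> a))\<rparr>"

definition self_module :: "('r, 'x) ring_scheme \<Rightarrow> ('r, 'r) module" where
  "self_module R =
     \<lparr>carrier = carrier R, mult = undefined, one = undefined,
      zero = \<zero>\<^bsub>R\<^esub>, add = (\<oplus>\<^bsub>R\<^esub>), smult = (\<otimes>\<^bsub>R\<^esub>)\<rparr>"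

definition restrict_scalars ::
  "('k \<Rightarrow> 'r) \<Rightarrow> ('r, 'm, 'x) module_scheme \<Rightarrow> ('k, 'm) module" where
  "restrict_scalars \<phi> M =
     \<lparr>carrier = carrier M, mult = undefined, one = undefined,
      zero = \<zero>\<^bsub>M\<^esub>, add = (\<oplus>\<^bsub>M\<^esub>), smult = (\<lambda>c x. \<phi> c \<odot>\<^bsub>M\<^esub> x)\<rparr>"

text \<open>
  Here \<open>\<phi>\<close> is the structure homomorphism from the field \<open>K\<close>, given as a type, to the ring of
  scalars of \<open>M\<close>: the \<open>K\<close>-span of a subset of \<open>M\<close>, and the \<open>K\<close>-dimension of a \<open>K\<close>-subspace.
\<close>

definition base_span ::
  "('k::field \<Rightarrow> 'r) \<Rightarrow> ('r, 'm, 'x) module_scheme \<Rightarrow> 'm set \<Rightarrow> 'm set" where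
  "base_span \<phi> M A = LinearCombinations.module.span class_ring (restrict_scalars \<phi> M) A"

definition base_dim ::
  "('k::field \<Rightarrow> 'r) \<Rightarrow> ('r, 'm, 'x) module_scheme \<Rightarrow> 'm set \<Rightarrow> nat" where
  "base_dim \<phi> M V = vectorspace.dim class_ring ((restrict_scalars \<phi> M)\<lparr>carrier := V\<rparr>)"

section \<open>Kaehler differentials and exterior powers\<close>

text \<open>
  \<open>\<Omega>\<^sup>1\<close> of \<open>R\<close> over the image \<open>k\<close> of the base ring in \<open>R\<close>: the free \<open>R\<close>-module on symbols
  \<open>d a\<close> with \<open>a \<in> R\<close>, modulo additivity, the Leibniz rule and \<open>d c = 0\<close> for \<open>c \<in> k\<close>.
\<close>

definition kaehler_rel :: "('r, 'x) ring_scheme \<Rightarrow> 'r set \<Rightarrow> ('r \<Rightarrow> 'r) set" where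
  "kaehler_rel R k = (let F = free_module R (carrier R); e = free_gen R in
     LinearCombinations.module.span R F
      ({e (a \<oplus>\<^bsub>R\<^esub> b) \<ominus>\<^bsub>F\<^esub> (e a \<oplus>\<^bsub>F\<^esub> e b) | a b. a \<in> carrier R \<and> b \<in> carrier R} \<union>
       {e (a \<otimes>\<^bsub>R\<^esub> b) \<ominus>\<^bsub>F\<^esub> (a \<odot>\<^bsub>F\<^esub> e b \<oplus>\<^bsub>F\<^esub> b \<odot>\<^bsub>F\<^esub> e a) | a b. a \<in> carrier R \<and> b \<in> carrier R} \<union>
       {e c | c. c \<in> k}))"

definition kaehler :: "('r, 'x) ring_scheme \<Rightarrow> 'r set \<Rightarrow> ('r, ('r \<Rightarrow> 'r) set) module" where
  "kaehler R k = quotient_module (free_module R (carrier R)) (kaehler_rel R k)"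

definition kaehler_d :: "('r, 'x) ring_scheme \<Rightarrow> 'r set \<Rightarrow> 'r \<Rightarrow> ('r \<Rightarrow> 'r) set" where
  "kaehler_d R k a = kaehler_rel R k +>\<^bsub>free_module R (carrier R)\<^esub> free_gen R a"

text \<open>
  The \<open>p\<close>-th exterior power of \<open>M\<close>: the free \<open>R\<close>-module on the \<open>p\<close>-tuples of elements of \<open>M\<close>,
  modulo multilinearity and the vanishing of tuples with a repeated entry.
\<close>

definition tuples :: "nat \<Rightarrow> 'm set \<Rightarrow> 'm list set" where
  "tuples p A = {xs. set xs \<subseteq> A \<and> length xs = p}"

definition ext_rel ::
  "('r, 'x) ring_scheme \<Rightarrow> nat \<Rightarrow> ('r, 'm, 'y) module_scheme \<Rightarrow> ('m list \<Rightarrow> 'r) set" where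
  "ext_rel R p M = (let T = tuples p (carrier M); F = free_module R T; e = free_gen R in
     LinearCombinations.module.span R F
      ({e (xs[j := x \<oplus>\<^bsub>M\<^esub> y]) \<ominus>\<^bsub>F\<^esub> (e (xs[j := x]) \<oplus>\<^bsub>F\<^esub> e (xs[j := y])) | xs j x y.
          xs \<in> T \<and> j < p \<and> x \<in> carrier M \<and> y \<in> carrier M} \<union>
       {e (xs[j := r \<odot>\<^bsub>M\<^esub> x]) \<ominus>\<^bsub>F\<^esub> r \<odot>\<^bsub>F\<^esub> e (xs[j := x]) | xs j r x.
          xs \<in> T \<and> j < p \<and> r \<in> carrier R \<and> x \<in> carrier M} \<union>
       {e xs | xs. xs \<in> T \<and> (\<exists>i j. i < j \<and> j < p \<and> xs ! i = xs ! j)}))"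

definition ext_power ::
  "('r, 'x) ring_scheme \<Rightarrow> nat \<Rightarrow> ('r, 'm, 'y) module_scheme \<Rightarrow> ('r, ('m list \<Rightarrow> 'r) set) module" where
  "ext_power R p M = quotient_module (free_module R (tuples p (carrier M))) (ext_rel R p M)"

definition wedge ::
  "('r, 'x) ring_scheme \<Rightarrow> ('r, 'm, 'y) module_scheme \<Rightarrow> 'm list \<Rightarrow> ('m list \<Rightarrow> 'r) set" where
  "wedge R M xs =
     ext_rel R (length xs) M +>\<^bsub>free_module R (tuples (length xs) (carrier M))\<^esub> free_gen R xs"

section \<open>Hilbert functions\<close>

text \<open>Throughout, \<open>I\<close> is a homogeneous ideal of \<open>S\<close> and \<open>R = S/I\<close>.\<close>

definition coord_ring :: "'k::field poly3 set \<Rightarrow> 'k poly3 set ring" where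
  "coord_ring I = poly_ring3 Quot I"

definition residue3 :: "'k::field poly3 set \<Rightarrow> 'k poly3 \<Rightarrow> 'k poly3 set" where
  "residue3 I f = I +>\<^bsub>poly_ring3\<^esub> f"

definition scalar :: "'k::field poly3 set \<Rightarrow> 'k \<Rightarrow> 'k poly3 set" where
  "scalar I c = residue3 I (const3 c)"

definition coord_grade :: "'k::field poly3 set \<Rightarrow> int \<Rightarrow> 'k poly3 set set" where
  "coord_grade I i = residue3 I ` forms i"

definition HF_coord :: "'k::field poly3 set \<Rightarrow> int \<Rightarrow> nat" where
  "HF_coord I i = base_dim (scalar I) (self_module (coord_ring I)) (coord_grade I i)"

abbreviation Omega1 ::
  "'k::field poly3 set \<Rightarrow> ('k poly3 set, ('k poly3 set \<Rightarrow> 'k poly3 set) set) module" where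
  "Omega1 I \<equiv> kaehler (coord_ring I) (range (scalar I))"

text \<open>The grading with \<open>deg (dx\<^sub>j) = 1\<close>: in degree \<open>i\<close>, the sums of terms \<open>r dx\<^sub>j\<close> with \<open>r \<in> R\<^bsub>i-1\<^esub>\<close>.\<close>

definition Omega1_grade ::
  "'k::field poly3 set \<Rightarrow> int \<Rightarrow> ('k poly3 set \<Rightarrow> 'k poly3 set) set set" where
  "Omega1_grade I i = base_span (scalar I) (Omega1 I)
     {r \<odot>\<^bsub>Omega1 I\<^esub> kaehler_d (coord_ring I) (range (scalar I)) (residue3 I (var3 j)) | r j.
        r \<in> coord_grade I (i - 1)}"

abbreviation Omega3 ::
  "'k::field poly3 set \<Rightarrow>
     ('k poly3 set, (('k poly3 set \<Rightarrow> 'k poly3 set) set list \<Rightarrow> 'k poly3 set) set) module" where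
  "Omega3 I \<equiv> ext_power (coord_ring I) 3 (Omega1 I)"

definition Omega3_grade ::
  "'k::field poly3 set \<Rightarrow> int \<Rightarrow>
     (('k poly3 set \<Rightarrow> 'k poly3 set) set list \<Rightarrow> 'k poly3 set) set set" where
  "Omega3_grade I i = base_span (scalar I) (Omega3 I)
     {wedge (coord_ring I) (Omega1 I) [u, v, w] | u v w a b c.
        u \<in> Omega1_grade I a \<and> v \<in> Omega1_grade I b \<and> w \<in> Omega1_grade I c \<and> a + b + c = i}"

definition HF_Omega3 :: "'k::field poly3 set \<Rightarrow> int \<Rightarrow> nat" where
  "HF_Omega3 I i = base_dim (scalar I) (Omega3 I) (Omega3_grade I i)"

section \<open>The correction terms\<close>

definition gen_count :: "'k::field poly3 set \<Rightarrow> nat \<Rightarrow> int \<Rightarrow> nat" where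
  "gen_count B \<nu> i = card {g \<in> B. int (pdeg g) = i + 1 - 2 * int \<nu>}"

definition delta4 :: "nat \<Rightarrow> int \<Rightarrow> int" where
  "delta4 \<nu> i = (if i = 2 * int \<nu> + 1 then int \<nu> - 2 else 0)"

text \<open>
  For \<open>\<nu> = 2\<close> the first and the last nonzero case would both apply to \<open>i = 6\<close>, with different
  values. The correct value is \<open>0\<close>: for the double points of five points on a non-singular conic
  \<open>C\<close>, the ideal is spanned in degree \<open>4\<close> by \<open>C\<^sup>2\<close>, so its partial derivatives of degree \<open>3\<close> span a
  space of dimension \<open>3\<close>, and \<open>\<Omega>\<^sup>3\<close> has dimension \<open>10 - 3 = 7 = 5 + h\<^sub>6\<close> in degree \<open>6\<close>.
\<close>

definition delta5 :: "nat \<Rightarrow> int \<Rightarrow> int" where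
  "delta5 \<nu> i = (let n = int \<nu> in
     if \<nu> = 2 then 0
     else if i = 2 * n + 2 then 1
     else if odd \<nu> \<and> 2 * n + 3 \<le> i \<and> i \<le> (5 * n + 1) div 2 then 3
     else if even \<nu> \<and> 2 * n + 3 \<le> i \<and> i < (5 * n + 2) div 2 then 3
     else if even \<nu> \<and> i = (5 * n + 2) div 2 then 2
     else 0)"

text \<open>All divisions by \<open>2\<close> are exact except those in the ranges of \<open>k\<close>, where the floor is meant.\<close>

definition delta6 :: "nat \<Rightarrow> nat \<Rightarrow> int \<Rightarrow> int" where
  "delta6 s \<nu> i = (let n = int \<nu>; s' = int s in
     if even s \<and> (\<exists>k. 2 \<le> k \<and> k \<le> n - 1 \<and> i = 2 * n - 2 * k + (k * s') div 2 + 1) then 1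
     else if odd s \<and> (\<exists>k. 1 \<le> k \<and> k \<le> (n - 1) div 2 \<and> i = 2 * n + k * (s' - 4) + 1) then 1
     else if odd s \<and> (\<exists>k. 1 \<le> k \<and> k \<le> (n - 2) div 2 \<and>
                          i = 2 * n + k * (s' - 4) + (s' + 1) div 2 - 1) then 2
     else 0)"

definition delta :: "nat \<Rightarrow> nat \<Rightarrow> int \<Rightarrow> int" where
  "delta s \<nu> i = (if s = 4 then delta4 \<nu> i else if s = 5 then delta5 \<nu> i else delta6 s \<nu> i)"

end

(*
In characteristic 0 the exterior power Omega^3 of R = S/I is cyclic, generated by dx_0 dx_1 dx_2, and its
annihilator in S is the ideal J generated by the partial derivatives of the elements of I. Since I is
homogeneous, Euler's formula makes J_d the span of the derivatives of I_{d+1}. So one has to compute the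
dimension of the space of derivatives of the forms of degree m = i - 2 vanishing to order nu at the points.

A rational parametrization of the conic restricts forms of degree m to polynomials of degree at most 2m,
with kernel C S_{m-2}. Let W_k(m) be the space of forms of degree m vanishing to order k at the points and
p the polynomial whose roots are their parameters. Then W_k(m) restricts onto the multiples of p^k, and
the kernel of the restriction is C W_{k-1}(m-2), which determines dim W_k(m). If 2m >= sk, then the
derivatives of C^l W_k(m) with l >= 1 span C^(l-1) W_k(m+1); otherwise W_k(m) = C W_{k-1}(m-2), and l grows
by one. Comparing the two recursions, the derivatives of W_nu(m) have codimension in W_{nu-1}(m-1)
equal to a sum over k < nu of terms depending on e = 2(m - 2(nu - k)) - sk only, which are max(0, e + 3) for
e < 0 and 0 otherwise. The terms with k = 0 and k = 1 count the minimal generators of I_X of degree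
i + 1 - 2 nu, and the remaining ones add up to delta_i.
*)
theory Submission
  imports Defs
begin

section \<open>Polynomials in three variables\<close>

text \<open>Vanishing at the points is measured in two ways. Powers of the point ideals are what the
  theorem speaks of, and products of lines through pairs of points produce members of them, but a
  factor \<open>C\<close> cannot be cancelled inside an ideal power. The order of a Taylor expansion
  is additive and permits this, since \<open>C\<close> has a nonzero gradient and hence order one at
  each point. Comparing both through the restriction to the conic shows that they agree on forms
  (\<open>OW_W\<close>). The derivatives of C^(l+1) f are C^l ((l+1) C_j f + C f_j), with an index j
  for partial derivatives. On the conic only C_j f survives, and the three C_j restrict to a basis
  of the polynomials of degree at most 2. This is how non-singularity enters, and why one factor C
  makes the derivatives fill the whole space. The condition 2m >= sk passes from (k, m) to (k-1,
  m-2) because s >= 4; equivalently, e changes by s - 4 >= 0 in such a step. The number e + 3 is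
  2(m+1) - sk + 1, the dimension of the multiples of p^k of degree at most 2(m+1).\<close>

lemma UNIV_three: "(UNIV :: 3 set) = {0, 1, 2}"
proof -
  have "x \<in> {0, 1, 2}" for x :: 3
  proof (induct x)
    case (of_int z)
    then have "z \<in> {0, 1, 2}" by auto
    then show ?case by (elim insertE emptyE) (simp_all only: of_int_0 of_int_1 of_int_numeral insert_iff simp_thms)
  qed
  then show ?thesis by blast
qed

lemma card_eq_3_distinct: "card {a, b, c} = 3 \<Longrightarrow> a \<noteq> b \<and> a \<noteq> c \<and> b \<noteq> c"
  by (auto simp: card_insert_if split: if_splits)

lemma three_distinct [simp]:
  "(0::3) \<noteq> 1" "(0::3) \<noteq> 2" "(1::3) \<noteq> 2" "(1::3) \<noteq> 0" "(2::3) \<noteq> 0" "(2::3) \<noteq> 1"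
proof -
  have "card (UNIV :: 3 set) = 3" by simp
  then have "card {0, 1, 2 :: 3} = 3" unfolding UNIV_three .
  from card_eq_3_distinct[OF this]
  show "(0::3) \<noteq> 1" "(0::3) \<noteq> 2" "(1::3) \<noteq> 2" "(1::3) \<noteq> 0" "(2::3) \<noteq> 0" "(2::3) \<noteq> 1"
    by metis+
qed

lemma sum_UNIV_three: "(\<Sum>j\<in>UNIV. f j) = f (0::3) + f 1 + f 2"
  unfolding UNIV_three by (simp add: add.assoc)

lemma all_three: "(\<forall>j::3. P j) \<longleftrightarrow> P 0 \<and> P 1 \<and> P 2"
proof -
  have "(\<forall>j::3. P j) \<longleftrightarrow> (\<forall>j\<in>UNIV. P j)" by blast
  then show ?thesis unfolding UNIV_three by blast
qed

lemma poly3_expand: "(f :: 'k::field poly3) = (\<Sum>m\<in>Poly_Mapping.keys f. Poly_Mapping.single m (Poly_Mapping.lookup f m))"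
proof (rule poly_mapping_eqI)
  fix k
  have "Poly_Mapping.lookup (Poly_Mapping.single m (Poly_Mapping.lookup f m)) k = (if m = k then Poly_Mapping.lookup f m else 0)" for m
    by (simp add: lookup_single when_def)
  then show "Poly_Mapping.lookup f k =
      Poly_Mapping.lookup (\<Sum>m\<in>Poly_Mapping.keys f. Poly_Mapping.single m (Poly_Mapping.lookup f m)) k"
    by (simp add: lookup_sum sum.delta in_keys_iff)
qed

lemma poly3_additive_induct [case_names zero single add]:
  fixes f :: "'k::field poly3"
  assumes "P 0" "\<And>m c. P (Poly_Mapping.single m c)" "\<And>f g. P f \<Longrightarrow> P g \<Longrightarrow> P (f + g)"
  shows "P f"
proof -
  have "P (\<Sum>m\<in>A. Poly_Mapping.single m (Poly_Mapping.lookup f m))" if "finite A" for A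
    using that by induction (auto intro: assms)
  from this[of "Poly_Mapping.keys f"] show ?thesis
    by (subst poly3_expand) simp
qed

lemma const3_add: "const3 (a + b) = const3 a + const3 b"
  and const3_mult: "const3 (a * b) = const3 a * const3 b"
  and const3_0 [simp]: "const3 0 = 0" and const3_1 [simp]: "const3 1 = 1"
  by (simp_all add: const3_def single_add mult_single)

lemma const3_inj [simp]: "const3 a = const3 b \<longleftrightarrow> a = b"
  by (simp add: const3_def inj_eq)

lemma const3_eq_0 [simp]: "const3 a = 0 \<longleftrightarrow> a = 0"
  using const3_inj[of a 0] by (simp del: const3_inj)

lemma const3_numeral: "const3 (numeral n) = numeral n"
  by (simp add: const3_def)

lemma const3_of_nat: "const3 (of_nat n) = of_nat n"
  by (simp add: const3_def)

lemma var3_power: "var3 j ^ n = (Poly_Mapping.single (Poly_Mapping.single j n) 1 :: 'k::field poly3)"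
  by (induction n) (simp_all add: var3_def mult_single single_add[symmetric] add.commute)

lemma exponent_expand: "m = (\<Sum>j\<in>(UNIV::3 set). Poly_Mapping.single j (Poly_Mapping.lookup m j))"
  by (rule poly_mapping_eqI) (auto simp: lookup_sum lookup_single when_def)

lemma single_as_product:
  "Poly_Mapping.single m c = const3 c * (\<Prod>j\<in>UNIV. var3 j ^ Poly_Mapping.lookup m j :: 'k::field poly3)"
proof -
  have "(\<Prod>j\<in>A. var3 j ^ Poly_Mapping.lookup m j) = (Poly_Mapping.single (\<Sum>j\<in>A. Poly_Mapping.single j (Poly_Mapping.lookup m j)) 1 :: 'k poly3)"
    if "finite A" for A
    using that by induction (auto simp: var3_power mult_single)
  from this[of UNIV] show ?thesis
    by (simp add: const3_def mult_single exponent_expand[symmetric])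
qed

text \<open>Constants and variables generate the polynomial ring. This induction serves statements
  compatible with sums and products: uniqueness of ring homomorphisms, the linear Taylor
  coefficient, the formula for the differential of a polynomial.\<close>

lemma poly3_induct [case_names const var add mult]:
  fixes f :: "'k::field poly3"
  assumes c: "\<And>c. P (const3 c)" and v: "\<And>j. P (var3 j)"
    and a: "\<And>f g. P f \<Longrightarrow> P g \<Longrightarrow> P (f + g)" and m: "\<And>f g. P f \<Longrightarrow> P g \<Longrightarrow> P (f * g)"
  shows "P f"
proof (induction f rule: poly3_additive_induct)
  case zero
  show ?case using c[of 0] by simp
next
  case (single m' c')
  have p: "P (var3 j ^ n)" for j n
    by (induction n) (use c[of 1] v m in auto)
  have "P (\<Prod>j\<in>A. var3 j ^ Poly_Mapping.lookup m' j)" if "finite A" for A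
    using that by induction (use c[of 1] p m in auto)
  then show ?case unfolding single_as_product by (intro m c) auto
qed (auto intro: a)

text \<open>The target is an arbitrary commutative ring because three are needed: a field for
  \<open>eval3\<close>, K[t] for the restriction to the conic, and S[T] for Taylor
  expansions.\<close>

definition psubst :: "('k::field \<Rightarrow> 'r::comm_ring_1) \<Rightarrow> (3 \<Rightarrow> 'r) \<Rightarrow> 'k poly3 \<Rightarrow> 'r" where
  "psubst \<phi> w f = (\<Sum>m\<in>Poly_Mapping.keys f.
     \<phi> (Poly_Mapping.lookup f m) * (\<Prod>j\<in>UNIV. w j ^ Poly_Mapping.lookup m j))"

lemma eval3_psubst: "eval3 \<phi> f v = psubst \<phi> v f"
  by (simp add: eval3_def psubst_def)

context
  fixes \<phi> :: "'k::field \<Rightarrow> 'r::comm_ring_1"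
  assumes hom: "comm_ring_hom \<phi>"
begin

interpretation \<phi>: comm_ring_hom \<phi> by (rule hom)

lemma psubst_superset:
  assumes "finite A" "Poly_Mapping.keys f \<subseteq> A"
  shows "psubst \<phi> w f = (\<Sum>m\<in>A. \<phi> (Poly_Mapping.lookup f m) * (\<Prod>j\<in>UNIV. w j ^ Poly_Mapping.lookup m j))"
  unfolding psubst_def using assms by (intro sum.mono_neutral_left) (auto simp: in_keys_iff)

lemma psubst_single:
  "psubst \<phi> w (Poly_Mapping.single m c) = \<phi> c * (\<Prod>j\<in>UNIV. w j ^ Poly_Mapping.lookup m j)"
  by (subst psubst_superset[where A = "{m}"]) auto

lemma psubst_add: "psubst \<phi> w (f + g) = psubst \<phi> w f + psubst \<phi> w g"
proof -
  let ?A = "Poly_Mapping.keys f \<union> Poly_Mapping.keys g"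
  have "Poly_Mapping.keys (f + g) \<subseteq> ?A" by (rule keys_add)
  then show ?thesis
    by (simp add: psubst_superset[where A = ?A] lookup_add \<phi>.hom_add distrib_right sum.distrib)
qed

lemma psubst_0 [simp]: "psubst \<phi> w 0 = 0"
  by (simp add: psubst_def)

lemma psubst_mult: "psubst \<phi> w (f * g) = psubst \<phi> w f * psubst \<phi> w g"
proof (induction f rule: poly3_additive_induct)
  case (single m c)
  show ?case
  proof (induction g rule: poly3_additive_induct)
    case (single m' c')
    show ?case
      unfolding mult_single psubst_single \<phi>.hom_mult lookup_add power_add prod.distrib
      by (simp only: mult.assoc mult.left_commute)
  qed (simp_all add: psubst_add distrib_left)
qed (simp_all add: psubst_add distrib_right)

lemma psubst_const [simp]: "psubst \<phi> w (const3 c) = \<phi> c"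
  unfolding const3_def psubst_single by (simp only: lookup_zero power_0 prod.neutral_const mult_1_right)

lemma psubst_var [simp]: "psubst \<phi> w (var3 j) = w j"
proof -
  have e: "w i ^ Poly_Mapping.lookup (Poly_Mapping.single j 1) i = (if i = j then w i else 1)" for i
    by (cases "i = j") (simp_all add: lookup_single)
  show ?thesis unfolding var3_def psubst_single e by (simp add: prod.delta)
qed

lemma psubst_hom: "comm_ring_hom (psubst \<phi> w)"
proof
  show "psubst \<phi> w 1 = 1" using psubst_const[of w 1] by simp
qed (simp_all add: psubst_add psubst_mult)

end

text \<open>The uniqueness half of the universal property of the polynomial ring;
  \<open>psubst_hom\<close> is the existence half.\<close>

lemma ring_hom_poly3_eqI:
  fixes h h' :: "'k::field poly3 \<Rightarrow> 'r::comm_ring_1"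
  assumes "comm_ring_hom h" "comm_ring_hom h'"
    and "\<And>c. h (const3 c) = h' (const3 c)" and "\<And>j. h (var3 j) = h' (var3 j)"
  shows "h f = h' f"
proof -
  interpret h: comm_ring_hom h by fact
  interpret h': comm_ring_hom h' by fact
  show ?thesis
    by (induction f rule: poly3_induct) (simp_all add: assms h.hom_add h'.hom_add h.hom_mult h'.hom_mult)
qed

lemma psubst_comp:
  fixes h :: "'r::comm_ring_1 \<Rightarrow> 's::comm_ring_1"
  assumes "comm_ring_hom \<phi>" "comm_ring_hom h"
  shows "h (psubst \<phi> w f) = psubst (\<lambda>c. h (\<phi> c)) (\<lambda>j. h (w j)) f"
proof -
  interpret \<phi>: comm_ring_hom \<phi> by fact
  interpret h: comm_ring_hom h by fact
  interpret p: comm_ring_hom "psubst \<phi> w" by (rule psubst_hom) fact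
  have c: "comm_ring_hom (\<lambda>c. h (\<phi> c))"
    by unfold_locales (simp_all add: \<phi>.hom_add \<phi>.hom_mult h.hom_add h.hom_mult)
  have "comm_ring_hom (\<lambda>f. h (psubst \<phi> w f))"
    by unfold_locales (simp_all add: p.hom_add p.hom_mult h.hom_add h.hom_mult)
  then show ?thesis
    by (rule ring_hom_poly3_eqI[OF _ psubst_hom[OF c]]) (simp_all add: assms c)
qed

section \<open>Homogeneous components\<close>

lemma mdeg_add: "mdeg (m + m') = mdeg m + mdeg m'"
  by (simp add: mdeg_def lookup_add sum.distrib)

lemma mdeg_single [simp]: "mdeg (Poly_Mapping.single j n) = n"
  by (simp add: mdeg_def lookup_single when_def)

lemma mdeg_0 [simp]: "mdeg 0 = 0"
  by (simp add: mdeg_def)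

lemma forms_iff: "f \<in> forms d \<longleftrightarrow> (\<forall>m. Poly_Mapping.lookup f m \<noteq> 0 \<longrightarrow> int (mdeg m) = d)"
  by (auto simp: forms_def in_keys_iff)

lemma forms_single: "int (mdeg m) = d \<Longrightarrow> Poly_Mapping.single m c \<in> forms d"
  by (auto simp: forms_iff lookup_single when_def)

lemma forms_0 [simp]: "0 \<in> forms d"
  by (simp add: forms_iff)

lemma forms_add: "f \<in> forms d \<Longrightarrow> g \<in> forms d \<Longrightarrow> f + g \<in> forms d"
  unfolding forms_iff lookup_add by (metis add.right_neutral)

lemma forms_uminus: "f \<in> forms d \<Longrightarrow> - f \<in> forms d"
  by (simp add: forms_iff)

lemma forms_diff: "f \<in> forms d \<Longrightarrow> g \<in> forms d \<Longrightarrow> f - g \<in> forms d"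
  using forms_add[of f d "- g"] forms_uminus[of g d] by simp

lemma forms_sum: "(\<And>x. x \<in> A \<Longrightarrow> F x \<in> forms d) \<Longrightarrow> sum F A \<in> forms d"
  by (induction A rule: infinite_finite_induct) (auto intro: forms_add)

lemma forms_mult:
  fixes f g :: "'k::field poly3"
  assumes "f \<in> forms d" "g \<in> forms e"
  shows "f * g \<in> forms (d + e)"
proof -
  have "Poly_Mapping.keys (f * g) \<subseteq> {a + b | a b. a \<in> Poly_Mapping.keys f \<and> b \<in> Poly_Mapping.keys g}"
    by (rule keys_mult)
  then show ?thesis using assms by (fastforce simp: forms_def mdeg_add)
qed

lemma forms_const [simp]: "const3 c \<in> forms 0"
  by (simp add: const3_def forms_single)

lemma forms_const_mult: "f \<in> forms d \<Longrightarrow> const3 c * f \<in> forms d"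
  using forms_mult[OF forms_const] by fastforce

lemma forms_var [simp]: "var3 j \<in> forms 1"
  by (simp add: var3_def forms_single)

lemma forms_1 [simp]: "1 \<in> forms 0"
  using forms_const[of 1] by simp

lemma forms_neg: "d < 0 \<Longrightarrow> forms d = {0}"
  by (auto simp: forms_iff intro!: poly_mapping_eqI)

lemma forms_0_const: "f \<in> forms 0 \<longleftrightarrow> (\<exists>c. f = const3 c)"
proof
  assume f: "f \<in> forms 0"
  have "mdeg m = 0 \<Longrightarrow> m = 0" for m
    by (auto simp: mdeg_def intro!: poly_mapping_eqI)
  then have "f = const3 (Poly_Mapping.lookup f 0)"
    using f by (intro poly_mapping_eqI) (force simp: const3_def lookup_single when_def forms_iff)
  then show "\<exists>c. f = const3 c" ..
qed auto

definition hcomp :: "int \<Rightarrow> 'k::field poly3 \<Rightarrow> 'k poly3" where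
  "hcomp d f = Poly_Mapping.mapp (\<lambda>m c. c when int (mdeg m) = d) f"

lemma lookup_hcomp: "Poly_Mapping.lookup (hcomp d f) m = (Poly_Mapping.lookup f m when int (mdeg m) = d)"
  by (auto simp: hcomp_def lookup_mapp when_def in_keys_iff)

lemma hcomp_add: "hcomp d (f + g) = hcomp d f + hcomp d g"
  by (rule poly_mapping_eqI) (simp add: lookup_hcomp lookup_add when_add_distrib)

lemma hcomp_0 [simp]: "hcomp d 0 = 0"
  by (rule poly_mapping_eqI) (simp add: lookup_hcomp)

lemma hcomp_sum: "hcomp d (sum F A) = (\<Sum>x\<in>A. hcomp d (F x))"
  by (induction A rule: infinite_finite_induct) (auto simp: hcomp_add)

lemma hcomp_forms [simp]: "hcomp d f \<in> forms d"
  by (auto simp: forms_iff lookup_hcomp when_def split: if_splits)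

lemma hcomp_of_form: "f \<in> forms e \<Longrightarrow> hcomp d f = (f when d = e)"
  by (rule poly_mapping_eqI) (auto simp: lookup_hcomp when_def forms_iff)

lemma hcomp_mult_form:
  fixes f g :: "'k::field poly3"
  assumes "g \<in> forms e"
  shows "hcomp d (f * g) = hcomp (d - e) f * g"
proof (induction f rule: poly3_additive_induct)
  case (single m c)
  have s: "Poly_Mapping.single m c \<in> forms (int (mdeg m))" by (simp add: forms_single)
  show ?case
    by (auto simp: hcomp_of_form[OF s] hcomp_of_form[OF forms_mult[OF s assms]] when_def)
qed (simp_all add: hcomp_add distrib_right)

lemma hcomp_expand:
  obtains D where "finite D" "(f :: 'k::field poly3) = (\<Sum>d\<in>D. hcomp d f)"
proof
  let ?D = "(\<lambda>m. int (mdeg m)) ` Poly_Mapping.keys f"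
  show "f = (\<Sum>d\<in>?D. hcomp d f)"
    by (rule poly_mapping_eqI) (auto simp: lookup_sum lookup_hcomp when_def in_keys_iff)
qed simp

section \<open>Partial derivatives\<close>

lemma pderiv3_superset:
  fixes f :: "'k::field poly3"
  assumes "finite A" "Poly_Mapping.keys f \<subseteq> A"
  shows "pderiv3 j f = (\<Sum>m\<in>A. Poly_Mapping.single (m - Poly_Mapping.single j 1)
     (of_nat (Poly_Mapping.lookup m j) * Poly_Mapping.lookup f m))"
  unfolding pderiv3_def using assms by (intro sum.mono_neutral_left) (auto simp: in_keys_iff)

lemma pderiv3_single:
  "pderiv3 j (Poly_Mapping.single m c :: 'k::field poly3) =
     Poly_Mapping.single (m - Poly_Mapping.single j 1) (of_nat (Poly_Mapping.lookup m j) * c)"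
  by (subst pderiv3_superset[where A = "{m}"]) auto

lemma pderiv3_add: "pderiv3 j (f + g :: 'k::field poly3) = pderiv3 j f + pderiv3 j g"
proof -
  let ?A = "Poly_Mapping.keys f \<union> Poly_Mapping.keys g"
  have "Poly_Mapping.keys (f + g) \<subseteq> ?A" by (rule keys_add)
  then show ?thesis
    by (simp add: pderiv3_superset[where A = ?A] lookup_add distrib_left sum.distrib single_add)
qed

lemma pderiv3_0 [simp]: "pderiv3 j (0 :: 'k::field poly3) = 0"
  by (simp add: pderiv3_def)

lemma pderiv3_uminus: "pderiv3 j (- f :: 'k::field poly3) = - pderiv3 j f"
  using pderiv3_add[of j f "- f"] by (simp add: eq_neg_iff_add_eq_0 add.commute)

lemma pderiv3_diff: "pderiv3 j (f - g :: 'k::field poly3) = pderiv3 j f - pderiv3 j g"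
  using pderiv3_add[of j f "- g"] by (simp add: pderiv3_uminus)

lemma pderiv3_sum: "pderiv3 j (sum F A :: 'k::field poly3) = (\<Sum>x\<in>A. pderiv3 j (F x))"
  by (induction A rule: infinite_finite_induct) (auto simp: pderiv3_add)

text \<open>Subtraction of exponents is truncated, so the identity fails when the variable is absent
  from \<open>m\<close>. In that case the coefficient \<open>lookup m j\<close> of the derivative is
  zero and the term disappears anyway.\<close>

lemma exponent_diff_add:
  fixes m m' :: "3 \<Rightarrow>\<^sub>0 nat"
  assumes "Poly_Mapping.lookup m j \<noteq> 0"
  shows "m - Poly_Mapping.single j 1 + m' = m + m' - Poly_Mapping.single j 1"
  using assms by (intro poly_mapping_eqI) (auto simp: lookup_add lookup_minus lookup_single when_def)

lemma pderiv3_mult: "pderiv3 j (f * g :: 'k::field poly3) = pderiv3 j f * g + f * pderiv3 j g"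
proof (induction f rule: poly3_additive_induct)
  case (single m c)
  show ?case
  proof (induction g rule: poly3_additive_induct)
    case (single m' c')
    let ?e = "Poly_Mapping.single j 1"
    have 1: "Poly_Mapping.single (m - ?e) (of_nat (Poly_Mapping.lookup m j) * c) * Poly_Mapping.single m' c'
      = Poly_Mapping.single (m + m' - ?e) (of_nat (Poly_Mapping.lookup m j) * c * c')"
      by (cases "Poly_Mapping.lookup m j = 0")
        (simp_all add: mult_single exponent_diff_add del: One_nat_def)
    have 2: "Poly_Mapping.single m c * Poly_Mapping.single (m' - ?e) (of_nat (Poly_Mapping.lookup m' j) * c')
      = Poly_Mapping.single (m + m' - ?e) (of_nat (Poly_Mapping.lookup m' j) * c * c')"
      using exponent_diff_add[of m' j m]
      by (cases "Poly_Mapping.lookup m' j = 0")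
        (simp_all add: mult_single add.commute mult_ac del: One_nat_def)
    have 3: "of_nat (Poly_Mapping.lookup (m + m') j) * (c * c') =
        of_nat (Poly_Mapping.lookup m j) * c * c' + of_nat (Poly_Mapping.lookup m' j) * c * c'"
      by (simp add: lookup_add distrib_right mult.assoc)
    show ?case
      unfolding pderiv3_single 1 2 mult_single[of m c m' c'] 3 single_add ..
  qed (simp_all add: pderiv3_add distrib_left)
qed (simp_all add: pderiv3_add distrib_right algebra_simps)

lemma pderiv3_const [simp]: "pderiv3 j (const3 c) = 0"
  by (simp add: const3_def pderiv3_single)

lemma pderiv3_const_mult: "pderiv3 j (const3 c * f) = const3 c * pderiv3 j f"
  by (simp add: pderiv3_mult)

lemma pderiv3_var: "pderiv3 j (var3 i :: 'k::field poly3) = (if i = j then 1 else 0)"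
  by (auto simp: var3_def pderiv3_single lookup_single)

lemma pderiv3_power:
  "pderiv3 j (f ^ Suc n :: 'k::field poly3) = of_nat (Suc n) * f ^ n * pderiv3 j f"
proof (induction n)
  case (Suc n)
  show ?case by (subst power_Suc, subst pderiv3_mult, subst Suc) (simp add: algebra_simps)
qed simp

lemma pderiv3_forms:
  fixes f :: "'k::field poly3"
  assumes "f \<in> forms d"
  shows "pderiv3 j f \<in> forms (d - 1)"
  unfolding pderiv3_def
proof (rule forms_sum)
  fix m assume m: "m \<in> Poly_Mapping.keys f"
  show "Poly_Mapping.single (m - Poly_Mapping.single j 1) (of_nat (Poly_Mapping.lookup m j) * Poly_Mapping.lookup f m) \<in> forms (d - 1)"
  proof (cases "Poly_Mapping.lookup m j = 0")
    case False
    have "m = (m - Poly_Mapping.single j 1) + Poly_Mapping.single j 1"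
      using False by (intro poly_mapping_eqI) (auto simp: lookup_add lookup_minus lookup_single when_def)
    then have "mdeg m = mdeg (m - Poly_Mapping.single j 1) + 1"
      using mdeg_add[of "m - Poly_Mapping.single j 1" "Poly_Mapping.single j 1"] by simp
    then show ?thesis using m assms by (intro forms_single) (auto simp: forms_def)
  qed simp
qed

lemma euler_formula:
  fixes f :: "'k::field poly3"
  assumes "f \<in> forms d"
  shows "(\<Sum>j\<in>UNIV. var3 j * pderiv3 j f) = const3 (of_int d) * f"
proof -
  \<comment> \<open>On a monomial, X_j times the j-th derivative multiplies by the exponent of X_j,
    and the exponents add up to the degree.\<close>
  have s: "(\<Sum>j\<in>UNIV. var3 j * pderiv3 j (Poly_Mapping.single m c)) = const3 (of_nat (mdeg m)) * Poly_Mapping.single m c"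
    for m and c :: 'k
  proof -
    have "var3 j * pderiv3 j (Poly_Mapping.single m c) = Poly_Mapping.single m (of_nat (Poly_Mapping.lookup m j) * c)" for j
      using exponent_diff_add[of m j "Poly_Mapping.single j 1"]
      by (cases "Poly_Mapping.lookup m j = 0")
        (simp_all add: pderiv3_single var3_def mult_single add.commute del: One_nat_def)
    then show ?thesis
      by (simp add: const3_def mult_single mdeg_def sum_UNIV_three distrib_right single_add del: single_of_nat)
  qed
  define M where "M m = Poly_Mapping.single m (Poly_Mapping.lookup f m)" for m
  have f: "f = sum M (Poly_Mapping.keys f)" unfolding M_def by (rule poly3_expand)
  have "pderiv3 j f = (\<Sum>m\<in>Poly_Mapping.keys f. pderiv3 j (M m))" for j
    by (subst f) (rule pderiv3_sum)
  then have "(\<Sum>j\<in>UNIV. var3 j * pderiv3 j f) = (\<Sum>j\<in>UNIV. \<Sum>m\<in>Poly_Mapping.keys f. var3 j * pderiv3 j (M m))"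
    by (simp add: sum_distrib_left)
  also have "\<dots> = (\<Sum>m\<in>Poly_Mapping.keys f. \<Sum>j\<in>UNIV. var3 j * pderiv3 j (M m))"
    by (rule sum.swap)
  also have "\<dots> = (\<Sum>m\<in>Poly_Mapping.keys f. const3 (of_int d) * M m)"
  proof (rule sum.cong[OF refl])
    fix m assume "m \<in> Poly_Mapping.keys f"
    then have "d = int (mdeg m)" using assms by (simp add: forms_def)
    then show "(\<Sum>j\<in>UNIV. var3 j * pderiv3 j (M m)) = const3 (of_int d) * M m"
      unfolding M_def s by (simp only: of_int_of_nat_eq)
  qed
  also have "\<dots> = const3 (of_int d) * f"
    unfolding sum_distrib_left[symmetric] f[symmetric] ..
  finally show ?thesis .
qed

section \<open>Dimensions\<close>

text \<open>The coordinates of \<open>x\<close> with respect to \<open>B\<close> are supported both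
  in \<open>A\<close> and in \<open>B - A\<close>, hence nowhere.\<close>

lemma (in vector_space) independent_Diff_span_Int:
  assumes B: "independent B" and x: "x \<in> span A" "x \<in> span (B - A)" and A: "A \<subseteq> B"
  shows "x = 0"
proof -

  have 1: "representation B x = representation A x"
    by (rule representation_extend[OF B x(1) A])
  have 2: "representation B x = representation (B - A) x"
    by (rule representation_extend[OF B x(2)]) auto
  have "representation B x b = 0" for b
    using 1 2 representation_ne_zero[of A x b] representation_ne_zero[of "B - A" x b] by force
  then have "representation B x = (\<lambda>_. 0)" by auto
  moreover have "x \<in> span B" using x(1) A span_mono by blast
  ultimately show ?thesis
    using sum_nonzero_representation_eq[OF B, of x] by simp
qed

text \<open>Finiteness is asked of the subspace \<open>V\<close> only, since the polynomial rings
  are infinite-dimensional and just their graded pieces are not. A basis of the kernel is extended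
  to a basis of \<open>V\<close>, and the added vectors map to a basis of the image.\<close>

lemma (in vector_space_pair) rank_nullity:
  assumes f: "Vector_Spaces.linear s1 s2 f" and V: "vs1.subspace V"
    and fin: "finite A" "V \<subseteq> vs1.span A"
  shows "vs1.dim V = vs1.dim (V \<inter> {x. f x = 0}) + vs2.dim (f ` V)"
proof -
  interpret f: Vector_Spaces.linear s1 s2 f by fact
  let ?N = "V \<inter> {x. f x = 0}"
  obtain C where C: "C \<subseteq> ?N" "vs1.independent C" "?N \<subseteq> vs1.span C" "card C = vs1.dim ?N"
    by (rule vs1.basis_exists)
  obtain B where B: "C \<subseteq> B" "B \<subseteq> V" "vs1.independent B" "V \<subseteq> vs1.span B"
    using vs1.maximal_independent_subset_extend[of C V] C by auto
  have finB: "finite B"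
    using vs1.independent_span_bound[of A B] fin B by auto
  have inj: "inj_on f (vs1.span (B - C))"
  proof (subst f.inj_on_iff_eq_0)
    show "\<forall>x\<in>vs1.span (B - C). f x = 0 \<longrightarrow> x = 0"
    proof safe
      fix x assume x: "x \<in> vs1.span (B - C)" "f x = 0"
      have "vs1.span (B - C) \<subseteq> V" using B V by (meson Diff_subset order_trans vs1.span_minimal)
      then have "x \<in> vs1.span C" using x C by auto
      then show "x = 0" using vs1.independent_Diff_span_Int[OF B(3)] x B(1) by blast
    qed
  qed simp
  have "vs2.dim (f ` V) = card (B - C)"
  proof (rule vs2.dim_unique)
    show "f ` (B - C) \<subseteq> f ` V" using B by auto
    show "vs2.independent (f ` (B - C))"
      using vs1.independent_mono[OF B(3)] by (intro f.independent_injective_image inj) blast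
    show "card (f ` (B - C)) = card (B - C)"
      using inj by (meson card_image inj_on_subset vs1.span_superset)
    have "f ` V \<subseteq> vs2.span (f ` B)"
      using B(4) f.span_image[of B] by blast
    also have "\<dots> \<subseteq> vs2.span (f ` (B - C))"
    proof (rule vs2.span_minimal)
      show "f ` B \<subseteq> vs2.span (f ` (B - C))"
      proof safe
        fix b assume b: "b \<in> B"
        show "f b \<in> vs2.span (f ` (B - C))"
        proof (cases "b \<in> C")
          case True
          then have "f b = 0" using C by auto
          then show ?thesis by (simp add: vs2.span_zero)
        qed (use b in \<open>auto intro: vs2.span_base\<close>)
      qed
    qed simp
    finally show "f ` V \<subseteq> vs2.span (f ` (B - C))" .
  qed
  moreover have "vs1.dim V = card B"
    using vs1.basis_card_eq_dim[of B V] B by simp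
  moreover have "card B = card C + card (B - C)"
    using finB B(1) by (metis Diff_disjoint Diff_partition card_Un_disjoint finite_Diff finite_subset)
  ultimately show ?thesis using C(4) by simp
qed

lemma (in vector_space) subspace_eqI_dim:
  assumes "subspace V" "V \<subseteq> U" "finite A" "U \<subseteq> span A" "dim U \<le> dim V"
  shows "V = U"
proof -
  obtain B where B: "B \<subseteq> V" "independent B" "V \<subseteq> span B" "card B = dim V"
    by (rule basis_exists)
  obtain D where D: "B \<subseteq> D" "D \<subseteq> U" "independent D" "U \<subseteq> span D"
    using maximal_independent_subset_extend[of B U] B assms(2) by (metis order_trans)
  have "finite D" using independent_span_bound[of A D] assms D by auto
  moreover have "card D \<le> card B"
    using basis_card_eq_dim[of D U] D B(4) assms(5) by simp
  ultimately have "B = D" using D(1) card_seteq by blast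
  then show ?thesis using D B assms(1,2) span_minimal by blast
qed

interpretation pv: vector_space "\<lambda>c (f :: 'k::field poly3). const3 c * f"
  by unfold_locales (simp_all add: algebra_simps const3_add const3_mult)

interpretation kt: vector_space "Polynomial.smult :: 'k::field \<Rightarrow> 'k poly \<Rightarrow> 'k poly"
  by unfold_locales (simp_all add: smult_add_left smult_add_right)

interpretation pk: vector_space_pair "\<lambda>c (f :: 'k::field poly3). const3 c * f"
  "Polynomial.smult :: 'k::field \<Rightarrow> 'k poly \<Rightarrow> 'k poly" ..

interpretation pp: vector_space_pair "\<lambda>c (f :: 'k::field poly3). const3 c * f"
  "\<lambda>c (f :: 'k::field poly3). const3 c * f" ..

lemma forms_subspace: "pv.subspace (forms d)"
  by (auto simp: pv.subspace_def intro: forms_add forms_const_mult)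

lemma poly3_sum_singles:
  assumes "finite A" "Poly_Mapping.keys f \<subseteq> A"
  shows "(f :: 'k::field poly3) = (\<Sum>m\<in>A. const3 (Poly_Mapping.lookup f m) * Poly_Mapping.single m 1)"
proof -
  have "f = (\<Sum>m\<in>Poly_Mapping.keys f. Poly_Mapping.single m (Poly_Mapping.lookup f m))"
    by (rule poly3_expand)
  also have "\<dots> = (\<Sum>m\<in>A. Poly_Mapping.single m (Poly_Mapping.lookup f m))"
    using assms by (intro sum.mono_neutral_left) (auto simp: in_keys_iff)
  finally show ?thesis by (simp add: const3_def mult_single)
qed

definition monomials_of :: "nat \<Rightarrow> (3 \<Rightarrow>\<^sub>0 nat) set" where
  "monomials_of d = {m. mdeg m = d}"

text \<open>The third exponent is determined by the degree, so the monomials of degree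
  \<open>d\<close> are the lattice points of a triangle.\<close>

lemma monomials_of_bij:
  "bij_betw (\<lambda>m. (Poly_Mapping.lookup m 0, Poly_Mapping.lookup m 1)) (monomials_of d) (SIGMA a:{..d}. {..d - a})"
proof (rule bij_betw_byWitness)
  let ?g = "\<lambda>(a, b). Poly_Mapping.single (0::3) a + Poly_Mapping.single 1 b + Poly_Mapping.single 2 (d - a - b)"
  show "\<forall>m\<in>monomials_of d. ?g (Poly_Mapping.lookup m 0, Poly_Mapping.lookup m 1) = m"
  proof
    fix m assume "m \<in> monomials_of d"
    then have "Poly_Mapping.lookup m 2 = d - Poly_Mapping.lookup m 0 - Poly_Mapping.lookup m 1"
      by (simp add: monomials_of_def mdeg_def sum_UNIV_three)
    then show "?g (Poly_Mapping.lookup m 0, Poly_Mapping.lookup m 1) = m"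
      using exponent_expand[of m] by (simp add: sum_UNIV_three)
  qed
  show "\<forall>p\<in>SIGMA a:{..d}. {..d - a}. (\<lambda>m. (Poly_Mapping.lookup m 0, Poly_Mapping.lookup m 1)) (?g p) = p"
    by (auto simp: lookup_add lookup_single)
  show "(\<lambda>m. (Poly_Mapping.lookup m 0, Poly_Mapping.lookup m 1)) ` monomials_of d \<subseteq> (SIGMA a:{..d}. {..d - a})"
    by (auto simp: monomials_of_def mdeg_def sum_UNIV_three)
  show "?g ` (SIGMA a:{..d}. {..d - a}) \<subseteq> monomials_of d"
    by (auto simp: monomials_of_def mdeg_add)
qed

lemma finite_monomials_of [simp]: "finite (monomials_of d)"
  using bij_betw_finite[OF monomials_of_bij[of d]] by simp

lemma card_monomials_of: "2 * card (monomials_of d) = (d + 1) * (d + 2)"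
proof -
  have "card (monomials_of d) = (\<Sum>a\<le>d. d - a + 1)"
    using bij_betw_same_card[OF monomials_of_bij[of d]] by simp
  also have "\<dots> = (\<Sum>a\<le>d. a + 1)"
    by (rule sum.reindex_bij_witness[where i = "\<lambda>a. d - a" and j = "\<lambda>a. d - a"]) auto
  also have "2 * \<dots> = (d + 1) * (d + 2)" by (induction d) auto
  finally show ?thesis .
qed

lemma forms_keys: "f \<in> forms (int d) \<Longrightarrow> Poly_Mapping.keys f \<subseteq> monomials_of d"
  by (auto simp: forms_def monomials_of_def)

lemma forms_span:
  "(forms (int d) :: 'k::field poly3 set) = pv.span ((\<lambda>m. Poly_Mapping.single m 1) ` monomials_of d)"
proof (rule subset_antisym)
  show "(forms (int d) :: 'k poly3 set) \<subseteq> pv.span ((\<lambda>m. Poly_Mapping.single m 1) ` monomials_of d)"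
  proof (rule subsetI)
    fix f :: "'k poly3" assume "f \<in> forms (int d)"
    then have "f = (\<Sum>m\<in>monomials_of d. const3 (Poly_Mapping.lookup f m) * Poly_Mapping.single m 1)"
      by (intro poly3_sum_singles forms_keys) auto
    moreover have "(\<Sum>m\<in>monomials_of d. const3 (Poly_Mapping.lookup f m) * Poly_Mapping.single m 1)
        \<in> pv.span ((\<lambda>m. Poly_Mapping.single m 1) ` monomials_of d)"
      by (intro pv.span_sum pv.span_scale pv.span_base imageI)
    ultimately show "f \<in> pv.span ((\<lambda>m. Poly_Mapping.single m 1) ` monomials_of d)"
      by simp
  qed
  show "pv.span ((\<lambda>m. Poly_Mapping.single m 1) ` monomials_of d) \<subseteq> (forms (int d) :: 'k poly3 set)"
    by (intro pv.span_minimal forms_subspace) (auto simp: monomials_of_def intro: forms_single)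
qed

lemma forms_fin: "\<exists>A. finite A \<and> (forms d :: 'k::field poly3 set) \<subseteq> pv.span A"
proof (cases "d < 0")
  case True
  then show ?thesis by (intro exI[of _ "{}"]) (simp add: forms_neg)
next
  case False
  then obtain n where "d = int n" by (metis nonneg_int_cases not_le)
  then show ?thesis
    by (intro exI[of _ "(\<lambda>m. Poly_Mapping.single m 1) ` monomials_of n"]) (simp add: forms_span)
qed

lemma dim_forms:
  "2 * pv.dim (forms (int d) :: 'k::field poly3 set) = (d + 1) * (d + 2)"
proof -
  let ?B = "(\<lambda>m. Poly_Mapping.single m 1 :: 'k poly3) ` monomials_of d"
  have inj: "inj_on (\<lambda>m. Poly_Mapping.single m 1 :: 'k poly3) (monomials_of d)"
    by (rule inj_onI) (metis lookup_single_eq lookup_single_not_eq zero_neq_one)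
  have "pv.independent ?B"
  proof (rule pv.independent_if_scalars_zero)
    fix c x assume s: "(\<Sum>x\<in>?B. const3 (c x) * x) = 0" and x: "x \<in> ?B"
    then obtain m where m: "x = Poly_Mapping.single m 1" "m \<in> monomials_of d" by auto
    have "(\<Sum>n\<in>monomials_of d. Poly_Mapping.single n (c (Poly_Mapping.single n 1))) = 0"
      using s by (simp add: sum.reindex[OF inj] const3_def mult_single)
    then have "Poly_Mapping.lookup (\<Sum>n\<in>monomials_of d. Poly_Mapping.single n (c (Poly_Mapping.single n 1))) m = 0"
      by simp
    then show "c x = 0"
      using m by (simp add: lookup_sum lookup_single when_def sum.delta)
  qed simp
  then have "pv.dim (forms (int d) :: 'k poly3 set) = card ?B"
    by (simp add: forms_span pv.dim_eq_card_independent)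
  then show ?thesis using card_monomials_of[of d] by (simp add: card_image[OF inj])
qed

text \<open>For \<open>g = 1\<close> this is the target of the restriction to the conic, and for
  \<open>g = pX ^ k\<close> the image of the forms that vanish to order \<open>k\<close> at the
  points.\<close>

lemma dim_poly_multiples:
  fixes g :: "'k::field poly"
  assumes "g \<noteq> 0"
  shows "kt.dim ((\<lambda>h. g * h) ` {h. degree h \<le> r}) = r + 1"
proof (rule kt.dim_unique)
  let ?B = "(\<lambda>i. g * monom 1 i) ` {..r}"
  have inj: "inj_on (\<lambda>i. g * monom 1 i) {..r}"
    by (rule inj_onI) (use assms in \<open>auto simp: monom_eq_iff'\<close>)
  show "?B \<subseteq> (\<lambda>h. g * h) ` {h. degree h \<le> r}"
    by (auto intro!: imageI degree_monom_le[THEN order_trans])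
  show "(\<lambda>h. g * h) ` {h. degree h \<le> r} \<subseteq> kt.span ?B"
  proof safe
    fix h :: "'k poly" assume "degree h \<le> r"
    then have "g * h = g * (\<Sum>i\<le>r. monom (coeff h i) i)" by (simp add: poly_as_sum_of_monoms')
    also have "\<dots> = (\<Sum>i\<le>r. Polynomial.smult (coeff h i) (g * monom 1 i))"
      by (simp add: sum_distrib_left smult_monom mult_smult_right[symmetric] del: mult_smult_right)
    finally show "g * h \<in> kt.span ?B"
      by (simp only:) (intro kt.span_sum kt.span_scale kt.span_base imageI)
  qed
  show "kt.independent ?B"
  proof (rule kt.independent_if_scalars_zero)
    fix c x assume s: "(\<Sum>x\<in>?B. Polynomial.smult (c x) x) = 0" and x: "x \<in> ?B"
    then obtain j where j: "x = g * monom 1 j" "j \<le> r" by auto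
    have "(\<Sum>i\<le>r. g * monom (c (g * monom 1 i)) i) = 0"
      using s by (simp add: sum.reindex[OF inj] smult_monom mult_smult_right[symmetric] del: mult_smult_right)
    then have "(\<Sum>i\<le>r. monom (c (g * monom 1 i)) i) = 0"
      using assms by (simp add: sum_distrib_left[symmetric])
    then have "coeff (\<Sum>i\<le>r. monom (c (g * monom 1 i)) i) j = 0" by simp
    then show "c x = 0" using j by (simp add: coeff_sum)
  qed simp
  show "card ?B = r + 1" by (simp add: card_image[OF inj])
qed

section \<open>Ideals of the polynomial ring\<close>

lemma class_is_ring: "ring (class_ring :: 'a::comm_ring_1 ring)"
  by (rule class_ring.ring_axioms)

lemma class_ops:
  "x \<oplus>\<^bsub>class_ring :: 'a::comm_ring_1 ring\<^esub> y = x + y" "x \<otimes>\<^bsub>class_ring :: 'a ring\<^esub> y = x * y"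
  by simp_all

lemma class_ideal_0: "ideal A (class_ring :: 'a::comm_ring_1 ring) \<Longrightarrow> 0 \<in> A"
  using additive_subgroup.zero_closed[OF ideal.axioms(1), of A "class_ring :: 'a ring"] by simp

lemma class_ideal_add: "ideal A (class_ring :: 'a::comm_ring_1 ring) \<Longrightarrow> a \<in> A \<Longrightarrow> b \<in> A \<Longrightarrow> a + b \<in> A"
  using additive_subgroup.a_closed[OF ideal.axioms(1), of A "class_ring :: 'a ring"] by simp

lemma class_ideal_mult: "ideal A (class_ring :: 'a::comm_ring_1 ring) \<Longrightarrow> a \<in> A \<Longrightarrow> r * a \<in> A"
  using ideal.I_l_closed[of A "class_ring :: 'a ring" a r] by simp

lemma class_ideal_mult_right: "ideal A (class_ring :: 'a::comm_ring_1 ring) \<Longrightarrow> a \<in> A \<Longrightarrow> a * r \<in> A"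
  using class_ideal_mult[of A a r] by (simp add: mult.commute)

lemma class_ideal_uminus: "ideal A (class_ring :: 'a::comm_ring_1 ring) \<Longrightarrow> a \<in> A \<Longrightarrow> - a \<in> A"
  using class_ideal_mult[of A a "-1"] by simp

lemma class_ideal_diff: "ideal A (class_ring :: 'a::comm_ring_1 ring) \<Longrightarrow> a \<in> A \<Longrightarrow> b \<in> A \<Longrightarrow> a - b \<in> A"
  using class_ideal_add[of A a "- b"] class_ideal_uminus[of A b] by simp

lemma class_ideal_sum: "ideal A (class_ring :: 'a::comm_ring_1 ring) \<Longrightarrow> (\<And>x. x \<in> Y \<Longrightarrow> F x \<in> A) \<Longrightarrow> (\<Sum>x\<in>Y. F x) \<in> A"
  by (induction Y rule: infinite_finite_induct) (auto intro: class_ideal_0 class_ideal_add)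

lemma class_idealI:
  assumes "0 \<in> A" "\<And>a b. a \<in> A \<Longrightarrow> b \<in> A \<Longrightarrow> a + b \<in> A" "\<And>a r. a \<in> A \<Longrightarrow> r * a \<in> A"
  shows "ideal A (class_ring :: 'a::comm_ring_1 ring)"
proof (rule idealI)
  show "ring (class_ring :: 'a ring)" by (rule class_is_ring)
  show "subgroup A (add_monoid (class_ring :: 'a ring))"
  proof
    fix x assume x: "x \<in> A"
    have "inv\<^bsub>add_monoid class_ring\<^esub> x = \<ominus>\<^bsub>class_ring\<^esub> x"
      unfolding a_inv_def ..
    then have "inv\<^bsub>add_monoid class_ring\<^esub> x = - x"
      by (simp only: class_ring_simps)
    then show "inv\<^bsub>add_monoid class_ring\<^esub> x \<in> A" using assms(3)[OF x, of "-1"] by simp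
  qed (use assms in auto)
  show "x \<otimes>\<^bsub>class_ring\<^esub> a \<in> A" if "a \<in> A" "x \<in> carrier class_ring" for a x :: 'a
    using that assms(3) by simp
  show "a \<otimes>\<^bsub>class_ring\<^esub> x \<in> A" if "a \<in> A" "x \<in> carrier class_ring" for a x :: 'a
    using assms(3)[OF that(1), of x] by (simp add: mult.commute)
qed

lemma class_genideal: "ideal (Idl\<^bsub>class_ring\<^esub> B) (class_ring :: 'a::comm_ring_1 ring)"
  by (rule ring.genideal_ideal[OF class_is_ring]) simp

lemma class_genideal_self: "b \<in> B \<Longrightarrow> b \<in> Idl\<^bsub>class_ring :: 'a::comm_ring_1 ring\<^esub> B"
  using ring.genideal_self[OF class_is_ring, of B] by auto

lemma class_genideal_minimal:
  "ideal A (class_ring :: 'a::comm_ring_1 ring) \<Longrightarrow> B \<subseteq> A \<Longrightarrow> Idl\<^bsub>class_ring :: 'a ring\<^esub> B \<subseteq> A"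
  by (rule ring.genideal_minimal[OF class_is_ring])

definition homogeneous :: "'k::field poly3 set \<Rightarrow> bool" where
  "homogeneous A \<longleftrightarrow> (\<forall>f\<in>A. \<forall>d. hcomp d f \<in> A)"

lemma hcomp_mult:
  fixes f g :: "'k::field poly3"
  assumes "finite D" "g = (\<Sum>e\<in>D. hcomp e g)"
  shows "hcomp d (f * g) = (\<Sum>e\<in>D. hcomp (d - e) f * hcomp e g)"
  by (subst assms(2)) (simp add: sum_distrib_left hcomp_sum hcomp_mult_form[OF hcomp_forms])

text \<open>The elements all of whose components lie in the ideal form an ideal themselves, and it
  contains the homogeneous generators.\<close>

lemma homogeneous_genideal:
  fixes B :: "'k::field poly3 set"
  assumes "\<And>f. f \<in> B \<Longrightarrow> \<exists>d. f \<in> forms d"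
  shows "homogeneous (Idl\<^bsub>class_ring\<^esub> B)"
proof -
  let ?I = "Idl\<^bsub>class_ring :: 'k poly3 ring\<^esub> B" and ?A = "{f. \<forall>d. hcomp d f \<in> Idl\<^bsub>class_ring :: 'k poly3 ring\<^esub> B}"
  note I = class_genideal[of B]
  have "ideal ?A class_ring"
  proof (rule class_idealI)
    show "r * a \<in> ?A" if a: "a \<in> ?A" for a r
    proof safe
      fix d
      obtain D where D: "finite D" "a = (\<Sum>e\<in>D. hcomp e a)" by (rule hcomp_expand)
      show "hcomp d (r * a) \<in> ?I"
        unfolding hcomp_mult[OF D] using a by (intro class_ideal_sum[OF I] class_ideal_mult[OF I]) auto
    qed
  qed (auto simp: hcomp_add intro: class_ideal_0[OF I] class_ideal_add[OF I])
  moreover have "B \<subseteq> ?A"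
  proof safe
    fix f d assume f: "f \<in> B"
    then obtain e where "f \<in> forms e" using assms by auto
    then show "hcomp d f \<in> ?I"
      using f by (auto simp: hcomp_of_form when_def intro: class_genideal_self class_ideal_0[OF I])
  qed
  ultimately have "?I \<subseteq> ?A" by (rule class_genideal_minimal)
  then show ?thesis by (auto simp: homogeneous_def)
qed

lemma homogeneous_ideal_prod:
  fixes A B :: "'k::field poly3 set"
  assumes "homogeneous A" "homogeneous B" and A: "ideal A class_ring" and B: "ideal B class_ring"
  shows "homogeneous (A \<cdot>\<^bsub>class_ring\<^esub> B)"
proof -
  have I: "ideal (A \<cdot>\<^bsub>class_ring\<^esub> B) class_ring" using ring.ideal_prod_is_ideal[OF class_is_ring A B] .
  have "\<forall>d. hcomp d f \<in> A \<cdot>\<^bsub>class_ring\<^esub> B" if "f \<in> A \<cdot>\<^bsub>class_ring\<^esub> B" for f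
    using that
  proof induction
    case (prod i j)
    obtain D where D: "finite D" "j = (\<Sum>e\<in>D. hcomp e j)" by (rule hcomp_expand)
    have "hcomp a i * hcomp b j \<in> A \<cdot>\<^bsub>class_ring\<^esub> B" for a b
      using ideal_prod.prod[of "hcomp a i" A "hcomp b j" B class_ring] prod assms(1,2)
      by (simp add: homogeneous_def)
    then show ?case
      by (auto simp: hcomp_mult[OF D] intro!: class_ideal_sum[OF I])
  next
    case (sum s1 s2)
    then show ?case by (auto simp: hcomp_add intro!: class_ideal_add[OF I])
  qed
  then show ?thesis by (auto simp: homogeneous_def)
qed

text \<open>Vanishing to order 0 is no condition; this is the start of the later inductions on the
  order.\<close>

lemma ideal_pow_0: "A [^]\<^bsub>ideals_set (class_ring :: 'a::comm_ring_1 ring)\<^esub> (0::nat) = UNIV"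
  by (simp add: ideals_set_def nat_pow_def)

lemma ideal_pow_Suc: "A [^]\<^bsub>ideals_set (class_ring :: 'a::comm_ring_1 ring)\<^esub> Suc k =
    (A [^]\<^bsub>ideals_set (class_ring :: 'a ring)\<^esub> k) \<cdot>\<^bsub>class_ring\<^esub> A"
  by (simp add: ideals_set_def nat_pow_def)

lemma ideals_set_one_mult [simp]:
  "\<one>\<^bsub>ideals_set (class_ring :: 'a::comm_ring_1 ring)\<^esub> = UNIV"
  "A \<otimes>\<^bsub>ideals_set (class_ring :: 'a ring)\<^esub> B = A \<cdot>\<^bsub>class_ring\<^esub> B"
  by (simp_all add: ideals_set_def)

lemma ideal_UNIV: "ideal UNIV (class_ring :: 'a::comm_ring_1 ring)"
  by (rule class_idealI) auto

context
  fixes A :: "'k::field poly3 set"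
  assumes A: "ideal A (class_ring :: 'k poly3 ring)"
begin

abbreviation (input) pow where "pow k \<equiv> A [^]\<^bsub>ideals_set (class_ring :: 'k poly3 ring)\<^esub> (k::nat)"

lemma ideal_pow_ideal: "ideal (pow k) (class_ring :: 'k poly3 ring)"
  by (induction k) (auto simp: ideal_pow_0 ideal_pow_Suc ideal_UNIV intro: ring.ideal_prod_is_ideal[OF class_is_ring] A)

lemma ideal_pow_homogeneous: "homogeneous A \<Longrightarrow> homogeneous (pow k)"
proof (induction k)
  case 0
  show ?case by (simp add: ideal_pow_0 homogeneous_def)
next
  case (Suc k)
  then show ?case by (auto simp: ideal_pow_Suc intro: homogeneous_ideal_prod ideal_pow_ideal A)
qed

lemma ideal_pow_mult_base: "f \<in> pow k \<Longrightarrow> g \<in> A \<Longrightarrow> f * g \<in> pow (Suc k)"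
  using ideal_prod.prod[of f "pow k" g A class_ring] by (simp add: ideal_pow_Suc)

lemma ideal_pow_mult: "f \<in> pow i \<Longrightarrow> g \<in> pow j \<Longrightarrow> f * g \<in> pow (i + j)"
proof (induction j arbitrary: g)
  case 0
  then show ?case by (simp add: class_ideal_mult_right[OF ideal_pow_ideal])
next
  case (Suc j)
  from Suc.prems(2) have "g \<in> pow j \<cdot>\<^bsub>class_ring\<^esub> A" by (simp add: ideal_pow_Suc)
  then show ?case
  proof induction
    case (prod a b)
    then have "f * a * b \<in> pow (Suc (i + j))"
      using Suc by (intro ideal_pow_mult_base) auto
    then show ?case by (simp add: mult.assoc)
  next
    case (sum s1 s2)
    then show ?case unfolding class_ops distrib_left by (intro class_ideal_add[OF ideal_pow_ideal])
  qed
qed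

text \<open>By Leibniz' rule, differentiating a product of elements of \<open>A\<close> spoils one
  factor only, so at most one power is lost.\<close>

lemma pderiv3_ideal_pow: "f \<in> pow (Suc k) \<Longrightarrow> pderiv3 j f \<in> pow k"
proof (induction k arbitrary: f)
  case 0
  show ?case by (simp add: ideal_pow_0)
next
  case (Suc k)
  from Suc.prems have "f \<in> pow (Suc k) \<cdot>\<^bsub>class_ring\<^esub> A" by (simp add: ideal_pow_Suc[of _ "Suc k"])
  then show ?case
  proof induction
    case (prod a b)
    then have "pderiv3 j a * b \<in> pow (Suc k)"
      using Suc.IH by (intro ideal_pow_mult_base) auto
    moreover have "a * pderiv3 j b \<in> pow (Suc k)"
      using prod(1) by (rule class_ideal_mult_right[OF ideal_pow_ideal])
    ultimately show ?case unfolding class_ops pderiv3_mult by (rule class_ideal_add[OF ideal_pow_ideal])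
  next
    case (sum s1 s2)
    then show ?case unfolding class_ops pderiv3_add by (intro class_ideal_add[OF ideal_pow_ideal])
  qed
qed

end

section \<open>Points and orders of vanishing\<close>

lemma eval3_scale:
  assumes "f \<in> forms (int d)"
  shows "eval3 id f (\<lambda>j. c * v j) = c ^ d * eval3 id f v"
proof -
  have "(\<Prod>j\<in>UNIV. (c * v j) ^ Poly_Mapping.lookup m j) = c ^ d * (\<Prod>j\<in>UNIV. v j ^ Poly_Mapping.lookup m j)"
    if "m \<in> Poly_Mapping.keys f" for m
  proof -
    have "mdeg m = d" using that assms by (simp add: forms_def)
    then show ?thesis
      unfolding power_mult_distrib prod.distrib power_sum[symmetric] mdeg_def[symmetric] by simp
  qed
  then show ?thesis by (simp add: eval3_def sum_distrib_left mult_ac)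
qed

lemma id_hom: "comm_ring_hom (id :: 'a::comm_ring_1 \<Rightarrow> 'a)"
  by unfold_locales simp_all

lemma vanishes_at_iff:
  fixes f :: "'k::field poly3"
  assumes "f \<in> forms d" "P \<in> proj_plane" "v \<in> P"
  shows "vanishes_at f P \<longleftrightarrow> eval3 id f v = 0"
proof
  assume z: "eval3 id f v = 0"
  obtain u where u: "P = {(\<lambda>j. c * u j) | c. c \<noteq> 0}" using assms(2) by (auto simp: proj_plane_def)
  obtain c where c: "v = (\<lambda>j. c * u j)" "c \<noteq> 0" using assms(3) u by auto
  show "vanishes_at f P"
    unfolding vanishes_at_def
  proof
    fix w assume "w \<in> P"
    then obtain c' where "w = (\<lambda>j. c' * u j)" using u by auto
    then have w: "w = (\<lambda>j. (c' / c) * v j)" using c by auto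
    show "eval3 id f w = 0"
    proof (cases "d < 0")
      case True
      then show ?thesis using assms(1) by (simp add: forms_neg eval3_def)
    next
      case False
      then obtain n where "d = int n" by (metis nonneg_int_cases not_le)
      then show ?thesis using z assms(1) eval3_scale[of f n "c' / c" v] w by simp
    qed
  qed
qed (use assms in \<open>auto simp: vanishes_at_def\<close>)

text \<open>Singularity is tested over the algebraic closure. A \<open>K\<close>-rational point is
  embedded there, and the injective \<open>to_ac\<close> carries the values back to
  \<open>K\<close>.\<close>

lemma nonsingular_conic_gradient:
  fixes v :: "3 \<Rightarrow> 'k::field"
  assumes "nonsingular_conic C" "v \<noteq> (\<lambda>_. 0)" "eval3 id C v = 0"
  obtains j where "eval3 id (pderiv3 j C) v \<noteq> 0"
proof -
  have h: "comm_ring_hom (to_ac :: 'k \<Rightarrow> _)" by unfold_locales simp_all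
  have e: "eval3 to_ac f (\<lambda>j. to_ac (v j)) = to_ac (eval3 id f v)" for f
    unfolding eval3_psubst psubst_comp[OF id_hom h] by simp
  have "(\<lambda>j. to_ac (v j)) \<noteq> (\<lambda>_. 0)" using assms(2) by (auto simp: fun_eq_iff)
  then show ?thesis using assms that by (auto simp: nonsingular_conic_def e)
qed

text \<open>Expansion along the line through \<open>v\<close> in the generic direction \<open>X\<close>.\<close>

definition taylor :: "(3 \<Rightarrow> 'k::field) \<Rightarrow> 'k poly3 \<Rightarrow> 'k poly3 poly" where
  "taylor v f = psubst (\<lambda>c. [:const3 c:]) (\<lambda>j. [:const3 (v j), var3 j:]) f"

lemma pCons_const3_hom: "comm_ring_hom (\<lambda>c :: 'k::field. [:const3 c:])"
  by unfold_locales (simp_all add: const3_add const3_mult one_pCons)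

lemma taylor_hom: "comm_ring_hom (taylor v :: 'k::field poly3 \<Rightarrow> _)"
  unfolding taylor_def by (rule psubst_hom[OF pCons_const3_hom])

lemma taylor_const: "taylor v (const3 c) = [:const3 c:]"
  and taylor_var: "taylor v (var3 j) = [:const3 (v j), var3 j:]"
  by (simp_all add: taylor_def psubst_const[OF pCons_const3_hom] psubst_var[OF pCons_const3_hom])

lemma coeff_taylor_0: "coeff (taylor v f) 0 = const3 (eval3 id f v)"
proof -
  interpret t: comm_ring_hom "taylor v" by (rule taylor_hom)
  interpret e: comm_ring_hom "psubst id v" by (rule psubst_hom[OF id_hom])
  have "comm_ring_hom (\<lambda>f. coeff (taylor v f) 0)"
    by unfold_locales (simp_all add: t.hom_mult coeff_mult t.hom_add)
  moreover have "comm_ring_hom (\<lambda>f. const3 (psubst id v f))"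
    by unfold_locales (simp_all add: e.hom_mult e.hom_add const3_add const3_mult)
  ultimately show ?thesis
    unfolding eval3_psubst
    by (rule ring_hom_poly3_eqI) (simp_all add: taylor_const taylor_var psubst_const[OF id_hom] psubst_var[OF id_hom])
qed

text \<open>This is the differential of \<open>f\<close> at \<open>v\<close> in the generic
  direction. Both sides obey the same product rule over evaluation at \<open>v\<close>, so constants
  and variables decide.\<close>

lemma coeff_taylor_1: "coeff (taylor v f) 1 = (\<Sum>j\<in>UNIV. const3 (eval3 id (pderiv3 j f) v) * var3 j)"
proof (induction f rule: poly3_induct)
  case (const c)
  show ?case by (simp add: taylor_const eval3_def)
next
  case (var i)
  have e: "const3 (eval3 id (pderiv3 j (var3 i)) v) * var3 j = (if i = j then var3 i else 0)" for j
    using psubst_const[OF id_hom, of v 1]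
    by (simp add: pderiv3_var eval3_psubst psubst_0[OF id_hom])
  show ?case unfolding taylor_var e by simp
next
  case (add f g)
  interpret t: comm_ring_hom "taylor v" by (rule taylor_hom)
  show ?case
    unfolding t.hom_add coeff_add add pderiv3_add eval3_psubst psubst_add[OF id_hom] const3_add distrib_right sum.distrib ..
next
  case (mult f g)
  interpret t: comm_ring_hom "taylor v" by (rule taylor_hom)
  have "coeff (taylor v (f * g)) 1 = coeff (taylor v f) 0 * coeff (taylor v g) 1 + coeff (taylor v f) 1 * coeff (taylor v g) 0"
    by (simp add: t.hom_mult coeff_mult)
  also have "\<dots> = (\<Sum>j\<in>UNIV. const3 (eval3 id f v) * (const3 (eval3 id (pderiv3 j g) v) * var3 j)
      + const3 (eval3 id (pderiv3 j f) v) * var3 j * const3 (eval3 id g v))"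
    unfolding mult coeff_taylor_0 sum.distrib sum_distrib_left sum_distrib_right ..
  also have "\<dots> = (\<Sum>j\<in>UNIV. const3 (eval3 id (pderiv3 j (f * g)) v) * var3 j)"
    unfolding pderiv3_mult eval3_psubst psubst_add[OF id_hom] psubst_mult[OF id_hom] const3_add const3_mult
    by (intro sum.cong refl) (simp only: distrib_right distrib_left mult_ac add.commute)
  finally show ?case .
qed

text \<open>The order in T of f(v + T X), with a generic direction X. Since S[T] is a domain, orders
  add in products and factors can be cancelled, which is not evident for the powers of an
  ideal.\<close>

definition ord_ge :: "(3 \<Rightarrow> 'k::field) \<Rightarrow> nat \<Rightarrow> 'k poly3 \<Rightarrow> bool" where
  "ord_ge v k f \<longleftrightarrow> [:0, 1:] ^ k dvd taylor v f"

lemma ord_ge_ideal: "ideal {f. ord_ge v k f} (class_ring :: 'k::field poly3 ring)"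
proof -
  interpret t: comm_ring_hom "taylor v" by (rule taylor_hom)
  show ?thesis by (rule class_idealI) (auto simp: ord_ge_def t.hom_add t.hom_mult)
qed

lemma ord_ge_point_ideal:
  assumes "v \<in> P" "f \<in> point_ideal P"
  shows "ord_ge v 1 f"
proof -
  have "{f. (\<exists>d. f \<in> forms d) \<and> vanishes_at f P} \<subseteq> {f. ord_ge v 1 f}"
  proof safe
    fix f assume "vanishes_at f P"
    then have "coeff (taylor v f) 0 = 0" using assms(1) by (simp add: coeff_taylor_0 vanishes_at_def)
    then show "ord_ge v 1 f" by (simp add: ord_ge_def dvd_iff_poly_eq_0 poly_0_coeff_0)
  qed
  from class_genideal_minimal[OF ord_ge_ideal this] show ?thesis using assms(2) by (auto simp: point_ideal_def)
qed

lemma point_ideal_ideal: "ideal (point_ideal P) (class_ring :: 'k::field poly3 ring)"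
  unfolding point_ideal_def by (rule class_genideal)

text \<open>The easy comparison of ideal powers with orders. The converse, for forms and for all
  points at once, is \<open>OW_W\<close>.\<close>

lemma ord_ge_point_ideal_pow:
  fixes f :: "'k::field poly3"
  assumes "v \<in> P" "f \<in> point_ideal P [^]\<^bsub>ideals_set poly_ring3\<^esub> k"
  shows "ord_ge v k f"
  using assms(2)
proof (induction k arbitrary: f)
  case 0
  show ?case by (simp add: ord_ge_def)
next
  case (Suc k)
  interpret t: comm_ring_hom "taylor v" by (rule taylor_hom)
  from Suc.prems have "f \<in> (point_ideal P [^]\<^bsub>ideals_set poly_ring3\<^esub> k) \<cdot>\<^bsub>class_ring\<^esub> point_ideal P"
    by (simp add: ideal_pow_Suc)
  then show ?case
  proof induction
    case (prod a b)
    have "[:0, 1:] ^ k dvd taylor v a" using Suc.IH prod by (simp add: ord_ge_def)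
    moreover have "[:0, 1:] dvd taylor v b" using ord_ge_point_ideal[OF assms(1)] prod by (simp add: ord_ge_def)
    ultimately have "[:0, 1:] ^ k * [:0, 1:] dvd taylor v a * taylor v b" by (rule mult_dvd_mono)
    then show ?case by (simp add: ord_ge_def t.hom_mult mult.commute)
  next
    case (sum s1 s2)
    then show ?case by (simp add: ord_ge_def t.hom_add)
  qed
qed

text \<open>A nonzero gradient at \<open>v\<close> bounds the order of \<open>C\<close> there by
  one, and orders add. For \<open>k = 0\<close> the truncated \<open>k - 1\<close> is 0 and the
  claim is trivial.\<close>

lemma ord_ge_cancel:
  fixes C f :: "'k::field poly3"
  assumes "ord_ge v k (C * f)" "eval3 id (pderiv3 j C) v \<noteq> 0"
  shows "ord_ge v (k - 1) f"
proof (cases "f = 0")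
  case True
  interpret t: comm_ring_hom "taylor v" by (rule taylor_hom)
  show ?thesis using True by (simp add: ord_ge_def)
next
  case False
  interpret t: comm_ring_hom "taylor v" by (rule taylor_hom)
  let ?p = "taylor v C" and ?q = "taylor v f"
  show ?thesis
  proof (cases "?q = 0")
    case True
    then show ?thesis by (simp add: ord_ge_def)
  next
    case q: False
    \<comment> \<open>The coefficient of X_j in the differential at \<open>v\<close> is the j-th
      derivative at \<open>v\<close>, so one nonzero derivative makes the linear Taylor coefficient
      nonzero.\<close>
    have "Poly_Mapping.lookup (\<Sum>i\<in>UNIV. const3 (eval3 id (pderiv3 i C) v) * var3 i) (Poly_Mapping.single j 1)
        = eval3 id (pderiv3 j C) v"
    proof -
      have "Poly_Mapping.lookup (const3 c * var3 i :: 'k poly3) (Poly_Mapping.single j 1) = (if i = j then c else 0)" for c i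
      proof (cases "i = j")
        case False
        then have "Poly_Mapping.single i (1::nat) \<noteq> Poly_Mapping.single j 1"
          by (metis lookup_single_eq lookup_single_not_eq zero_neq_one)
        then show ?thesis using False by (simp add: const3_def var3_def mult_single lookup_single_not_eq del: One_nat_def)
      qed (simp add: const3_def var3_def mult_single)
      then show ?thesis by (simp add: lookup_sum)
    qed
    then have c1: "coeff ?p 1 \<noteq> 0" using assms(2) unfolding coeff_taylor_1 by (metis lookup_zero)
    then have p: "?p \<noteq> 0" by auto
    have "\<not> [:0, 1:] ^ 2 dvd ?p"
    proof
      assume "[:0, 1:] ^ 2 dvd ?p"
      then obtain r where "?p = [:0, 1:] ^ 2 * r" by (rule dvdE)
      then have "?p = monom 1 2 * r" by (simp add: monom_altdef)
      then show False using c1 by (simp add: coeff_monom_mult)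
    qed
    then have "order 0 ?p < 2"
      using order_divides[of 0 2 ?p] p by simp
    moreover have "k \<le> order 0 (?p * ?q)"
      using assms(1) order_divides[of 0 k "?p * ?q"] p q by (simp add: ord_ge_def t.hom_mult)
    ultimately have "k - 1 \<le> order 0 ?q" using order_mult[of ?p ?q 0] p q by simp
    then show ?thesis using order_divides[of 0 "k - 1" ?q] by (simp add: ord_ge_def)
  qed
qed

section \<open>Orders of vanishing along a parametrized curve\<close>

lemma pCons_hom: "comm_ring_hom (\<lambda>c :: 'k::field. [:c:])"
  by unfold_locales (simp_all add: one_pCons)

text \<open>Substitution in a polynomial ring over a ring: coefficients go through
  \<open>\<psi>\<close>, the variable goes to \<open>x\<close>. This specialises a Taylor expansion
  to a curve.\<close>

lemma eval_map_poly_hom: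
  fixes \<psi> :: "'a::comm_ring_1 \<Rightarrow> 'b::comm_ring_1"
  assumes "comm_ring_hom \<psi>"
  shows "comm_ring_hom (\<lambda>p. poly (map_poly \<psi> p) x)"
proof -
  interpret \<psi>: comm_ring_hom \<psi> by fact
  let ?h = "\<lambda>p. poly (map_poly \<psi> p) x"
  have pC: "?h (pCons a p) = \<psi> a + x * ?h p" for a p
    by (simp add: map_poly_pCons)
  have add: "?h (p + q) = ?h p + ?h q" for p q
  proof (induction p q rule: poly_induct2)
    case (pCons a p b q)
    then show ?case by (simp only: add_pCons pC \<psi>.hom_add) (simp add: algebra_simps)
  qed simp
  have smult: "?h (Polynomial.smult a q) = \<psi> a * ?h q" for a q
  proof (induction q)
    case (pCons b q)
    then show ?case by (simp only: smult_pCons pC \<psi>.hom_mult) (simp add: algebra_simps)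
  qed simp
  have mult: "?h (p * q) = ?h p * ?h q" for p q
  proof (induction p)
    case (pCons a p)
    then show ?case by (simp only: mult_pCons_left add smult pC \<psi>.hom_zero) (simp add: algebra_simps)
  qed simp
  show ?thesis
    by unfold_locales (simp_all only: add mult, simp_all add: one_pCons pC)
qed

lemma eval_map_poly_linear:
  fixes \<psi> :: "'a::comm_ring_1 \<Rightarrow> 'b::comm_ring_1"
  assumes "\<psi> 0 = 0"
  shows "poly (map_poly \<psi> [:b, c:]) x = \<psi> b + x * \<psi> c" "poly (map_poly \<psi> [:b:]) x = \<psi> b"
    "poly (map_poly \<psi> [:0, 1:]) x = x * \<psi> 1"
  using assms by (simp_all add: map_poly_pCons)

text \<open>Writing q(t) = q(a) + (t - a) w(t), the composite f(q(t)) is the Taylor expansion at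
  q(a) with T = t - a and X = w(t), so a factor T^k turns into (t - a)^k.\<close>

lemma ord_ge_curve:
  fixes q :: "3 \<Rightarrow> 'k::field poly"
  assumes "ord_ge (\<lambda>j. poly (q j) a) k f"
  shows "[:- a, 1:] ^ k dvd psubst (\<lambda>c. [:c:]) q f"
proof -
  let ?v = "\<lambda>j. poly (q j) a"
  have "\<exists>w. q j = [:?v j:] + [:- a, 1:] * w" for j
  proof -
    have "[:- a, 1:] dvd q j - [:?v j:]" by (simp add: dvd_iff_poly_eq_0)
    then show ?thesis by (metis add.commute diff_add_cancel dvdE)
  qed
  then obtain w where w: "\<And>j. q j = [:?v j:] + [:- a, 1:] * w j" by metis
  let ?\<psi> = "psubst (\<lambda>c :: 'k. [:c:]) w"
  interpret \<psi>: comm_ring_hom ?\<psi> by (rule psubst_hom[OF pCons_hom])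

  let ?h = "\<lambda>p. poly (map_poly ?\<psi> p) [:- a, 1:]"
  have h: "comm_ring_hom ?h" by (rule eval_map_poly_hom[OF psubst_hom[OF pCons_hom]])
  interpret h: comm_ring_hom ?h by (rule h)
  note H = eval_map_poly_linear[of ?\<psi>, OF \<psi>.hom_zero]
  have 1: "(\<lambda>c. ?h [:const3 c:]) = (\<lambda>c. [:c:])"
    by (simp only: H psubst_const[OF pCons_hom])
  have 2: "(\<lambda>j. ?h [:const3 (?v j), var3 j:]) = q"
  proof
    fix j
    have "?h [:const3 (?v j), var3 j:] = [:?v j:] + [:- a, 1:] * w j"
      by (simp only: H psubst_const[OF pCons_hom] psubst_var[OF pCons_hom])
    then show "?h [:const3 (?v j), var3 j:] = q j" using w[of j] by (rule trans[OF _ sym])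
  qed
  have e: "?h (taylor ?v f) = psubst (\<lambda>c. [:c:]) q f"
    using psubst_comp[OF pCons_const3_hom h, of "\<lambda>j. [:const3 (?v j), var3 j:]" f]
    unfolding 1 2 taylor_def .
  obtain r where "taylor ?v f = [:0, 1:] ^ k * r" using assms by (auto simp: ord_ge_def elim: dvdE)
  then have "?h (taylor ?v f) = ?h [:0, 1:] ^ k * ?h r" by (simp only: h.hom_mult h.hom_power)
  moreover have "?h [:0, 1:] = [:- a, 1:]" by (simp only: H \<psi>.hom_zero \<psi>.hom_one mult_1_right add_0)
  ultimately show ?thesis unfolding e by (metis dvd_triv_left)
qed

section \<open>Rational parametrization of the conic\<close>

lemma linear_form_expand:
  fixes L :: "'k::field poly3"
  assumes "L \<in> forms 1"
  obtains l where "L = (\<Sum>j\<in>UNIV. const3 (l j) * var3 j)"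
proof -
  have "\<exists>c. pderiv3 j L = const3 c" for j
    using pderiv3_forms[OF assms, of j] by (simp add: forms_0_const)
  then obtain l where l: "\<And>j. pderiv3 j L = const3 (l j)" by metis
  have "L = (\<Sum>j\<in>UNIV. const3 (l j) * var3 j)"
    using euler_formula[OF assms] by (simp only: l of_int_1 const3_1 mult_1_left mult.commute)
  then show ?thesis by (rule that)
qed

text \<open>Euler's formula expresses 2 C through the derivatives, which are linear forms; the
  coefficients are halved afterwards.\<close>

lemma quadratic_form_expand:
  fixes C :: "'k::field_char_0 poly3"
  assumes "C \<in> forms 2"
  obtains a b c d e f where
    "C = const3 a * (var3 0 * var3 0) + const3 b * (var3 1 * var3 1) + const3 c * (var3 2 * var3 2)
      + const3 d * (var3 1 * var3 2) + const3 e * (var3 0 * var3 2) + const3 f * (var3 0 * var3 1)"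
proof -
  have "pderiv3 j C \<in> forms 1" for j using pderiv3_forms[OF assms, of j] by simp
  then have "\<exists>l. pderiv3 j C = (\<Sum>i\<in>UNIV. const3 (l i) * var3 i)" for j
    using linear_form_expand by metis
  then obtain h where h: "\<And>j. pderiv3 j C = (\<Sum>i\<in>UNIV. const3 (h j i) * var3 i)" by metis
  let ?c = "\<lambda>x. const3 (x / 2) :: 'k poly3"
  have "C = const3 (1 / 2) * (const3 2 * C)"
    by (simp only: mult.assoc[symmetric] const3_mult[symmetric]) simp
  also have "const3 2 * C = (\<Sum>j\<in>UNIV. var3 j * (\<Sum>i\<in>UNIV. const3 (h j i) * var3 i))"
    using euler_formula[OF assms] by (simp only: h of_int_numeral)
  also have "const3 (1 / 2) * \<dots> =
      const3 (1 / 2) * const3 (h 0 0) * (var3 0 * var3 0) + const3 (1 / 2) * const3 (h 1 1) * (var3 1 * var3 1)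
      + const3 (1 / 2) * const3 (h 2 2) * (var3 2 * var3 2)
      + const3 (1 / 2) * (const3 (h 1 2) + const3 (h 2 1)) * (var3 1 * var3 2)
      + const3 (1 / 2) * (const3 (h 0 2) + const3 (h 2 0)) * (var3 0 * var3 2)
      + const3 (1 / 2) * (const3 (h 0 1) + const3 (h 1 0)) * (var3 0 * var3 1)"
    unfolding sum_UNIV_three by (simp only: algebra_simps)
  finally show ?thesis unfolding const3_mult[symmetric] const3_add[symmetric] by (rule that)
qed

text \<open>With u1 = x1 - p x0 and u2 = x2 - r x0 this is the expansion around the point (1, p, r),
  which lies on the conic by \<open>a\<close>; (g1, g2) is the gradient there in the last two
  variables. The last identity is the derivative along (1, p, r).\<close>

lemma normal_form_identities:
  fixes a b c d e f g1 g2 p r x0 x1 x2 :: "'k::field_char_0"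
  assumes a: "a + b * (p * p) + c * (r * r) + d * (p * r) + e * r + f * p = 0"
    and f: "f = g1 - 2 * b * p - d * r" and e: "e = g2 - 2 * c * r - d * p"
  shows "a * (x0 * x0) + b * (x1 * x1) + c * (x2 * x2) + d * (x1 * x2) + e * (x0 * x2) + f * (x0 * x1)
      = b * (x1 - p * x0)^2 + c * (x2 - r * x0)^2 + d * (x1 - p * x0) * (x2 - r * x0)
        + x0 * (g1 * (x1 - p * x0) + g2 * (x2 - r * x0))"
    and "2 * b * x1 + d * x2 + f * x0 = 2 * b * (x1 - p * x0) + d * (x2 - r * x0) + x0 * g1"
    and "2 * c * x2 + d * x1 + e * x0 = 2 * c * (x2 - r * x0) + d * (x1 - p * x0) + x0 * g2"
    and "2 * a * x0 + e * x2 + f * x1 + p * (2 * b * x1 + d * x2 + f * x0) + r * (2 * c * x2 + d * x1 + e * x0)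
       = g1 * (x1 - p * x0) + g2 * (x2 - r * x0)"
proof -
  have "a = - (b * (p * p) + c * (r * r) + d * (p * r) + e * r + f * p)"
    using a by (simp only: eq_neg_iff_add_eq_0 add.assoc)
  then have a': "a = b * (p * p) + c * (r * r) + d * (p * r) - g2 * r - g1 * p"
    by (simp add: e f algebra_simps)
  show "a * (x0 * x0) + b * (x1 * x1) + c * (x2 * x2) + d * (x1 * x2) + e * (x0 * x2) + f * (x0 * x1)
      = b * (x1 - p * x0)^2 + c * (x2 - r * x0)^2 + d * (x1 - p * x0) * (x2 - r * x0)
        + x0 * (g1 * (x1 - p * x0) + g2 * (x2 - r * x0))"
    by (simp add: a' e f algebra_simps power2_eq_square)
  show "2 * b * x1 + d * x2 + f * x0 = 2 * b * (x1 - p * x0) + d * (x2 - r * x0) + x0 * g1"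
    by (simp add: f algebra_simps)
  show "2 * c * x2 + d * x1 + e * x0 = 2 * c * (x2 - r * x0) + d * (x1 - p * x0) + x0 * g2"
    by (simp add: e algebra_simps)
  show "2 * a * x0 + e * x2 + f * x1 + p * (2 * b * x1 + d * x2 + f * x0) + r * (2 * c * x2 + d * x1 + e * x0)
       = g1 * (x1 - p * x0) + g2 * (x2 - r * x0)"
    by (simp add: a' e f algebra_simps)
qed

text \<open>The expression in \<open>D\<close> is the quadratic part of the equation on the tangent
  direction (-g2, g1). If it vanishes, the whole tangent line lies on the conic, and the point of
  that line with first coordinate -B is singular.\<close>

lemma tangent_identities:
  fixes b c d g1 g2 y z :: "'k::field_char_0"
  assumes D: "b * g2^2 + c * g1^2 - d * g1 * g2 = 0" and yz: "g1 * y + g2 * z = 1"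
    and B: "B = 2 * c * z * g1 - 2 * b * y * g2 + d * (y * g1 - z * g2)"
  shows "b * (- g2)^2 + c * g1^2 + d * (- g2) * g1 + (- B) * (g1 * (- g2) + g2 * g1) = 0"
    and "2 * b * (- g2) + d * g1 + (- B) * g1 = 0"
    and "2 * c * g1 + d * (- g2) + (- B) * g2 = 0"
proof -
  show "b * (- g2)^2 + c * g1^2 + d * (- g2) * g1 + (- B) * (g1 * (- g2) + g2 * g1) = 0"
    using D by (simp add: algebra_simps)
  have "B * g1 = (d * g1 - 2 * b * g2) * (g1 * y + g2 * z) + 2 * z * (b * g2^2 + c * g1^2 - d * g1 * g2)"
    by (simp add: B algebra_simps power2_eq_square)
  then show "2 * b * (- g2) + d * g1 + (- B) * g1 = 0" unfolding D yz by simp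
  have "B * g2 = (2 * c * g1 - d * g2) * (g1 * y + g2 * z) - 2 * y * (b * g2^2 + c * g1^2 - d * g1 * g2)"
    by (simp add: B algebra_simps power2_eq_square)
  then show "2 * c * g1 + d * (- g2) + (- B) * g2 = 0" unfolding D yz by simp
qed

text \<open>The direction (y, z) + t (-g2, g1) has linear part 1, so the equation of the conic at
  the point with first coordinate x0 and this displacement reads N + x0 = 0. The identities give N
  as a quadratic polynomial in t, and the derivatives along (-g2, g1) and (y, z) at the point with
  x0 = -N.\<close>

lemma parametrization_identities:
  fixes b c d g1 g2 y z t :: "'k::field_char_0"
  assumes yz: "g1 * y + g2 * z = 1"
    and A: "A = b * y^2 + c * z^2 + d * y * z"
    and B: "B = 2 * c * z * g1 - 2 * b * y * g2 + d * (y * g1 - z * g2)"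
    and D: "D = b * g2^2 + c * g1^2 - d * g1 * g2"
    and N: "N = b * (y - g2 * t)^2 + c * (z + g1 * t)^2 + d * (y - g2 * t) * (z + g1 * t)"
  shows "N = A + t * (B + t * D)"
    and "g1 * (y - g2 * t) + g2 * (z + g1 * t) = 1"
    and "- g2 * (2 * b * (y - g2 * t) + d * (z + g1 * t) + (- N) * g1)
       + g1 * (2 * c * (z + g1 * t) + d * (y - g2 * t) + (- N) * g2) = B + t * (2 * D)"
    and "y * (2 * b * (y - g2 * t) + d * (z + g1 * t) + (- N) * g1)
       + z * (2 * c * (z + g1 * t) + d * (y - g2 * t) + (- N) * g2) = A - t^2 * D"
proof -
  show N': "N = A + t * (B + t * D)"
    by (simp add: A B D N algebra_simps power2_eq_square)
  show "g1 * (y - g2 * t) + g2 * (z + g1 * t) = 1"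
    using yz by (simp add: algebra_simps)
  show "- g2 * (2 * b * (y - g2 * t) + d * (z + g1 * t) + (- N) * g1)
       + g1 * (2 * c * (z + g1 * t) + d * (y - g2 * t) + (- N) * g2) = B + t * (2 * D)"
    by (simp add: B D algebra_simps power2_eq_square)
  have "y * (2 * b * (y - g2 * t) + d * (z + g1 * t) + (- N) * g1)
       + z * (2 * c * (z + g1 * t) + d * (y - g2 * t) + (- N) * g2) = 2 * A + t * B - N * (g1 * y + g2 * z)"
    by (simp add: A B algebra_simps power2_eq_square)
  then show "y * (2 * b * (y - g2 * t) + d * (z + g1 * t) + (- N) * g1)
       + z * (2 * c * (z + g1 * t) + d * (y - g2 * t) + (- N) * g2) = A - t^2 * D"
    unfolding yz N' by (simp add: algebra_simps power2_eq_square)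
qed

text \<open>\<open>\<beta>\<close> and \<open>\<gamma>\<close> are the coordinates of (u1, u2) in
  the basis (y, z), (-g2, g1), whose determinant is 1.\<close>

lemma coordinates_identities:
  fixes b c d g1 g2 y z u1 u2 \<beta> \<gamma> :: "'k::field_char_0"
  assumes yz: "g1 * y + g2 * z = 1" and \<beta>: "\<beta> = g1 * u1 + g2 * u2" and \<gamma>: "\<gamma> = y * u2 - z * u1"
  shows "u1 = \<beta> * y - \<gamma> * g2" "u2 = \<beta> * z + \<gamma> * g1"
    and "\<beta> = 0 \<Longrightarrow> b * u1^2 + c * u2^2 + d * u1 * u2 = \<gamma>^2 * (b * g2^2 + c * g1^2 - d * g1 * g2)"
proof -
  have "\<beta> * y - \<gamma> * g2 = u1 * (g1 * y + g2 * z)" "\<beta> * z + \<gamma> * g1 = u2 * (g1 * y + g2 * z)"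
    by (simp_all add: \<beta> \<gamma> algebra_simps)
  then show *: "u1 = \<beta> * y - \<gamma> * g2" "u2 = \<beta> * z + \<gamma> * g1" unfolding yz by simp_all
  show "b * u1^2 + c * u2^2 + d * u1 * u2 = \<gamma>^2 * (b * g2^2 + c * g1^2 - d * g1 * g2)" if "\<beta> = 0"
    unfolding *[unfolded that] by (simp add: algebra_simps power2_eq_square)
qed
text \<open>The conic in the affine coordinates \<open>u\<^sub>1, u\<^sub>2\<close> centred at its point \<open>(1, p, r)\<close>.\<close>

lemma conic_normal_form:
  fixes C :: "'k::field_char_0 poly3"
  assumes "C \<in> forms 2" and v: "eval3 id C v = 0" "v 0 = 1"
  obtains b c d g1 g2 where
    "\<And>x. eval3 id C x = b * (x 1 - v 1 * x 0)^2 + c * (x 2 - v 2 * x 0)^2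
        + d * (x 1 - v 1 * x 0) * (x 2 - v 2 * x 0)
        + x 0 * (g1 * (x 1 - v 1 * x 0) + g2 * (x 2 - v 2 * x 0))"
    "\<And>x. eval3 id (pderiv3 1 C) x = 2 * b * (x 1 - v 1 * x 0) + d * (x 2 - v 2 * x 0) + x 0 * g1"
    "\<And>x. eval3 id (pderiv3 2 C) x = 2 * c * (x 2 - v 2 * x 0) + d * (x 1 - v 1 * x 0) + x 0 * g2"
    "\<And>x. eval3 id (pderiv3 0 C) x + v 1 * eval3 id (pderiv3 1 C) x + v 2 * eval3 id (pderiv3 2 C) x
       = g1 * (x 1 - v 1 * x 0) + g2 * (x 2 - v 2 * x 0)"
proof -
  obtain a b c d e f where
    C: "C = const3 a * (var3 0 * var3 0) + const3 b * (var3 1 * var3 1) + const3 c * (var3 2 * var3 2)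
      + const3 d * (var3 1 * var3 2) + const3 e * (var3 0 * var3 2) + const3 f * (var3 0 * var3 1)"
    using quadratic_form_expand[OF assms(1)] by blast
  have ev: "eval3 id (F + G) x = eval3 id F x + eval3 id G x" "eval3 id (F * G) x = eval3 id F x * eval3 id G x"
    "eval3 id (const3 k) x = k" "eval3 id (var3 j) x = x j" for F G and k :: 'k and x j
    unfolding eval3_psubst
    by (simp_all only: psubst_add[OF id_hom] psubst_mult[OF id_hom] psubst_const[OF id_hom] psubst_var[OF id_hom] id_apply)
  have ev01: "eval3 id (0 :: 'k poly3) x = 0" "eval3 id (1 :: 'k poly3) x = 1" for x
    using ev(3)[of 0 x] ev(3)[of 1 x] by (simp_all only: const3_0 const3_1)
  have Cx: "eval3 id C x = a * (x 0 * x 0) + b * (x 1 * x 1) + c * (x 2 * x 2) + d * (x 1 * x 2) + e * (x 0 * x 2) + f * (x 0 * x 1)" for x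
    unfolding C ev ..
  note pd = C pderiv3_add pderiv3_mult pderiv3_const pderiv3_var three_distinct if_True if_False mult_zero_left mult_zero_right
    mult_1_left mult_1_right add_0_left add_0_right refl simp_thms
  have s: "k * (m + m) = 2 * k * m" for k m :: 'k by simp
  have d0: "eval3 id (pderiv3 0 C) x = 2 * a * x 0 + e * x 2 + f * x 1" for x
    by (simp only: pd ev ev01 s)
  have d1: "eval3 id (pderiv3 1 C) x = 2 * b * x 1 + d * x 2 + f * x 0" for x
    by (simp only: pd ev ev01 s)
  have d2: "eval3 id (pderiv3 2 C) x = 2 * c * x 2 + d * x 1 + e * x 0" for x
    by (simp only: pd ev ev01 s)
  define g1 where "g1 = 2 * b * v 1 + d * v 2 + f"
  define g2 where "g2 = 2 * c * v 2 + d * v 1 + e"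
  have f: "f = g1 - 2 * b * v 1 - d * v 2" and e: "e = g2 - 2 * c * v 2 - d * v 1"
    by (simp_all add: g1_def g2_def)
  have a: "a + b * (v 1 * v 1) + c * (v 2 * v 2) + d * (v 1 * v 2) + e * v 2 + f * v 1 = 0"
    using v(1) unfolding Cx v(2) mult_1_left mult_1_right .
  note ids = normal_form_identities[OF a f e]
  show thesis
  proof (rule that)
    show "eval3 id C x = b * (x 1 - v 1 * x 0)^2 + c * (x 2 - v 2 * x 0)^2
        + d * (x 1 - v 1 * x 0) * (x 2 - v 2 * x 0)
        + x 0 * (g1 * (x 1 - v 1 * x 0) + g2 * (x 2 - v 2 * x 0))" for x
      unfolding Cx by (rule ids)
    show "eval3 id (pderiv3 1 C) x = 2 * b * (x 1 - v 1 * x 0) + d * (x 2 - v 2 * x 0) + x 0 * g1" for x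
      unfolding d1 by (rule ids)
    show "eval3 id (pderiv3 2 C) x = 2 * c * (x 2 - v 2 * x 0) + d * (x 1 - v 1 * x 0) + x 0 * g2" for x
      unfolding d2 by (rule ids)
    show "eval3 id (pderiv3 0 C) x + v 1 * eval3 id (pderiv3 1 C) x + v 2 * eval3 id (pderiv3 2 C) x
       = g1 * (x 1 - v 1 * x 0) + g2 * (x 2 - v 2 * x 0)" for x
      unfolding d0 d1 d2 by (rule ids)
  qed
qed

lemma poly_eqI_pointwise:
  fixes p q :: "'k::field_char_0 poly"
  assumes "\<And>t. poly p t = poly q t"
  shows "p = q"
  using assms by (simp add: poly_eq_poly_eq_iff[symmetric] fun_eq_iff)

lemma poly_psubst: "poly (psubst (\<lambda>c. [:c:]) q f) t = eval3 id f (\<lambda>j. poly (q j) t)"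
proof -
  have h: "comm_ring_hom (\<lambda>p :: 'a poly. poly p t)" by unfold_locales simp_all
  show ?thesis unfolding eval3_psubst psubst_comp[OF pCons_hom h] by (simp add: id_def)
qed

text \<open>
  The parametrization \<open>t \<mapsto> q(t)\<close> comes from the pencil of lines through the point \<open>v\<close>, which
  corresponds to the parameter \<open>\<infinity>\<close>. The linear forms \<open>\<Sum>\<^sub>j y\<^sub>i\<^sub>j \<partial>\<^sub>j C\<close> restrict to \<open>1, t, t\<^sup>2\<close>.
\<close>

lemma conic_parametrization_at:
  fixes C :: "'k::field_char_0 poly3"
  assumes C: "nonsingular_conic C" and v: "eval3 id C v = 0" "v 0 = 1"
  obtains q y where
    "\<And>j. degree (q j) \<le> 2" "q 0 \<noteq> 0" "psubst (\<lambda>c. [:c:]) q C = 0"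
    "\<And>i. i \<le> 2 \<Longrightarrow> (\<Sum>j\<in>UNIV. Polynomial.smult (y i j) (psubst (\<lambda>c. [:c:]) q (pderiv3 j C))) = monom 1 i"
    "\<And>x. x 0 = 1 \<Longrightarrow> eval3 id C x = 0 \<Longrightarrow> x \<noteq> v \<Longrightarrow> \<exists>t k. k \<noteq> 0 \<and> (\<forall>j. poly (q j) t = k * x j)"
proof -
  have C2: "C \<in> forms 2" using C by (simp add: nonsingular_conic_def)
  obtain b c d g1 g2 where
    Cx: "\<And>x. eval3 id C x = b * (x 1 - v 1 * x 0)^2 + c * (x 2 - v 2 * x 0)^2
        + d * (x 1 - v 1 * x 0) * (x 2 - v 2 * x 0)
        + x 0 * (g1 * (x 1 - v 1 * x 0) + g2 * (x 2 - v 2 * x 0))" and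
    d1: "\<And>x. eval3 id (pderiv3 1 C) x = 2 * b * (x 1 - v 1 * x 0) + d * (x 2 - v 2 * x 0) + x 0 * g1" and
    d2: "\<And>x. eval3 id (pderiv3 2 C) x = 2 * c * (x 2 - v 2 * x 0) + d * (x 1 - v 1 * x 0) + x 0 * g2" and
    d0: "\<And>x. eval3 id (pderiv3 0 C) x + v 1 * eval3 id (pderiv3 1 C) x + v 2 * eval3 id (pderiv3 2 C) x
       = g1 * (x 1 - v 1 * x 0) + g2 * (x 2 - v 2 * x 0)"
    using conic_normal_form[OF C2 v] by blast
  \<comment> \<open>Because \<open>v 0 = 1\<close>, the derivative along \<open>v\<close> can stand
    in for the derivative in the first variable.\<close>
  have grad: "\<not> (eval3 id (pderiv3 1 C) x = 0 \<and> eval3 id (pderiv3 2 C) x = 0 \<and>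
      g1 * (x 1 - v 1 * x 0) + g2 * (x 2 - v 2 * x 0) = 0)" if x: "x \<noteq> (\<lambda>_. 0)" "eval3 id C x = 0" for x
  proof
    assume *: "eval3 id (pderiv3 1 C) x = 0 \<and> eval3 id (pderiv3 2 C) x = 0 \<and>
      g1 * (x 1 - v 1 * x 0) + g2 * (x 2 - v 2 * x 0) = 0"
    then have "eval3 id (pderiv3 0 C) x = 0" using d0[of x] by simp
    with * have "\<forall>j. eval3 id (pderiv3 j C) x = 0" unfolding all_three by blast
    then show False using nonsingular_conic_gradient[OF C x] by metis
  qed
  have v0: "v \<noteq> (\<lambda>_. 0)" using v(2) by (metis zero_neq_one)
  have g: "g1 \<noteq> 0 \<or> g2 \<noteq> 0"
    using grad[OF v0 v(1)] d1[of v] d2[of v] v(2) by auto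
  have "\<exists>y z. g1 * y + g2 * z = 1"
  proof (cases "g1 = 0")
    case True
    then show ?thesis using g by (intro exI[of _ 0] exI[of _ "1 / g2"]) simp
  next
    case False
    then show ?thesis by (intro exI[of _ "1 / g1"] exI[of _ 0]) simp
  qed
  then obtain y z where yz: "g1 * y + g2 * z = 1" by blast
  define A where "A = b * y^2 + c * z^2 + d * y * z"
  define B where "B = 2 * c * z * g1 - 2 * b * y * g2 + d * (y * g1 - z * g2)"
  define D where "D = b * g2^2 + c * g1^2 - d * g1 * g2"
  have D: "D \<noteq> 0"
  proof
    assume D: "D = 0"
    \<comment> \<open>The candidate for a singular point on the tangent line at \<open>v\<close>:
      first coordinate -B and displacement (-g2, g1) from the multiple of \<open>v\<close>.\<close>
    define x :: "3 \<Rightarrow> 'k" where "x = (\<lambda>j. if j = 0 then - B else if j = 1 then - g2 - B * v 1 else g1 - B * v 2)"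
    have x: "x 0 = - B" "x 1 - v 1 * x 0 = - g2" "x 2 - v 2 * x 0 = g1"
      by (simp_all only: x_def three_distinct if_True if_False) (simp_all add: algebra_simps)
    have "x \<noteq> (\<lambda>_. 0)"
    proof
      assume "x = (\<lambda>_. 0)"
      then have "x 0 = 0" "x 1 = 0" "x 2 = 0" by auto
      then show False using x g by auto
    qed
    moreover have "eval3 id C x = 0"
      unfolding Cx x(2,3) unfolding x(1) by (rule tangent_identities[OF D[unfolded D_def] yz B_def])
    moreover have "eval3 id (pderiv3 1 C) x = 0"
      unfolding d1 x(2,3) unfolding x(1) by (rule tangent_identities[OF D[unfolded D_def] yz B_def])
    moreover have "eval3 id (pderiv3 2 C) x = 0"
      unfolding d2 x(2,3) unfolding x(1) by (rule tangent_identities[OF D[unfolded D_def] yz B_def])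
    moreover have "g1 * (x 1 - v 1 * x 0) + g2 * (x 2 - v 2 * x 0) = 0"
      unfolding x(2,3) by simp
    ultimately show False using grad by blast
  qed
  \<comment> \<open>The line through \<open>v\<close> in the direction (y, z) + t (-g2, g1) meets
    the conic again where the first coordinate is -N(t); \<open>q\<close> is that point in the
    original coordinates.\<close>
  define N where "N = [:A, B, D:]"
  define q where "q = (\<lambda>j::3. if j = 0 then - N else if j = 1 then [:y, - g2:] - Polynomial.smult (v 1) N
      else [:z, g1:] - Polynomial.smult (v 2) N)"
  have q: "q 0 = - N" "q 1 = [:y, - g2:] - Polynomial.smult (v 1) N" "q 2 = [:z, g1:] - Polynomial.smult (v 2) N"
    by (simp_all only: q_def three_distinct if_True if_False refl)
  have qt: "poly (q 0) t = - poly N t" "poly (q 1) t - v 1 * poly (q 0) t = y - g2 * t"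
      "poly (q 2) t - v 2 * poly (q 0) t = z + g1 * t" for t
    by (simp_all add: q algebra_simps)
  have Nt: "poly N t = b * (y - g2 * t)^2 + c * (z + g1 * t)^2 + d * (y - g2 * t) * (z + g1 * t)" for t
    using parametrization_identities(1)[OF yz A_def B_def D_def refl, of t] by (simp add: N_def)
  note ids = parametrization_identities[OF yz A_def B_def D_def Nt]
  note gt = ids(2)
  \<comment> \<open>The derivatives of \<open>C\<close> along \<open>v\<close>, \<open>W1\<close>
    and \<open>W0\<close> restrict to 1, B + 2 D t and A - D t^2. As D is nonzero and the
    characteristic is 0, these span the polynomials of degree at most 2; the weights
    \<open>Y\<close> solve for 1, t and t^2.\<close>
  define W0 where "W0 = (\<lambda>j::3. if j = 0 then 0 else if j = 1 then y else z)"
  define W1 where "W1 = (\<lambda>j::3. if j = 0 then 0 else if j = 1 then - g2 else g1)"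
  define R where "R = (\<lambda>j. psubst (\<lambda>c. [:c:]) q (pderiv3 j C))"
  have W: "W0 0 = 0" "W0 1 = y" "W0 2 = z" "W1 0 = 0" "W1 1 = - g2" "W1 2 = g1"
    by (simp_all only: W0_def W1_def three_distinct if_True if_False refl)
  have R0: "(\<Sum>j\<in>UNIV. Polynomial.smult (v j) (R j)) = 1"
  proof (rule poly_eqI_pointwise)
    fix t
    show "poly (\<Sum>j\<in>UNIV. Polynomial.smult (v j) (R j)) t = poly 1 t"
      using d0[of "\<lambda>j. poly (q j) t"] unfolding qt(2,3) gt
      by (simp add: sum_UNIV_three v(2) R_def poly_psubst)
  qed
  have R1: "(\<Sum>j\<in>UNIV. Polynomial.smult (W1 j) (R j)) = [:B, 2 * D:]"
  proof (rule poly_eqI_pointwise)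
    fix t
    have "poly (\<Sum>j\<in>UNIV. Polynomial.smult (W1 j) (R j)) t =
        - g2 * eval3 id (pderiv3 1 C) (\<lambda>j. poly (q j) t) + g1 * eval3 id (pderiv3 2 C) (\<lambda>j. poly (q j) t)"
      by (simp add: sum_UNIV_three W R_def poly_psubst)
    also have "\<dots> = B + t * (2 * D)"
      unfolding d1 d2 qt(2,3) unfolding qt(1) by (rule ids)
    finally show "poly (\<Sum>j\<in>UNIV. Polynomial.smult (W1 j) (R j)) t = poly [:B, 2 * D:] t" by simp
  qed
  have R2: "(\<Sum>j\<in>UNIV. Polynomial.smult (W0 j) (R j)) = [:A, 0, - D:]"
  proof (rule poly_eqI_pointwise)
    fix t
    have "poly (\<Sum>j\<in>UNIV. Polynomial.smult (W0 j) (R j)) t =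
        y * eval3 id (pderiv3 1 C) (\<lambda>j. poly (q j) t) + z * eval3 id (pderiv3 2 C) (\<lambda>j. poly (q j) t)"
      by (simp add: sum_UNIV_three W R_def poly_psubst)
    also have "\<dots> = A - t^2 * D"
      unfolding d1 d2 qt(2,3) unfolding qt(1) by (rule ids)
    finally show "poly (\<Sum>j\<in>UNIV. Polynomial.smult (W0 j) (R j)) t = poly [:A, 0, - D:] t"
      by (simp add: power2_eq_square algebra_simps)
  qed
  define Y where "Y = (\<lambda>i::nat. \<lambda>j. if i = 0 then v j else if i = 1 then (W1 j - B * v j) / (2 * D) else (A * v j - W0 j) / D)"
  have lin: "(\<Sum>j\<in>UNIV. Polynomial.smult ((k1 * f1 j + k2 * f2 j) / l) (R j))
      = Polynomial.smult (k1 / l) (\<Sum>j\<in>UNIV. Polynomial.smult (f1 j) (R j)) + Polynomial.smult (k2 / l) (\<Sum>j\<in>UNIV. Polynomial.smult (f2 j) (R j))"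
    for k1 k2 l f1 f2
    unfolding kt.scale_sum_right sum.distrib[symmetric]
    by (intro sum.cong refl) (simp add: smult_add_left[symmetric] add_divide_distrib)
  show thesis
  proof (rule that[of q Y])
    have N2: "degree N \<le> 2" using D by (simp add: N_def)
    have "degree [:k, l:] \<le> 2" for k l :: 'k by (simp add: degree_pCons_eq_if)
    then have "\<forall>j. degree (q j) \<le> 2"
      unfolding all_three q degree_minus using N2 by (blast intro: degree_diff_le order.trans[OF degree_smult_le])
    then show "degree (q j) \<le> 2" for j by blast
    show "q 0 \<noteq> 0" using D by (simp add: q N_def)
    show "psubst (\<lambda>c. [:c:]) q C = 0"
    proof (rule poly_eqI_pointwise)
      fix t
      show "poly (psubst (\<lambda>c. [:c:]) q C) t = poly 0 t"
        unfolding poly_psubst Cx qt(2,3) gt unfolding qt(1) Nt by simp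
    qed
    show "(\<Sum>j\<in>UNIV. Polynomial.smult (Y i j) (psubst (\<lambda>c. [:c:]) q (pderiv3 j C))) = monom 1 i" if "i \<le> 2" for i
    proof -
      have "i = 0 \<or> i = 1 \<or> i = 2" using that by auto
      then consider "i = 0" | "i = 1" | "i = 2" by blast
      then have "(\<Sum>j\<in>UNIV. Polynomial.smult (Y i j) (R j)) = monom 1 i"
      proof cases
        case 1
        then show ?thesis using R0 by (simp add: Y_def)
      next
        case 2
        then have "Y i = (\<lambda>j. (1 * W1 j + (- B) * v j) / (2 * D))" by (simp add: Y_def)
        then have "(\<Sum>j\<in>UNIV. Polynomial.smult (Y i j) (R j)) = Polynomial.smult (1 / (2 * D)) [:B, 2 * D:] + Polynomial.smult (- B / (2 * D)) 1"
          by (simp only: lin R0 R1)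
        also have "\<dots> = monom 1 i" using D 2 by (simp add: monom_Suc monom_0 one_pCons)
        finally show ?thesis .
      next
        case 3
        then have "Y i = (\<lambda>j. (A * v j + (- 1) * W0 j) / D)" by (simp add: Y_def)
        then have "(\<Sum>j\<in>UNIV. Polynomial.smult (Y i j) (R j)) = Polynomial.smult (A / D) 1 + Polynomial.smult (- 1 / D) [:A, 0, - D:]"
          by (simp only: lin R0 R2)
        also have "\<dots> = monom 1 i" using D 3 by (simp add: monom_Suc monom_0 one_pCons numeral_2_eq_2)
        finally show ?thesis .
      qed
      then show ?thesis by (simp add: R_def)
    qed
    show "\<exists>t k. k \<noteq> 0 \<and> (\<forall>j. poly (q j) t = k * x j)" if x: "x 0 = 1" "eval3 id C x = 0" "x \<noteq> v" for x
    proof -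
      define u1 u2 where "u1 = x 1 - v 1" and "u2 = x 2 - v 2"
      define \<beta> where "\<beta> = g1 * u1 + g2 * u2"
      define \<gamma> where "\<gamma> = y * u2 - z * u1"
      have u: "u1 = \<beta> * y - \<gamma> * g2" "u2 = \<beta> * z + \<gamma> * g1"
        by (rule coordinates_identities[OF yz \<beta>_def \<gamma>_def])+
      have Q: "b * u1^2 + c * u2^2 + d * u1 * u2 + \<beta> = 0"
        using x(2) unfolding Cx x(1) mult_1_right mult_1_left u1_def[symmetric] u2_def[symmetric] \<beta>_def .
      \<comment> \<open>A point with vanishing \<open>\<beta>\<close> lies on the tangent at
        \<open>v\<close>, which meets the conic only in \<open>v\<close> because D is
        nonzero.\<close>
      have \<beta>: "\<beta> \<noteq> 0"
      proof
        assume b0: "\<beta> = 0"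
        then have "\<gamma>^2 * D = 0"
          using Q coordinates_identities(3)[OF yz \<beta>_def \<gamma>_def b0, of b c d] by (simp add: D_def)
        then have "\<gamma> = 0" using D by simp
        then have "u1 = 0" "u2 = 0" using u b0 by simp_all
        then have "\<forall>j. x j = v j" unfolding all_three using x(1) v(2) by (simp add: u1_def u2_def)
        then show False using x(3) by auto
      qed
      define t where "t = \<gamma> / \<beta>"
      have ut: "u1 = \<beta> * (y - g2 * t)" "u2 = \<beta> * (z + g1 * t)"
        using \<beta> u by (simp_all add: t_def right_diff_distrib distrib_left mult.commute)
      have "\<beta> * (\<beta> * poly N t + 1) = 0"
        using Q unfolding ut Nt by (simp add: algebra_simps power2_eq_square)
      then have N: "\<beta> * poly N t = - 1" using \<beta> by (simp add: eq_neg_iff_add_eq_0)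
      have N': "poly N t = - (1 / \<beta>)" using N \<beta> by (simp add: field_simps)
      have "poly (q 0) t = 1 / \<beta> * x 0" "poly (q 1) t = 1 / \<beta> * x 1" "poly (q 2) t = 1 / \<beta> * x 2"
      proof -
        show q0: "poly (q 0) t = 1 / \<beta> * x 0" unfolding qt N' x(1) by simp
        have "x 1 = \<beta> * (y - g2 * t) + v 1" "x 2 = \<beta> * (z + g1 * t) + v 2"
          using ut by (simp_all add: u1_def u2_def diff_eq_eq)
        moreover have "poly (q 1) t = (y - g2 * t) + v 1 * (1 / \<beta>)" "poly (q 2) t = (z + g1 * t) + v 2 * (1 / \<beta>)"
          using qt(2,3)[of t] unfolding q0 x(1) by (simp_all add: diff_eq_eq)
        ultimately show "poly (q 1) t = 1 / \<beta> * x 1" "poly (q 2) t = 1 / \<beta> * x 2"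
          using \<beta> by (simp_all add: distrib_left add_divide_distrib)
      qed
      then have "\<forall>j. poly (q j) t = 1 / \<beta> * x j" unfolding all_three by blast
      moreover have "1 / \<beta> \<noteq> 0" using \<beta> by simp
      ultimately show ?thesis by blast
    qed
  qed
qed

lemma proj_plane_scale:
  assumes "P \<in> proj_plane" "v \<in> P" "c \<noteq> (0::'k::field)"
  shows "(\<lambda>j. c * v j) \<in> P"
proof -
  obtain u a where u: "P = {(\<lambda>j. c * u j) | c. c \<noteq> 0}" "v = (\<lambda>j. a * u j)" "a \<noteq> 0"
    using assms by (auto simp: proj_plane_def)
  then have "(\<lambda>j. c * v j) = (\<lambda>j. (c * a) * u j)" by (simp add: mult.assoc)
  moreover have "c * a \<noteq> 0" using u assms(3) by simp
  ultimately show ?thesis unfolding u(1) by blast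
qed

lemma proj_plane_proportional:
  assumes "P \<in> proj_plane" "v \<in> P" "w \<in> P"
  obtains c :: "'k::field" where "c \<noteq> 0" "w = (\<lambda>j. c * v j)"
proof -
  obtain u where u: "P = {(\<lambda>j. c * u j) | c. c \<noteq> 0}"
    using assms by (auto simp: proj_plane_def)
  then obtain a b where ab: "v = (\<lambda>j. a * u j)" "a \<noteq> 0" "w = (\<lambda>j. b * u j)" "b \<noteq> 0"
    using assms by auto
  then show ?thesis by (intro that[of "b / a"]) auto
qed

lemma proj_plane_disjoint:
  assumes "P \<in> proj_plane" "P' \<in> proj_plane" "v \<in> P" "v \<in> P'"
  shows "P = (P' :: (3 \<Rightarrow> 'k::field) set)"
  using proj_plane_proportional[OF assms(1,3)] proj_plane_proportional[OF assms(2,4)]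
    proj_plane_scale[OF assms(1,3)] proj_plane_scale[OF assms(2,4)] by (metis subsetI subset_antisym)

lemma proj_plane_nonempty: "P \<in> proj_plane \<Longrightarrow> \<exists>v. v \<in> P"
  unfolding proj_plane_def using zero_neq_one by blast

text \<open>The base point of the pencil has no finite parameter, so it must be a rational point of
  the conic outside \<open>\<X>\<close>. Such a point comes from a first parametrization, based at a
  member of \<open>\<X>\<close>: only finitely many parameters lead to members of
  \<open>\<X>\<close> or to first coordinate 0.\<close>

lemma conic_parametrization:
  fixes C :: "'k::field_char_0 poly3"
  assumes C: "nonsingular_conic C" and \<X>: "\<X> \<subseteq> proj_plane" "finite \<X>" "\<X> \<noteq> {}"
    and X0: "\<forall>P\<in>\<X>. \<forall>v\<in>P. v 0 \<noteq> 0" and CX: "\<forall>P\<in>\<X>. vanishes_at C P"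
  obtains q y \<tau> where
    "\<And>j. degree (q j) \<le> 2" "psubst (\<lambda>c. [:c:]) q C = 0"
    "\<And>i. i \<le> 2 \<Longrightarrow> (\<Sum>j\<in>UNIV. Polynomial.smult (y i j) (psubst (\<lambda>c. [:c:]) q (pderiv3 j C))) = monom 1 i"
    "\<And>P. P \<in> \<X> \<Longrightarrow> (\<lambda>j. poly (q j) (\<tau> P)) \<in> P"
proof -
  have C2: "C \<in> forms 2" using C by (simp add: nonsingular_conic_def)
  have norm: "\<exists>v\<in>P. v 0 = 1" if P: "P \<in> \<X>" for P
  proof -
    obtain v where v: "v \<in> P" using proj_plane_nonempty[of P] P \<X>(1) by blast
    then have "v 0 \<noteq> 0" using X0 P by blast
    then show ?thesis
      using proj_plane_scale[of P v "1 / v 0"] v P \<X>(1)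
      by (intro bexI[of _ "\<lambda>j. 1 / v 0 * v j"]) auto
  qed
  obtain P0 where P0: "P0 \<in> \<X>" using \<X>(3) by blast
  obtain v where v: "v \<in> P0" "v 0 = 1" using norm[OF P0] by blast
  have Cv: "eval3 id C v = 0" using CX P0 v(1) by (simp add: vanishes_at_def)
  obtain q y where q: "q 0 \<noteq> 0" "psubst (\<lambda>c. [:c:]) q C = 0"
    "\<And>i. i \<le> 2 \<Longrightarrow> (\<Sum>j\<in>UNIV. Polynomial.smult (y i j) (psubst (\<lambda>c. [:c:]) q (pderiv3 j C))) = monom 1 i"
    by (rule conic_parametrization_at[OF C Cv v(2)]) blast
  have comb: "(\<Sum>j\<in>UNIV. y i j * eval3 id (pderiv3 j C) (\<lambda>j. poly (q j) t)) = t ^ i" if "i \<le> 2" for i t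
  proof -
    have "poly (\<Sum>j\<in>UNIV. Polynomial.smult (y i j) (psubst (\<lambda>c. [:c:]) q (pderiv3 j C))) t = poly (monom 1 i) t"
      using q(3)[OF that] by simp
    then show ?thesis by (simp add: poly_sum poly_psubst poly_monom)
  qed
  \<comment> \<open>The linear forms that restrict to 1 and t recover first the scaling factor and
    then the parameter from a point of the curve.\<close>
  have uniq: "t = t'" if P: "P \<in> \<X>" "(\<lambda>j. poly (q j) t) \<in> P" "(\<lambda>j. poly (q j) t') \<in> P" for P t t'
  proof -
    obtain c where c: "(\<lambda>j. poly (q j) t') = (\<lambda>j. c * poly (q j) t)"
      using proj_plane_proportional[OF _ P(2,3)] P(1) \<X>(1) by blast
    have "pderiv3 j C \<in> forms (int 1)" for j using pderiv3_forms[OF C2, of j] by simp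
    then have "t' ^ i = c * t ^ i" if "i \<le> 2" for i
      unfolding comb[OF that, symmetric] c using eval3_scale[of _ 1 c "\<lambda>j. poly (q j) t"]
      by (simp add: sum_distrib_left mult_ac)
    from this[of 0] this[of 1] show ?thesis by simp
  qed
  have "finite {t. poly (q 0) t = 0}" using poly_roots_finite[OF q(1)] .
  moreover have "finite (\<Union>P\<in>\<X>. {t. (\<lambda>j. poly (q j) t) \<in> P})"
  proof (rule finite_UN_I[OF \<X>(2)])
    fix P assume P: "P \<in> \<X>"
    show "finite {t. (\<lambda>j. poly (q j) t) \<in> P}"
    proof (cases "\<exists>t0. (\<lambda>j. poly (q j) t0) \<in> P")
      case True
      then obtain t0 where "(\<lambda>j. poly (q j) t0) \<in> P" by blast
      then have "{t. (\<lambda>j. poly (q j) t) \<in> P} \<subseteq> {t0}" using uniq[OF P] by blast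
      then show ?thesis using finite_subset by blast
    qed simp
  qed
  ultimately have "\<exists>t. t \<notin> {t. poly (q 0) t = 0} \<union> (\<Union>P\<in>\<X>. {t. (\<lambda>j. poly (q j) t) \<in> P})"
    by (intro ex_new_if_finite infinite_UNIV_char_0) simp
  then obtain t where t: "poly (q 0) t \<noteq> 0" "\<And>P. P \<in> \<X> \<Longrightarrow> (\<lambda>j. poly (q j) t) \<notin> P" by blast
  define w where "w = (\<lambda>j. 1 / poly (q 0) t * poly (q j) t)"
  have w0: "w 0 = 1" using t by (simp add: w_def)
  have "eval3 id C (\<lambda>j. poly (q j) t) = 0" unfolding poly_psubst[symmetric] q(2) by simp
  moreover have "C \<in> forms (int 2)" using C2 by simp
  ultimately have Cw: "eval3 id C w = 0"
    unfolding w_def by (subst eval3_scale[of C 2]) simp_all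
  obtain q' y' where q':
    "\<And>j. degree (q' j) \<le> 2" "psubst (\<lambda>c. [:c:]) q' C = 0"
    "\<And>i. i \<le> 2 \<Longrightarrow> (\<Sum>j\<in>UNIV. Polynomial.smult (y' i j) (psubst (\<lambda>c. [:c:]) q' (pderiv3 j C))) = monom 1 i"
    "\<And>x. x 0 = 1 \<Longrightarrow> eval3 id C x = 0 \<Longrightarrow> x \<noteq> w \<Longrightarrow> \<exists>t k. k \<noteq> 0 \<and> (\<forall>j. poly (q' j) t = k * x j)"
    by (rule conic_parametrization_at[OF C Cw w0]) blast
  have "\<exists>t. (\<lambda>j. poly (q' j) t) \<in> P" if P: "P \<in> \<X>" for P
  proof -
    obtain x where x: "x \<in> P" "x 0 = 1" using norm[OF P] by blast
    have PP: "P \<in> proj_plane" using P \<X>(1) by blast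
    have "x \<noteq> w"
    proof
      assume "x = w"
      then have "(\<lambda>j. poly (q 0) t * w j) \<in> P" using proj_plane_scale[OF PP x(1) t(1)] by simp
      then show False using t(1) t(2)[OF P] by (simp add: w_def)
    qed
    moreover have "eval3 id C x = 0" using CX P x(1) by (simp add: vanishes_at_def)
    ultimately obtain t k where k: "k \<noteq> 0" "\<forall>j. poly (q' j) t = k * x j" using q'(4) x(2) by blast
    then have "(\<lambda>j. poly (q' j) t) = (\<lambda>j. k * x j)" by auto
    then show ?thesis using proj_plane_scale[OF PP x(1) k(1)] by metis
  qed
  then obtain \<tau> where "\<And>P. P \<in> \<X> \<Longrightarrow> (\<lambda>j. poly (q' j) (\<tau> P)) \<in> P" by metis
  with q'(1-3) show thesis by (rule that)
qed

section \<open>Restriction to the conic\<close>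

text \<open>Non-singularity is recorded through \<open>grad\<close>: combinations of the derivatives
  of \<open>C\<close> restrict to 1, t and t^2.\<close>

locale conic_points =
  fixes C :: "'k::field_char_0 poly3" and \<X> :: "(3 \<Rightarrow> 'k) set set"
    and q :: "3 \<Rightarrow> 'k poly" and y :: "nat \<Rightarrow> 3 \<Rightarrow> 'k" and \<tau> :: "(3 \<Rightarrow> 'k) set \<Rightarrow> 'k"
  assumes C2: "C \<in> forms 2" and CX: "\<And>P. P \<in> \<X> \<Longrightarrow> vanishes_at C P"
    and \<X>: "\<X> \<subseteq> proj_plane" and finX: "finite \<X>" and cardX: "4 \<le> card \<X>"
    and degq: "\<And>j. degree (q j) \<le> 2"
    and qC: "psubst (\<lambda>c. [:c:]) q C = 0"
    and grad: "\<And>i. i \<le> 2 \<Longrightarrow>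
      (\<Sum>j\<in>UNIV. Polynomial.smult (y i j) (psubst (\<lambda>c. [:c:]) q (pderiv3 j C))) = monom 1 i"
    and node: "\<And>P. P \<in> \<X> \<Longrightarrow> (\<lambda>j. poly (q j) (\<tau> P)) \<in> P"
begin

definition rho :: "'k poly3 \<Rightarrow> 'k poly" where
  "rho f = psubst (\<lambda>c. [:c:]) q f"

lemma rho_hom: "comm_ring_hom rho"
  unfolding rho_def by (rule psubst_hom[OF pCons_hom])

sublocale rho: comm_ring_hom rho by (rule rho_hom)

lemma rho_const [simp]: "rho (const3 c) = [:c:]"
  by (simp only: rho_def psubst_const[OF pCons_hom])

lemma rho_scale: "rho (const3 c * f) = Polynomial.smult c (rho f)"
  by (simp add: rho.hom_mult)

lemma rho_linear: "Vector_Spaces.linear (\<lambda>c f. const3 c * f) Polynomial.smult rho"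
  by (rule Vector_Spaces.linear.intro)
    (unfold_locales, simp_all only: rho_scale rho.hom_add)

lemma rho_C [simp]: "rho C = 0"
  by (simp add: rho_def qC)

lemma degree_rho:
  assumes "f \<in> forms (int m)"
  shows "degree (rho f) \<le> 2 * m"
  unfolding rho_def psubst_def
proof (rule degree_sum_le)
  fix e assume e: "e \<in> Poly_Mapping.keys f"
  have "degree (\<Prod>j\<in>UNIV. q j ^ Poly_Mapping.lookup e j) \<le> (\<Sum>j\<in>UNIV. degree (q j ^ Poly_Mapping.lookup e j))"
    by (rule order.trans[OF degree_prod_sum_le]) (simp_all add: o_def)
  also have "\<dots> \<le> (\<Sum>j\<in>UNIV. 2 * Poly_Mapping.lookup e j)"
  proof (rule sum_mono)
    fix j
    show "degree (q j ^ Poly_Mapping.lookup e j) \<le> 2 * Poly_Mapping.lookup e j"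
      using degree_power_le[of "q j" "Poly_Mapping.lookup e j"] mult_le_mono1[OF degq[of j], of "Poly_Mapping.lookup e j"]
      by linarith
  qed
  also have "\<dots> = 2 * mdeg e" by (simp add: mdeg_def sum_distrib_left)
  also have "mdeg e = m" using e assms by (simp add: forms_def)
  finally show "degree ([:Poly_Mapping.lookup f e:] * (\<Prod>j\<in>UNIV. q j ^ Poly_Mapping.lookup e j)) \<le> 2 * m"
    by (simp add: order.trans[OF degree_smult_le])
qed simp

lemma grad_forms: "pderiv3 j C \<in> forms 1"
  using pderiv3_forms[OF C2, of j] by simp

text \<open>These linear forms restrict to 1, t, t^2. They are built from the derivatives of
  \<open>C\<close>, so that multiplying by them on the conic can be imitated by differentiating
  multiples of \<open>C\<close>.\<close>

definition lam :: "nat \<Rightarrow> 'k poly3" where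
  "lam i = (\<Sum>j\<in>UNIV. const3 (y i j) * pderiv3 j C)"

lemma lam_forms: "lam i \<in> forms 1"
  unfolding lam_def by (intro forms_sum forms_const_mult grad_forms)

lemma rho_lam: "i \<le> 2 \<Longrightarrow> rho (lam i) = monom 1 i"
  unfolding lam_def rho.hom_sum rho_scale unfolding rho_def by (rule grad)

text \<open>The pieces are the constant term, the linear coefficient and the rest divided by t^2, so
  one linear form accounts for two degrees.\<close>

lemma poly_split_degree:
  fixes h :: "'k poly"
  assumes "degree h \<le> e + 2"
  obtains h' where "\<And>i. degree (h' i) \<le> e" "h = (\<Sum>i\<le>2. monom 1 i * h' i)"
proof -
  obtain a h1 where h1: "h = pCons a h1" by (rule pCons_cases)
  obtain b g where g: "h1 = pCons b g" by (rule pCons_cases)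
  have "degree g \<le> e" using assms unfolding h1 g by (auto simp: degree_pCons_eq_if split: if_splits)
  moreover have "h = (\<Sum>i\<le>2. monom 1 i * (if i = 0 then [:a:] else if i = 1 then [:b:] else g))"
    unfolding h1 g by (simp add: numeral_2_eq_2 monom_Suc monom_0)
  ultimately show ?thesis
    by (intro that[of "\<lambda>i. if i = 0 then [:a:] else if i = 1 then [:b:] else g"]) simp_all
qed

lemma rho_linear_surj:
  assumes "degree h \<le> 2"
  obtains L where "L \<in> forms 1" "rho L = h"
proof -
  have "rho (\<Sum>i\<le>2. const3 (coeff h i) * lam i) = (\<Sum>i\<le>2. monom (coeff h i) i)"
    unfolding rho.hom_sum rho_scale by (intro sum.cong refl) (simp add: rho_lam smult_monom)
  also have "\<dots> = h" by (rule poly_as_sum_of_monoms'[OF assms])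
  finally show ?thesis
    by (intro that[of "\<Sum>i\<le>2. const3 (coeff h i) * lam i"] forms_sum forms_const_mult lam_forms)
qed

lemma rho_surj:
  assumes "degree h \<le> 2 * m"
  shows "\<exists>f\<in>forms (int m). rho f = h"
  using assms
proof (induction m arbitrary: h)
  case 0
  then obtain c where "h = [:c:]" by (auto elim: degree_eq_zeroE)
  then show ?case by (intro bexI[of _ "const3 c"]) auto
next
  case (Suc m)
  then have "degree h \<le> 2 * m + 2" by simp
  then obtain h' where h': "\<And>i. degree (h' i) \<le> 2 * m" "h = (\<Sum>i\<le>2. monom 1 i * h' i)"
    by (rule poly_split_degree) blast
  have "\<forall>i. \<exists>f. f \<in> forms (int m) \<and> rho f = h' i" using Suc.IH[OF h'(1)] by blast
  from choice[OF this] obtain f where f: "\<And>i. f i \<in> forms (int m)" "\<And>i. rho (f i) = h' i" by blast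
  have "(\<Sum>i\<le>2. lam i * f i) \<in> forms (int (Suc m))"
  proof (rule forms_sum)
    fix i
    show "lam i * f i \<in> forms (int (Suc m))"
      using forms_mult[OF lam_forms f(1), of i i] by simp
  qed
  moreover have "rho (\<Sum>i\<le>2. lam i * f i) = h"
    unfolding rho.hom_sum rho.hom_mult h'(2)
  proof (rule sum.cong[OF refl])
    fix i :: nat assume "i \<in> {..2}"
    then show "rho (lam i) * rho (f i) = monom 1 i * h' i" by (simp only: atMost_iff rho_lam f(2))
  qed
  ultimately show ?case by blast
qed

lemma rho_image_forms: "rho ` forms (int m) = {h. degree h \<le> 2 * m}"
  using degree_rho rho_surj by force

lemma pv_dim_0: "pv.dim {0 :: 'k poly3} = 0"
proof (rule pv.dim_unique[of "{}"])
  show "{0 :: 'k poly3} \<subseteq> pv.span {}" unfolding pv.span_empty ..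
  show "pv.independent ({} :: 'k poly3 set)" by (rule pv.independent_empty)
qed auto

lemma C_neq_0: "C \<noteq> 0"
proof
  assume "C = 0"
  then have "pderiv3 j C = 0" for j by simp
  then have "lam 0 = 0" unfolding lam_def by (simp only: mult_zero_right sum.neutral_const)
  then show False using rho_lam[of 0] by simp
qed

lemma mult_left_linear: "Vector_Spaces.linear (\<lambda>c f. const3 c * f) (\<lambda>c f. const3 c * f) ((*) (g :: 'k poly3))"
  by (rule Vector_Spaces.linear.intro) (unfold_locales, simp_all only: distrib_left mult_ac)

lemma dim_mult_image:
  assumes "pv.subspace V" "V \<subseteq> forms d" "g \<noteq> (0 :: 'k poly3)"
  shows "pv.dim ((*) g ` V) = pv.dim V"
proof -
  obtain A where A: "finite A" "(forms d :: 'k poly3 set) \<subseteq> pv.span A" using forms_fin[of d] by blast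
  have V0: "0 \<in> V" by (rule pv.subspace_0[OF assms(1)])
  have g: "g * x = 0 \<longleftrightarrow> x = 0" for x unfolding mult_eq_0_iff using assms(3) by blast
  have e: "V \<inter> {x. g * x = 0} = {0}" unfolding g using V0 by blast
  show ?thesis
    using pp.rank_nullity[OF mult_left_linear[of g] assms(1) A(1) order.trans[OF assms(2) A(2)]]
    unfolding e pv_dim_0 add_0_left ..
qed

lemma two_dim_forms_diff: "2 * pv.dim (forms (int m - 2) :: 'k poly3 set) + 2 * (2 * m + 1) = (m + 1) * (m + 2)"
proof (cases "m < 2")
  case True
  then have "m = 0 \<or> m = 1" by auto
  then show ?thesis using True by (auto simp: forms_neg pv_dim_0)
next
  case False
  define n where "n = m - 2"
  have m: "m = n + 2" using False by (simp add: n_def)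
  then have e: "int m - 2 = int n" by simp
  show ?thesis unfolding e dim_forms unfolding m by (simp add: algebra_simps)
qed

text \<open>A dimension count replaces a divisibility argument: the image has dimension 2n + 1 = dim
  S_n - dim S_(n-2), so the kernel has the dimension of C S_(n-2), which it contains.\<close>

lemma kernel_rho:
  assumes "f \<in> forms m" "rho f = 0"
  shows "\<exists>g\<in>forms (m - 2). f = C * g"
proof (cases "m < 0")
  case True
  then show ?thesis using assms by (auto simp: forms_neg)
next
  case False
  then obtain n where m: "m = int n" by (metis nonneg_int_cases not_le)
  let ?N = "forms (int n) \<inter> {f. rho f = 0}" and ?I = "(*) C ` forms (int n - 2)"
  obtain A where A: "finite A" "(forms (int n) :: 'k poly3 set) \<subseteq> pv.span A" using forms_fin by blast
  have "pv.dim (forms (int n) :: 'k poly3 set) = pv.dim ?N + kt.dim (rho ` forms (int n))"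
    by (rule pk.rank_nullity[OF rho_linear forms_subspace A])
  also have "kt.dim (rho ` forms (int n)) = 2 * n + 1"
    unfolding rho_image_forms using dim_poly_multiples[of 1 "2 * n"] by simp
  finally have "2 * (pv.dim ?N + (2 * n + 1)) = (n + 1) * (n + 2)"
    using dim_forms[of n, where 'k = 'k] by (simp only:)
  also have "\<dots> = 2 * (pv.dim ?I + (2 * n + 1))"
    using two_dim_forms_diff[of n]
    by (simp only: dim_mult_image[OF forms_subspace order_refl C_neq_0] distrib_left[of "2::nat"])
  finally have d: "pv.dim ?N = pv.dim ?I" by simp
  have eq: "?I = ?N"
  proof (rule pv.subspace_eqI_dim)
    show "pv.subspace ?I"
      using pp.linear_subspace_image[OF mult_left_linear forms_subspace] .
    show "?I \<subseteq> ?N"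
    proof safe
      fix g :: "'k poly3" assume "g \<in> forms (int n - 2)"
      then show "C * g \<in> forms (int n)" using forms_mult[OF C2, of g "int n - 2"] by simp
      show "rho (C * g) = 0" by (simp add: rho.hom_mult)
    qed
    show "finite A" "?N \<subseteq> pv.span A" using A by auto
    show "pv.dim ?N \<le> pv.dim ?I" unfolding d ..
  qed
  have "f \<in> ?N" using assms unfolding m by (intro IntI CollectI)
  then have "f \<in> ?I" unfolding eq .
  then show ?thesis unfolding m image_iff .
qed

end

section \<open>Lists of points whose successive pairs are to be joined by lines\<close>

fun paired :: "'a list \<Rightarrow> bool" where
  "paired [] = True"
| "paired [a] = True"
| "paired (a # b # xs) \<longleftrightarrow> a \<noteq> b \<and> paired xs"

lemma paired_successively: "successively (\<noteq>) xs \<Longrightarrow> paired xs"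
  by (induction xs rule: paired.induct) (auto simp: successively_Cons)

lemma distinct_successively: "distinct xs \<Longrightarrow> successively (\<noteq>) xs"
proof (induction xs)
  case (Cons a xs)
  then show ?case by (cases xs) auto
qed simp

text \<open>In \<open>k\<close> rounds through the points neighbours are always distinct, also where
  one round ends and the next begins. With an odd number of points some pairs straddle such an end,
  so these places matter.\<close>

lemma paired_concat_replicate:
  assumes "distinct ts" "2 \<le> length ts"
  shows "paired (concat (replicate k ts))"
proof (rule paired_successively)
  have ts: "ts \<noteq> []" using assms by auto
  have "last ts \<noteq> hd ts"
    using assms by (cases ts) (auto split: if_splits)
  then show "successively (\<noteq>) (concat (replicate k ts))"
  proof (induction k)
    case (Suc k)
    have "concat (replicate k ts) = [] \<or> hd (concat (replicate k ts)) = hd ts"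
      using ts by (cases k) auto
    then show ?case
      using Suc ts distinct_successively[OF assms(1)] by (auto simp: successively_append_iff)
  qed simp
qed

lemma linear_power_dvd_cancel:
  fixes u r :: "'k::field poly"
  assumes "poly u a \<noteq> 0" "[:- a, 1:] ^ k dvd u * r"
  shows "[:- a, 1:] ^ k dvd r"
proof (cases "r = 0")
  case False
  have u: "u \<noteq> 0" using assms(1) by auto
  then have "u * r \<noteq> 0" using False by simp
  then have "k \<le> order a (u * r)" using assms(2) order_divides by blast
  also have "\<dots> = order a r"
    using order_mult[OF \<open>u * r \<noteq> 0\<close>] order_root[of u a] assms(1) by simp
  finally show ?thesis using order_divides by blast
qed simp

lemma fat_ideal_ideal: "ideal (fat_ideal k \<X>) (poly_ring3 :: 'k::field poly3 ring)"
  unfolding fat_ideal_def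
  by (rule class_idealI)
    (auto intro: class_ideal_0 class_ideal_add class_ideal_mult ideal_pow_ideal point_ideal_ideal)

lemma point_ideal_homogeneous: "homogeneous (point_ideal P)"
  unfolding point_ideal_def by (rule homogeneous_genideal) blast

lemma fat_ideal_homogeneous: "homogeneous (fat_ideal k \<X>)"
  using ideal_pow_homogeneous[OF point_ideal_ideal point_ideal_homogeneous]
  unfolding fat_ideal_def homogeneous_def by blast

section \<open>Forms with prescribed orders of vanishing at the points\<close>

context conic_points
begin

definition W :: "nat \<Rightarrow> int \<Rightarrow> 'k poly3 set" where
  "W k m = fat_ideal k \<X> \<inter> forms m"

lemma W_forms: "f \<in> W k m \<Longrightarrow> f \<in> forms m"
  by (simp add: W_def)

lemma W_0: "W 0 m = forms m"
  unfolding W_def fat_ideal_def ideal_pow_0 by blast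

lemma W_add: "f \<in> W k m \<Longrightarrow> g \<in> W k m \<Longrightarrow> f + g \<in> W k m"
  by (simp add: W_def forms_add class_ideal_add[OF fat_ideal_ideal])

lemma W_zero: "0 \<in> W k m"
  by (simp add: W_def class_ideal_0[OF fat_ideal_ideal])

lemma W_diff: "f \<in> W k m \<Longrightarrow> g \<in> W k m \<Longrightarrow> f - g \<in> W k m"
  by (simp add: W_def forms_diff class_ideal_diff[OF fat_ideal_ideal])

lemma W_sum: "(\<And>i. i \<in> A \<Longrightarrow> F i \<in> W k m) \<Longrightarrow> sum F A \<in> W k m"
  by (induction A rule: infinite_finite_induct) (simp_all add: W_zero W_add)

lemma W_mult_form: "g \<in> forms a \<Longrightarrow> f \<in> W k m \<Longrightarrow> g * f \<in> W k (a + m)"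
  by (simp add: W_def forms_mult class_ideal_mult[OF fat_ideal_ideal])

lemma W_const_mult: "f \<in> W k m \<Longrightarrow> const3 c * f \<in> W k m"
  using W_mult_form[OF forms_const] by fastforce

lemma W_subspace: "pv.subspace (W k m)"
  unfolding pv.subspace_def using W_zero W_add W_const_mult by blast

lemma W_iff: "f \<in> W k m \<longleftrightarrow> f \<in> forms m \<and> (\<forall>P\<in>\<X>. f \<in> point_ideal P [^]\<^bsub>ideals_set poly_ring3\<^esub> k)"
  unfolding W_def fat_ideal_def by blast

lemma W_point: "f \<in> W k m \<Longrightarrow> P \<in> \<X> \<Longrightarrow> f \<in> point_ideal P [^]\<^bsub>ideals_set poly_ring3\<^esub> k"
  unfolding W_iff by blast

lemma W_intro:
  "f \<in> forms m \<Longrightarrow> (\<And>P. P \<in> \<X> \<Longrightarrow> f \<in> point_ideal P [^]\<^bsub>ideals_set poly_ring3\<^esub> k) \<Longrightarrow> f \<in> W k m"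
  unfolding W_iff by blast

lemma W_mult: "f \<in> W i a \<Longrightarrow> g \<in> W j b \<Longrightarrow> f * g \<in> W (i + j) (a + b)"
  by (rule W_intro, rule forms_mult[OF W_forms W_forms], assumption+)
    (rule ideal_pow_mult[OF point_ideal_ideal W_point W_point], assumption+)

lemma W_pderiv: "f \<in> W (Suc k) m \<Longrightarrow> pderiv3 j f \<in> W k (m - 1)"
  by (rule W_intro, rule pderiv3_forms[OF W_forms], assumption)
    (rule pderiv3_ideal_pow[OF point_ideal_ideal W_point], assumption+)

lemma point_ideal_form: "f \<in> forms d \<Longrightarrow> vanishes_at f P \<Longrightarrow> f \<in> point_ideal P"
  unfolding point_ideal_def by (rule class_genideal_self) blast

lemma pow_1: "f \<in> point_ideal P \<Longrightarrow> f \<in> point_ideal P [^]\<^bsub>ideals_set poly_ring3\<^esub> (1::nat)"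
  using ideal_pow_mult_base[OF point_ideal_ideal, of 1 P 0 f] unfolding ideal_pow_0 One_nat_def
  by (metis UNIV_I mult_1_left)

lemma C_in_W: "C \<in> W 1 2"
proof -
  have "C \<in> point_ideal P" if "P \<in> \<X>" for P
    using point_ideal_form[OF C2 CX[OF that]] .
  then show ?thesis by (intro W_intro C2 pow_1)
qed

text \<open>For \<open>k = 0\<close> the truncated index \<open>k - 1\<close> is 0 again, in
  accordance with the absence of a condition.\<close>

lemma C_mult_W: "g \<in> W (k - 1) (m - 2) \<Longrightarrow> C * g \<in> W k m"
proof (cases k)
  case 0
  assume "g \<in> W (k - 1) (m - 2)"
  then have "C * g \<in> forms (2 + (m - 2))" by (intro forms_mult C2 W_forms)
  then show ?thesis unfolding 0 W_0 by simp
next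
  case (Suc n)
  assume "g \<in> W (k - 1) (m - 2)"
  then have "C * g \<in> W (1 + n) (2 + (m - 2))" unfolding Suc diff_Suc_1 by (rule W_mult[OF C_in_W])
  then show ?thesis unfolding Suc by simp
qed

definition vnode :: "(3 \<Rightarrow> 'k) set \<Rightarrow> 3 \<Rightarrow> 'k" where
  "vnode P = (\<lambda>j. poly (q j) (\<tau> P))"

text \<open>Vanishing by Taylor order, at the representatives that lie on the parametrized curve. In
  contrast to membership in ideal powers it permits the cancellation of \<open>C\<close>, and it
  bounds the order of the restriction at the parameters.\<close>

definition OW :: "nat \<Rightarrow> 'k poly3 \<Rightarrow> bool" where
  "OW k f \<longleftrightarrow> (\<forall>P\<in>\<X>. ord_ge (vnode P) k f)"

lemma W_OW: "f \<in> W k m \<Longrightarrow> OW k f"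
  unfolding OW_def vnode_def by (intro ballI ord_ge_point_ideal_pow[OF node] W_point)

lemma OW_diff: "OW k f \<Longrightarrow> OW k g \<Longrightarrow> OW k (f - g)"
  unfolding OW_def using class_ideal_diff[OF ord_ge_ideal] by blast

lemma poly_rho: "poly (rho f) t = eval3 id f (\<lambda>j. poly (q j) t)"
  unfolding rho_def by (rule poly_psubst)

text \<open>The combination of the derivatives with weights \<open>y 0\<close> restricts to the
  constant 1, so they have no common zero on the parametrized curve.\<close>

lemma grad_vnode: "\<exists>j. eval3 id (pderiv3 j C) (vnode P) \<noteq> 0"
proof (rule ccontr)
  assume "\<not> ?thesis"
  then have z: "poly (rho (pderiv3 j C)) (\<tau> P) = 0" for j
    unfolding poly_rho vnode_def by blast
  have "poly (\<Sum>j\<in>UNIV. Polynomial.smult (y 0 j) (rho (pderiv3 j C))) (\<tau> P) = 1"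
    using grad[of 0] unfolding rho_def by (simp add: monom_0)
  then show False unfolding poly_sum poly_smult z by simp
qed

lemma OW_cancel: "OW k (C * f) \<Longrightarrow> OW (k - 1) f"
  unfolding OW_def using ord_ge_cancel grad_vnode by blast

definition pX :: "'k poly" where
  "pX = (\<Prod>P\<in>\<X>. [:- \<tau> P, 1:])"

lemma inj_tau: "inj_on \<tau> \<X>"
proof (rule inj_onI)
  fix P P' assume P: "P \<in> \<X>" "P' \<in> \<X>" "\<tau> P = \<tau> P'"
  have "(\<lambda>j. poly (q j) (\<tau> P)) \<in> P'" using node[OF P(2)] unfolding P(3) .
  with node[OF P(1)] show "P = P'"
    using proj_plane_disjoint[of P P'] P(1,2) \<X> by blast
qed

lemma degree_pX: "degree (pX ^ k) = k * card \<X>" and pX_pow_neq_0: "pX ^ k \<noteq> 0"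
proof -
  have "pX \<noteq> 0" unfolding pX_def using finX by (simp add: prod_zero_iff)
  moreover have "degree pX = card \<X>" unfolding pX_def by (subst degree_prod_eq_sum_degree) simp_all
  ultimately show "degree (pX ^ k) = k * card \<X>" "pX ^ k \<noteq> 0" by (simp_all add: degree_power_eq)
qed

text \<open>The parameters are distinct, so the factors collected so far do not vanish at the next
  parameter and can be cancelled there.\<close>

lemma OW_rho:
  assumes "OW k f"
  shows "pX ^ k dvd rho f"
proof -
  have "(\<Prod>P\<in>A. [:- \<tau> P, 1:] ^ k) dvd rho f" if "finite A" "A \<subseteq> \<X>" for A
    using that
  proof (induction A)
    case (insert P A)
    then obtain r where r: "rho f = (\<Prod>P\<in>A. [:- \<tau> P, 1:] ^ k) * r" by (auto elim: dvdE)
    have "[:- \<tau> P, 1:] ^ k dvd rho f"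
      using assms insert.prems ord_ge_curve[of q "\<tau> P" k f] unfolding OW_def vnode_def rho_def by blast
    moreover have "poly (\<Prod>P\<in>A. [:- \<tau> P, 1:] ^ k) (\<tau> P) \<noteq> 0"
    proof -
      have "\<forall>P'\<in>A. \<tau> P \<noteq> \<tau> P'"
        using inj_onD[OF inj_tau] insert.hyps insert.prems by blast
      then show ?thesis using insert.hyps(1) by (simp add: poly_prod)
    qed
    ultimately have "[:- \<tau> P, 1:] ^ k dvd r" unfolding r by (rule linear_power_dvd_cancel[rotated])
    then have "(\<Prod>P\<in>A. [:- \<tau> P, 1:] ^ k) * [:- \<tau> P, 1:] ^ k dvd rho f"
      unfolding r by (rule mult_dvd_mono[OF dvd_refl])
    then show ?case unfolding prod.insert[OF insert.hyps] by (subst mult.commute)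
  qed simp
  from this[OF finX order_refl] show ?thesis
    unfolding pX_def prod_power_distrib .
qed

lemma line_in_point_ideal:
  assumes "L \<in> forms 1" "poly (rho L) (\<tau> P) = 0" "P \<in> \<X>"
  shows "L \<in> point_ideal P"
proof (rule point_ideal_form[OF assms(1)])
  have "P \<in> proj_plane" using assms(3) \<X> by blast
  then show "vanishes_at L P"
    using vanishes_at_iff[OF assms(1) _ node[OF assms(3)]] assms(2) unfolding poly_rho by blast
qed

text \<open>A linear form with restriction (t - \<tau> a)(t - \<tau> b) lies in the point ideals of
  both \<open>a\<close> and \<open>b\<close>, so one linear form pays for two points. The degree
  bound is therefore sharp: all 2m zeros on the conic may be prescribed.\<close>

lemma lines_exist:
  assumes "paired xs" "set xs \<subseteq> \<X>" "degree h + length xs \<le> 2 * m"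
  shows "\<exists>F\<in>forms (int m). rho F = (\<Prod>x\<leftarrow>xs. [:- \<tau> x, 1:]) * h \<and>
    (\<forall>P\<in>\<X>. F \<in> point_ideal P [^]\<^bsub>ideals_set poly_ring3\<^esub> count_list xs P)"
  using assms
proof (induction xs arbitrary: m rule: paired.induct)
  case 1
  then obtain F where "F \<in> forms (int m)" "rho F = h" using rho_surj[of h m] by auto
  then show ?case unfolding count_list.simps ideal_pow_0 by (intro bexI[of _ F]) simp_all
next
  case (2 a)
  define n where "n = m - 1"
  have m: "m = Suc n" using 2(3) by (simp add: n_def)
  \<comment> \<open>A single point is left over. One linear form through it would only serve
    \<open>h\<close> of degree at most 2n, but degree 2n + 1 must be allowed. So h = c + t h1 is
    split, and two linear forms through the point are used, one of them with the additional zero t =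
    0.\<close>
  obtain c h1 where h1: "h = pCons c h1" by (rule pCons_cases)
  have d: "degree h1 \<le> 2 * n" "degree [:c:] \<le> 2 * n"
    using 2(3) unfolding h1 m by (auto simp: degree_pCons_eq_if split: if_splits)
  obtain G0 where G0: "G0 \<in> forms (int n)" "rho G0 = [:c:]" using rho_surj[OF d(2)] by blast
  obtain G1 where G1: "G1 \<in> forms (int n)" "rho G1 = h1" using rho_surj[OF d(1)] by blast
  obtain L0 where L0: "L0 \<in> forms 1" "rho L0 = [:- \<tau> a, 1:]" by (rule rho_linear_surj[of "[:- \<tau> a, 1:]"]) simp_all
  have dq: "degree ([:- \<tau> a, 1:] * [:0, 1:]) \<le> 2" by (rule order.trans[OF degree_mult_le]) simp
  obtain L1 where L1: "L1 \<in> forms 1" "rho L1 = [:- \<tau> a, 1:] * [:0, 1:]" by (rule rho_linear_surj[OF dq])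
  have a: "a \<in> \<X>" using 2(2) by simp
  have L: "L0 \<in> point_ideal a" "L1 \<in> point_ideal a"
    by (rule line_in_point_ideal[OF L0(1) _ a], simp add: L0(2))
      (rule line_in_point_ideal[OF L1(1) _ a], simp add: L1(2))
  let ?F = "L0 * G0 + L1 * G1"
  have "?F \<in> forms (1 + int n)" using forms_mult[OF L0(1) G0(1)] forms_mult[OF L1(1) G1(1)] by (rule forms_add)
  moreover have "rho ?F = (\<Prod>x\<leftarrow>[a]. [:- \<tau> x, 1:]) * h"
  proof -
    have "h = [:c:] + [:0, 1:] * h1" unfolding h1 by simp
    then show ?thesis
      unfolding rho.hom_add rho.hom_mult L0 L1 G0 G1 by (simp only: list.map prod_list.Cons prod_list.Nil mult_1_right distrib_left mult.assoc)
  qed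
  moreover have "?F \<in> point_ideal P [^]\<^bsub>ideals_set poly_ring3\<^esub> count_list [a] P" for P
  proof (cases "P = a")
    case True
    have "?F \<in> point_ideal a"
      using L class_ideal_mult_right[OF point_ideal_ideal] class_ideal_add[OF point_ideal_ideal] by blast
    from pow_1[OF this] show ?thesis using True by simp
  next
    case False
    then have "count_list [a] P = 0" by simp
    then show ?thesis by (simp only: ideal_pow_0 UNIV_I)
  qed
  moreover have "1 + int n = int m" unfolding m by simp
  ultimately show ?case by (metis (no_types, lifting))
next
  case (3 a b xs)
  define n where "n = m - 1"
  have m: "m = Suc n" using 3(4) by (simp add: n_def)
  have ab: "a \<in> \<X>" "b \<in> \<X>" "a \<noteq> b" using 3(2,3) by simp_all
  have "paired xs" "set xs \<subseteq> \<X>" "degree h + length xs \<le> 2 * n" using 3(2-4) unfolding m by simp_all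
  from 3(1)[OF this] obtain F where F: "F \<in> forms (int n)" "rho F = (\<Prod>x\<leftarrow>xs. [:- \<tau> x, 1:]) * h"
    "\<And>P. P \<in> \<X> \<Longrightarrow> F \<in> point_ideal P [^]\<^bsub>ideals_set poly_ring3\<^esub> count_list xs P" by blast
  have dq: "degree ([:- \<tau> a, 1:] * [:- \<tau> b, 1:]) \<le> 2" by (rule order.trans[OF degree_mult_le]) simp
  obtain L where L: "L \<in> forms 1" "rho L = [:- \<tau> a, 1:] * [:- \<tau> b, 1:]" by (rule rho_linear_surj[OF dq])
  have La: "L \<in> point_ideal a" by (rule line_in_point_ideal[OF L(1) _ ab(1)]) (simp add: L(2))
  have Lb: "L \<in> point_ideal b" by (rule line_in_point_ideal[OF L(1) _ ab(2)]) (simp add: L(2))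
  have "F * L \<in> forms (int n + 1)" using forms_mult[OF F(1) L(1)] .
  moreover have "rho (F * L) = (\<Prod>x\<leftarrow>a # b # xs. [:- \<tau> x, 1:]) * h"
    unfolding rho.hom_mult F(2) L(2) by (simp only: list.map prod_list.Cons mult_ac)
  moreover have "F * L \<in> point_ideal P [^]\<^bsub>ideals_set poly_ring3\<^esub> count_list (a # b # xs) P" if P: "P \<in> \<X>" for P
  proof (cases "P = a \<or> P = b")
    case True
    then have "L \<in> point_ideal P" using La Lb by blast
    from ideal_pow_mult_base[OF point_ideal_ideal F(3)[OF P] this]
    moreover have "count_list (a # b # xs) P = Suc (count_list xs P)" using True ab(3) by auto
    ultimately show ?thesis by (simp only:)
  next
    case False
    then have "count_list (a # b # xs) P = count_list xs P" by auto
    then show ?thesis using class_ideal_mult_right[OF ideal_pow_ideal[OF point_ideal_ideal] F(3)[OF P]] by (simp only:)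
  qed
  moreover have "int n + 1 = int m" unfolding m by simp
  ultimately show ?case by (metis (no_types, lifting))
qed

lemma count_list_distinct: "distinct ts \<Longrightarrow> a \<in> set ts \<Longrightarrow> count_list ts a = 1"
  by (induction ts) (auto simp: count_list_0_iff)

text \<open>Going through all points in \<open>k\<close> rounds gives order \<open>k\<close> at each
  of them without loss of degree.\<close>

lemma W_surj:
  assumes "degree h + k * card \<X> \<le> 2 * m"
  shows "\<exists>F\<in>W k (int m). rho F = pX ^ k * h"
proof -
  obtain ts where ts: "set ts = \<X>" "distinct ts" using finite_distinct_list[OF finX] by blast
  have len: "length ts = card \<X>" using ts distinct_card by metis
  let ?xs = "concat (replicate k ts)"
  have p: "paired ?xs" by (rule paired_concat_replicate[OF ts(2)]) (use len cardX in linarith)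
  have s: "set ?xs \<subseteq> \<X>" using ts by auto
  have l: "length ?xs = k * card \<X>" by (induction k) (simp_all add: len)
  have c: "count_list ?xs P = k" if "P \<in> \<X>" for P
    using count_list_distinct[OF ts(2), of P] that ts(1) by (induction k) simp_all
  have "(\<Prod>x\<leftarrow>ts. [:- \<tau> x, 1:]) = pX"
    using prod.distinct_set_conv_list[OF ts(2), of "\<lambda>x. [:- \<tau> x, 1:]"] unfolding pX_def ts(1) by (rule sym)
  then have pr: "(\<Prod>x\<leftarrow>?xs. [:- \<tau> x, 1:]) = pX ^ k"
    by (induction k) simp_all
  from lines_exist[OF p s, of h m] assms l obtain F where F: "F \<in> forms (int m)" "rho F = pX ^ k * h"
    "\<forall>P\<in>\<X>. F \<in> point_ideal P [^]\<^bsub>ideals_set poly_ring3\<^esub> count_list ?xs P"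
    unfolding pr by auto
  then have "F \<in> W k (int m)" unfolding W_def fat_ideal_def using c by simp
  then show ?thesis using F(2) by blast
qed

lemma OW_rho_cases:
  assumes "OW k f" "f \<in> forms (int m)"
  obtains "rho f = 0" | h where "rho f = pX ^ k * h" "degree h + k * card \<X> \<le> 2 * m"
proof -
  obtain h where h: "rho f = pX ^ k * h" using OW_rho[OF assms(1)] by (rule dvdE)
  show thesis
  proof (cases "h = 0")
    case True
    then show thesis using that(1) h by simp
  next
    case False
    have "degree (rho f) = k * card \<X> + degree h"
      unfolding h degree_mult_eq[OF pX_pow_neq_0 False] degree_pX ..
    then have "degree h + k * card \<X> \<le> 2 * m" using degree_rho[OF assms(2)] by linarith
    then show thesis by (rule that(2)[OF h])
  qed
qed

text \<open>Taylor orders force membership in the ideal powers: by \<open>W_surj\<close> some member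
  of \<open>W k m\<close> has the same restriction as \<open>f\<close>, the difference is C g, the
  factor \<open>C\<close> is cancelled for orders, and \<open>g\<close> has its degree lowered by
  two and its order by one.\<close>

lemma OW_W_nat: "f \<in> forms (int m) \<Longrightarrow> OW k f \<Longrightarrow> f \<in> W k (int m)"
proof (induction m arbitrary: k f rule: less_induct)
  case (less m)
  have "\<exists>F\<in>W k (int m). rho F = rho f"
  proof (rule OW_rho_cases[OF less.prems(2,1)])
    assume "rho f = 0"
    then show ?thesis using W_zero rho.hom_zero by metis
  next
    fix h assume "rho f = pX ^ k * h" "degree h + k * card \<X> \<le> 2 * m"
    then show ?thesis using W_surj by metis
  qed
  then obtain F where F: "F \<in> W k (int m)" "rho F = rho f" by blast
  have "rho (f - F) = 0" unfolding rho.hom_minus F(2) by simp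
  from kernel_rho[OF forms_diff[OF less.prems(1) W_forms[OF F(1)]] this]
  obtain g where g: "g \<in> forms (int m - 2)" "f - F = C * g" by blast
  have "OW k (C * g)" using OW_diff[OF less.prems(2) W_OW[OF F(1)]] unfolding g(2) .
  then have og: "OW (k - 1) g" by (rule OW_cancel)
  have "g \<in> W (k - 1) (int m - 2)"
  proof (cases "m < 2")
    case True
    then have "g = 0" using g(1) by (simp add: forms_neg)
    then show ?thesis by (simp only: W_zero)
  next
    case False
    then have e: "int m - 2 = int (m - 2)" by simp
    show ?thesis using less.IH[of "m - 2" g "k - 1"] g(1) og False unfolding e by simp
  qed
  then have "f - F \<in> W k (int m)" unfolding g(2) by (rule C_mult_W)
  from W_add[OF this F(1)] show ?case by simp
qed

lemma OW_W: "f \<in> forms m \<Longrightarrow> OW k f \<Longrightarrow> f \<in> W k m"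
proof (cases "m < 0")
  case True
  assume "f \<in> forms m"
  then have "f = 0" using forms_neg[OF True] by blast
  then show ?thesis by (simp only: W_zero)
next
  case False
  assume *: "f \<in> forms m" "OW k f"
  obtain n where "m = int n" using False by (metis nonneg_int_cases not_le)
  then show ?thesis using OW_W_nat * by blast
qed

text \<open>The factor \<open>C\<close> can be cancelled for orders, which is why the argument
  leaves \<open>W\<close> for \<open>OW\<close> and then comes back.\<close>

lemma W_kernel:
  assumes "f \<in> W k m" "rho f = 0"
  obtains g where "g \<in> W (k - 1) (m - 2)" "f = C * g"
proof -
  obtain g where g: "g \<in> forms (m - 2)" "f = C * g"
    using kernel_rho[OF W_forms[OF assms(1)] assms(2)] by blast
  have "OW (k - 1) g" by (rule OW_cancel) (use W_OW[OF assms(1)] g(2) in simp)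
  from that[OF OW_W[OF g(1) this] g(2)] show thesis .
qed

lemma W_rho_neg:
  assumes "f \<in> W k m" "2 * m < int (k * card \<X>)"
  shows "rho f = 0"
proof (cases "m < 0")
  case True
  then have "f = 0" using W_forms[OF assms(1)] forms_neg by blast
  then show ?thesis by (simp only: rho.hom_zero)
next
  case False
  then obtain n where m: "m = int n" by (metis nonneg_int_cases not_le)
  from W_OW[OF assms(1)] W_forms[OF assms(1)[unfolded m]] show ?thesis
    by (rule OW_rho_cases) (use assms(2) m in auto)
qed

text \<open>The second summand is the dimension of the multiples of \<open>pX ^ k\<close> of degree
  at most 2m.\<close>

lemma dim_W_step:
  "pv.dim (W k (int m)) = pv.dim (W (k - 1) (int m - 2)) + (if k * card \<X> \<le> 2 * m then 2 * m - k * card \<X> + 1 else 0)"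
proof -
  obtain A where A: "finite A" "(forms (int m) :: 'k poly3 set) \<subseteq> pv.span A" using forms_fin by blast
  have WA: "W k (int m) \<subseteq> pv.span A" using A W_forms by blast
  have "pv.dim (W k (int m)) = pv.dim (W k (int m) \<inter> {f. rho f = 0}) + kt.dim (rho ` W k (int m))"
    by (rule pk.rank_nullity[OF rho_linear W_subspace A(1) WA])
  also have "W k (int m) \<inter> {f. rho f = 0} = (*) C ` W (k - 1) (int m - 2)"
  proof (intro equalityI subsetI)
    fix f assume "f \<in> W k (int m) \<inter> {f. rho f = 0}"
    then have "f \<in> W k (int m)" "rho f = 0" by blast+
    then obtain g where "g \<in> W (k - 1) (int m - 2)" "f = C * g" by (rule W_kernel)
    then show "f \<in> (*) C ` W (k - 1) (int m - 2)" by blast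
  next
    fix f assume "f \<in> (*) C ` W (k - 1) (int m - 2)"
    then obtain g where g: "g \<in> W (k - 1) (int m - 2)" "f = C * g" by blast
    have "rho f = 0" unfolding g(2) rho.hom_mult rho_C by simp
    then show "f \<in> W k (int m) \<inter> {f. rho f = 0}" using C_mult_W[OF g(1)] g(2) by blast
  qed
  also have "pv.dim ((*) C ` W (k - 1) (int m - 2)) = pv.dim (W (k - 1) (int m - 2))"
    by (rule dim_mult_image[OF W_subspace _ C_neq_0]) (use W_forms in blast)
  also have "kt.dim (rho ` W k (int m)) = (if k * card \<X> \<le> 2 * m then 2 * m - k * card \<X> + 1 else 0)"
  proof (cases "k * card \<X> \<le> 2 * m")
    case True
    have "rho ` W k (int m) = (\<lambda>h. pX ^ k * h) ` {h. degree h \<le> 2 * m - k * card \<X>}"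
    proof (intro equalityI subsetI)
      fix h assume "h \<in> rho ` W k (int m)"
      then obtain f where f: "f \<in> W k (int m)" "h = rho f" by blast
      show "h \<in> (\<lambda>h. pX ^ k * h) ` {h. degree h \<le> 2 * m - k * card \<X>}"
      proof (rule OW_rho_cases[OF W_OW[OF f(1)] W_forms[OF f(1)]])
        assume "rho f = 0"
        then have "h = pX ^ k * 0" using f(2) by simp
        then show ?thesis by (rule image_eqI) simp
      next
        fix h' assume h': "rho f = pX ^ k * h'" "degree h' + k * card \<X> \<le> 2 * m"
        show ?thesis
          by (rule image_eqI[of _ _ h']) (use h' f(2) in \<open>simp_all\<close>)
      qed
    next
      fix h assume "h \<in> (\<lambda>h. pX ^ k * h) ` {h. degree h \<le> 2 * m - k * card \<X>}"
      then obtain h' where h': "h = pX ^ k * h'" "degree h' \<le> 2 * m - k * card \<X>" by blast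
      then have "degree h' + k * card \<X> \<le> 2 * m" using True by linarith
      from W_surj[OF this] show "h \<in> rho ` W k (int m)" unfolding h'(1) by force
    qed
    then show ?thesis using dim_poly_multiples[OF pX_pow_neq_0, of k "2 * m - k * card \<X>"] True by simp
  next
    case False
    have "int (2 * m) < int (k * card \<X>)" using False by (simp only: of_nat_less_iff not_le)
    moreover have "int (2 * m) = 2 * int m" by simp
    ultimately have z: "rho f = 0" if "f \<in> W k (int m)" for f
      by (intro W_rho_neg[OF that]) (simp only:)
    have "rho ` W k (int m) = {0}"
      using z W_zero[of k "int m"] by (auto simp: image_iff intro!: bexI[of _ 0])
    moreover have "kt.dim {0 :: 'k poly} = 0"
    proof (rule kt.dim_unique[of "{}"])
      show "{0 :: 'k poly} \<subseteq> kt.span {}" unfolding kt.span_empty ..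
      show "kt.independent ({} :: 'k poly set)" by (rule kt.independent_empty)
    qed auto
    ultimately show ?thesis using False by simp
  qed
  finally show ?thesis .
qed

end

section \<open>The derivatives of a fat point ideal\<close>

context conic_points
begin

definition D :: "nat \<Rightarrow> nat \<Rightarrow> int \<Rightarrow> 'k poly3 set" where
  "D k l m = pv.span {pderiv3 j (C ^ l * f) | j f. f \<in> W k m}"

lemma D_base: "f \<in> W k m \<Longrightarrow> pderiv3 j (C ^ l * f) \<in> D k l m"
  unfolding D_def by (rule pv.span_base) blast

text \<open>Modulo \<open>C ^ Suc l\<close> only the term with the derivative of \<open>C\<close>
  remains. This is why at least one factor \<open>C\<close> is wanted: the derivatives are then
  controlled on the conic.\<close>

lemma pderiv3_C_power_mult:
  "pderiv3 j (C ^ Suc l * f) = C ^ l * (const3 (of_nat (Suc l)) * (pderiv3 j C * f) + C * pderiv3 j f)"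
  unfolding pderiv3_mult pderiv3_power const3_of_nat by (simp only: power_Suc distrib_left mult_ac)

lemma C_pderiv_W: "f \<in> W k m \<Longrightarrow> C * pderiv3 j f \<in> W k (m + 1)"
proof (cases k)
  case 0
  assume f: "f \<in> W k m"
  have e: "2 + (m - 1) = m + 1" by simp
  have "C * pderiv3 j f \<in> forms (2 + (m - 1))" by (rule forms_mult[OF C2 pderiv3_forms[OF W_forms[OF f]]])
  then show ?thesis unfolding 0 W_0 e .
next
  case (Suc k')
  assume "f \<in> W k m"
  then have "pderiv3 j f \<in> W (k - 1) (m + 1 - 2)" unfolding Suc using W_pderiv[of f k' m j] by simp
  then show ?thesis by (rule C_mult_W)
qed

lemma gradC_mult_W: "f \<in> W k m \<Longrightarrow> pderiv3 j C * f \<in> W k (m + 1)"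
  using W_mult_form[OF grad_forms] by (simp only: add.commute[of m])

lemma D_Suc_subset: "D k (Suc l) m \<subseteq> (*) (C ^ l) ` W k (m + 1)"
  unfolding D_def
proof (rule pv.span_minimal)
  show "pv.subspace ((*) (C ^ l) ` W k (m + 1))"
    using pp.linear_subspace_image[OF mult_left_linear W_subspace] .
  show "{pderiv3 j (C ^ Suc l * f) | j f. f \<in> W k m} \<subseteq> (*) (C ^ l) ` W k (m + 1)"
  proof
    fix g assume "g \<in> {pderiv3 j (C ^ Suc l * f) | j f. f \<in> W k m}"
    then obtain j f where f: "g = pderiv3 j (C ^ Suc l * f)" "f \<in> W k m" by blast
    show "g \<in> (*) (C ^ l) ` W k (m + 1)"
      unfolding f(1) pderiv3_C_power_mult
      by (rule imageI, rule W_add, rule W_const_mult, rule gradC_mult_W[OF f(2)], rule C_pderiv_W[OF f(2)])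
  qed
qed

lemma D_C_shift: "D (k - 1) (Suc l) (m - 2) \<subseteq> D k l m"
proof -
  have "{pderiv3 j (C ^ Suc l * f) | j f. f \<in> W (k - 1) (m - 2)} \<subseteq> {pderiv3 j (C ^ l * f) | j f. f \<in> W k m}"
  proof
    fix g assume "g \<in> {pderiv3 j (C ^ Suc l * f) | j f. f \<in> W (k - 1) (m - 2)}"
    then obtain j f where f: "g = pderiv3 j (C ^ Suc l * f)" "f \<in> W (k - 1) (m - 2)" by blast
    have "g = pderiv3 j (C ^ l * (C * f))" unfolding f(1) by (simp only: power_Suc mult_ac)
    with C_mult_W[OF f(2)] show "g \<in> {pderiv3 j (C ^ l * f) | j f. f \<in> W k m}" by blast
  qed
  then show ?thesis unfolding D_def by (rule pv.span_mono)
qed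

text \<open>The divergence of \<open>C ^ Suc l\<close> times the vector (X_0, X_1, X_2) is 2 l + 5
  times \<open>C ^ Suc l\<close>, the factor being the degree plus the number of variables. This is
  the lowest case of \<open>D_Suc_supset\<close>.\<close>

lemma C_power_const_in_D: "const3 c * C ^ Suc l \<in> D 0 (Suc l) 1"
proof -
  have x: "var3 j \<in> W 0 1" for j unfolding W_0 by (rule forms_var)
  have "(\<Sum>j\<in>UNIV. pderiv3 j (C ^ Suc l * var3 j)) =
      (\<Sum>j\<in>UNIV. C ^ l * (const3 (of_nat (Suc l)) * (var3 j * pderiv3 j C)) + C ^ l * C)"
    unfolding pderiv3_C_power_mult
    by (rule sum.cong[OF refl]) (simp only: pderiv3_var if_True refl mult_1_right distrib_left mult.commute)
  also have "\<dots> = C ^ l * (const3 (of_nat (Suc l)) * (\<Sum>j\<in>UNIV. var3 j * pderiv3 j C)) + (\<Sum>j\<in>(UNIV :: 3 set). C ^ l * C)"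
    unfolding sum.distrib sum_distrib_left[symmetric] ..
  also have "(\<Sum>j\<in>(UNIV :: 3 set). C ^ l * C) = const3 3 * C ^ Suc l"
    unfolding sum_UNIV_three power_Suc
    by (simp only: mult.commute[of "C ^ l"] const3_numeral) simp
  also have "(\<Sum>j\<in>UNIV. var3 j * pderiv3 j C) = const3 2 * C"
    using euler_formula[OF C2] by (simp only: of_int_numeral)
  also have "C ^ l * (const3 (of_nat (Suc l)) * (const3 2 * C)) + const3 3 * C ^ Suc l
      = const3 (of_nat (Suc l) * 2 + 3) * C ^ Suc l"
    by (simp only: const3_add const3_mult distrib_right distrib_left power_Suc mult_ac)
  finally have s: "(\<Sum>j\<in>UNIV. pderiv3 j (C ^ Suc l * var3 j)) = const3 (of_nat (Suc l) * 2 + 3) * C ^ Suc l" .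
  have "of_nat (Suc l) * 2 + 3 = (of_nat (2 * l + 5) :: 'k)" by simp
  then have nz: "of_nat (Suc l) * 2 + 3 \<noteq> (0 :: 'k)" by (simp only: of_nat_eq_0_iff)
  have "const3 c * C ^ Suc l = const3 (c / (of_nat (Suc l) * 2 + 3)) * (\<Sum>j\<in>UNIV. pderiv3 j (C ^ Suc l * var3 j))"
    unfolding s mult.assoc[symmetric] const3_mult[symmetric] using nz by simp
  moreover have "(\<Sum>j\<in>UNIV. pderiv3 j (C ^ Suc l * var3 j)) \<in> D 0 (Suc l) 1"
    unfolding D_def by (rule pv.span_sum) (rule D_base[OF x, unfolded D_def])
  ultimately show ?thesis unfolding D_def by (simp only: pv.span_scale)
qed

text \<open>The cofactor of \<open>pX ^ k\<close> has degree at most 2 (m + 1) - sk, and splitting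
  it along 1, t, t^2 leaves pieces of degree at most 2m - sk. The hypothesis 2m >= sk makes these
  pieces restrictions from \<open>W k m\<close>.\<close>

lemma rho_lam_expand:
  assumes H: "H \<in> W k (int m + 1)" and m: "k * card \<X> \<le> 2 * m"
  obtains F where "\<And>i. F i \<in> W k (int m)" "rho H = (\<Sum>i\<le>2. rho (lam i) * rho (F i))"
proof -
  have e: "int m + 1 = int (Suc m)" by simp
  have "\<exists>h. rho H = pX ^ k * h \<and> degree h + k * card \<X> \<le> 2 * Suc m"
  proof (rule OW_rho_cases[OF W_OW[OF H] W_forms[OF H[unfolded e]]])
    assume "rho H = 0"
    then show ?thesis using m by (intro exI[of _ 0]) simp
  qed blast
  then obtain h where h: "rho H = pX ^ k * h" "degree h + k * card \<X> \<le> 2 * Suc m" by blast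
  have "a \<le> (2 * m - b) + 2" if "a + b \<le> 2 * Suc m" for a b :: nat using that by arith
  from this[OF h(2)] have "degree h \<le> (2 * m - k * card \<X>) + 2" .
  then obtain h' where h': "\<And>i. degree (h' i) \<le> 2 * m - k * card \<X>" "h = (\<Sum>i\<le>2. monom 1 i * h' i)"
    by (rule poly_split_degree) blast
  have "degree (h' i) + k * card \<X> \<le> 2 * m" for i using h'(1)[of i] m by linarith
  then have "\<forall>i. \<exists>F. F \<in> W k (int m) \<and> rho F = pX ^ k * h' i" using W_surj by blast
  from choice[OF this] obtain F where F: "\<And>i. F i \<in> W k (int m)" "\<And>i. rho (F i) = pX ^ k * h' i" by blast
  have "rho H = (\<Sum>i\<le>2. pX ^ k * (monom 1 i * h' i))" unfolding h(1) h'(2) sum_distrib_left ..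
  also have "\<dots> = (\<Sum>i\<le>2. rho (lam i) * rho (F i))"
  proof (rule sum.cong[OF refl])
    fix i :: nat assume "i \<in> {..2}"
    then show "pX ^ k * (monom 1 i * h' i) = rho (lam i) * rho (F i)"
      by (simp only: atMost_iff rho_lam F(2) mult_ac)
  qed
  finally show thesis by (rule that[OF F(1)])
qed

text \<open>After division by \<open>C ^ l\<close>, the derivatives of \<open>C ^ Suc l * F\<close>
  restrict to the conic like the derivatives of \<open>C\<close> times \<open>F\<close>, up to the
  factor l + 1 that \<open>Fl\<close> divides out in advance. Weighted with \<open>y i j\<close>
  they imitate the product of \<open>lam i\<close> and \<open>F i\<close>.\<close>

lemma lift_gradient:
  assumes H: "H \<in> W k (int m + 1)" and m: "k * card \<X> \<le> 2 * m"
  obtains G where "G \<in> W k (int m + 1)" "rho G = rho H" "C ^ l * G \<in> D k (Suc l) (int m)"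
proof -
  obtain F where F: "\<And>i. F i \<in> W k (int m)" "rho H = (\<Sum>i\<le>2. rho (lam i) * rho (F i))"
    by (rule rho_lam_expand[OF H m]) blast
  define c where "c = const3 (1 / of_nat (Suc l)) * const3 (of_nat (Suc l) :: 'k)"
  have c: "c = 1" unfolding c_def const3_mult[symmetric] by (simp del: of_nat_Suc)
  define Fl where "Fl i = const3 (1 / of_nat (Suc l)) * F i" for i
  have Fl: "Fl i \<in> W k (int m)" for i unfolding Fl_def by (rule W_const_mult[OF F(1)])
  define g where "g i j = const3 (of_nat (Suc l)) * (pderiv3 j C * Fl i) + C * pderiv3 j (Fl i)" for i j
  have gW: "g i j \<in> W k (int m + 1)" for i j
    unfolding g_def by (rule W_add, rule W_const_mult, rule gradC_mult_W[OF Fl], rule C_pderiv_W[OF Fl])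
  define G where "G = (\<Sum>i\<le>2. \<Sum>j\<in>UNIV. const3 (y i j) * g i j)"
  show thesis
  proof (rule that)
    show "G \<in> W k (int m + 1)" unfolding G_def by (intro W_sum W_const_mult gW)
    have g: "rho (g i j) = rho (pderiv3 j C) * rho (F i)" for i j
    proof -
      have e: "const3 (of_nat (Suc l)) * (pderiv3 j C * Fl i) = c * (pderiv3 j C * F i)"
        unfolding Fl_def c_def by (simp only: mult_ac)
      show ?thesis
        unfolding g_def e c rho.hom_add rho.hom_mult rho_C rho.hom_one mult_zero_left mult_1_left add_0_right ..
    qed
    have "rho G = (\<Sum>i\<le>2. rho (lam i) * rho (F i))"
      unfolding G_def lam_def rho.hom_sum rho_scale g by (simp only: sum_distrib_right mult_smult_left)
    also have "\<dots> = rho H" unfolding F(2) ..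
    finally show "rho G = rho H" .
    have "C ^ l * G = (\<Sum>i\<le>2. \<Sum>j\<in>UNIV. const3 (y i j) * pderiv3 j (C ^ Suc l * Fl i))"
      unfolding G_def pderiv3_C_power_mult g_def sum_distrib_left
      by (intro sum.cong refl) (simp only: mult.left_commute)
    also have "\<dots> \<in> D k (Suc l) (int m)"
      unfolding D_def by (intro pv.span_sum pv.span_scale) (rule D_base[OF Fl, unfolded D_def])
    finally show "C ^ l * G \<in> D k (Suc l) (int m)" .
  qed
qed

text \<open>The derivatives of \<open>C\<close> span the quadratic forms on the parameter line, so some \<open>G\<close> in the span
  has the same restriction to the conic as \<open>H\<close>; the difference is divisible by \<open>C\<close>.\<close>

lemma D_Suc_supset:
  "H \<in> W k (int m + 1) \<Longrightarrow> k * card \<X> \<le> 2 * m \<Longrightarrow> C ^ l * H \<in> D k (Suc l) (int m)"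
proof (induction m arbitrary: k l H rule: less_induct)
  case (less m)
  obtain G where G: "G \<in> W k (int m + 1)" "rho G = rho H" "C ^ l * G \<in> D k (Suc l) (int m)"
    by (rule lift_gradient[OF less.prems])
  have "rho (H - G) = 0" unfolding rho.hom_minus G(2) by simp
  then obtain H' where H': "H' \<in> W (k - 1) (int m + 1 - 2)" "H - G = C * H'"
    by (rule W_kernel[OF W_diff[OF less.prems(1) G(1)]])
  have "C ^ Suc l * H' \<in> D k (Suc l) (int m)"
  proof (cases "m < 2")
    case True
    \<comment> \<open>The product of \<open>k\<close> and the number of points is at most 2, and
      there are at least 4 points.\<close>
    have k: "k = 0"
    proof (rule ccontr)
      assume "k \<noteq> 0"
      then have "card \<X> \<le> k * card \<X>" by (cases k) simp_all
      then show False using less.prems(2) cardX True by linarith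
    qed
    \<comment> \<open>The remainder \<open>H'\<close> has degree m - 1, so it is zero or a constant;
      \<open>C_power_const_in_D\<close> settles the constant.\<close>
    consider "m = 0" | "m = 1" using True by linarith
    then show ?thesis
    proof cases
      case 1
      then have "int m + 1 - 2 < 0" by simp
      then have "H' = 0" using W_forms[OF H'(1)] forms_neg by blast
      then have "C ^ Suc l * H' = 0" by (simp only: mult_zero_right)
      then show ?thesis unfolding D_def by (simp only: pv.span_zero)
    next
      case 2
      then have "H' \<in> forms 0" using W_forms[OF H'(1)] by simp
      then obtain c where c: "H' = const3 c" unfolding forms_0_const by blast
      have "int m = 1" using 2 by simp
      then show ?thesis using C_power_const_in_D[of c l] unfolding c k mult.commute[of _ "const3 c"] by (simp only:)
    qed
  next
    case False
    have e: "int m + 1 - 2 = int (m - 2) + 1" "int m - 2 = int (m - 2)" using False by simp_all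
    \<comment> \<open>For positive \<open>k\<close>, passing to \<open>k - 1\<close> and
      \<open>m - 2\<close> lowers the left side by s >= 4 and the right side by exactly 4, so the
      hypothesis survives. This is the place where four points are needed.\<close>
    have "(k - 1) * card \<X> \<le> 2 * (m - 2)"
    proof (cases k)
      case (Suc k')
      then show ?thesis using less.prems(2) cardX by simp
    qed simp
    then have "C ^ Suc l * H' \<in> D (k - 1) (Suc (Suc l)) (int (m - 2))"
      using less.IH[of "m - 2" H' "k - 1" "Suc l"] H'(1) False unfolding e(1) by simp
    then show ?thesis using D_C_shift[of k "Suc l" "int m"] unfolding e(2) by blast
  qed
  moreover have "C ^ l * H = C ^ l * G + C ^ Suc l * H'"
  proof -
    have "H = G + C * H'" using H'(2) by (simp only: diff_eq_eq add.commute)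
    then show ?thesis by (simp only: distrib_left power_Suc mult_ac)
  qed
  ultimately show ?case using G(3) unfolding D_def by (simp only: pv.span_add)
qed

lemma D_eq_full:
  assumes "k * card \<X> \<le> 2 * m"
  shows "D k (Suc l) (int m) = (*) (C ^ l) ` W k (int m + 1)"
proof (rule subset_antisym[OF D_Suc_subset])
  show "(*) (C ^ l) ` W k (int m + 1) \<subseteq> D k (Suc l) (int m)"
    using D_Suc_supset[OF _ assms] by blast
qed

lemma W_small:
  assumes "f \<in> W k m" "2 * m < int (k * card \<X>)"
  obtains g where "g \<in> W (k - 1) (m - 2)" "f = C * g"
  using W_kernel[OF assms(1) W_rho_neg[OF assms]] by blast

lemma D_eq_shift:
  assumes "2 * m < int (k * card \<X>)"
  shows "D k l m = D (k - 1) (Suc l) (m - 2)"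
proof (rule subset_antisym[OF _ D_C_shift])
  have "{pderiv3 j (C ^ l * f) | j f. f \<in> W k m} \<subseteq> {pderiv3 j (C ^ Suc l * f) | j f. f \<in> W (k - 1) (m - 2)}"
  proof
    fix g assume "g \<in> {pderiv3 j (C ^ l * f) | j f. f \<in> W k m}"
    then obtain j f where f: "g = pderiv3 j (C ^ l * f)" "f \<in> W k m" by blast
    obtain f' where f': "f' \<in> W (k - 1) (m - 2)" "f = C * f'" by (rule W_small[OF f(2) assms])
    have "g = pderiv3 j (C ^ Suc l * f')" unfolding f(1) f'(2) by (simp only: power_Suc mult_ac)
    with f'(1) show "g \<in> {pderiv3 j (C ^ Suc l * f) | j f. f \<in> W (k - 1) (m - 2)}" by blast
  qed
  then show "D k l m \<subseteq> D (k - 1) (Suc l) (m - 2)" unfolding D_def by (rule pv.span_mono)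
qed

text \<open>The derivatives of the ideal itself come without a factor \<open>C\<close>, but they
  have order \<open>k\<close> and degree \<open>m - 1\<close>, hence lie in
  \<open>W k (m - 1)\<close>. If 2m >= s (k + 1), the derivatives of the multiples of
  \<open>C\<close> alone fill this space; otherwise every form concerned is a multiple of
  \<open>C\<close>.\<close>

lemma D_Suc_0: "D (Suc k) 0 m = D k 1 (m - 2)"
proof (cases "2 * m < int (Suc k * card \<X>)")
  case True
  then show ?thesis using D_eq_shift[OF True, of 0] by simp
next
  case False
  have "int (card \<X>) \<le> int (Suc k * card \<X>)" by simp
  then have "2 \<le> m" using False cardX by linarith
  define n where "n = nat (m - 2)"
  have m: "m - 2 = int n" using \<open>2 \<le> m\<close> by (simp add: n_def)
  have "int (k * card \<X>) + int (card \<X>) \<le> 2 * m" using False by simp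
  then have "int (k * card \<X>) \<le> int (2 * n)" using m cardX by linarith
  then have n: "k * card \<X> \<le> 2 * n" by (simp only: of_nat_le_iff)
  have "D (Suc k) 0 m \<subseteq> W k (m - 1)"
    unfolding D_def
  proof (rule pv.span_minimal[OF _ W_subspace])
    show "{pderiv3 j (C ^ 0 * f) | j f. f \<in> W (Suc k) m} \<subseteq> W k (m - 1)"
    proof
      fix g assume "g \<in> {pderiv3 j (C ^ 0 * f) | j f. f \<in> W (Suc k) m}"
      then obtain j f where f: "g = pderiv3 j (C ^ 0 * f)" "f \<in> W (Suc k) m" by blast
      show "g \<in> W k (m - 1)" unfolding f(1) power_0 mult_1_left by (rule W_pderiv[OF f(2)])
    qed
  qed
  also have "W k (m - 1) = D k 1 (m - 2)"
  proof -
    have e: "m - 1 = int n + 1" using m by simp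
    have "(*) (1 :: 'k poly3) = id" by (rule ext) (simp only: mult_1_left id_apply)
    then show ?thesis unfolding e m unfolding One_nat_def D_eq_full[OF n] power_0 by (simp only: image_id id_apply)
  qed
  finally have "D (Suc k) 0 m \<subseteq> D k 1 (m - 2)" .
  moreover have "D k 1 (m - 2) \<subseteq> D (Suc k) 0 m"
    using D_C_shift[of "Suc k" 0 m] unfolding diff_Suc_1 by (simp only: One_nat_def)
  ultimately show ?thesis by (rule subset_antisym)
qed

text \<open>If \<open>e < 0\<close>, all of \<open>W k m\<close> vanishes on the conic, whereas \<open>W k (m + 1)\<close> restricts to a space
  of dimension \<open>max 0 (e + 3)\<close>.\<close>

definition gap :: "nat \<Rightarrow> int \<Rightarrow> int" where
  "gap k m = (let e = 2 * m - int (k * card \<X>) in if e < 0 then max 0 (e + 3) else 0)"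

lemma dim_W_neg: "m < 0 \<Longrightarrow> pv.dim (W k m) = 0"
proof -
  assume m: "m < 0"
  have "W k m = {0}" using W_zero[of k m] W_forms[of _ k m] forms_neg[OF m] by blast
  then show ?thesis by (simp only: pv_dim_0)
qed

lemma dim_W_int:
  assumes "0 \<le> m"
  shows "int (pv.dim (W k m)) = int (pv.dim (W (k - 1) (m - 2))) + max 0 (2 * m - int (k * card \<X>) + 1)"
proof -
  obtain n where m: "m = int n" using assms by (metis nonneg_int_cases)
  show ?thesis
  proof (cases "k * card \<X> \<le> 2 * n")
    case True
    then have "int (k * card \<X>) \<le> 2 * int n" using of_nat_le_iff[of "k * card \<X>" "2 * n", where 'a = int] by simp
    moreover have "int (2 * n - k * card \<X>) = 2 * int n - int (k * card \<X>)" using True by (simp add: of_nat_diff)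
    ultimately show ?thesis unfolding m dim_W_step using True by simp
  next
    case False
    then have "2 * int n < int (k * card \<X>)" using of_nat_less_iff[of "2 * n" "k * card \<X>", where 'a = int] by simp
    then show ?thesis unfolding m dim_W_step using False by simp
  qed
qed

text \<open>While 2m < sk, the shift to \<open>k - 1\<close> and \<open>m - 2\<close> leaves the
  span as it is, whereas \<open>W k (m + 1)\<close> loses its restriction to the conic, of dimension
  \<open>gap k m\<close>. As soon as 2m >= sk, the span has full dimension and all remaining gaps
  vanish. The exponent \<open>l\<close> is arbitrary for the induction, since each shift raises it
  by one.\<close>

lemma dim_D:
  "int (pv.dim (W k (m + 1))) = int (pv.dim (D k (Suc l) m)) + (\<Sum>i\<le>k. gap (k - i) (m - 2 * int i))"
proof (induction k arbitrary: m l)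
  case 0
  show ?case
  proof (cases "m < 0")
    case False
    then obtain n where m: "m = int n" by (metis nonneg_int_cases not_le)
    have "D 0 (Suc l) m = (*) (C ^ l) ` W 0 (m + 1)" unfolding m by (rule D_eq_full) simp
    then have "pv.dim (D 0 (Suc l) m) = pv.dim (W 0 (m + 1))"
      using dim_mult_image[OF W_subspace, of 0 "m + 1" "m + 1" "C ^ l"] C_neq_0 W_forms by (simp add: subset_iff)
    then show ?thesis using False by (simp add: gap_def)
  next
    case True
    have "W 0 m = {0}" using forms_neg[OF True] by (simp only: W_0)
    then have "{pderiv3 j (C ^ Suc l * f) | j f. f \<in> W 0 m} \<subseteq> {0}" by auto
    then have "D 0 (Suc l) m \<subseteq> {0}" unfolding D_def by (rule pv.span_minimal[OF _ pv.subspace_single_0])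
    moreover have "0 \<in> D 0 (Suc l) m" unfolding D_def by (rule pv.span_zero)
    ultimately have "D 0 (Suc l) m = {0}" by blast
    then have d: "pv.dim (D 0 (Suc l) m) = 0" by (simp only: pv_dim_0)
    show ?thesis
    \<comment> \<open>In degree m + 1 = 0 there are constants, and no form of degree -1 has them as
      derivatives; this is the value 1 of the gap at e = -2.\<close>
    proof (cases "m = -1")
      case m: True
      have "int (pv.dim (W 0 (m + 1))) = 1"
        using dim_forms[of 0, where 'k = 'k] unfolding W_0 m by simp
      then show ?thesis using m d by (simp add: gap_def)
    next
      case False
      then have "m + 1 < 0" using True by simp
      then show ?thesis using d True by (simp add: dim_W_neg gap_def)
    qed
  qed
next
  case (Suc k)
  define s where "s = int (card \<X>)"
  have s: "4 \<le> s" using cardX by (simp add: s_def)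
  define K where "K = int (Suc k * card \<X>)"
  have K0: "0 \<le> K" unfolding K_def by (rule of_nat_0_le_iff)
  show ?case
  proof (cases "2 * m < int (Suc k * card \<X>)")
    case True
    have sp: "(\<Sum>i\<le>Suc k. gap (Suc k - i) (m - 2 * int i)) = gap (Suc k) m + (\<Sum>i\<le>k. gap (k - i) (m - 2 - 2 * int i))"
      unfolding sum.atMost_Suc_shift by (simp add: algebra_simps)
    have W: "int (pv.dim (W (Suc k) (m + 1))) = int (pv.dim (W k (m - 2 + 1))) + gap (Suc k) m"
    proof (cases "0 \<le> m + 1")
      case t: True
      show ?thesis using dim_W_int[OF t, of "Suc k"] True
        by (simp add: gap_def Let_def algebra_simps)
    next
      case False
      then have "2 * m - K + 3 \<le> 0" using K0 by linarith
      then have "gap (Suc k) m = 0" unfolding gap_def Let_def K_def[symmetric] by simp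
      then show ?thesis using False by (simp add: dim_W_neg)
    qed
    show ?thesis
      unfolding W sp D_eq_shift[OF True] diff_Suc_1 Suc.IH[of "m - 2" "Suc l"] by simp
  next
    case False
    then have f: "int (Suc k) * s \<le> 2 * m" unfolding s_def by (simp only: of_nat_mult not_less)
    have "0 \<le> m" using False K0 unfolding K_def[symmetric] by linarith
    then obtain n where m: "m = int n" by (metis nonneg_int_cases)
    have "int (Suc k * card \<X>) \<le> int (2 * n)" using False m by simp
    then have n: "Suc k * card \<X> \<le> 2 * n" by (simp only: of_nat_le_iff)
    \<comment> \<open>Each shift changes e = 2m - sk by s - 4 >= 0, so e stays nonnegative.\<close>
    have z: "gap (Suc k - i) (m - 2 * int i) = 0" if "i \<le> Suc k" for i
    proof -
      have 1: "int ((Suc k - i) * card \<X>) = int (Suc k) * s - int i * s"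
        unfolding s_def of_nat_mult of_nat_diff[OF that] by (rule left_diff_distrib)
      have 2: "int i * 4 \<le> int i * s" by (rule mult_left_mono[OF s]) simp
      have "0 \<le> 2 * (m - 2 * j) - a" if "a = b - c" "j * 4 \<le> c" "b \<le> 2 * m" for a b c j :: int
        using that by presburger
      from this[OF 1 2 f] have "2 * (m - 2 * int i) - int ((Suc k - i) * card \<X>) \<ge> 0" .
      then show ?thesis by (simp add: gap_def Let_def)
    qed
    have "D (Suc k) (Suc l) m = (*) (C ^ l) ` W (Suc k) (m + 1)" unfolding m by (rule D_eq_full[OF n])
    then have "pv.dim (D (Suc k) (Suc l) m) = pv.dim (W (Suc k) (m + 1))"
      using dim_mult_image[OF W_subspace, of "Suc k" "m + 1" "m + 1" "C ^ l"] C_neq_0 W_forms by (simp add: subset_iff)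
    moreover have "(\<Sum>i\<le>Suc k. gap (Suc k - i) (m - 2 * int i)) = 0"
      by (rule sum.neutral) (use z in auto)
    ultimately show ?thesis by simp
  qed
qed

lemma dim_forms_step:
  "int (pv.dim (forms (int d) :: 'k poly3 set)) = int (pv.dim (forms (int d - 2) :: 'k poly3 set)) + 2 * int d + 1"
  using dim_W_int[of "int d" 0] unfolding W_0 diff_0_eq_0 by simp

text \<open>The codimension is the expected one, s k (k + 1) / 2. The hypothesis admits sk = 2d + 1
  because the positive part of 2d - sk + 1 still equals this linear expression there.\<close>

lemma codim_W:
  "int (k * card \<X>) \<le> 2 * int d + 1 \<Longrightarrow>
   2 * (int (pv.dim (forms (int d) :: 'k poly3 set)) - int (pv.dim (W k (int d)))) = int (card \<X>) * int k * (int k + 1)"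
proof (induction k arbitrary: d)
  case 0
  show ?case by (simp add: W_0)
next
  case (Suc k)
  define c where "c = int (Suc k * card \<X>)"
  have c: "c \<le> 2 * int d + 1" using Suc.prems unfolding c_def .
  have k: "c = int (k * card \<X>) + int (card \<X>)" unfolding c_def by simp
  have "0 \<le> int (k * card \<X>)" by (rule of_nat_0_le_iff)
  then have d: "2 \<le> d" using k c cardX by linarith
  then have e: "int d - 2 = int (d - 2)" by simp
  have "u \<le> 2 * (w - 2) + 1" if "c = u + v" "c \<le> 2 * w + 1" "4 \<le> v" for u v w :: int
    using that by presburger
  moreover have "4 \<le> int (card \<X>)" using cardX by simp
  ultimately have "int (k * card \<X>) \<le> 2 * int (d - 2) + 1" using k c unfolding e[symmetric] by blast
  note IH = Suc.IH[OF this]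
  have "max 0 (2 * int d - c + 1) = 2 * int d - c + 1" using c by (intro max_absorb2) linarith
  then have W: "int (pv.dim (W (Suc k) (int d))) = int (pv.dim (W k (int (d - 2)))) + (2 * int d - c + 1)"
    using dim_W_int[of "int d" "Suc k"] unfolding diff_Suc_1 e c_def[symmetric] by (simp only: of_nat_0_le_iff)
  have F: "int (pv.dim (forms (int d) :: 'k poly3 set)) = int (pv.dim (forms (int (d - 2)) :: 'k poly3 set)) + 2 * int d + 1"
    using dim_forms_step[of d] unfolding e .
  have "2 * (int (pv.dim (forms (int d) :: 'k poly3 set)) - int (pv.dim (W (Suc k) (int d))))
      = 2 * (int (pv.dim (forms (int (d - 2)) :: 'k poly3 set)) - int (pv.dim (W k (int (d - 2))))) + 2 * c"
    unfolding W F by simp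
  also have "\<dots> = int (card \<X>) * int k * (int k + 1) + 2 * (int (Suc k) * int (card \<X>))"
    unfolding IH c_def of_nat_mult ..
  also have "\<dots> = int (card \<X>) * int (Suc k) * (int (Suc k) + 1)"
    unfolding of_nat_Suc by (simp only: distrib_left distrib_right mult_1_left mult_1_right mult_2 mult_ac add_ac)
  finally show ?case .
qed

end

section \<open>Minimal homogeneous generators\<close>

text \<open>The hypothesis \<open>ind\<close> is independence of \<open>T\<close> modulo
  \<open>V\<close>; it makes \<open>T\<close> disjoint from a basis of \<open>V\<close> and their
  union independent.\<close>

lemma (in vector_space) dim_span_Un_independent_mod:
  assumes V: "subspace V" "V \<subseteq> span A" "finite A" and T: "finite T"
    and ind: "\<And>c t. (\<Sum>t\<in>T. c t *s t) \<in> V \<Longrightarrow> t \<in> T \<Longrightarrow> c t = 0"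
  shows "dim (span (V \<union> T)) = dim V + card T"
proof -
  obtain E where E: "E \<subseteq> V" "independent E" "V \<subseteq> span E" "card E = dim V" by (rule basis_exists)
  have finE: "finite E" using independent_span_bound[OF V(3) E(2)] E(1) V(2) by (meson order_trans)
  have disj: "E \<inter> T = {}"
  proof (rule ccontr)
    assume "E \<inter> T \<noteq> {}"
    then obtain t where t: "t \<in> E" "t \<in> T" by blast
    have "(\<Sum>u\<in>T. (if u = t then 1 else 0) *s u) = t"
      using T t(2) by (simp add: if_distrib[of "\<lambda>c. c *s _"] sum.delta cong: if_cong)
    then have "(\<Sum>u\<in>T. (if u = t then 1 else 0) *s u) \<in> V" using t(1) E(1) by auto
    from ind[OF this t(2)] show False by simp
  qed
  have indET: "independent (E \<union> T)"
  proof (rule independent_if_scalars_zero)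
    show "finite (E \<union> T)" using finE T by simp
    fix f x assume s: "(\<Sum>x\<in>E \<union> T. f x *s x) = 0" and x: "x \<in> E \<union> T"
    have s': "(\<Sum>x\<in>E. f x *s x) + (\<Sum>x\<in>T. f x *s x) = 0"
      using s unfolding sum.union_disjoint[OF finE T disj] .
    then have "(\<Sum>x\<in>T. f x *s x) = - (\<Sum>x\<in>E. f x *s x)" by (simp add: eq_neg_iff_add_eq_0 add.commute)
    moreover have "(\<Sum>x\<in>E. f x *s x) \<in> V"
      using E(1) V(1) by (intro subspace_sum subspace_scale) auto
    ultimately have "(\<Sum>x\<in>T. f x *s x) \<in> V" using subspace_neg[OF V(1)] by simp
    then have fT: "f t = 0" if "t \<in> T" for t using ind that by blast
    then have "(\<Sum>x\<in>E. f x *s x) = 0" using s' by simp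
    then have "f t = 0" if "t \<in> E" for t using independentD[OF E(2) finE order_refl] that by blast
    then show "f x = 0" using fT x by blast
  qed
  have "span (V \<union> T) = span (E \<union> T)"
  proof (rule subset_antisym)
    have "V \<union> T \<subseteq> span (E \<union> T)"
      using E(3) span_mono[of E "E \<union> T"] span_superset[of "E \<union> T"] by blast
    then show "span (V \<union> T) \<subseteq> span (E \<union> T)" by (rule span_minimal) simp
    show "span (E \<union> T) \<subseteq> span (V \<union> T)" using E(1) by (intro span_mono) blast
  qed
  then have "dim (span (V \<union> T)) = card (E \<union> T)" using dim_eq_card_independent[OF indET] by simp
  also have "\<dots> = dim V + card T" using card_Un_disjoint[OF finE T disj] E(4) by simp
  finally show ?thesis .
qed

lemma form_pdeg:
  fixes g :: "'k::field poly3"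
  assumes "g \<in> forms d" "g \<noteq> 0"
  shows "int (pdeg g) = d"
proof -
  have ne: "Poly_Mapping.keys g \<noteq> {}" using assms(2) by (simp only: keys_eq_empty not_False_eq_True)
  then obtain m where m: "m \<in> Poly_Mapping.keys g" by blast
  have k: "mdeg m' = nat d" if "m' \<in> Poly_Mapping.keys g" for m'
  proof -
    have "int (mdeg m') = d" using assms(1) that by (simp add: forms_def)
    then show ?thesis by (metis nat_int)
  qed
  have "0 \<le> d" using assms(1) m by (auto simp: forms_def)
  moreover have "mdeg ` Poly_Mapping.keys g = {nat d}"
    using k m by (intro equalityI subsetI) (auto intro: image_eqI[of _ _ m])
  ultimately show ?thesis unfolding pdeg_def by simp
qed

lemma genideal_finite:
  fixes B :: "'a::comm_ring_1 set"
  assumes "finite B" "f \<in> Idl\<^bsub>class_ring\<^esub> B"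
  obtains a where "f = (\<Sum>g\<in>B. a g * g)"
proof -
  let ?S = "{f. \<exists>a. f = (\<Sum>g\<in>B. a g * g)}"
  have "ideal ?S class_ring"
  proof (rule class_idealI)
    show "0 \<in> ?S" by (intro CollectI exI[of _ "\<lambda>_. 0"]) simp
    show "f + h \<in> ?S" if fh: "f \<in> ?S" "h \<in> ?S" for f h
    proof -
      obtain a b where ab: "f = (\<Sum>g\<in>B. a g * g)" "h = (\<Sum>g\<in>B. b g * g)" using fh by blast
      show ?thesis unfolding ab
        by (intro CollectI exI[of _ "\<lambda>g. a g + b g"]) (simp only: distrib_right sum.distrib)
    qed
    show "r * f \<in> ?S" if f: "f \<in> ?S" for f r
    proof -
      obtain a where a: "f = (\<Sum>g\<in>B. a g * g)" using f by blast
      show ?thesis unfolding a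
        by (intro CollectI exI[of _ "\<lambda>g. r * a g"]) (simp only: sum_distrib_left mult.assoc)
    qed
  qed
  moreover have "B \<subseteq> ?S"
  proof
    fix b assume b: "b \<in> B"
    have "(\<Sum>g\<in>B. (if g = b then 1 else 0) * g) = (\<Sum>g\<in>B. if g = b then g else 0)"
      by (rule sum.cong[OF refl]) simp
    also have "\<dots> = b" using assms(1) b by (simp add: sum.delta)
    finally show "b \<in> ?S" by (intro CollectI exI[of _ "\<lambda>g. if g = b then 1 else 0"]) (rule sym)
  qed
  ultimately have "Idl\<^bsub>class_ring\<^esub> B \<subseteq> ?S" by (rule class_genideal_minimal)
  then have "f \<in> ?S" using assms(2) by blast
  then show thesis using that by blast
qed

lemma class_ideal_subspace:
  fixes A :: "'k::field poly3 set"
  assumes "ideal A class_ring"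
  shows "pv.subspace A"
  by (rule pv.subspaceI)
    (rule class_ideal_0[OF assms], rule class_ideal_add[OF assms], assumption+, rule class_ideal_mult[OF assms])

text \<open>For an ideal \<open>A\<close>, the degree \<open>d\<close> part of its product with the
  irrelevant ideal.\<close>

definition var_span :: "'k::field poly3 set \<Rightarrow> int \<Rightarrow> 'k poly3 set" where
  "var_span A d = pv.span {var3 j * f | j f. f \<in> A \<inter> forms (d - 1)}"

text \<open>Euler's formula writes a form of positive degree through the variables, with its own
  derivatives as coefficients.\<close>

lemma form_mult_in_var_span:
  fixes A :: "'k::field_char_0 poly3 set"
  assumes A: "ideal A class_ring" and f: "f \<in> A" "f \<in> forms a" and h: "h \<in> forms e" and e: "0 < e"
  shows "h * f \<in> var_span A (e + a)"
proof -
  have e0: "of_int e \<noteq> (0 :: 'k)" using e by simp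
  have "const3 (of_int e) * (h * f) = (\<Sum>j\<in>UNIV. var3 j * (pderiv3 j h * f))"
    unfolding mult.assoc[symmetric] euler_formula[OF h, symmetric] sum_distrib_right ..
  moreover have "(\<Sum>j\<in>UNIV. var3 j * (pderiv3 j h * f)) \<in> var_span A (e + a)"
    unfolding var_span_def
  proof (rule pv.span_sum, rule pv.span_base)
    fix j :: 3
    have "pderiv3 j h * f \<in> forms (e - 1 + a)" by (rule forms_mult[OF pderiv3_forms[OF h] f(2)])
    moreover have "e - 1 + a = e + a - 1" by simp
    ultimately have "pderiv3 j h * f \<in> forms (e + a - 1)" by (simp only:)
    then have "pderiv3 j h * f \<in> A \<inter> forms (e + a - 1)" using class_ideal_mult[OF A f(1)] by blast
    then show "var3 j * (pderiv3 j h * f) \<in> {var3 j * f | j f. f \<in> A \<inter> forms (e + a - 1)}" by blast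
  qed
  ultimately have "const3 (1 / of_int e) * (const3 (of_int e) * (h * f)) \<in> var_span A (e + a)"
    unfolding var_span_def by (simp only: pv.span_scale)
  moreover have "const3 (1 / of_int e) * (const3 (of_int e) * (h * f)) = h * f"
    unfolding mult.assoc[symmetric] const3_mult[symmetric] using e0 by simp
  ultimately show ?thesis by (simp only:)
qed

text \<open>Graded Nakayama: the generators of degree \<open>d\<close> are a basis of the degree
  \<open>d\<close> part modulo the products with variables. Minimality for inclusion is enough for
  their independence.\<close>

theorem generator_count:
  fixes A B :: "'k::field_char_0 poly3 set"
  assumes B: "minimal_homogeneous_generators A B" "finite B"
  shows "pv.dim (A \<inter> forms d) = pv.dim (var_span A d) + card {g \<in> B. int (pdeg g) = d}"
proof -
  have AB: "A = Idl\<^bsub>class_ring\<^esub> B" and hom: "\<And>f. f \<in> B \<Longrightarrow> \<exists>d. f \<in> forms d"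
    and min: "\<And>B'. B' \<subset> B \<Longrightarrow> Idl\<^bsub>class_ring\<^esub> B' \<noteq> A"
    using B(1) by (auto simp: minimal_homogeneous_generators_def)
  have A: "ideal A class_ring" unfolding AB by (rule class_genideal)
  have BA: "g \<in> A" if "g \<in> B" for g unfolding AB by (rule class_genideal_self[OF that])
  have irr: "g \<notin> Idl\<^bsub>class_ring\<^esub> (B - {g})" if g: "g \<in> B" for g
  proof
    assume gi: "g \<in> Idl\<^bsub>class_ring\<^esub> (B - {g})"
    have "b \<in> Idl\<^bsub>class_ring\<^esub> (B - {g})" if "b \<in> B" for b
      using gi class_genideal_self[of b "B - {g}"] that by (cases "b = g") blast+
    then have "A \<subseteq> Idl\<^bsub>class_ring\<^esub> (B - {g})"
      unfolding AB by (intro class_genideal_minimal[OF class_genideal]) blast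
    moreover have "Idl\<^bsub>class_ring\<^esub> (B - {g}) \<subseteq> A"
      using BA by (intro class_genideal_minimal[OF A]) blast
    ultimately show False using min[of "B - {g}"] g by blast
  qed
  have nz: "g \<noteq> 0" if "g \<in> B" for g
    using irr[OF that] class_ideal_0[OF class_genideal] by metis
  have deg: "g \<in> forms (int (pdeg g))" if "g \<in> B" for g
    using hom[OF that] form_pdeg[OF _ nz[OF that]] by metis
  have expand: "\<exists>a. f = (\<Sum>g\<in>B. a g * g) \<and> (\<forall>g\<in>B. a g \<in> forms (e - int (pdeg g)))"
    if f: "f \<in> A" "f \<in> forms e" for f e
  proof -
    obtain a where a: "f = (\<Sum>g\<in>B. a g * g)" using genideal_finite[OF B(2)] f(1) unfolding AB by blast
    have "f = hcomp e f" using hcomp_of_form[OF f(2), of e] by simp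
    also have "\<dots> = (\<Sum>g\<in>B. hcomp (e - int (pdeg g)) (a g) * g)"
      unfolding a hcomp_sum by (intro sum.cong refl hcomp_mult_form deg)
    finally show ?thesis
      by (intro exI[of _ "\<lambda>g. hcomp (e - int (pdeg g)) (a g)"] conjI ballI hcomp_forms)
  qed
  let ?S = "{g \<in> B. int (pdeg g) = d}"
  have finS: "finite ?S" using B(2) by simp
  have V: "var_span A d \<subseteq> A \<inter> forms d"
    unfolding var_span_def
  proof (rule pv.span_minimal)
    show "pv.subspace (A \<inter> forms d)"
      by (rule pv.subspace_inter[OF class_ideal_subspace[OF A] forms_subspace])
    show "{var3 j * f | j f. f \<in> A \<inter> forms (d - 1)} \<subseteq> A \<inter> forms d"
    proof
      fix h assume "h \<in> {var3 j * f | j f. f \<in> A \<inter> forms (d - 1)}"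
      then obtain j f where f: "h = var3 j * f" "f \<in> A" "f \<in> forms (d - 1)" by blast
      have "var3 j * f \<in> forms (1 + (d - 1))" by (rule forms_mult[OF forms_var f(3)])
      moreover have "1 + (d - 1) = d" by simp
      ultimately have "h \<in> forms d" unfolding f(1) by (simp only:)
      then show "h \<in> A \<inter> forms d" using class_ideal_mult[OF A f(2)] f(1) by blast
    qed
  qed
  obtain E where E: "finite E" "(forms d :: 'k poly3 set) \<subseteq> pv.span E" using forms_fin by blast
  have "pv.dim (pv.span (var_span A d \<union> ?S)) = pv.dim (var_span A d) + card ?S"
  proof (rule pv.dim_span_Un_independent_mod[OF _ _ E(1) finS])
    show "pv.subspace (var_span A d)" unfolding var_span_def by (rule pv.subspace_span)
    show "var_span A d \<subseteq> pv.span E" using V E(2) by blast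
    fix c g assume s: "(\<Sum>t\<in>?S. const3 (c t) * t) \<in> var_span A d" and g: "g \<in> ?S"
    show "c g = 0"
    proof (rule ccontr)
      assume cg: "c g \<noteq> 0"
      let ?J = "Idl\<^bsub>class_ring\<^esub> (B - {g})"
      have J: "ideal ?J class_ring" by (rule class_genideal)
      \<comment> \<open>A relation modulo \<open>var_span A d\<close> puts \<open>g\<close> into the
        ideal of the other generators once \<open>var_span A d\<close> lies there. It does, because
        elements of degree d - 1 cannot involve \<open>g\<close>: its coefficient would have
        negative degree.\<close>
      have "var_span A d \<subseteq> ?J"
        unfolding var_span_def
      proof (rule pv.span_minimal)
        show "pv.subspace ?J"
          by (rule class_ideal_subspace[OF J])
        show "{var3 j * f | j f. f \<in> A \<inter> forms (d - 1)} \<subseteq> ?J"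
        proof
          fix h assume "h \<in> {var3 j * f | j f. f \<in> A \<inter> forms (d - 1)}"
          then obtain j f where f: "h = var3 j * f" "f \<in> A" "f \<in> forms (d - 1)" by blast
          obtain a where a: "f = (\<Sum>g\<in>B. a g * g)" "\<forall>g\<in>B. a g \<in> forms (d - 1 - int (pdeg g))"
            using expand[OF f(2,3)] by blast
          have "a b * b \<in> ?J" if b: "b \<in> B" for b
          proof (cases "b = g")
            case True
            have "d - 1 - int (pdeg b) < 0" using True g by simp
            moreover have "a b \<in> forms (d - 1 - int (pdeg b))" using a(2) b by blast
            ultimately have "a b = 0" using forms_neg by blast
            then have "a b * b = 0" by (simp only: mult_zero_left)
            then show ?thesis using class_ideal_0[OF J] by (simp only:)
          next
            case False
            then show ?thesis using b by (intro class_ideal_mult[OF J] class_genideal_self) blast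
          qed
          then have "f \<in> ?J" unfolding a(1) by (rule class_ideal_sum[OF J])
          then show "h \<in> ?J" unfolding f(1) by (rule class_ideal_mult[OF J])
        qed
      qed
      then have s': "(\<Sum>t\<in>?S. const3 (c t) * t) \<in> ?J" using s by blast
      have "(\<Sum>t\<in>?S. const3 (c t) * t) = const3 (c g) * g + (\<Sum>t\<in>?S - {g}. const3 (c t) * t)"
        by (rule sum.remove[OF finS g])
      then have "const3 (c g) * g = (\<Sum>t\<in>?S. const3 (c t) * t) - (\<Sum>t\<in>?S - {g}. const3 (c t) * t)"
        by (simp only: add_diff_cancel_right')
      also have "\<dots> \<in> ?J"
        by (intro class_ideal_diff[OF J s'] class_ideal_sum[OF J] class_ideal_mult[OF J] class_genideal_self) blast
      finally have "const3 (1 / c g) * (const3 (c g) * g) \<in> ?J" by (rule class_ideal_mult[OF J])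
      moreover have "const3 (1 / c g) * (const3 (c g) * g) = g"
        unfolding mult.assoc[symmetric] const3_mult[symmetric] using cg by simp
      ultimately have "g \<in> ?J" by (simp only:)
      then show False using irr g by blast
    qed
  qed
  moreover have "pv.span (var_span A d \<union> ?S) = A \<inter> forms d"
  proof (rule subset_antisym)
    show "pv.span (var_span A d \<union> ?S) \<subseteq> A \<inter> forms d"
    proof (rule pv.span_minimal)
      show "var_span A d \<union> ?S \<subseteq> A \<inter> forms d" using V BA deg by blast
      show "pv.subspace (A \<inter> forms d)"
        by (rule pv.subspace_inter[OF class_ideal_subspace[OF A] forms_subspace])
    qed
    show "A \<inter> forms d \<subseteq> pv.span (var_span A d \<union> ?S)"
    proof
      fix f assume f: "f \<in> A \<inter> forms d"
      then obtain a where a: "f = (\<Sum>g\<in>B. a g * g)" "\<forall>g\<in>B. a g \<in> forms (d - int (pdeg g))"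
        using expand by blast
      have "a g * g \<in> pv.span (var_span A d \<union> ?S)" if g: "g \<in> B" for g
      proof -
        have ag: "a g \<in> forms (d - int (pdeg g))" using a(2) g by blast
        consider "int (pdeg g) = d" | "0 < d - int (pdeg g)" | "d - int (pdeg g) < 0" by linarith
        then show ?thesis
        proof cases
          case 1
          then have "a g \<in> forms 0" using ag by simp
          then obtain k where k: "a g = const3 k" unfolding forms_0_const by blast
          have "g \<in> pv.span (var_span A d \<union> ?S)" using 1 g by (intro pv.span_base) blast
          then show ?thesis unfolding k by (rule pv.span_scale)
        next
          case 2
          have "a g * g \<in> var_span A (d - int (pdeg g) + int (pdeg g))"
            by (rule form_mult_in_var_span[OF A BA[OF g] deg[OF g] ag 2])
          then have "a g * g \<in> var_span A d" by simp
          then show ?thesis by (intro pv.span_base) blast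
        next
          case 3
          then have "a g = 0" using ag forms_neg by blast
          then have "a g * g = 0" by (simp only: mult_zero_left)
          then show ?thesis by (simp only: pv.span_zero)
        qed
      qed
      then show "f \<in> pv.span (var_span A d \<union> ?S)" unfolding a(1) by (rule pv.span_sum)
    qed
  qed
  ultimately show ?thesis by simp
qed

section \<open>The number of minimal generators of the ideal of the points in each degree\<close>

context conic_points
begin

lemma W_1: "W 1 d = fat_ideal 1 \<X> \<inter> forms d"
  by (simp add: W_def)

lemma var_span_W: "var_span (fat_ideal 1 \<X>) d = pv.span {var3 j * f | j f. f \<in> W 1 (d - 1)}"
  unfolding var_span_def W_def ..

lemma form_mult_W_var_span: "f \<in> W 1 a \<Longrightarrow> h \<in> forms e \<Longrightarrow> 0 < e \<Longrightarrow> h * f \<in> var_span (fat_ideal 1 \<X>) (e + a)"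
  by (rule form_mult_in_var_span[OF fat_ideal_ideal]) (simp_all add: W_def)

lemma var_span_subset: "var_span (fat_ideal 1 \<X>) d \<subseteq> W 1 d"
  unfolding var_span_W
proof (rule pv.span_minimal[OF _ W_subspace])
  show "{var3 j * f | j f. f \<in> W 1 (d - 1)} \<subseteq> W 1 d"
  proof
    fix h assume "h \<in> {var3 j * f | j f. f \<in> W 1 (d - 1)}"
    then obtain j f where f: "h = var3 j * f" "f \<in> W 1 (d - 1)" by blast
    have "var3 j * f \<in> W 1 (1 + (d - 1))" by (rule W_mult_form[OF forms_var f(2)])
    then show "h \<in> W 1 d" unfolding f(1) by simp
  qed
qed

text \<open>The lifting used for derivatives, in the case k = 1 and with plain products: subtracting
  the sum of the \<open>lam i * F i\<close> leaves C H' with H' of degree m - 1. As m >= 2 this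
  degree is positive, so C H' is a combination of products with variables.\<close>

lemma var_span_full:
  assumes "card \<X> \<le> 2 * m"
  shows "var_span (fat_ideal 1 \<X>) (int m + 1) = W 1 (int m + 1)"
proof (rule subset_antisym[OF var_span_subset], rule subsetI)
  have m: "2 \<le> m" using assms cardX by linarith
  fix H assume H: "H \<in> W 1 (int m + 1)"
  have "1 * card \<X> \<le> 2 * m" using assms by simp
  then obtain F where F: "\<And>i. F i \<in> W 1 (int m)" "rho H = (\<Sum>i\<le>2. rho (lam i) * rho (F i))"
    by (rule rho_lam_expand[OF H]) blast
  define G where "G = (\<Sum>i\<le>2. lam i * F i)"
  have "lam i * F i \<in> var_span (fat_ideal 1 \<X>) (1 + int m)" for i
    by (rule form_mult_W_var_span[OF F(1) lam_forms]) simp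
  then have "G \<in> var_span (fat_ideal 1 \<X>) (1 + int m)"
    unfolding G_def var_span_def by (intro pv.span_sum)
  then have G: "G \<in> var_span (fat_ideal 1 \<X>) (int m + 1)" by (simp only: add.commute)
  have "rho (H - G) = 0" unfolding rho.hom_minus F(2) G_def rho.hom_sum rho.hom_mult by simp
  moreover have "G \<in> W 1 (int m + 1)" using G var_span_subset by blast
  ultimately obtain H' where H': "H' \<in> W (1 - 1) (int m + 1 - 2)" "H - G = C * H'"
    using W_kernel[OF W_diff[OF H]] by metis
  have "H' \<in> forms (int m - 1)" using W_forms[OF H'(1)] by simp
  moreover have "0 < int m - 1" using m by simp
  ultimately have "H' * C \<in> var_span (fat_ideal 1 \<X>) (int m - 1 + 2)" by (rule form_mult_W_var_span[OF C_in_W])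
  moreover have "int m - 1 + 2 = int m + 1" by simp
  ultimately have "H - G \<in> var_span (fat_ideal 1 \<X>) (int m + 1)" unfolding H'(2) by (simp only: mult.commute)
  with G have "(H - G) + G \<in> var_span (fat_ideal 1 \<X>) (int m + 1)"
    unfolding var_span_def by (intro pv.span_add)
  then show "H \<in> var_span (fat_ideal 1 \<X>) (int m + 1)" by (simp only: diff_add_cancel)
qed

text \<open>In degree d - 1 only multiples of \<open>C\<close> vanish at the points, so the products
  with variables are the multiples of \<open>C\<close> in degree d, except that \<open>C\<close>
  itself is no such product. The side condition removes this exception, which occurs for d =
  2.\<close>

lemma var_span_small:
  assumes "2 * (d - 1) < int (card \<X>)"
  shows "var_span (fat_ideal 1 \<X>) d = (*) C ` {f \<in> forms (d - 2). 3 \<le> d \<or> f = 0}"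
proof (rule subset_antisym)
  have S: "pv.subspace {f \<in> forms (d - 2). 3 \<le> d \<or> f = (0 :: 'k poly3)}"
    unfolding pv.subspace_def
    by (intro conjI ballI allI; clarsimp simp: forms_add forms_const_mult)
  show "var_span (fat_ideal 1 \<X>) d \<subseteq> (*) C ` {f \<in> forms (d - 2). 3 \<le> d \<or> f = 0}"
    unfolding var_span_W
  proof (rule pv.span_minimal[OF _ pp.linear_subspace_image[OF mult_left_linear S]], rule subsetI)
    fix h assume "h \<in> {var3 j * f | j f. f \<in> W 1 (d - 1)}"
    then obtain j f where f: "h = var3 j * f" "f \<in> W 1 (d - 1)" by blast
    have "2 * (d - 1) < int (1 * card \<X>)" using assms by simp
    then obtain g where g: "g \<in> W (1 - 1) (d - 1 - 2)" "f = C * g" by (rule W_small[OF f(2)])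
    have gf: "g \<in> forms (d - 3)" using W_forms[OF g(1)] by simp
    have "var3 j * g \<in> forms (1 + (d - 3))" by (rule forms_mult[OF forms_var gf])
    then have "var3 j * g \<in> forms (d - 2)" by simp
    moreover have "3 \<le> d \<or> var3 j * g = 0"
    proof (cases "3 \<le> d")
      case False
      then have "d - 3 < 0" by simp
      then have "g = 0" using gf forms_neg by blast
      then show ?thesis by (simp only: mult_zero_right simp_thms)
    qed simp
    moreover have "h = C * (var3 j * g)" unfolding f(1) g(2) by (rule mult.left_commute)
    ultimately show "h \<in> (*) C ` {f \<in> forms (d - 2). 3 \<le> d \<or> f = 0}" by blast
  qed
  show "(*) C ` {f \<in> forms (d - 2). 3 \<le> d \<or> f = 0} \<subseteq> var_span (fat_ideal 1 \<X>) d"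
  proof
    fix h assume "h \<in> (*) C ` {f \<in> forms (d - 2). 3 \<le> d \<or> f = 0}"
    then obtain f where f: "h = C * f" "f \<in> forms (d - 2)" "3 \<le> d \<or> f = 0" by blast
    show "h \<in> var_span (fat_ideal 1 \<X>) d"
    proof (cases "f = 0")
      case True
      then have "h = 0" unfolding f(1) by (simp only: mult_zero_right)
      then show ?thesis unfolding var_span_def by (simp only: pv.span_zero)
    next
      case False
      then have "0 < d - 2" using f(3) by simp
      from form_mult_W_var_span[OF C_in_W f(2) this] have "f * C \<in> var_span (fat_ideal 1 \<X>) d" by simp
      then show ?thesis unfolding f(1) by (simp only: mult.commute)
    qed
  qed
qed

text \<open>\<open>gap 0 (d - 3)\<close> is 1 for d = 2 and 0 otherwise, and accounts for
  \<open>C\<close>. \<open>gap 1 (d - 1)\<close> accounts for the generators that do not vanish on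
  the conic: one of degree s/2 or two of degree (s + 1)/2, according to the parity of s.\<close>

lemma dim_var_span:
  "int (pv.dim (W 1 d)) = int (pv.dim (var_span (fat_ideal 1 \<X>) d)) + gap 1 (d - 1) + gap 0 (d - 3)"
proof (cases "2 * (d - 1) < int (card \<X>)")
  case False
  moreover have "4 \<le> int (card \<X>)" using cardX by simp
  ultimately have "2 \<le> d" by presburger
  define m where "m = nat (d - 1)"
  have m: "d = int m + 1" using \<open>2 \<le> d\<close> by (simp add: m_def)
  have "card \<X> \<le> 2 * m" using False unfolding m by simp
  moreover have "gap 1 (d - 1) = 0" using False by (simp add: gap_def Let_def)
  moreover have "gap 0 (d - 3) = 0"
  proof -
    have "2 \<le> m" using \<open>card \<X> \<le> 2 * m\<close> cardX by linarith
    then show ?thesis unfolding m by (simp add: gap_def Let_def)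
  qed
  ultimately show ?thesis using var_span_full unfolding m by simp
next
  case True
  have S: "pv.subspace {f \<in> forms (d - 2). 3 \<le> d \<or> f = (0 :: 'k poly3)}"
    unfolding pv.subspace_def
    by (intro conjI ballI allI; clarsimp simp: forms_add forms_const_mult)
  have v: "pv.dim (var_span (fat_ideal 1 \<X>) d) = pv.dim {f \<in> forms (d - 2). 3 \<le> d \<or> f = (0 :: 'k poly3)}"
    unfolding var_span_small[OF True] by (rule dim_mult_image[OF S _ C_neq_0]) blast
  have g1: "gap 1 (d - 1) = max 0 (2 * d - int (card \<X>) + 1)"
    using True by (simp add: gap_def Let_def algebra_simps)
  show ?thesis
  proof (cases "3 \<le> d")
    case d: True
    then have "{f \<in> forms (d - 2). 3 \<le> d \<or> f = (0 :: 'k poly3)} = W 0 (d - 2)" unfolding W_0 by blast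
    moreover have "gap 0 (d - 3) = 0" using d by (simp add: gap_def Let_def)
    ultimately show ?thesis using dim_W_int[of d 1] d v g1 by simp
  next
    case d: False
    have "{f \<in> forms (d - 2). 3 \<le> d \<or> f = (0 :: 'k poly3)} = {0}" using d forms_0 by blast
    then have v0: "pv.dim (var_span (fat_ideal 1 \<X>) d) = 0" unfolding v by (simp only: pv_dim_0)
    have s: "4 \<le> int (card \<X>)" using cardX by simp
    show ?thesis
    proof (cases "0 \<le> d")
      case d0: True
      have "int (pv.dim (W 0 (d - 2))) = gap 0 (d - 3)"
      proof (cases "d = 2")
        case True
        then show ?thesis using dim_forms[of 0, where 'k = 'k] unfolding W_0 by (simp add: gap_def Let_def)
      next
        case False
        then have "d - 2 < 0" using d by simp
        then show ?thesis using d False by (simp add: dim_W_neg gap_def Let_def)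
      qed
      then show ?thesis using dim_W_int[OF d0, of 1] v0 g1 by simp
    next
      case False
      then have "d < 0" by simp
      then have "2 * d - int (card \<X>) + 1 \<le> 0" using s by presburger
      then show ?thesis using \<open>d < 0\<close> v0 g1 by (simp add: dim_W_neg gap_def Let_def)
    qed
  qed
qed

lemma gen_count_gap:
  assumes "minimal_homogeneous_generators (fat_ideal 1 \<X>) B" "finite B"
  shows "int (card {g \<in> B. int (pdeg g) = d}) = gap 1 (d - 1) + gap 0 (d - 3)"
  using generator_count[OF assms, of d] dim_var_span[of d] unfolding W_1 by simp

end

section \<open>Free modules and quotient modules\<close>

lemma free_module_module:
  assumes "cring R"
  shows "module R (free_module R B)"
proof -
  interpret R: cring R by fact
  let ?F = "free_module R B"
  have fin: "finite {b. f b \<oplus>\<^bsub>R\<^esub> g b \<noteq> \<zero>\<^bsub>R\<^esub>}" if "finite {b. f b \<noteq> \<zero>\<^bsub>R\<^esub>}" "finite {b. g b \<noteq> \<zero>\<^bsub>R\<^esub>}"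
    and "\<forall>b. f b \<in> carrier R" "\<forall>b. g b \<in> carrier R" for f g
    by (rule finite_subset[OF _ finite_UnI[OF that(1,2)]]) (use that(3,4) in auto)
  have fin': "finite {b. r \<otimes>\<^bsub>R\<^esub> f b \<noteq> \<zero>\<^bsub>R\<^esub>}" if "finite {b. f b \<noteq> \<zero>\<^bsub>R\<^esub>}" "r \<in> carrier R" for f r
    by (rule finite_subset[OF _ that(1)]) (use that(2) in auto)
  show ?thesis
  proof (rule module_criteria[OF assms])
    show "\<zero>\<^bsub>?F\<^esub> \<in> carrier ?F" by (simp add: free_module_def)
    show "\<forall>v w. v \<in> carrier ?F \<and> w \<in> carrier ?F \<longrightarrow> v \<oplus>\<^bsub>?F\<^esub> w \<in> carrier ?F"
      using fin by (auto simp: free_module_def)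
    show "\<forall>v\<in>carrier ?F. \<exists>w\<in>carrier ?F. v \<oplus>\<^bsub>?F\<^esub> w = \<zero>\<^bsub>?F\<^esub>"
    proof
      fix v assume v: "v \<in> carrier ?F"
      have "finite {b. \<ominus>\<^bsub>R\<^esub> v b \<noteq> \<zero>\<^bsub>R\<^esub>}"
        by (rule finite_subset[of _ "{b. v b \<noteq> \<zero>\<^bsub>R\<^esub>}"]) (use v in \<open>auto simp: free_module_def\<close>)
      then show "\<exists>w\<in>carrier ?F. v \<oplus>\<^bsub>?F\<^esub> w = \<zero>\<^bsub>?F\<^esub>"
        using v by (intro bexI[of _ "\<lambda>b. \<ominus>\<^bsub>R\<^esub> v b"]) (auto simp: free_module_def R.r_neg)
    qed
    show "\<forall>c v. c \<in> carrier R \<and> v \<in> carrier ?F \<longrightarrow> c \<odot>\<^bsub>?F\<^esub> v \<in> carrier ?F"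
      using fin' by (auto simp: free_module_def)
  qed (auto simp: free_module_def fun_eq_iff R.a_ac R.m_assoc R.l_distr R.r_distr)
qed

lemma free_gen_closed: "cring R \<Longrightarrow> b \<in> B \<Longrightarrow> free_gen R b \<in> carrier (free_module R B)"
proof -
  assume "cring R" "b \<in> B"
  then interpret R: cring R by simp
  have "{x. (if x = b then \<one>\<^bsub>R\<^esub> else \<zero>\<^bsub>R\<^esub>) \<noteq> \<zero>\<^bsub>R\<^esub>} \<subseteq> {b}" by auto
  from finite_subset[OF this] \<open>b \<in> B\<close> show ?thesis by (auto simp: free_module_def free_gen_def)
qed

locale quotient_mod =
  fixes R :: "('r, 'x) ring_scheme" and M :: "('r, 'm, 'y) module_scheme" and N :: "'m set"
  assumes M: "module R M" and N: "submodule R N M"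
begin

sublocale M: module R M by (rule M)

lemma N_subset: "N \<subseteq> carrier M"
  using N by (simp add: submodule_def)

lemma sub: "abelian_subgroup N M"
proof (rule abelian_subgroupI3)
  show "additive_subgroup N M"
  proof (rule additive_subgroupI)
    show "subgroup N (add_monoid M)"
    proof
      fix x assume x: "x \<in> N"
      then have "\<ominus>\<^bsub>M\<^esub> x = (\<ominus>\<^bsub>R\<^esub> \<one>\<^bsub>R\<^esub>) \<odot>\<^bsub>M\<^esub> x"
        using N_subset M.smult_l_minus[of "\<one>\<^bsub>R\<^esub>" x] by auto
      then have "\<ominus>\<^bsub>M\<^esub> x \<in> N" using N x unfolding submodule_def by auto
      then show "inv\<^bsub>add_monoid M\<^esub> x \<in> N" by (simp add: a_inv_def)
    qed (use N in \<open>auto simp: submodule_def\<close>)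
  qed
qed (rule M.abelian_group_axioms)

sublocale N: abelian_subgroup N M by (rule sub)

abbreviation Q where "Q \<equiv> quotient_module M N"
definition proj :: "'m \<Rightarrow> 'm set" where "proj x = N +>\<^bsub>M\<^esub> x"

lemma proj_closed: "x \<in> carrier M \<Longrightarrow> proj x \<in> carrier Q"
  using N_subset by (auto simp: quotient_module_def proj_def intro: M.a_rcosetsI)

lemma proj_surj: "A \<in> carrier Q \<Longrightarrow> \<exists>x\<in>carrier M. A = proj x"
  by (auto simp: quotient_module_def proj_def A_RCOSETS_def')

lemma proj_self: "x \<in> carrier M \<Longrightarrow> x \<in> proj x"
  unfolding proj_def by (rule N.a_rcos_self)

lemma proj_eqI: "x \<in> carrier M \<Longrightarrow> y \<in> proj x \<Longrightarrow> proj y = proj x"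
  unfolding proj_def using M.a_repr_independence[of y N x] N.a_subgroup by simp

lemma proj_add: "x \<in> carrier M \<Longrightarrow> y \<in> carrier M \<Longrightarrow> proj x \<oplus>\<^bsub>Q\<^esub> proj y = proj (x \<oplus>\<^bsub>M\<^esub> y)"
  by (simp add: quotient_module_def proj_def N.a_rcos_sum)

lemma proj_diff: "x \<in> carrier M \<Longrightarrow> y \<in> proj x \<Longrightarrow> \<exists>n\<in>N. y = n \<oplus>\<^bsub>M\<^esub> x"
  by (auto simp: proj_def a_r_coset_def')

lemma proj_addN: "n \<in> N \<Longrightarrow> x \<in> carrier M \<Longrightarrow> proj (n \<oplus>\<^bsub>M\<^esub> x) = proj x"
  by (rule proj_eqI) (auto simp: proj_def a_r_coset_def')

text \<open>The scalar multiple is defined as a union of cosets over all representatives; closure of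
  \<open>N\<close> under scalars makes these cosets equal.\<close>

lemma proj_smult: "r \<in> carrier R \<Longrightarrow> x \<in> carrier M \<Longrightarrow> r \<odot>\<^bsub>Q\<^esub> proj x = proj (r \<odot>\<^bsub>M\<^esub> x)"
proof -
  assume r: "r \<in> carrier R" and x: "x \<in> carrier M"
  have "proj (r \<odot>\<^bsub>M\<^esub> a) = proj (r \<odot>\<^bsub>M\<^esub> x)" if a: "a \<in> proj x" for a
  proof -
    obtain n where n: "n \<in> N" "a = n \<oplus>\<^bsub>M\<^esub> x" using proj_diff[OF x a] by blast
    have rn: "r \<odot>\<^bsub>M\<^esub> n \<in> N" using N r n(1) unfolding submodule_def by blast
    have "r \<odot>\<^bsub>M\<^esub> a = r \<odot>\<^bsub>M\<^esub> n \<oplus>\<^bsub>M\<^esub> r \<odot>\<^bsub>M\<^esub> x"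
      unfolding n(2) using n(1) N_subset by (intro M.smult_r_distr r x) blast
    then show ?thesis using proj_addN[OF rn M.smult_closed[OF r x]] by simp
  qed
  then have "(\<Union>a\<in>proj x. proj (r \<odot>\<^bsub>M\<^esub> a)) = proj (r \<odot>\<^bsub>M\<^esub> x)"
    using proj_self[OF x] by blast
  then show ?thesis by (simp add: quotient_module_def proj_def)
qed

lemma Q_zero: "\<zero>\<^bsub>Q\<^esub> = proj \<zero>\<^bsub>M\<^esub>"
  using N_subset by (simp add: quotient_module_def proj_def M.a_coset_add_zero)

lemma proj_zero_iff: "x \<in> carrier M \<Longrightarrow> proj x = \<zero>\<^bsub>Q\<^esub> \<longleftrightarrow> x \<in> N"
proof
  assume x: "x \<in> carrier M" and "proj x = \<zero>\<^bsub>Q\<^esub>"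
  then have "N +>\<^bsub>M\<^esub> x = N" by (simp add: quotient_module_def proj_def)
  from M.a_coset_join1[OF this x N.a_subgroup] show "x \<in> N" .
next
  assume "x \<in> N"
  then show "proj x = \<zero>\<^bsub>Q\<^esub>" by (simp add: quotient_module_def proj_def N.a_rcos_const)
qed

lemma proj_eq_if_minus:
  assumes "x \<in> carrier M" "y \<in> carrier M" "x \<ominus>\<^bsub>M\<^esub> y \<in> N"
  shows "proj x = proj y"
proof -
  have "x = (x \<ominus>\<^bsub>M\<^esub> y) \<oplus>\<^bsub>M\<^esub> y"
    using assms(1,2) by (simp add: M.minus_eq M.a_assoc M.l_neg)
  then show ?thesis using proj_addN[OF assms(3,2)] by simp
qed

lemma Q_module: "module R Q"
proof (rule module_criteria)
  show "cring R" by (rule M.R.cring_axioms)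
  show "\<zero>\<^bsub>Q\<^esub> \<in> carrier Q" unfolding Q_zero by (rule proj_closed) simp
  show "\<forall>v w. v \<in> carrier Q \<and> w \<in> carrier Q \<longrightarrow> v \<oplus>\<^bsub>Q\<^esub> w \<in> carrier Q"
  proof (intro allI impI)
    fix v w assume "v \<in> carrier Q \<and> w \<in> carrier Q"
    then obtain x y where "x \<in> carrier M" "v = proj x" "y \<in> carrier M" "w = proj y" using proj_surj by blast
    then show "v \<oplus>\<^bsub>Q\<^esub> w \<in> carrier Q" by (simp add: proj_add proj_closed)
  qed
  show "\<forall>v\<in>carrier Q. \<exists>w\<in>carrier Q. v \<oplus>\<^bsub>Q\<^esub> w = \<zero>\<^bsub>Q\<^esub>"
  proof
    fix v assume "v \<in> carrier Q"
    then obtain x where "x \<in> carrier M" "v = proj x" using proj_surj by blast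
    then show "\<exists>w\<in>carrier Q. v \<oplus>\<^bsub>Q\<^esub> w = \<zero>\<^bsub>Q\<^esub>"
      by (intro bexI[of _ "proj (\<ominus>\<^bsub>M\<^esub> x)"]) (simp_all add: proj_add proj_closed Q_zero M.r_neg)
  qed
  show "\<forall>c v. c \<in> carrier R \<and> v \<in> carrier Q \<longrightarrow> c \<odot>\<^bsub>Q\<^esub> v \<in> carrier Q"
  proof (intro allI impI)
    fix c v assume "c \<in> carrier R \<and> v \<in> carrier Q"
    moreover from this obtain x where "x \<in> carrier M" "v = proj x" using proj_surj by blast
    ultimately show "c \<odot>\<^bsub>Q\<^esub> v \<in> carrier Q" by (simp add: proj_smult proj_closed)
  qed
  show "\<forall>v w. v \<in> carrier Q \<and> w \<in> carrier Q \<longrightarrow> v \<oplus>\<^bsub>Q\<^esub> w = w \<oplus>\<^bsub>Q\<^esub> v"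
  proof (intro allI impI)
    fix v w assume "v \<in> carrier Q \<and> w \<in> carrier Q"
    then obtain x y where "x \<in> carrier M" "v = proj x" "y \<in> carrier M" "w = proj y" using proj_surj by blast
    then show "v \<oplus>\<^bsub>Q\<^esub> w = w \<oplus>\<^bsub>Q\<^esub> v" by (simp add: proj_add M.a_comm)
  qed
  show "\<forall>v w x. v \<in> carrier Q \<and> w \<in> carrier Q \<and> x \<in> carrier Q \<longrightarrow> v \<oplus>\<^bsub>Q\<^esub> w \<oplus>\<^bsub>Q\<^esub> x = v \<oplus>\<^bsub>Q\<^esub> (w \<oplus>\<^bsub>Q\<^esub> x)"
  proof (intro allI impI)
    fix v w u assume "v \<in> carrier Q \<and> w \<in> carrier Q \<and> u \<in> carrier Q"
    then obtain x y z where "x \<in> carrier M" "v = proj x" "y \<in> carrier M" "w = proj y" "z \<in> carrier M" "u = proj z"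
      using proj_surj by meson
    then show "v \<oplus>\<^bsub>Q\<^esub> w \<oplus>\<^bsub>Q\<^esub> u = v \<oplus>\<^bsub>Q\<^esub> (w \<oplus>\<^bsub>Q\<^esub> u)" by (simp add: proj_add M.a_assoc)
  qed
  show "\<forall>v\<in>carrier Q. v \<oplus>\<^bsub>Q\<^esub> \<zero>\<^bsub>Q\<^esub> = v"
  proof
    fix v assume "v \<in> carrier Q"
    then obtain x where "x \<in> carrier M" "v = proj x" using proj_surj by blast
    then show "v \<oplus>\<^bsub>Q\<^esub> \<zero>\<^bsub>Q\<^esub> = v" by (simp add: proj_add Q_zero)
  qed
  show "\<forall>a b v. a \<in> carrier R \<and> b \<in> carrier R \<and> v \<in> carrier Q \<longrightarrow> (a \<otimes>\<^bsub>R\<^esub> b) \<odot>\<^bsub>Q\<^esub> v = a \<odot>\<^bsub>Q\<^esub> (b \<odot>\<^bsub>Q\<^esub> v)"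
  proof (intro allI impI)
    fix a b v assume *: "a \<in> carrier R \<and> b \<in> carrier R \<and> v \<in> carrier Q"
    then obtain x where "x \<in> carrier M" "v = proj x" using proj_surj by blast
    with * show "(a \<otimes>\<^bsub>R\<^esub> b) \<odot>\<^bsub>Q\<^esub> v = a \<odot>\<^bsub>Q\<^esub> (b \<odot>\<^bsub>Q\<^esub> v)" by (simp add: proj_smult M.smult_assoc1)
  qed
  show "\<forall>v\<in>carrier Q. \<one>\<^bsub>R\<^esub> \<odot>\<^bsub>Q\<^esub> v = v"
  proof
    fix v assume "v \<in> carrier Q"
    then obtain x where "x \<in> carrier M" "v = proj x" using proj_surj by blast
    then show "\<one>\<^bsub>R\<^esub> \<odot>\<^bsub>Q\<^esub> v = v" by (simp add: proj_smult)
  qed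
  show "\<forall>a b v. a \<in> carrier R \<and> b \<in> carrier R \<and> v \<in> carrier Q \<longrightarrow> (a \<oplus>\<^bsub>R\<^esub> b) \<odot>\<^bsub>Q\<^esub> v = a \<odot>\<^bsub>Q\<^esub> v \<oplus>\<^bsub>Q\<^esub> b \<odot>\<^bsub>Q\<^esub> v"
  proof (intro allI impI)
    fix a b v assume *: "a \<in> carrier R \<and> b \<in> carrier R \<and> v \<in> carrier Q"
    then obtain x where "x \<in> carrier M" "v = proj x" using proj_surj by blast
    with * show "(a \<oplus>\<^bsub>R\<^esub> b) \<odot>\<^bsub>Q\<^esub> v = a \<odot>\<^bsub>Q\<^esub> v \<oplus>\<^bsub>Q\<^esub> b \<odot>\<^bsub>Q\<^esub> v"
      by (simp add: proj_smult proj_add M.smult_l_distr)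
  qed
  show "\<forall>a v w. a \<in> carrier R \<and> v \<in> carrier Q \<and> w \<in> carrier Q \<longrightarrow> a \<odot>\<^bsub>Q\<^esub> (v \<oplus>\<^bsub>Q\<^esub> w) = a \<odot>\<^bsub>Q\<^esub> v \<oplus>\<^bsub>Q\<^esub> a \<odot>\<^bsub>Q\<^esub> w"
  proof (intro allI impI)
    fix a v w assume *: "a \<in> carrier R \<and> v \<in> carrier Q \<and> w \<in> carrier Q"
    then obtain x y where "x \<in> carrier M" "v = proj x" "y \<in> carrier M" "w = proj y" using proj_surj by blast
    with * show "a \<odot>\<^bsub>Q\<^esub> (v \<oplus>\<^bsub>Q\<^esub> w) = a \<odot>\<^bsub>Q\<^esub> v \<oplus>\<^bsub>Q\<^esub> a \<odot>\<^bsub>Q\<^esub> w"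
      by (simp add: proj_smult proj_add M.smult_r_distr)
  qed
qed

end

section \<open>Kaehler differentials\<close>

text \<open>The generating set inside \<open>kaehler_rel\<close>, named so that statements about the
  span can be checked on it.\<close>

definition kaehler_gens :: "('r, 'x) ring_scheme \<Rightarrow> 'r set \<Rightarrow> ('r \<Rightarrow> 'r) set" where
  "kaehler_gens R k = (let F = free_module R (carrier R); e = free_gen R in
      {e (a \<oplus>\<^bsub>R\<^esub> b) \<ominus>\<^bsub>F\<^esub> (e a \<oplus>\<^bsub>F\<^esub> e b) | a b. a \<in> carrier R \<and> b \<in> carrier R} \<union>
       {e (a \<otimes>\<^bsub>R\<^esub> b) \<ominus>\<^bsub>F\<^esub> (a \<odot>\<^bsub>F\<^esub> e b \<oplus>\<^bsub>F\<^esub> b \<odot>\<^bsub>F\<^esub> e a) | a b. a \<in> carrier R \<and> b \<in> carrier R} \<union>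
       {e c | c. c \<in> k})"

locale kaehler_module = R: cring R for R :: "('r, 'x) ring_scheme" +
  fixes k :: "'r set"
  assumes k: "k \<subseteq> carrier R"
begin

abbreviation F where "F \<equiv> free_module R (carrier R)"
abbreviation e where "e \<equiv> free_gen R"

sublocale F: module R F by (rule free_module_module[OF R.cring_axioms])

lemma e_closed: "a \<in> carrier R \<Longrightarrow> e a \<in> carrier F"
  by (rule free_gen_closed[OF R.cring_axioms])

lemma rel_span: "kaehler_rel R k = F.span (kaehler_gens R k)"
  by (simp add: kaehler_rel_def kaehler_gens_def Let_def)

lemma gens_subset: "kaehler_gens R k \<subseteq> carrier F"
  using k by (auto simp: kaehler_gens_def Let_def intro!: F.minus_closed F.a_closed F.smult_closed e_closed)

lemma rel_submodule: "submodule R (kaehler_rel R k) F"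
  unfolding rel_span by (rule F.span_is_submodule[OF gens_subset])

lemma gens_rel: "g \<in> kaehler_gens R k \<Longrightarrow> g \<in> kaehler_rel R k"
  unfolding rel_span using F.in_own_span[OF gens_subset] by blast

sublocale q: quotient_mod R F "kaehler_rel R k"
  by (rule quotient_mod.intro[OF F.module_axioms rel_submodule])

abbreviation \<Omega> where "\<Omega> \<equiv> kaehler R k"

lemma \<Omega>_def: "\<Omega> = q.Q"
  by (simp add: kaehler_def)

lemma \<Omega>_module: "module R \<Omega>"
  unfolding \<Omega>_def by (rule q.Q_module)

abbreviation d where "d \<equiv> kaehler_d R k"

lemma d_proj: "d a = q.proj (e a)"
  by (simp add: kaehler_d_def q.proj_def)

lemma d_closed: "a \<in> carrier R \<Longrightarrow> d a \<in> carrier \<Omega>"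
  unfolding d_proj \<Omega>_def by (intro q.proj_closed e_closed)

lemma d_add: "a \<in> carrier R \<Longrightarrow> b \<in> carrier R \<Longrightarrow> d (a \<oplus>\<^bsub>R\<^esub> b) = d a \<oplus>\<^bsub>\<Omega>\<^esub> d b"
proof -
  assume a: "a \<in> carrier R" "b \<in> carrier R"
  have "e (a \<oplus>\<^bsub>R\<^esub> b) \<ominus>\<^bsub>F\<^esub> (e a \<oplus>\<^bsub>F\<^esub> e b) \<in> kaehler_gens R k"
    using a unfolding kaehler_gens_def Let_def by blast
  from q.proj_eq_if_minus[OF _ _ gens_rel[OF this]] a
  show ?thesis unfolding d_proj \<Omega>_def by (simp add: e_closed q.proj_add)
qed

lemma d_mult: "a \<in> carrier R \<Longrightarrow> b \<in> carrier R \<Longrightarrow>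
  d (a \<otimes>\<^bsub>R\<^esub> b) = a \<odot>\<^bsub>\<Omega>\<^esub> d b \<oplus>\<^bsub>\<Omega>\<^esub> b \<odot>\<^bsub>\<Omega>\<^esub> d a"
proof -
  assume a: "a \<in> carrier R" "b \<in> carrier R"
  have "e (a \<otimes>\<^bsub>R\<^esub> b) \<ominus>\<^bsub>F\<^esub> (a \<odot>\<^bsub>F\<^esub> e b \<oplus>\<^bsub>F\<^esub> b \<odot>\<^bsub>F\<^esub> e a) \<in> kaehler_gens R k"
    using a unfolding kaehler_gens_def Let_def by blast
  from q.proj_eq_if_minus[OF _ _ gens_rel[OF this]] a
  show ?thesis unfolding d_proj \<Omega>_def by (simp add: e_closed q.proj_add q.proj_smult)
qed

lemma d_const: "c \<in> k \<Longrightarrow> d c = \<zero>\<^bsub>\<Omega>\<^esub>"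
proof -
  assume c: "c \<in> k"
  then have "e c \<in> kaehler_gens R k" unfolding kaehler_gens_def Let_def by blast
  then show ?thesis unfolding d_proj \<Omega>_def using q.proj_zero_iff[OF e_closed] gens_rel c k by blast
qed

end

section \<open>Third exterior powers\<close>

definition ext_gens ::
  "('r, 'x) ring_scheme \<Rightarrow> nat \<Rightarrow> ('r, 'm, 'y) module_scheme \<Rightarrow> ('m list \<Rightarrow> 'r) set" where
  "ext_gens R p M = (let T = tuples p (carrier M); F = free_module R T; e = free_gen R in
      {e (xs[j := x \<oplus>\<^bsub>M\<^esub> y]) \<ominus>\<^bsub>F\<^esub> (e (xs[j := x]) \<oplus>\<^bsub>F\<^esub> e (xs[j := y])) | xs j x y.
          xs \<in> T \<and> j < p \<and> x \<in> carrier M \<and> y \<in> carrier M} \<union>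
       {e (xs[j := r \<odot>\<^bsub>M\<^esub> x]) \<ominus>\<^bsub>F\<^esub> r \<odot>\<^bsub>F\<^esub> e (xs[j := x]) | xs j r x.
          xs \<in> T \<and> j < p \<and> r \<in> carrier R \<and> x \<in> carrier M} \<union>
       {e xs | xs. xs \<in> T \<and> (\<exists>i j. i < j \<and> j < p \<and> xs ! i = xs ! j)})"

locale exterior_power3 = M: module R M for R :: "('r, 'x) ring_scheme" and M :: "('r, 'm, 'y) module_scheme"
begin

abbreviation T where "T \<equiv> tuples 3 (carrier M)"
abbreviation F where "F \<equiv> free_module R T"
abbreviation e where "e \<equiv> free_gen R"

sublocale F: module R F by (rule free_module_module[OF M.R.cring_axioms])

lemma e_closed: "xs \<in> T \<Longrightarrow> e xs \<in> carrier F"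
  by (rule free_gen_closed[OF M.R.cring_axioms])

lemma T_update: "xs \<in> T \<Longrightarrow> x \<in> carrier M \<Longrightarrow> xs[j := x] \<in> T"
  unfolding tuples_def using set_update_subset_insert[of xs j x] by auto

lemma T_triple: "[x, y, z] \<in> T \<longleftrightarrow> x \<in> carrier M \<and> y \<in> carrier M \<and> z \<in> carrier M"
  by (simp add: tuples_def)

lemma rel_span: "ext_rel R 3 M = F.span (ext_gens R 3 M)"
  by (simp add: ext_rel_def ext_gens_def Let_def)

lemma gens_subset: "ext_gens R 3 M \<subseteq> carrier F"
  by (auto simp: ext_gens_def Let_def
      intro!: F.minus_closed F.a_closed F.smult_closed e_closed T_update M.a_closed M.smult_closed)

lemma rel_submodule: "submodule R (ext_rel R 3 M) F"
  unfolding rel_span by (rule F.span_is_submodule[OF gens_subset])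

lemma gens_rel: "g \<in> ext_gens R 3 M \<Longrightarrow> g \<in> ext_rel R 3 M"
  unfolding rel_span using F.in_own_span[OF gens_subset] by blast

sublocale q: quotient_mod R F "ext_rel R 3 M"
  by (rule quotient_mod.intro[OF F.module_axioms rel_submodule])

abbreviation E where "E \<equiv> ext_power R 3 M"

lemma E_def: "E = q.Q"
  by (simp add: ext_power_def)

lemma E_module: "module R E"
  unfolding E_def by (rule q.Q_module)

abbreviation w where "w x y z \<equiv> wedge R M [x, y, z]"

lemma w_proj: "w x y z = q.proj (e [x, y, z])"
proof -
  have "length [x, y, z] = 3" by simp
  then show ?thesis unfolding wedge_def q.proj_def by (simp only:)
qed

lemma w_closed: "x \<in> carrier M \<Longrightarrow> y \<in> carrier M \<Longrightarrow> z \<in> carrier M \<Longrightarrow> w x y z \<in> carrier E"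
  unfolding w_proj E_def by (intro q.proj_closed e_closed) (simp add: T_triple)

lemma add_gen: "xs \<in> T \<Longrightarrow> j < 3 \<Longrightarrow> x \<in> carrier M \<Longrightarrow> y \<in> carrier M \<Longrightarrow>
    q.proj (e (xs[j := x \<oplus>\<^bsub>M\<^esub> y])) = q.proj (e (xs[j := x])) \<oplus>\<^bsub>E\<^esub> q.proj (e (xs[j := y]))"
proof -
  assume a: "xs \<in> T" "j < 3" "x \<in> carrier M" "y \<in> carrier M"
  then have "e (xs[j := x \<oplus>\<^bsub>M\<^esub> y]) \<ominus>\<^bsub>F\<^esub> (e (xs[j := x]) \<oplus>\<^bsub>F\<^esub> e (xs[j := y])) \<in> ext_gens R 3 M"
    unfolding ext_gens_def Let_def by blast
  from q.proj_eq_if_minus[OF _ _ gens_rel[OF this]] a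
  show ?thesis unfolding E_def by (simp add: e_closed T_update q.proj_add)
qed

lemma smult_gen: "xs \<in> T \<Longrightarrow> j < 3 \<Longrightarrow> r \<in> carrier R \<Longrightarrow> x \<in> carrier M \<Longrightarrow>
    q.proj (e (xs[j := r \<odot>\<^bsub>M\<^esub> x])) = r \<odot>\<^bsub>E\<^esub> q.proj (e (xs[j := x]))"
proof -
  assume a: "xs \<in> T" "j < 3" "r \<in> carrier R" "x \<in> carrier M"
  then have "e (xs[j := r \<odot>\<^bsub>M\<^esub> x]) \<ominus>\<^bsub>F\<^esub> r \<odot>\<^bsub>F\<^esub> e (xs[j := x]) \<in> ext_gens R 3 M"
    unfolding ext_gens_def Let_def by blast
  from q.proj_eq_if_minus[OF _ _ gens_rel[OF this]] a
  show ?thesis unfolding E_def by (simp add: e_closed T_update q.proj_smult)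
qed

lemma alt_gen: "xs \<in> T \<Longrightarrow> i < j \<Longrightarrow> j < 3 \<Longrightarrow> xs ! i = xs ! j \<Longrightarrow> q.proj (e xs) = \<zero>\<^bsub>E\<^esub>"
proof -
  assume a: "xs \<in> T" "i < j" "j < 3" "xs ! i = xs ! j"
  then have "e xs \<in> ext_gens R 3 M" unfolding ext_gens_def Let_def by blast
  then show ?thesis unfolding E_def using q.proj_zero_iff[OF e_closed] gens_rel a(1) by blast
qed

context
  fixes x y z assumes xyz: "x \<in> carrier M" "y \<in> carrier M" "z \<in> carrier M"
begin

lemma w_add:
  assumes u: "u \<in> carrier M"
  shows "w (x \<oplus>\<^bsub>M\<^esub> u) y z = w x y z \<oplus>\<^bsub>E\<^esub> w u y z"
    and "w x (y \<oplus>\<^bsub>M\<^esub> u) z = w x y z \<oplus>\<^bsub>E\<^esub> w x u z"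
    and "w x y (z \<oplus>\<^bsub>M\<^esub> u) = w x y z \<oplus>\<^bsub>E\<^esub> w x y u"
  using add_gen[of "[x, y, z]" 0 x u] add_gen[of "[x, y, z]" 1 y u] add_gen[of "[x, y, z]" 2 z u] xyz u
  by (simp_all add: T_triple w_proj numeral_2_eq_2)

lemma w_smult:
  assumes r: "r \<in> carrier R"
  shows "w (r \<odot>\<^bsub>M\<^esub> x) y z = r \<odot>\<^bsub>E\<^esub> w x y z"
    and "w x (r \<odot>\<^bsub>M\<^esub> y) z = r \<odot>\<^bsub>E\<^esub> w x y z"
    and "w x y (r \<odot>\<^bsub>M\<^esub> z) = r \<odot>\<^bsub>E\<^esub> w x y z"
  using smult_gen[of "[x, y, z]" 0 r x] smult_gen[of "[x, y, z]" 1 r y] smult_gen[of "[x, y, z]" 2 r z] xyz r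
  by (simp_all add: T_triple w_proj numeral_2_eq_2)

lemma w_alt:
  shows "w x x z = \<zero>\<^bsub>E\<^esub>" "w x y x = \<zero>\<^bsub>E\<^esub>" "w x y y = \<zero>\<^bsub>E\<^esub>"
  using alt_gen[of "[x, x, z]" 0 1] alt_gen[of "[x, y, x]" 0 2] alt_gen[of "[x, y, y]" 1 2] xyz
  by (simp_all add: T_triple w_proj numeral_2_eq_2)

end

context
  fixes x y z assumes xyz: "x \<in> carrier M" "y \<in> carrier M" "z \<in> carrier M"
begin

interpretation E: module R E by (rule E_module)

text \<open>Expand the vanishing product that has the sum of \<open>x\<close> and \<open>y\<close>
  in both places.\<close>

lemma w_swap12: "w y x z = \<ominus>\<^bsub>E\<^esub> w x y z"
proof -
  have "\<zero>\<^bsub>E\<^esub> = w (x \<oplus>\<^bsub>M\<^esub> y) (x \<oplus>\<^bsub>M\<^esub> y) z" using xyz by (simp add: w_alt)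
  also have "\<dots> = w x (x \<oplus>\<^bsub>M\<^esub> y) z \<oplus>\<^bsub>E\<^esub> w y (x \<oplus>\<^bsub>M\<^esub> y) z"
    by (rule w_add(1)) (use xyz in simp_all)
  also have "w x (x \<oplus>\<^bsub>M\<^esub> y) z = w x y z" using xyz by (simp add: w_add w_alt w_closed)
  also have "w y (x \<oplus>\<^bsub>M\<^esub> y) z = w y x z" using xyz by (simp add: w_add w_alt w_closed)
  finally show ?thesis using xyz by (metis E.minus_equality E.a_comm w_closed)
qed

lemma w_swap23: "w x z y = \<ominus>\<^bsub>E\<^esub> w x y z"
proof -
  have "\<zero>\<^bsub>E\<^esub> = w x (y \<oplus>\<^bsub>M\<^esub> z) (y \<oplus>\<^bsub>M\<^esub> z)" using xyz by (simp add: w_alt)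
  also have "\<dots> = w x y (y \<oplus>\<^bsub>M\<^esub> z) \<oplus>\<^bsub>E\<^esub> w x z (y \<oplus>\<^bsub>M\<^esub> z)"
    by (rule w_add(2)) (use xyz in simp_all)
  also have "w x y (y \<oplus>\<^bsub>M\<^esub> z) = w x y z" using xyz by (simp add: w_add w_alt w_closed)
  also have "w x z (y \<oplus>\<^bsub>M\<^esub> z) = w x z y" using xyz by (simp add: w_add w_alt w_closed)
  finally show ?thesis using xyz by (metis E.minus_equality E.a_comm w_closed)
qed

end

end

section \<open>The top exterior power of the differentials of a coordinate ring\<close>

definition det3 :: "(3 \<Rightarrow> 'a::comm_ring_1) \<Rightarrow> (3 \<Rightarrow> 'a) \<Rightarrow> (3 \<Rightarrow> 'a) \<Rightarrow> 'a" where
  "det3 a b c = a 0 * (b 1 * c 2 - b 2 * c 1) - a 1 * (b 0 * c 2 - b 2 * c 0) + a 2 * (b 0 * c 1 - b 1 * c 0)"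

lemma det3_scalar_identities:
  fixes a0 a1 a2 a0' a1' a2' b0 b1 b2 c0 c1 c2 r :: "'a::comm_ring_1"
  shows "(a0 + a0') * (b1 * c2 - b2 * c1) - (a1 + a1') * (b0 * c2 - b2 * c0) + (a2 + a2') * (b0 * c1 - b1 * c0)
      = (a0 * (b1 * c2 - b2 * c1) - a1 * (b0 * c2 - b2 * c0) + a2 * (b0 * c1 - b1 * c0))
      + (a0' * (b1 * c2 - b2 * c1) - a1' * (b0 * c2 - b2 * c0) + a2' * (b0 * c1 - b1 * c0))"
    and "b0 * ((a1 + a1') * c2 - (a2 + a2') * c1) - b1 * ((a0 + a0') * c2 - (a2 + a2') * c0) + b2 * ((a0 + a0') * c1 - (a1 + a1') * c0)
      = (b0 * (a1 * c2 - a2 * c1) - b1 * (a0 * c2 - a2 * c0) + b2 * (a0 * c1 - a1 * c0))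
      + (b0 * (a1' * c2 - a2' * c1) - b1 * (a0' * c2 - a2' * c0) + b2 * (a0' * c1 - a1' * c0))"
    and "b0 * (c1 * (a2 + a2') - c2 * (a1 + a1')) - b1 * (c0 * (a2 + a2') - c2 * (a0 + a0')) + b2 * (c0 * (a1 + a1') - c1 * (a0 + a0'))
      = (b0 * (c1 * a2 - c2 * a1) - b1 * (c0 * a2 - c2 * a0) + b2 * (c0 * a1 - c1 * a0))
      + (b0 * (c1 * a2' - c2 * a1') - b1 * (c0 * a2' - c2 * a0') + b2 * (c0 * a1' - c1 * a0'))"
    and "r * a0 * (b1 * c2 - b2 * c1) - r * a1 * (b0 * c2 - b2 * c0) + r * a2 * (b0 * c1 - b1 * c0)
      = r * (a0 * (b1 * c2 - b2 * c1) - a1 * (b0 * c2 - b2 * c0) + a2 * (b0 * c1 - b1 * c0))"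
    and "b0 * (r * a1 * c2 - r * a2 * c1) - b1 * (r * a0 * c2 - r * a2 * c0) + b2 * (r * a0 * c1 - r * a1 * c0)
      = r * (b0 * (a1 * c2 - a2 * c1) - b1 * (a0 * c2 - a2 * c0) + b2 * (a0 * c1 - a1 * c0))"
    and "b0 * (c1 * (r * a2) - c2 * (r * a1)) - b1 * (c0 * (r * a2) - c2 * (r * a0)) + b2 * (c0 * (r * a1) - c1 * (r * a0))
      = r * (b0 * (c1 * a2 - c2 * a1) - b1 * (c0 * a2 - c2 * a0) + b2 * (c0 * a1 - c1 * a0))"
    and "a0 * (a1 * c2 - a2 * c1) - a1 * (a0 * c2 - a2 * c0) + a2 * (a0 * c1 - a1 * c0) = 0"
    and "a0 * (b1 * a2 - b2 * a1) - a1 * (b0 * a2 - b2 * a0) + a2 * (b0 * a1 - b1 * a0) = 0"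
    and "b0 * (a1 * a2 - a2 * a1) - b1 * (a0 * a2 - a2 * a0) + b2 * (a0 * a1 - a1 * a0) = 0"
  by (simp_all add: algebra_simps)

lemma det3_add:
  "det3 (\<lambda>j. a j + a' j) b c = det3 a b c + det3 a' b c"
  "det3 b (\<lambda>j. a j + a' j) c = det3 b a c + det3 b a' c"
  "det3 b c (\<lambda>j. a j + a' j) = det3 b c a + det3 b c a'"
  unfolding det3_def by (rule det3_scalar_identities)+

lemma det3_smult:
  "det3 (\<lambda>j. r * a j) b c = r * det3 a b c"
  "det3 b (\<lambda>j. r * a j) c = r * det3 b a c"
  "det3 b c (\<lambda>j. r * a j) = r * det3 b c a"
  unfolding det3_def by (rule det3_scalar_identities)+

lemma det3_alt: "det3 a a c = 0" "det3 a b a = 0" "det3 b a a = 0"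
  unfolding det3_def by (rule det3_scalar_identities)+

lemma diff_diff_swap: "(a - b) - (c - d) = (a - c) - (b - d)" for a b c d :: "'a::ab_group_add"
  by (simp add: algebra_simps)

locale coordinate_ring =
  fixes I :: "'k::field_char_0 poly3 set"
  assumes I: "ideal I (poly_ring3 :: 'k poly3 ring)" and hom_I: "homogeneous I"
begin

abbreviation S where "S \<equiv> (poly_ring3 :: 'k poly3 ring)"
abbreviation R where "R \<equiv> coord_ring I"
abbreviation res where "res \<equiv> residue3 I"

lemma cring_S: "cring S"
  by (rule class_cring.cring_axioms)

lemma cring_R: "cring R"
  unfolding coord_ring_def by (rule ideal.quotient_is_cring[OF I cring_S])

sublocale R: cring R by (rule cring_R)

lemma res_ring_hom: "res \<in> Ring.ring_hom S R"
  using ideal.rcos_ring_hom[OF I] unfolding coord_ring_def residue3_def by simp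

lemma res_closed [simp]: "res f \<in> carrier R"
  using ring_hom_closed[OF res_ring_hom, of f] by simp

lemma res_add: "res (f + g) = res f \<oplus>\<^bsub>R\<^esub> res g"
  using ring_hom_add[OF res_ring_hom, of f g] by simp

lemma res_mult: "res (f * g) = res f \<otimes>\<^bsub>R\<^esub> res g"
  using ring_hom_mult[OF res_ring_hom, of f g] by simp

lemma res_1: "res 1 = \<one>\<^bsub>R\<^esub>"
  using ring_hom_one[OF res_ring_hom] by simp

lemma res_surj: "a \<in> carrier R \<Longrightarrow> \<exists>f. a = res f"
  by (auto simp: coord_ring_def FactRing_def A_RCOSETS_def' residue3_def)

lemma abelian_subgroup_I: "abelian_subgroup I S"
  by (rule abelian_subgroupI3[OF ideal.axioms(1)[OF I]]) (rule ring.axioms(1)[OF class_is_ring])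

lemma res_self: "f \<in> res f"
  unfolding residue3_def by (rule abelian_subgroup.a_rcos_self[OF abelian_subgroup_I]) simp

lemma res_mem: "g \<in> res f \<longleftrightarrow> g - f \<in> I"
proof -
  have "g \<in> res f \<longleftrightarrow> g \<ominus>\<^bsub>S\<^esub> f \<in> I"
    unfolding residue3_def by (rule abelian_subgroup.a_rcos_module_minus[OF abelian_subgroup_I class_is_ring]) simp_all
  then show ?thesis by (simp only: class_ring_simps)
qed

lemma res_eq_iff: "res f = res g \<longleftrightarrow> f - g \<in> I"
proof
  assume "res f = res g"
  then show "f - g \<in> I" using res_self[of f] res_mem by blast
next
  assume "f - g \<in> I"
  then have "f \<in> res g" using res_mem by blast
  then show "res f = res g"
    unfolding residue3_def
    by (intro abelian_group.a_repr_independence[symmetric, OF ring.axioms(1)[OF class_is_ring]]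
        additive_subgroup.a_subgroup[OF ideal.axioms(1)[OF I]]) simp_all
qed

lemma res_0: "res 0 = \<zero>\<^bsub>R\<^esub>"
proof -
  have "res 0 \<oplus>\<^bsub>R\<^esub> res 0 = res 0 \<oplus>\<^bsub>R\<^esub> \<zero>\<^bsub>R\<^esub>" using res_add[of 0 0] by simp
  then show ?thesis by simp
qed

lemma res_0_iff: "res f = \<zero>\<^bsub>R\<^esub> \<longleftrightarrow> f \<in> I"
  unfolding res_0[symmetric] res_eq_iff by simp

section \<open>The quotient by J through representatives and congruences\<close>

definition rep :: "'k poly3 set \<Rightarrow> 'k poly3" where
  "rep a = (SOME f. res f = a)"

lemma res_rep: "a \<in> carrier R \<Longrightarrow> res (rep a) = a"
  unfolding rep_def by (rule someI_ex) (metis res_surj)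

definition J :: "'k poly3 set" where
  "J = Idl\<^bsub>S\<^esub> {pderiv3 j f | j f. f \<in> I}"

lemma J_ideal: "ideal J S"
  unfolding J_def by (rule class_genideal)

lemma pderiv_J: "f \<in> I \<Longrightarrow> pderiv3 j f \<in> J"
  unfolding J_def by (rule class_genideal_self) blast

text \<open>The divergence of f times the vector (X_0, X_1, X_2) is (d + 3) f. Since an ideal
  contains X_j f together with f, it follows that \<open>I\<close> lies in \<open>J\<close>, and
  that each form in \<open>I\<close> is a sum of derivatives of members of \<open>I\<close>.\<close>

lemma form_as_derivatives:
  fixes f :: "'k poly3"
  assumes "f \<in> forms d" "0 \<le> d"
  shows "f = (\<Sum>j\<in>UNIV. pderiv3 j (const3 (1 / of_int (d + 3)) * (var3 j * f)))"
proof -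
  have "pderiv3 j (var3 j * f) = f + var3 j * pderiv3 j f" for j
    unfolding pderiv3_mult pderiv3_var by (simp only: if_True refl mult_1_left)
  then have "(\<Sum>j\<in>UNIV. pderiv3 j (var3 j * f)) = (\<Sum>j\<in>(UNIV::3 set). f) + const3 (of_int d) * f"
    by (simp only: sum.distrib euler_formula[OF assms(1)])
  also have "(\<Sum>j\<in>(UNIV::3 set). f) = const3 3 * f"
    unfolding sum_UNIV_three const3_numeral by (simp add: mult.commute)
  also have "const3 3 * f + const3 (of_int d) * f = const3 (of_int (d + 3)) * f"
    unfolding distrib_right[symmetric] const3_add[symmetric] by (simp add: add.commute)
  finally have e: "(\<Sum>j\<in>UNIV. pderiv3 j (var3 j * f)) = const3 (of_int (d + 3)) * f" .
  have "of_int (d + 3) \<noteq> (0 :: 'k)" using assms(2) by (simp only: of_int_eq_0_iff)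
  then have "const3 (1 / of_int (d + 3)) * (const3 (of_int (d + 3)) * f) = f"
    unfolding mult.assoc[symmetric] const3_mult[symmetric] by simp
  then show ?thesis unfolding pderiv3_const_mult sum_distrib_left[symmetric] e by (rule sym)
qed

lemma I_subset_J: "f \<in> I \<Longrightarrow> f \<in> J"
proof -
  assume f: "f \<in> I"
  obtain D where D: "finite D" "f = (\<Sum>d\<in>D. hcomp d f)" by (rule hcomp_expand)
  have "hcomp d f \<in> J" for d
  proof (cases "0 \<le> d")
    case True
    have h: "hcomp d f \<in> I" using hom_I f unfolding homogeneous_def by blast
    show ?thesis
      by (subst form_as_derivatives[OF hcomp_forms True])
        (intro class_ideal_sum[OF J_ideal] pderiv_J class_ideal_mult[OF I] h)
  next
    case False
    then have "d < 0" by (simp only: not_le)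
    then have "hcomp d f = 0" using hcomp_forms[of d f] forms_neg by blast
    then show ?thesis using class_ideal_0[OF J_ideal] by (simp only:)
  qed
  then show "f \<in> J" by (subst D(2)) (rule class_ideal_sum[OF J_ideal])
qed

text \<open>Values in S/J are handled as polynomials up to this relation, so that the
  representatives chosen by \<open>rep\<close> can be computed with directly.\<close>

definition cong :: "'k poly3 \<Rightarrow> 'k poly3 \<Rightarrow> bool" (infix \<open>\<approx>\<close> 50) where
  "f \<approx> g \<longleftrightarrow> f - g \<in> J"

lemma cong_refl [simp]: "f \<approx> f"
  by (simp add: cong_def class_ideal_0[OF J_ideal])

lemma cong_sym: "f \<approx> g \<Longrightarrow> g \<approx> f"
  using class_ideal_uminus[OF J_ideal, of "f - g"] unfolding cong_def minus_diff_eq .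

lemma cong_trans [trans]: "f \<approx> g \<Longrightarrow> g \<approx> h \<Longrightarrow> f \<approx> h"
  using class_ideal_add[OF J_ideal, of "f - g" "g - h"] unfolding cong_def by simp

lemma cong_add: "f \<approx> g \<Longrightarrow> f' \<approx> g' \<Longrightarrow> f + f' \<approx> g + g'"
  using class_ideal_add[OF J_ideal, of "f - g" "f' - g'"] unfolding cong_def add_diff_add .

lemma cong_diff: "f \<approx> g \<Longrightarrow> f' \<approx> g' \<Longrightarrow> f - f' \<approx> g - g'"
  using class_ideal_diff[OF J_ideal, of "f - g" "f' - g'"] unfolding cong_def diff_diff_swap .

lemma cong_mult: "f \<approx> g \<Longrightarrow> f' \<approx> g' \<Longrightarrow> f * f' \<approx> g * g'"
proof -
  assume "f \<approx> g" "f' \<approx> g'"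
  then have "f * (f' - g') + (f - g) * g' \<in> J"
    unfolding cong_def by (intro class_ideal_add[OF J_ideal] class_ideal_mult[OF J_ideal] class_ideal_mult_right[OF J_ideal])
  moreover have "f * (f' - g') + (f - g) * g' = f * f' - g * g'"
    by (simp only: right_diff_distrib left_diff_distrib add_diff_eq diff_add_cancel)
  ultimately show ?thesis unfolding cong_def by (simp only:)
qed

lemma cong_sum: "(\<And>x. x \<in> A \<Longrightarrow> u x \<approx> v x) \<Longrightarrow> sum u A \<approx> sum v A"
  by (induction A rule: infinite_finite_induct) (auto intro: cong_add)

lemma cong_J: "f \<approx> g \<Longrightarrow> g \<in> J \<Longrightarrow> f \<in> J"
  using class_ideal_add[OF J_ideal, of "f - g" g] unfolding cong_def by simp

lemma cong_0: "f \<in> J \<Longrightarrow> f \<approx> 0"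
  by (simp add: cong_def)

lemma res_cong: "res f = res g \<Longrightarrow> f \<approx> g"
  unfolding res_eq_iff cong_def by (rule I_subset_J)

lemma res_pderiv_cong: "res f = res g \<Longrightarrow> pderiv3 j f \<approx> pderiv3 j g"
  using pderiv_J[of "f - g" j] unfolding res_eq_iff cong_def pderiv3_diff .

lemma rep_cong: "rep (res f) \<approx> f"
  by (rule res_cong) (simp add: res_rep)

lemma rep_add: "a \<in> carrier R \<Longrightarrow> b \<in> carrier R \<Longrightarrow> res (rep (a \<oplus>\<^bsub>R\<^esub> b)) = res (rep a + rep b)"
  by (simp add: res_rep res_add)

lemma rep_mult: "a \<in> carrier R \<Longrightarrow> b \<in> carrier R \<Longrightarrow> res (rep (a \<otimes>\<^bsub>R\<^esub> b)) = res (rep a * rep b)"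
  by (simp add: res_rep res_mult)

lemma rep_0: "rep \<zero>\<^bsub>R\<^esub> \<approx> 0"
  using rep_cong[of 0] by (simp add: res_0)

lemma rep_1: "rep \<one>\<^bsub>R\<^esub> \<approx> 1"
  using rep_cong[of 1] by (simp add: res_1)

text \<open>The \<open>R\<close>-linear map to \<open>S/J\<close> with prescribed values on a basis, on representatives.\<close>

definition \<Psi> :: "('b \<Rightarrow> 'k poly3) \<Rightarrow> ('b \<Rightarrow> 'k poly3 set) \<Rightarrow> 'k poly3" where
  "\<Psi> wt h = (\<Sum>b\<in>{b. h b \<noteq> \<zero>\<^bsub>R\<^esub>}. rep (h b) * wt b)"

lemma \<Psi>_superset:
  assumes "finite A" "{b. h b \<noteq> \<zero>\<^bsub>R\<^esub>} \<subseteq> A"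
  shows "\<Psi> wt h \<approx> (\<Sum>b\<in>A. rep (h b) * wt b)"
proof -
  have "(\<Sum>b\<in>A. rep (h b) * wt b) = (\<Sum>b\<in>{b. h b \<noteq> \<zero>\<^bsub>R\<^esub>}. rep (h b) * wt b) + (\<Sum>b\<in>A - {b. h b \<noteq> \<zero>\<^bsub>R\<^esub>}. rep (h b) * wt b)"
    using sum.subset_diff[OF assms(2,1), of "\<lambda>b. rep (h b) * wt b"] by (simp only: add.commute)
  moreover have "(\<Sum>b\<in>A - {b. h b \<noteq> \<zero>\<^bsub>R\<^esub>}. rep (h b) * wt b) \<approx> (\<Sum>b\<in>A - {b. h b \<noteq> \<zero>\<^bsub>R\<^esub>}. 0)"
  proof (rule cong_sum)
    fix b assume "b \<in> A - {b. h b \<noteq> \<zero>\<^bsub>R\<^esub>}"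
    then have "rep (h b) \<approx> 0" using rep_0 by simp
    from cong_mult[OF this cong_refl, of "wt b"] show "rep (h b) * wt b \<approx> 0" by simp
  qed
  ultimately have "(\<Sum>b\<in>A. rep (h b) * wt b) \<approx> \<Psi> wt h + 0"
    unfolding \<Psi>_def by (simp only: sum.neutral_const) (intro cong_add cong_refl)
  then show ?thesis using cong_sym by simp
qed

context
  fixes B :: "'b set" and wt :: "'b \<Rightarrow> 'k poly3"
begin

abbreviation (input) FB where "FB \<equiv> free_module R B"

interpretation FB: module R FB by (rule free_module_module[OF cring_R])

lemma FB_fin: "h \<in> carrier FB \<Longrightarrow> finite {b. h b \<noteq> \<zero>\<^bsub>R\<^esub>}"
  and FB_closed: "h \<in> carrier FB \<Longrightarrow> h b \<in> carrier R"
  by (simp_all add: free_module_def)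

lemma \<Psi>_add:
  assumes "g \<in> carrier FB" "h \<in> carrier FB"
  shows "\<Psi> wt (g \<oplus>\<^bsub>FB\<^esub> h) \<approx> \<Psi> wt g + \<Psi> wt h"
proof -
  let ?A = "{b. g b \<noteq> \<zero>\<^bsub>R\<^esub>} \<union> {b. h b \<noteq> \<zero>\<^bsub>R\<^esub>}"
  have A: "finite ?A" using FB_fin assms by blast
  have gh: "(g \<oplus>\<^bsub>FB\<^esub> h) b = g b \<oplus>\<^bsub>R\<^esub> h b" for b by (simp add: free_module_def)
  have "{b. (g \<oplus>\<^bsub>FB\<^esub> h) b \<noteq> \<zero>\<^bsub>R\<^esub>} \<subseteq> ?A" unfolding gh by auto
  from \<Psi>_superset[OF A this]
  have "\<Psi> wt (g \<oplus>\<^bsub>FB\<^esub> h) \<approx> (\<Sum>b\<in>?A. rep (g b \<oplus>\<^bsub>R\<^esub> h b) * wt b)" unfolding gh .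
  moreover have "(\<Sum>b\<in>?A. rep (g b \<oplus>\<^bsub>R\<^esub> h b) * wt b) \<approx> (\<Sum>b\<in>?A. (rep (g b) + rep (h b)) * wt b)"
    by (intro cong_sum cong_mult cong_refl res_cong rep_add FB_closed assms)
  moreover have "(\<Sum>b\<in>?A. (rep (g b) + rep (h b)) * wt b) = (\<Sum>b\<in>?A. rep (g b) * wt b) + (\<Sum>b\<in>?A. rep (h b) * wt b)"
    unfolding distrib_right sum.distrib ..
  moreover have "(\<Sum>b\<in>?A. rep (g b) * wt b) + (\<Sum>b\<in>?A. rep (h b) * wt b) \<approx> \<Psi> wt g + \<Psi> wt h"
    by (rule cong_add) (rule cong_sym[OF \<Psi>_superset[OF A]], blast)+
  ultimately show ?thesis by (simp only:) (blast intro: cong_trans)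
qed

lemma \<Psi>_smult:
  assumes "r \<in> carrier R" "h \<in> carrier FB"
  shows "\<Psi> wt (r \<odot>\<^bsub>FB\<^esub> h) \<approx> rep r * \<Psi> wt h"
proof -
  let ?A = "{b. h b \<noteq> \<zero>\<^bsub>R\<^esub>}"
  have A: "finite ?A" by (rule FB_fin[OF assms(2)])
  have rh: "(r \<odot>\<^bsub>FB\<^esub> h) b = r \<otimes>\<^bsub>R\<^esub> h b" for b by (simp add: free_module_def)
  have "r \<otimes>\<^bsub>R\<^esub> h b = \<zero>\<^bsub>R\<^esub>" if "h b = \<zero>\<^bsub>R\<^esub>" for b
    unfolding that by (rule R.r_null[OF assms(1)])
  then have "{b. (r \<odot>\<^bsub>FB\<^esub> h) b \<noteq> \<zero>\<^bsub>R\<^esub>} \<subseteq> ?A" unfolding rh by blast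
  from \<Psi>_superset[OF A this]
  have "\<Psi> wt (r \<odot>\<^bsub>FB\<^esub> h) \<approx> (\<Sum>b\<in>?A. rep (r \<otimes>\<^bsub>R\<^esub> h b) * wt b)" unfolding rh .
  also have "(\<Sum>b\<in>?A. rep (r \<otimes>\<^bsub>R\<^esub> h b) * wt b) \<approx> (\<Sum>b\<in>?A. (rep r * rep (h b)) * wt b)"
    by (rule cong_sum, rule cong_mult[OF res_cong[OF rep_mult[OF assms(1) FB_closed[OF assms(2)]]] cong_refl])
  also have "(\<Sum>b\<in>?A. (rep r * rep (h b)) * wt b) = rep r * \<Psi> wt h"
    unfolding \<Psi>_def sum_distrib_left mult.assoc by (rule refl)
  finally show ?thesis .
qed

lemma \<Psi>_gen: "\<Psi> wt (free_gen R b) \<approx> wt b"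
proof -
  have "{b'. free_gen R b b' \<noteq> \<zero>\<^bsub>R\<^esub>} \<subseteq> {b}" by (auto simp: free_gen_def)
  from \<Psi>_superset[OF _ this, of wt] have "\<Psi> wt (free_gen R b) \<approx> rep \<one>\<^bsub>R\<^esub> * wt b"
    by (simp add: free_gen_def)
  moreover have "rep \<one>\<^bsub>R\<^esub> * wt b \<approx> 1 * wt b" by (intro cong_mult rep_1 cong_refl)
  ultimately show ?thesis unfolding mult_1_left by (rule cong_trans)
qed

lemma \<Psi>_minus:
  assumes "g \<in> carrier FB" "h \<in> carrier FB"
  shows "\<Psi> wt (g \<ominus>\<^bsub>FB\<^esub> h) \<approx> \<Psi> wt g - \<Psi> wt h"
proof -
  have "(g \<ominus>\<^bsub>FB\<^esub> h) \<oplus>\<^bsub>FB\<^esub> h = g"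
    using assms by (simp add: FB.minus_eq FB.a_assoc FB.l_neg)
  then have "\<Psi> wt g \<approx> \<Psi> wt (g \<ominus>\<^bsub>FB\<^esub> h) + \<Psi> wt h"
    using \<Psi>_add[OF FB.minus_closed[OF assms] assms(2)] by simp
  from cong_diff[OF this cong_refl, of "\<Psi> wt h"] show ?thesis unfolding add_diff_cancel_right' by (rule cong_sym)
qed

text \<open>The elements of the free module that are sent into \<open>J\<close> form a submodule, so
  relations need to be checked on generators only.\<close>

lemma \<Psi>_span:
  assumes "A \<subseteq> carrier FB" "\<And>g. g \<in> A \<Longrightarrow> \<Psi> wt g \<in> J" "h \<in> FB.span A"
  shows "\<Psi> wt h \<in> J"
proof -
  let ?N = "{h \<in> carrier FB. \<Psi> wt h \<in> J}"
  have z: "\<Psi> wt \<zero>\<^bsub>FB\<^esub> = 0" by (simp add: \<Psi>_def free_module_def)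
  have "submodule R ?N FB"
  proof
    show "v \<oplus>\<^bsub>FB\<^esub> w \<in> ?N" if "v \<in> ?N" "w \<in> ?N" for v w
      using that cong_J[OF \<Psi>_add] class_ideal_add[OF J_ideal] by simp
    show "\<zero>\<^bsub>FB\<^esub> \<in> ?N" using z class_ideal_0[OF J_ideal] by simp
    show "c \<odot>\<^bsub>FB\<^esub> v \<in> ?N" if "c \<in> carrier R" "v \<in> ?N" for c v
      using that cong_J[OF \<Psi>_smult] class_ideal_mult[OF J_ideal] by simp
  qed auto
  then have "FB.span A \<subseteq> ?N" using assms(1,2) by (intro FB.span_is_subset) auto
  then show ?thesis using assms(3) by blast
qed

end

lemma k_subset: "range (scalar I) \<subseteq> carrier R"
  by (auto simp: scalar_def)

sublocale K: kaehler_module R "range (scalar I)"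
  by unfold_locales (rule k_subset)

definition pd :: "3 \<Rightarrow> 'k poly3 set \<Rightarrow> 'k poly3" where
  "pd j a = pderiv3 j (rep a)"

text \<open>The derivative of a representative is determined modulo \<open>J\<close>, because
  \<open>J\<close> contains the derivatives of \<open>I\<close>; additivity and Leibniz' rule then
  hold modulo \<open>J\<close>.\<close>

lemma kaehler_gens_J:
  assumes "g \<in> kaehler_gens R (range (scalar I))"
  shows "\<Psi> (pd j) g \<in> J"
proof -
  note e = K.e_closed
  have gen: "\<Psi> (pd j) (K.e a) \<approx> pderiv3 j (rep a)" for a
    using \<Psi>_gen[of "pd j" a] by (simp add: pd_def)
  consider (1) a b where "a \<in> carrier R" "b \<in> carrier R" "g = K.e (a \<oplus>\<^bsub>R\<^esub> b) \<ominus>\<^bsub>K.F\<^esub> (K.e a \<oplus>\<^bsub>K.F\<^esub> K.e b)"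
    | (2) a b where "a \<in> carrier R" "b \<in> carrier R"
        "g = K.e (a \<otimes>\<^bsub>R\<^esub> b) \<ominus>\<^bsub>K.F\<^esub> (a \<odot>\<^bsub>K.F\<^esub> K.e b \<oplus>\<^bsub>K.F\<^esub> b \<odot>\<^bsub>K.F\<^esub> K.e a)"
    | (3) c where "g = K.e (scalar I c)"
    using assms unfolding kaehler_gens_def Let_def by blast
  then show ?thesis
  proof cases
    case 1
    have "\<Psi> (pd j) g \<approx> \<Psi> (pd j) (K.e (a \<oplus>\<^bsub>R\<^esub> b)) - \<Psi> (pd j) (K.e a \<oplus>\<^bsub>K.F\<^esub> K.e b)"
      unfolding 1(3) by (rule \<Psi>_minus) (use 1 e in simp_all)
    also have "\<Psi> (pd j) (K.e (a \<oplus>\<^bsub>R\<^esub> b)) - \<Psi> (pd j) (K.e a \<oplus>\<^bsub>K.F\<^esub> K.e b)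
        \<approx> pderiv3 j (rep a + rep b) - (pderiv3 j (rep a) + pderiv3 j (rep b))"
    proof (rule cong_diff)
      show "\<Psi> (pd j) (K.e (a \<oplus>\<^bsub>R\<^esub> b)) \<approx> pderiv3 j (rep a + rep b)"
        by (rule cong_trans[OF gen res_pderiv_cong[OF rep_add]]) (use 1 in simp_all)
      show "\<Psi> (pd j) (K.e a \<oplus>\<^bsub>K.F\<^esub> K.e b) \<approx> pderiv3 j (rep a) + pderiv3 j (rep b)"
        by (rule cong_trans[OF \<Psi>_add cong_add[OF gen gen]]) (use 1 e in simp_all)
    qed
    finally have "\<Psi> (pd j) g \<approx> 0" unfolding pderiv3_add diff_self .
    then show ?thesis by (rule cong_J) (rule class_ideal_0[OF J_ideal])
  next
    case 2
    have "\<Psi> (pd j) g \<approx> \<Psi> (pd j) (K.e (a \<otimes>\<^bsub>R\<^esub> b)) - \<Psi> (pd j) (a \<odot>\<^bsub>K.F\<^esub> K.e b \<oplus>\<^bsub>K.F\<^esub> b \<odot>\<^bsub>K.F\<^esub> K.e a)"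
      unfolding 2(3) by (rule \<Psi>_minus) (use 2 e in simp_all)
    also have "\<Psi> (pd j) (K.e (a \<otimes>\<^bsub>R\<^esub> b)) - \<Psi> (pd j) (a \<odot>\<^bsub>K.F\<^esub> K.e b \<oplus>\<^bsub>K.F\<^esub> b \<odot>\<^bsub>K.F\<^esub> K.e a)
        \<approx> pderiv3 j (rep a * rep b) - (rep a * pderiv3 j (rep b) + rep b * pderiv3 j (rep a))"
    proof (rule cong_diff)
      show "\<Psi> (pd j) (K.e (a \<otimes>\<^bsub>R\<^esub> b)) \<approx> pderiv3 j (rep a * rep b)"
        by (rule cong_trans[OF gen res_pderiv_cong[OF rep_mult]]) (use 2 in simp_all)
      have s: "\<Psi> (pd j) (a \<odot>\<^bsub>K.F\<^esub> K.e b) \<approx> rep a * pderiv3 j (rep b)" if "a \<in> carrier R" "b \<in> carrier R" for a b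
        by (rule cong_trans[OF \<Psi>_smult cong_mult[OF cong_refl gen]]) (use that e in simp_all)
      show "\<Psi> (pd j) (a \<odot>\<^bsub>K.F\<^esub> K.e b \<oplus>\<^bsub>K.F\<^esub> b \<odot>\<^bsub>K.F\<^esub> K.e a) \<approx> rep a * pderiv3 j (rep b) + rep b * pderiv3 j (rep a)"
        by (rule cong_trans[OF \<Psi>_add cong_add[OF s s]]) (use 2 e in simp_all)
    qed
    finally have c: "\<Psi> (pd j) g \<approx> pderiv3 j (rep a * rep b) - (rep a * pderiv3 j (rep b) + rep b * pderiv3 j (rep a))" .
    have "pderiv3 j (rep a * rep b) - (rep a * pderiv3 j (rep b) + rep b * pderiv3 j (rep a)) = 0"
      unfolding pderiv3_mult by (simp only: mult.commute[of "pderiv3 j (rep a)"] add.commute diff_self)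
    then show ?thesis using c by (simp only:) (rule cong_J[OF _ class_ideal_0[OF J_ideal]])
  next
    case 3
    have "\<Psi> (pd j) g \<approx> pderiv3 j (const3 c)"
      unfolding 3 by (rule cong_trans[OF gen res_pderiv_cong]) (simp add: scalar_def res_rep)
    then show ?thesis unfolding pderiv3_const by (rule cong_J) (rule class_ideal_0[OF J_ideal])
  qed
qed

lemma kaehler_rel_J: "h \<in> kaehler_rel R (range (scalar I)) \<Longrightarrow> \<Psi> (pd j) h \<in> J"
  unfolding K.rel_span by (rule \<Psi>_span[OF K.gens_subset kaehler_gens_J])

text \<open>The coefficient of \<open>dx\<^sub>j\<close>, which is well defined modulo \<open>J\<close>.\<close>

definition cf :: "3 \<Rightarrow> ('k poly3 set \<Rightarrow> 'k poly3 set) set \<Rightarrow> 'k poly3" where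
  "cf j u = \<Psi> (pd j) (SOME g. g \<in> u)"

lemma cf_proj:
  assumes x: "x \<in> carrier K.F"
  shows "cf j (K.q.proj x) \<approx> \<Psi> (pd j) x"
proof -
  have "(SOME g. g \<in> K.q.proj x) \<in> K.q.proj x" 
    by (rule someI[where P = "\<lambda>g. g \<in> K.q.proj x", OF K.q.proj_self[OF x]])
  then obtain n where n: "n \<in> kaehler_rel R (range (scalar I))" "(SOME g. g \<in> K.q.proj x) = n \<oplus>\<^bsub>K.F\<^esub> x"
    using K.q.proj_diff[OF x] by blast
  have "\<Psi> (pd j) (n \<oplus>\<^bsub>K.F\<^esub> x) \<approx> \<Psi> (pd j) n + \<Psi> (pd j) x"
    using n(1) K.q.N_subset x by (intro \<Psi>_add) blast+
  moreover have "\<Psi> (pd j) n + \<Psi> (pd j) x \<approx> 0 + \<Psi> (pd j) x"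
    by (intro cong_add cong_refl cong_0 kaehler_rel_J n)
  ultimately show ?thesis unfolding cf_def n(2) add_0 by (rule cong_trans)
qed

lemma cf_add: "u \<in> carrier K.\<Omega> \<Longrightarrow> v \<in> carrier K.\<Omega> \<Longrightarrow> cf j (u \<oplus>\<^bsub>K.\<Omega>\<^esub> v) \<approx> cf j u + cf j v"
proof -
  assume "u \<in> carrier K.\<Omega>" "v \<in> carrier K.\<Omega>"
  then obtain x y where xy: "x \<in> carrier K.F" "u = K.q.proj x" "y \<in> carrier K.F" "v = K.q.proj y"
    unfolding K.\<Omega>_def using K.q.proj_surj by metis
  have "cf j (u \<oplus>\<^bsub>K.\<Omega>\<^esub> v) \<approx> \<Psi> (pd j) (x \<oplus>\<^bsub>K.F\<^esub> y)"
    unfolding xy K.\<Omega>_def K.q.proj_add[OF xy(1,3)] by (rule cf_proj) (use xy in simp)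
  also have "\<Psi> (pd j) (x \<oplus>\<^bsub>K.F\<^esub> y) \<approx> \<Psi> (pd j) x + \<Psi> (pd j) y" by (rule \<Psi>_add[OF xy(1,3)])
  also have "\<Psi> (pd j) x + \<Psi> (pd j) y \<approx> cf j u + cf j v"
    unfolding xy by (intro cong_add cong_sym[OF cf_proj] xy)
  finally show ?thesis .
qed

lemma cf_smult: "r \<in> carrier R \<Longrightarrow> u \<in> carrier K.\<Omega> \<Longrightarrow> cf j (r \<odot>\<^bsub>K.\<Omega>\<^esub> u) \<approx> rep r * cf j u"
proof -
  assume r: "r \<in> carrier R" and "u \<in> carrier K.\<Omega>"
  then obtain x where x: "x \<in> carrier K.F" "u = K.q.proj x"
    unfolding K.\<Omega>_def using K.q.proj_surj by metis
  have "cf j (r \<odot>\<^bsub>K.\<Omega>\<^esub> u) \<approx> \<Psi> (pd j) (r \<odot>\<^bsub>K.F\<^esub> x)"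
    unfolding x K.\<Omega>_def K.q.proj_smult[OF r x(1)] by (rule cf_proj) (use x r in simp)
  also have "\<Psi> (pd j) (r \<odot>\<^bsub>K.F\<^esub> x) \<approx> rep r * \<Psi> (pd j) x" by (rule \<Psi>_smult[OF r x(1)])
  also have "rep r * \<Psi> (pd j) x \<approx> rep r * cf j u"
    unfolding x by (intro cong_mult cong_refl cong_sym[OF cf_proj] x)
  finally show ?thesis .
qed

lemma cf_d: "cf j (K.d (res f)) \<approx> pderiv3 j f"
proof -
  have "cf j (K.d (res f)) \<approx> \<Psi> (pd j) (K.e (res f))"
    unfolding K.d_proj by (rule cf_proj) (simp add: K.e_closed)
  also have "\<Psi> (pd j) (K.e (res f)) \<approx> pderiv3 j (rep (res f))"
    using \<Psi>_gen[of "pd j"] by (simp add: pd_def)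
  also have "pderiv3 j (rep (res f)) \<approx> pderiv3 j f"
    by (rule res_pderiv_cong) (simp add: res_rep)
  finally show ?thesis .
qed

lemma det3_cong:
  assumes "\<And>j. a j \<approx> a' j" "\<And>j. b j \<approx> b' j" "\<And>j. c j \<approx> c' j"
  shows "det3 a b c \<approx> det3 a' b' c'"
  unfolding det3_def by (intro cong_add cong_diff cong_mult assms)

sublocale E: exterior_power3 R K.\<Omega>
  by (rule exterior_power3.intro[OF K.\<Omega>_module])

text \<open>The coefficient of the product of the three differentials of the variables. It induces a
  map from the exterior power to S/J, and this map bounds the annihilator of the generator from
  above.\<close>

definition dt :: "('k poly3 set \<Rightarrow> 'k poly3 set) set list \<Rightarrow> 'k poly3" where
  "dt xs = det3 (\<lambda>j. cf j (xs ! 0)) (\<lambda>j. cf j (xs ! 1)) (\<lambda>j. cf j (xs ! 2))"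

lemma T_cases:
  assumes "xs \<in> E.T"
  obtains x y z where "xs = [x, y, z]" "x \<in> carrier K.\<Omega>" "y \<in> carrier K.\<Omega>" "z \<in> carrier K.\<Omega>"
proof -
  have "length xs = Suc (Suc (Suc 0))" using assms by (simp add: tuples_def)
  then obtain x y z where "xs = [x, y, z]" by (auto simp: length_Suc_conv)
  then show thesis using that assms by (simp add: tuples_def)
qed

lemma dt_add:
  assumes "xs \<in> E.T" "j < 3" "x \<in> carrier K.\<Omega>" "y \<in> carrier K.\<Omega>"
  shows "dt (xs[j := x \<oplus>\<^bsub>K.\<Omega>\<^esub> y]) \<approx> dt (xs[j := x]) + dt (xs[j := y])"
proof -
  obtain a b c where xs: "xs = [a, b, c]" by (rule T_cases[OF assms(1)])
  note ca = cf_add[OF assms(3,4)]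
  have "j = 0 \<or> j = 1 \<or> j = 2" using assms(2) by auto
  then show ?thesis
  proof (elim disjE)
    assume j: "j = 0"
    have "dt (xs[j := x \<oplus>\<^bsub>K.\<Omega>\<^esub> y]) \<approx> det3 (\<lambda>i. cf i x + cf i y) (\<lambda>i. cf i b) (\<lambda>i. cf i c)"
      unfolding dt_def xs j by (simp add: det3_cong ca)
    then show ?thesis unfolding det3_add dt_def xs j by simp
  next
    assume j: "j = 1"
    have "dt (xs[j := x \<oplus>\<^bsub>K.\<Omega>\<^esub> y]) \<approx> det3 (\<lambda>i. cf i a) (\<lambda>i. cf i x + cf i y) (\<lambda>i. cf i c)"
      unfolding dt_def xs j by (simp add: det3_cong ca)
    then show ?thesis unfolding det3_add dt_def xs j by simp
  next
    assume j: "j = 2"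
    have "dt (xs[j := x \<oplus>\<^bsub>K.\<Omega>\<^esub> y]) \<approx> det3 (\<lambda>i. cf i a) (\<lambda>i. cf i b) (\<lambda>i. cf i x + cf i y)"
      unfolding dt_def xs j by (simp add: det3_cong ca numeral_2_eq_2)
    then show ?thesis unfolding det3_add dt_def xs j by (simp add: numeral_2_eq_2)
  qed
qed

lemma dt_smult:
  assumes "xs \<in> E.T" "j < 3" "r \<in> carrier R" "x \<in> carrier K.\<Omega>"
  shows "dt (xs[j := r \<odot>\<^bsub>K.\<Omega>\<^esub> x]) \<approx> rep r * dt (xs[j := x])"
proof -
  obtain a b c where xs: "xs = [a, b, c]" by (rule T_cases[OF assms(1)])
  note cs = cf_smult[OF assms(3,4)]
  have "j = 0 \<or> j = 1 \<or> j = 2" using assms(2) by auto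
  then show ?thesis
  proof (elim disjE)
    assume j: "j = 0"
    have "dt (xs[j := r \<odot>\<^bsub>K.\<Omega>\<^esub> x]) \<approx> det3 (\<lambda>i. rep r * cf i x) (\<lambda>i. cf i b) (\<lambda>i. cf i c)"
      unfolding dt_def xs j by (simp add: det3_cong cs)
    then show ?thesis unfolding det3_smult dt_def xs j by simp
  next
    assume j: "j = 1"
    have "dt (xs[j := r \<odot>\<^bsub>K.\<Omega>\<^esub> x]) \<approx> det3 (\<lambda>i. cf i a) (\<lambda>i. rep r * cf i x) (\<lambda>i. cf i c)"
      unfolding dt_def xs j by (simp add: det3_cong cs)
    then show ?thesis unfolding det3_smult dt_def xs j by simp
  next
    assume j: "j = 2"
    have "dt (xs[j := r \<odot>\<^bsub>K.\<Omega>\<^esub> x]) \<approx> det3 (\<lambda>i. cf i a) (\<lambda>i. cf i b) (\<lambda>i. rep r * cf i x)"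
      unfolding dt_def xs j by (simp add: det3_cong cs numeral_2_eq_2)
    then show ?thesis unfolding det3_smult dt_def xs j by (simp add: numeral_2_eq_2)
  qed
qed

lemma dt_alt:
  assumes "xs \<in> E.T" "i < j" "j < 3" "xs ! i = xs ! j"
  shows "dt xs = 0"
proof -
  obtain a b c where xs: "xs = [a, b, c]" by (rule T_cases[OF assms(1)])
  have "i = 0 \<and> j = 1 \<or> i = 0 \<and> j = 2 \<or> i = 1 \<and> j = 2" using assms(2,3) by auto
  then have "a = b \<or> a = c \<or> b = c" using assms(4) unfolding xs by (auto simp: numeral_2_eq_2)
  then show ?thesis unfolding dt_def xs by (elim disjE) (simp_all add: det3_alt)
qed

lemma ext_gens_J:
  assumes "g \<in> ext_gens R 3 K.\<Omega>"
  shows "\<Psi> dt g \<in> J"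
proof -
  note e = E.e_closed
  note gen = \<Psi>_gen[of dt]
  note upd = E.T_update
  interpret \<Omega>: module R K.\<Omega> by (rule K.\<Omega>_module)
  consider (1) xs j x y where "xs \<in> E.T" "j < 3" "x \<in> carrier K.\<Omega>" "y \<in> carrier K.\<Omega>"
        "g = E.e (xs[j := x \<oplus>\<^bsub>K.\<Omega>\<^esub> y]) \<ominus>\<^bsub>E.F\<^esub> (E.e (xs[j := x]) \<oplus>\<^bsub>E.F\<^esub> E.e (xs[j := y]))"
    | (2) xs j r x where "xs \<in> E.T" "j < 3" "r \<in> carrier R" "x \<in> carrier K.\<Omega>"
        "g = E.e (xs[j := r \<odot>\<^bsub>K.\<Omega>\<^esub> x]) \<ominus>\<^bsub>E.F\<^esub> r \<odot>\<^bsub>E.F\<^esub> E.e (xs[j := x])"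
    | (3) xs i j where "xs \<in> E.T" "i < j" "j < 3" "xs ! i = xs ! j" "g = E.e xs"
    using assms unfolding ext_gens_def Let_def by (elim UnE CollectE exE conjE) (rule that; assumption)+
  then show ?thesis
  proof cases
    case 1
    have "\<Psi> dt g \<approx> \<Psi> dt (E.e (xs[j := x \<oplus>\<^bsub>K.\<Omega>\<^esub> y])) - \<Psi> dt (E.e (xs[j := x]) \<oplus>\<^bsub>E.F\<^esub> E.e (xs[j := y]))"
      unfolding 1(5) by (rule \<Psi>_minus) (use 1 e upd in simp_all)
    also have "\<Psi> dt (E.e (xs[j := x \<oplus>\<^bsub>K.\<Omega>\<^esub> y])) - \<Psi> dt (E.e (xs[j := x]) \<oplus>\<^bsub>E.F\<^esub> E.e (xs[j := y]))
       \<approx> (dt (xs[j := x]) + dt (xs[j := y])) - (dt (xs[j := x]) + dt (xs[j := y]))"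
    proof (rule cong_diff)
      show "\<Psi> dt (E.e (xs[j := x \<oplus>\<^bsub>K.\<Omega>\<^esub> y])) \<approx> dt (xs[j := x]) + dt (xs[j := y])"
        by (rule cong_trans[OF gen dt_add[OF 1(1-4)]])
      show "\<Psi> dt (E.e (xs[j := x]) \<oplus>\<^bsub>E.F\<^esub> E.e (xs[j := y])) \<approx> dt (xs[j := x]) + dt (xs[j := y])"
        by (rule cong_trans[OF \<Psi>_add cong_add[OF gen gen]]) (use 1 e upd in simp_all)
    qed
    finally show ?thesis unfolding diff_self by (rule cong_J) (rule class_ideal_0[OF J_ideal])
  next
    case 2
    have "\<Psi> dt g \<approx> \<Psi> dt (E.e (xs[j := r \<odot>\<^bsub>K.\<Omega>\<^esub> x])) - \<Psi> dt (r \<odot>\<^bsub>E.F\<^esub> E.e (xs[j := x]))"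
      unfolding 2(5) by (rule \<Psi>_minus) (use 2 e upd in simp_all)
    also have "\<Psi> dt (E.e (xs[j := r \<odot>\<^bsub>K.\<Omega>\<^esub> x])) - \<Psi> dt (r \<odot>\<^bsub>E.F\<^esub> E.e (xs[j := x]))
       \<approx> rep r * dt (xs[j := x]) - rep r * dt (xs[j := x])"
    proof (rule cong_diff)
      show "\<Psi> dt (E.e (xs[j := r \<odot>\<^bsub>K.\<Omega>\<^esub> x])) \<approx> rep r * dt (xs[j := x])"
        by (rule cong_trans[OF gen dt_smult[OF 2(1-4)]])
      show "\<Psi> dt (r \<odot>\<^bsub>E.F\<^esub> E.e (xs[j := x])) \<approx> rep r * dt (xs[j := x])"
        by (rule cong_trans[OF \<Psi>_smult cong_mult[OF cong_refl gen]]) (use 2 e upd in simp_all)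
    qed
    finally show ?thesis unfolding diff_self by (rule cong_J) (rule class_ideal_0[OF J_ideal])
  next
    case 3
    have "\<Psi> dt g \<approx> dt xs" unfolding 3(5) by (rule gen)
    then show ?thesis unfolding dt_alt[OF 3(1-4)] by (rule cong_J) (rule class_ideal_0[OF J_ideal])
  qed
qed

lemma ext_rel_J: "h \<in> ext_rel R 3 K.\<Omega> \<Longrightarrow> \<Psi> dt h \<in> J"
  unfolding E.rel_span by (rule \<Psi>_span[OF E.gens_subset ext_gens_J])

end

section \<open>Dimensions of graded pieces\<close>

context coordinate_ring
begin

lemma scalar_closed: "scalar I c \<in> carrier R"
  by (simp add: scalar_def)

lemma restrict_module:
  assumes "module R M"
  shows "vectorspace (class_ring :: 'k ring) (restrict_scalars (scalar I) M)"
proof -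
  interpret M: module R M by fact
  let ?M = "restrict_scalars (scalar I) M"
  have "module (class_ring :: 'k ring) ?M"
  proof (rule module_criteria[OF class_cring.cring_axioms])
    show "\<forall>v\<in>carrier ?M. \<exists>w\<in>carrier ?M. v \<oplus>\<^bsub>?M\<^esub> w = \<zero>\<^bsub>?M\<^esub>"
      by (auto simp: restrict_scalars_def intro: M.r_neg bexI[of _ "\<ominus>\<^bsub>M\<^esub> _"])
  qed (auto simp: restrict_scalars_def scalar_def const3_add const3_mult res_add res_mult res_1
      M.a_ac M.smult_l_distr M.smult_r_distr M.smult_assoc1)
  then show ?thesis unfolding vectorspace_def using class_field by blast
qed

lemma restrict_submoduleI:
  assumes M: "module R M" and N: "N \<subseteq> carrier M" "\<zero>\<^bsub>M\<^esub> \<in> N"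
    and add: "\<And>x y. x \<in> N \<Longrightarrow> y \<in> N \<Longrightarrow> x \<oplus>\<^bsub>M\<^esub> y \<in> N"
    and smult: "\<And>c x. x \<in> N \<Longrightarrow> scalar I c \<odot>\<^bsub>M\<^esub> x \<in> N"
  shows "submodule (class_ring :: 'k ring) N (restrict_scalars (scalar I) M)"
proof -
  have "module (class_ring :: 'k ring) (restrict_scalars (scalar I) M)"
    using restrict_module[OF M] by (simp only: vectorspace_def)
  then show ?thesis unfolding submodule_def using N add smult by (simp add: restrict_scalars_def)
qed

lemma base_span_subset:
  assumes M: "module R M" and "A \<subseteq> N" and N: "N \<subseteq> carrier M" "\<zero>\<^bsub>M\<^esub> \<in> N"
    and add: "\<And>x y. x \<in> N \<Longrightarrow> y \<in> N \<Longrightarrow> x \<oplus>\<^bsub>M\<^esub> y \<in> N"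
    and smult: "\<And>c x. x \<in> N \<Longrightarrow> scalar I c \<odot>\<^bsub>M\<^esub> x \<in> N"
  shows "base_span (scalar I) M A \<subseteq> N"
proof -
  interpret v: vectorspace "class_ring :: 'k ring" "restrict_scalars (scalar I) M" by (rule restrict_module[OF M])
  show ?thesis unfolding base_span_def
    by (rule v.span_is_subset[OF \<open>A \<subseteq> N\<close> restrict_submoduleI[OF M N add smult]])
qed

lemma base_span_superset:
  assumes M: "module R M" and "A \<subseteq> carrier M"
  shows "A \<subseteq> base_span (scalar I) M A"
proof -
  interpret v: vectorspace "class_ring :: 'k ring" "restrict_scalars (scalar I) M" by (rule restrict_module[OF M])
  show ?thesis unfolding base_span_def
    by (rule v.in_own_span) (simp add: restrict_scalars_def assms(2))
qed

text \<open>Rank-nullity between two notions of vector space: polynomials carry theirs on a whole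
  type, the image lives on a carrier set inside an algebraic module. A basis of the kernel is
  extended to \<open>V\<close>, and the images of the added vectors are shown to be a basis by
  transporting linear combinations.\<close>

lemma base_dim_image:
  assumes M: "module R M" and V: "pv.subspace V" and fin: "finite A" "V \<subseteq> pv.span A"
    and closed: "\<And>f. T f \<in> carrier M"
    and add: "\<And>f g. T (f + g) = T f \<oplus>\<^bsub>M\<^esub> T g"
    and smult: "\<And>c f. T (const3 c * f) = scalar I c \<odot>\<^bsub>M\<^esub> T f"
  shows "base_dim (scalar I) M (T ` V) + pv.dim {f \<in> V. T f = \<zero>\<^bsub>M\<^esub>} = pv.dim V"
proof -
  interpret M: module R M by (rule M)
  let ?K = "class_ring :: 'k ring" and ?M = "restrict_scalars (scalar I) M"
  interpret v: vectorspace ?K ?M by (rule restrict_module[OF M])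
  have T0: "T 0 = \<zero>\<^bsub>M\<^esub>"
  proof -
    have "T 0 \<oplus>\<^bsub>M\<^esub> T 0 = T 0 \<oplus>\<^bsub>M\<^esub> \<zero>\<^bsub>M\<^esub>" using add[of 0 0] closed[of 0] by simp
    then show ?thesis using closed[of 0] by simp
  qed
  have sub: "submodule ?K (T ` V) ?M"
  proof (rule restrict_submoduleI[OF M])
    show "\<zero>\<^bsub>M\<^esub> \<in> T ` V" using T0 pv.subspace_0[OF V] by (metis imageI)
    show "x \<oplus>\<^bsub>M\<^esub> y \<in> T ` V" if "x \<in> T ` V" "y \<in> T ` V" for x y
      using that add pv.subspace_add[OF V] by (metis (no_types, lifting) imageE imageI)
    show "scalar I c \<odot>\<^bsub>M\<^esub> x \<in> T ` V" if "x \<in> T ` V" for c x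
      using that smult pv.subspace_scale[OF V] by (metis (no_types, lifting) imageE imageI)
  qed (use closed in blast)
  let ?W = "?M\<lparr>carrier := T ` V\<rparr>"
  interpret w: vectorspace ?K ?W
    by (rule v.subspace_is_vs) (simp add: subspace_def sub v.vectorspace_axioms)
  let ?N = "{f \<in> V. T f = \<zero>\<^bsub>M\<^esub>}"
  have N: "pv.subspace ?N"
    unfolding pv.subspace_def
    using V T0 by (auto simp: pv.subspace_def add smult M.smult_r_null[OF scalar_closed])
  obtain B0 where B0: "B0 \<subseteq> ?N" "pv.independent B0" "?N \<subseteq> pv.span B0" "card B0 = pv.dim ?N"
    by (rule pv.basis_exists[of ?N])
  obtain B where B: "B0 \<subseteq> B" "B \<subseteq> V" "pv.independent B" "V \<subseteq> pv.span B"
    by (rule pv.maximal_independent_subset_extend[of B0 V]) (use B0 in auto)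
  have finB: "finite B"
    using pv.independent_span_bound[OF fin(1) B(3)] B(2) fin(2) by blast
  have cB: "card B = pv.dim V"
    by (rule pv.basis_card_eq_dim[OF B(2,4,3)])
  let ?B1 = "B - B0"
  have lin: "w.lincomb a (T ` D) = T (\<Sum>b\<in>D. const3 (a (T b)) * b)"
    if "finite D" "inj_on T D" "D \<subseteq> V" for a D
    using that
  proof (induction D rule: finite_induct)
    case empty
    show ?case unfolding w.lincomb_def image_empty w.finsum_empty using T0 by (simp add: restrict_scalars_def)
  next
    case (insert x D)
    have x: "T x \<notin> T ` D" using insert.hyps insert.prems(1) by (simp add: inj_on_def) blast
    have c: "T ` insert x D \<subseteq> carrier ?W" using insert.prems(2) by auto
    have "w.lincomb a (T ` insert x D) = a (T x) \<odot>\<^bsub>?W\<^esub> T x \<oplus>\<^bsub>?W\<^esub> w.lincomb a (T ` D)"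
      unfolding w.lincomb_def image_insert
    proof (rule w.finsum_insert)
      show "(\<lambda>y. a y \<odot>\<^bsub>?W\<^esub> y) \<in> T ` D \<rightarrow> carrier ?W" using c by (intro Pi_I w.smult_closed) auto
      show "a (T x) \<odot>\<^bsub>?W\<^esub> T x \<in> carrier ?W" using c by (intro w.smult_closed) auto
    qed (use insert.hyps x in simp_all)
    also have "\<dots> = T (const3 (a (T x)) * x) \<oplus>\<^bsub>M\<^esub> T (\<Sum>b\<in>D. const3 (a (T b)) * b)"
      using insert by (simp add: restrict_scalars_def smult)
    also have "\<dots> = T (\<Sum>b\<in>insert x D. const3 (a (T b)) * b)"
      unfolding add[symmetric] using insert.hyps by simp
    finally show ?case .
  qed
  have ker: "f = 0" if "f \<in> pv.span ?B1" "T f = \<zero>\<^bsub>M\<^esub>" for f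
  proof -
    have "pv.span ?B1 \<subseteq> V" using B(2) V by (intro pv.span_minimal) auto
    then have "f \<in> ?N" using that by blast
    then have "f \<in> pv.span B0" using B0(3) by blast
    then show ?thesis using pv.independent_Diff_span_Int[OF B(3) _ that(1) B(1)] by blast
  qed
  have Tdiff: "T (f - g) = \<zero>\<^bsub>M\<^esub>" if "T f = T g" for f g
  proof -
    have "T (f - g) \<oplus>\<^bsub>M\<^esub> T g = \<zero>\<^bsub>M\<^esub> \<oplus>\<^bsub>M\<^esub> T g"
      unfolding add[symmetric] using that closed[of g] by simp
    then show ?thesis using closed by (metis M.add.right_cancel M.zero_closed)
  qed
  have inj: "inj_on T ?B1"
  proof (rule inj_onI)
    fix x y assume "x \<in> ?B1" "y \<in> ?B1" "T x = T y"
    then have "x - y = 0" by (intro ker Tdiff pv.span_diff pv.span_base)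
    then show "x = y" by simp
  qed
  have B1V: "?B1 \<subseteq> V" using B(2) by blast
  have basis: "w.basis (T ` ?B1)"
    unfolding w.basis_def
  proof (intro conjI)
    show cB1: "T ` ?B1 \<subseteq> carrier ?W" using B1V by auto
    show "\<not> w.lin_dep (T ` ?B1)"
    proof (rule w.finite_lin_indpt2)
      show "finite (T ` ?B1)" using finB by simp
      show "T ` ?B1 \<subseteq> carrier ?W" by (rule cB1)
      fix a assume "w.lincomb a (T ` ?B1) = \<zero>\<^bsub>?W\<^esub>"
      then have "T (\<Sum>b\<in>?B1. const3 (a (T b)) * b) = \<zero>\<^bsub>M\<^esub>"
        unfolding lin[OF finite_Diff[OF finB] inj B1V] by (simp add: restrict_scalars_def)
      then have "(\<Sum>b\<in>?B1. const3 (a (T b)) * b) = 0"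
        by (intro ker pv.span_sum pv.span_scale pv.span_base)
      then have "a (T b) = 0" if "b \<in> ?B1" for b
        using pv.independentD[OF pv.independent_mono[OF B(3) Diff_subset] finite_Diff[OF finB] subset_refl _ that, of "\<lambda>b. a (T b)"]
        by blast
      then show "\<forall>v\<in>T ` ?B1. a v = \<zero>\<^bsub>?K\<^esub>" by simp
    qed
    show "w.span (T ` ?B1) = carrier ?W"
    proof (rule subset_antisym)
      show "w.span (T ` ?B1) \<subseteq> carrier ?W" by (rule w.span_is_subset2[OF cB1])
      have "T f \<in> w.span (T ` ?B1)" if f: "f \<in> V" for f
      proof -
        have "f \<in> pv.span (B0 \<union> ?B1)" using f B(1,4) by (metis Un_Diff_cancel Un_absorb1 subsetD)
        then obtain g h where gh: "f = g + h" "g \<in> pv.span B0" "h \<in> pv.span ?B1"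
          unfolding pv.span_Un by blast
        have "pv.span B0 \<subseteq> ?N" by (rule pv.span_minimal[OF B0(1) N])
        then have "T g = \<zero>\<^bsub>M\<^esub>" using gh(2) by blast
        then have Tf: "T f = T h" unfolding gh(1) add using closed[of h] by simp
        obtain u where u: "h = (\<Sum>b\<in>?B1. const3 (u b) * b)"
          using gh(3) unfolding pv.span_finite[OF finite_Diff[OF finB]] by blast
        \<comment> \<open>Linear combinations in the image are indexed by image vectors, so the
          coefficients are transported by the inverse of \<open>T\<close> on the added
          vectors.\<close>
        let ?a = "\<lambda>y. u (the_inv_into ?B1 T y)"
        have "(\<Sum>b\<in>?B1. const3 (?a (T b)) * b) = h"
          unfolding u by (rule sum.cong) (simp_all add: the_inv_into_f_f[OF inj])
        then have "w.lincomb ?a (T ` ?B1) = T f"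
          unfolding lin[OF finite_Diff[OF finB] inj B1V] Tf by simp
        then show ?thesis
          unfolding w.span_def using finB by (intro CollectI exI[of _ ?a] exI[of _ "T ` ?B1"]) auto
      qed
      then show "carrier ?W \<subseteq> w.span (T ` ?B1)" by auto
    qed
  qed
  have "base_dim (scalar I) M (T ` V) = card ?B1"
    unfolding base_dim_def using w.dim_basis[OF _ basis] finB card_image[OF inj] by simp
  moreover have "card B = card ?B1 + card B0"
    using card_Diff_subset[OF finite_subset[OF B(1) finB] B(1)] card_mono[OF finB B(1)] by simp
  ultimately show ?thesis using B0(4) cB by simp
qed

end

section \<open>The top exterior power as a quotient of the polynomial ring\<close>

context coordinate_ring
begin

sublocale Ex: module R E.E by (rule E.E_module)

abbreviation dx :: "3 \<Rightarrow> ('k poly3 set \<Rightarrow> 'k poly3 set) set" where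
  "dx j \<equiv> K.d (res (var3 j))"

lemma dx_closed: "dx j \<in> carrier K.\<Omega>"
  by (rule K.d_closed) simp

definition lc :: "(3 \<Rightarrow> 'k poly3) \<Rightarrow> ('k poly3 set \<Rightarrow> 'k poly3 set) set" where
  "lc u = res (u 0) \<odot>\<^bsub>K.\<Omega>\<^esub> dx 0 \<oplus>\<^bsub>K.\<Omega>\<^esub> (res (u 1) \<odot>\<^bsub>K.\<Omega>\<^esub> dx 1 \<oplus>\<^bsub>K.\<Omega>\<^esub> res (u 2) \<odot>\<^bsub>K.\<Omega>\<^esub> dx 2)"

lemma lc_closed: "lc u \<in> carrier K.\<Omega>"
  unfolding lc_def by (intro E.M.a_closed E.M.smult_closed dx_closed res_closed)

lemma lc_add: "lc (\<lambda>j. u j + v j) = lc u \<oplus>\<^bsub>K.\<Omega>\<^esub> lc v"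
proof -
  have c: "res f \<odot>\<^bsub>K.\<Omega>\<^esub> dx j \<in> carrier K.\<Omega>" for f j by (intro E.M.smult_closed dx_closed res_closed)
  show ?thesis
    unfolding lc_def res_add E.M.smult_l_distr[OF res_closed res_closed dx_closed]
    by (simp only: E.M.a_ac c E.M.a_closed)
qed

lemma lc_smult: "lc (\<lambda>j. f * u j) = res f \<odot>\<^bsub>K.\<Omega>\<^esub> lc u"
proof -
  have c: "res f \<odot>\<^bsub>K.\<Omega>\<^esub> dx j \<in> carrier K.\<Omega>" for f j by (intro E.M.smult_closed dx_closed res_closed)
  show ?thesis
    unfolding lc_def res_mult E.M.smult_assoc1[OF res_closed res_closed dx_closed]
    by (simp only: E.M.smult_r_distr c E.M.a_closed res_closed)
qed

lemma res_0_smult: "x \<in> carrier K.\<Omega> \<Longrightarrow> res 0 \<odot>\<^bsub>K.\<Omega>\<^esub> x = \<zero>\<^bsub>K.\<Omega>\<^esub>"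
  unfolding res_0 by (rule E.M.smult_l_null)

lemma res_1_smult: "x \<in> carrier K.\<Omega> \<Longrightarrow> res 1 \<odot>\<^bsub>K.\<Omega>\<^esub> x = x"
  unfolding res_1 by (rule E.M.smult_one)

lemma lc_unit: "lc (\<lambda>i. if i = j then f else 0) = res f \<odot>\<^bsub>K.\<Omega>\<^esub> dx j"
proof -
  have c: "res f \<odot>\<^bsub>K.\<Omega>\<^esub> dx j \<in> carrier K.\<Omega>" for j by (intro E.M.smult_closed dx_closed res_closed)
  have "\<forall>j. lc (\<lambda>i. if i = j then f else 0) = res f \<odot>\<^bsub>K.\<Omega>\<^esub> dx j"
    unfolding all_three lc_def
    by (simp only: three_distinct if_True if_False refl res_0_smult[OF dx_closed] E.M.l_zero E.M.r_zero c
        E.M.zero_closed simp_thms)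
  then show ?thesis by blast
qed

text \<open>Both sides are derivations that vanish on constants, and they agree on the
  variables.\<close>

lemma d_res: "K.d (res g) = lc (\<lambda>j. pderiv3 j g)"
proof (induction g rule: poly3_induct)
  case (const c)
  have "K.d (res (const3 c)) = \<zero>\<^bsub>K.\<Omega>\<^esub>" by (rule K.d_const) (simp add: scalar_def[symmetric])
  also have "\<dots> = lc (\<lambda>j. 0)"
    unfolding lc_def res_0_smult[OF dx_closed] E.M.l_zero[OF E.M.zero_closed] by (rule refl)
  finally show ?case unfolding pderiv3_const .
next
  case (var i)
  have "lc (\<lambda>j. pderiv3 j (var3 i)) = lc (\<lambda>j. if j = i then 1 else 0)"
    unfolding pderiv3_var by (simp only: eq_commute)
  then show ?case unfolding lc_unit res_1_smult[OF dx_closed] by (rule sym)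
next
  case (add f g)
  then show ?case
    unfolding pderiv3_add lc_add res_add K.d_add[OF res_closed res_closed] by (simp only:)
next
  case (mult f g)
  have "lc (\<lambda>j. pderiv3 j (f * g)) = lc (\<lambda>j. f * pderiv3 j g + g * pderiv3 j f)"
    unfolding pderiv3_mult by (simp only: mult.commute add.commute)
  then show ?case
    unfolding lc_add lc_smult mult[symmetric] res_mult K.d_mult[OF res_closed res_closed] by (rule sym)
qed

text \<open>\<open>\<Omega>\<^sup>3\<close> is generated by \<open>\<omega>\<close>, and its annihilator in \<open>S\<close> is \<open>J\<close>.\<close>

definition \<omega> :: "(('k poly3 set \<Rightarrow> 'k poly3 set) set list \<Rightarrow> 'k poly3 set) set" where
  "\<omega> = E.w (dx 0) (dx 1) (dx 2)"

definition \<psi> :: "'k poly3 \<Rightarrow> (('k poly3 set \<Rightarrow> 'k poly3 set) set list \<Rightarrow> 'k poly3 set) set" where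
  "\<psi> f = res f \<odot>\<^bsub>E.E\<^esub> \<omega>"

lemma \<omega>_closed: "\<omega> \<in> carrier E.E"
  unfolding \<omega>_def by (intro E.w_closed dx_closed)

lemma \<psi>_closed: "\<psi> f \<in> carrier E.E"
  unfolding \<psi>_def by (intro Ex.smult_closed \<omega>_closed res_closed)

lemma \<psi>_add: "\<psi> (f + g) = \<psi> f \<oplus>\<^bsub>E.E\<^esub> \<psi> g"
  unfolding \<psi>_def res_add by (rule Ex.smult_l_distr[OF res_closed res_closed \<omega>_closed])

lemma \<psi>_mult: "\<psi> (f * g) = res f \<odot>\<^bsub>E.E\<^esub> \<psi> g"
  unfolding \<psi>_def res_mult by (rule Ex.smult_assoc1[OF res_closed res_closed \<omega>_closed])

lemma \<psi>_0: "\<psi> 0 = \<zero>\<^bsub>E.E\<^esub>"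
  unfolding \<psi>_def res_0 by (rule Ex.smult_l_null[OF \<omega>_closed])

lemma \<psi>_1: "\<psi> 1 = \<omega>"
  unfolding \<psi>_def res_1 by (rule Ex.smult_one[OF \<omega>_closed])

lemma \<psi>_uminus: "\<psi> (- f) = \<ominus>\<^bsub>E.E\<^esub> \<psi> f"
proof -
  have "\<psi> (- f) \<oplus>\<^bsub>E.E\<^esub> \<psi> f = \<zero>\<^bsub>E.E\<^esub>" unfolding \<psi>_add[symmetric] by (simp add: \<psi>_0)
  then show ?thesis by (metis Ex.minus_equality \<psi>_closed)
qed

lemma w_lc:
  assumes "y \<in> carrier K.\<Omega>" "z \<in> carrier K.\<Omega>"
  shows "E.w (lc u) y z = res (u 0) \<odot>\<^bsub>E.E\<^esub> E.w (dx 0) y z \<oplus>\<^bsub>E.E\<^esub>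
      (res (u 1) \<odot>\<^bsub>E.E\<^esub> E.w (dx 1) y z \<oplus>\<^bsub>E.E\<^esub> res (u 2) \<odot>\<^bsub>E.E\<^esub> E.w (dx 2) y z)"
    and "E.w y (lc u) z = res (u 0) \<odot>\<^bsub>E.E\<^esub> E.w y (dx 0) z \<oplus>\<^bsub>E.E\<^esub>
      (res (u 1) \<odot>\<^bsub>E.E\<^esub> E.w y (dx 1) z \<oplus>\<^bsub>E.E\<^esub> res (u 2) \<odot>\<^bsub>E.E\<^esub> E.w y (dx 2) z)"
    and "E.w y z (lc u) = res (u 0) \<odot>\<^bsub>E.E\<^esub> E.w y z (dx 0) \<oplus>\<^bsub>E.E\<^esub>
      (res (u 1) \<odot>\<^bsub>E.E\<^esub> E.w y z (dx 1) \<oplus>\<^bsub>E.E\<^esub> res (u 2) \<odot>\<^bsub>E.E\<^esub> E.w y z (dx 2))"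
  unfolding lc_def
  by (simp_all only: E.w_add E.w_smult assms dx_closed E.M.smult_closed E.M.a_closed res_closed)

text \<open>Terms with a repeated differential vanish, so replacing one factor of
  \<open>\<omega>\<close> reads off one coefficient.\<close>

lemma w_lc_dx:
  "E.w (lc u) (dx 1) (dx 2) = \<psi> (u 0)"
  "E.w (dx 0) (lc u) (dx 2) = \<psi> (u 1)"
  "E.w (dx 0) (dx 1) (lc u) = \<psi> (u 2)"
  unfolding w_lc[OF dx_closed dx_closed] E.w_alt[OF dx_closed dx_closed dx_closed] \<omega>_def[symmetric]
    Ex.smult_r_null[OF res_closed] \<psi>_def[symmetric]
  by (simp_all only: Ex.l_zero Ex.r_zero Ex.zero_closed \<psi>_closed)

lemma w_zero:
  assumes "y \<in> carrier K.\<Omega>" "z \<in> carrier K.\<Omega>"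
  shows "E.w \<zero>\<^bsub>K.\<Omega>\<^esub> y z = \<zero>\<^bsub>E.E\<^esub>" "E.w y \<zero>\<^bsub>K.\<Omega>\<^esub> z = \<zero>\<^bsub>E.E\<^esub>" "E.w y z \<zero>\<^bsub>K.\<Omega>\<^esub> = \<zero>\<^bsub>E.E\<^esub>"
proof -
  have e: "\<zero>\<^bsub>K.\<Omega>\<^esub> = \<zero>\<^bsub>R\<^esub> \<odot>\<^bsub>K.\<Omega>\<^esub> dx 0" by (rule E.M.smult_l_null[OF dx_closed, symmetric])
  show "E.w \<zero>\<^bsub>K.\<Omega>\<^esub> y z = \<zero>\<^bsub>E.E\<^esub>" "E.w y \<zero>\<^bsub>K.\<Omega>\<^esub> z = \<zero>\<^bsub>E.E\<^esub>" "E.w y z \<zero>\<^bsub>K.\<Omega>\<^esub> = \<zero>\<^bsub>E.E\<^esub>"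
    unfolding e by (simp_all only: E.w_smult assms dx_closed R.zero_closed Ex.smult_l_null E.w_closed)
qed

text \<open>Since \<open>g\<close> is zero in the coordinate ring, so is its differential; putting
  it in place of one factor of \<open>\<omega>\<close> leaves a single partial derivative of
  \<open>g\<close>.\<close>

lemma \<psi>_pderiv:
  assumes "g \<in> I"
  shows "\<psi> (pderiv3 j g) = \<zero>\<^bsub>E.E\<^esub>"
proof -
  have "res g = res 0" using assms unfolding res_eq_iff by simp
  then have "lc (\<lambda>j. pderiv3 j g) = lc (\<lambda>j. pderiv3 j 0)" unfolding d_res[symmetric] by simp
  also have "\<dots> = \<zero>\<^bsub>K.\<Omega>\<^esub>"
    unfolding pderiv3_0 lc_def res_0_smult[OF dx_closed] E.M.l_zero[OF E.M.zero_closed] by (rule refl)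
  finally have z: "lc (\<lambda>j. pderiv3 j g) = \<zero>\<^bsub>K.\<Omega>\<^esub>" .
  have "\<forall>j. \<psi> (pderiv3 j g) = \<zero>\<^bsub>E.E\<^esub>"
    unfolding all_three w_lc_dx[of "\<lambda>j. pderiv3 j g", symmetric] z
    by (intro conjI w_zero dx_closed)
  then show ?thesis by blast
qed

text \<open>That \<open>J\<close> annihilates follows from \<open>\<psi>_pderiv\<close>. Conversely,
  the map induced by \<open>dt\<close> sends the multiple of \<open>\<omega>\<close> by
  \<open>f\<close> to \<open>f\<close> times the determinant of the identity matrix, so
  \<open>f\<close> is zero in S/J.\<close>

lemma \<psi>_zero_iff: "\<psi> f = \<zero>\<^bsub>E.E\<^esub> \<longleftrightarrow> f \<in> J"
proof
  assume "f \<in> J"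
  have "ideal {f. \<psi> f = \<zero>\<^bsub>E.E\<^esub>} S"
  proof (rule class_idealI)
    show "0 \<in> {f. \<psi> f = \<zero>\<^bsub>E.E\<^esub>}" by (simp add: \<psi>_0)
    show "a + b \<in> {f. \<psi> f = \<zero>\<^bsub>E.E\<^esub>}" if "a \<in> {f. \<psi> f = \<zero>\<^bsub>E.E\<^esub>}" "b \<in> {f. \<psi> f = \<zero>\<^bsub>E.E\<^esub>}" for a b
      using that by (simp add: \<psi>_add)
    show "r * a \<in> {f. \<psi> f = \<zero>\<^bsub>E.E\<^esub>}" if "a \<in> {f. \<psi> f = \<zero>\<^bsub>E.E\<^esub>}" for r a
      using that by (simp add: \<psi>_mult)
  qed
  moreover have "{pderiv3 j g | j g. g \<in> I} \<subseteq> {f. \<psi> f = \<zero>\<^bsub>E.E\<^esub>}"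
    using \<psi>_pderiv by blast
  ultimately have "J \<subseteq> {f. \<psi> f = \<zero>\<^bsub>E.E\<^esub>}"
    unfolding J_def by (rule class_genideal_minimal)
  then show "\<psi> f = \<zero>\<^bsub>E.E\<^esub>" using \<open>f \<in> J\<close> by blast
next
  let ?xs = "[dx 0, dx 1, dx 2]"
  have T: "?xs \<in> E.T" unfolding E.T_triple by (intro conjI dx_closed)
  have e: "E.e ?xs \<in> carrier E.F" by (rule E.e_closed[OF T])
  assume "\<psi> f = \<zero>\<^bsub>E.E\<^esub>"
  then have "E.q.proj (res f \<odot>\<^bsub>E.F\<^esub> E.e ?xs) = \<zero>\<^bsub>E.q.Q\<^esub>"
    unfolding \<psi>_def \<omega>_def E.w_proj E.E_def E.q.proj_smult[OF res_closed e] .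
  then have "res f \<odot>\<^bsub>E.F\<^esub> E.e ?xs \<in> ext_rel R 3 K.\<Omega>"
    using E.q.proj_zero_iff[OF E.F.smult_closed[OF res_closed e]] by blast
  then have "\<Psi> dt (res f \<odot>\<^bsub>E.F\<^esub> E.e ?xs) \<in> J" by (rule ext_rel_J)
  moreover have "\<Psi> dt (res f \<odot>\<^bsub>E.F\<^esub> E.e ?xs) \<approx> f"
  proof -
    have "\<Psi> dt (res f \<odot>\<^bsub>E.F\<^esub> E.e ?xs) \<approx> rep (res f) * \<Psi> dt (E.e ?xs)"
      by (rule \<Psi>_smult[OF res_closed e])
    also have "rep (res f) * \<Psi> dt (E.e ?xs) \<approx> f * dt ?xs"
      by (rule cong_mult[OF rep_cong \<Psi>_gen])
    also have "f * dt ?xs \<approx> f * det3 (\<lambda>j. pderiv3 j (var3 0)) (\<lambda>j. pderiv3 j (var3 1)) (\<lambda>j. pderiv3 j (var3 2))"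
    proof (rule cong_mult[OF cong_refl])
      have n: "?xs ! 0 = dx 0" "?xs ! 1 = dx 1" "?xs ! 2 = dx 2" by (simp_all add: numeral_2_eq_2)
      show "dt ?xs \<approx> det3 (\<lambda>j. pderiv3 j (var3 0)) (\<lambda>j. pderiv3 j (var3 1)) (\<lambda>j. pderiv3 j (var3 2))"
        unfolding dt_def n by (rule det3_cong) (rule cf_d)+
    qed
    also have "f * det3 (\<lambda>j. pderiv3 j (var3 0)) (\<lambda>j. pderiv3 j (var3 1)) (\<lambda>j. pderiv3 j (var3 2)) = f"
      unfolding det3_def pderiv3_var
      by (simp only: three_distinct if_True if_False refl simp_thms mult_1_right mult_zero_right mult_zero_left
          diff_zero add_0_right)
    finally show ?thesis .
  qed
  ultimately show "f \<in> J" using cong_J[OF cong_sym] by blast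
qed

definition G :: "int \<Rightarrow> (('k poly3 set \<Rightarrow> 'k poly3 set) set list \<Rightarrow> 'k poly3 set) set set" where
  "G m = \<psi> ` forms m"

lemma G_I: "f \<in> forms m \<Longrightarrow> \<psi> f \<in> G m"
  unfolding G_def by (rule imageI)

lemma G_E:
  assumes "x \<in> G m"
  obtains f where "f \<in> forms m" "x = \<psi> f"
  using assms unfolding G_def by (elim imageE)

lemma G_add: "x \<in> G m \<Longrightarrow> y \<in> G m \<Longrightarrow> x \<oplus>\<^bsub>E.E\<^esub> y \<in> G m"
  by (elim G_E) (simp only: \<psi>_add[symmetric] G_I forms_add)

lemma G_smult: "f \<in> forms d \<Longrightarrow> x \<in> G m \<Longrightarrow> res f \<odot>\<^bsub>E.E\<^esub> x \<in> G (d + m)"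
  by (elim G_E) (simp only: \<psi>_mult[symmetric] G_I forms_mult)

lemma G_uminus: "x \<in> G m \<Longrightarrow> \<ominus>\<^bsub>E.E\<^esub> x \<in> G m"
  by (elim G_E) (simp only: \<psi>_uminus[symmetric] G_I forms_uminus)

lemma G_0: "\<zero>\<^bsub>E.E\<^esub> \<in> G m"
  unfolding \<psi>_0[symmetric] by (rule G_I) (rule forms_0)

text \<open>Two adjacent transpositions generate all permutations and only change signs, and
  repeated factors give zero.\<close>

lemma w_dx_G: "E.w (dx i) (dx j) (dx k) \<in> G 0"
proof -
  let ?P = "\<lambda>i j k. E.w (dx i) (dx j) (dx k) \<in> G 0"
  have s12: "?P j i k" if "?P i j k" for i j k
    unfolding E.w_swap12[of "dx i" "dx j" "dx k", OF dx_closed dx_closed dx_closed] by (rule G_uminus[OF that])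
  have s23: "?P i k j" if "?P i j k" for i j k
    unfolding E.w_swap23[of "dx i" "dx j" "dx k", OF dx_closed dx_closed dx_closed] by (rule G_uminus[OF that])
  have p012: "?P 0 1 2" unfolding \<omega>_def[symmetric] \<psi>_1[symmetric] by (rule G_I) (rule forms_1)
  note p102 = s12[OF p012] and p021 = s23[OF p012]
  note p120 = s23[OF p102] and p201 = s12[OF p021]
  note p210 = s12[OF p120]
  have a: "?P i i k" "?P i k i" "?P k i i" for i k
    unfolding E.w_alt[OF dx_closed dx_closed dx_closed] by (rule G_0)+
  have "\<forall>i j k. ?P i j k"
    unfolding all_three by (intro conjI a p012 p102 p021 p120 p201 p210)
  then show ?thesis by blast
qed

lemma w_lc_G:
  assumes u: "\<And>j. u j \<in> forms d" and c: "y \<in> carrier K.\<Omega>" "z \<in> carrier K.\<Omega>"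
  shows "(\<And>j. E.w (dx j) y z \<in> G m) \<Longrightarrow> E.w (lc u) y z \<in> G (d + m)"
    and "(\<And>j. E.w y (dx j) z \<in> G m) \<Longrightarrow> E.w y (lc u) z \<in> G (d + m)"
    and "(\<And>j. E.w y z (dx j) \<in> G m) \<Longrightarrow> E.w y z (lc u) \<in> G (d + m)"
  unfolding w_lc[OF c] by (intro G_add G_smult u; assumption)+

lemma w_lc3_G:
  assumes u: "\<And>j. u j \<in> forms a" and v: "\<And>j. v j \<in> forms b" and t: "\<And>j. t j \<in> forms c"
  shows "E.w (lc u) (lc v) (lc t) \<in> G (a + (b + (c + 0)))"
  by (intro w_lc_G(1)[OF u lc_closed lc_closed] w_lc_G(2)[OF v dx_closed lc_closed]
      w_lc_G(3)[OF t dx_closed dx_closed] w_dx_G)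

lemma Omega1_grade_subset: "Omega1_grade I a \<subseteq> lc ` {u. \<forall>j. u j \<in> forms (a - 1)}"
  unfolding Omega1_grade_def
proof (rule base_span_subset[OF K.\<Omega>_module])
  let ?N = "lc ` {u. \<forall>j. u j \<in> forms (a - 1)}"
  show "{r \<odot>\<^bsub>K.\<Omega>\<^esub> dx j | r j. r \<in> coord_grade I (a - 1)} \<subseteq> ?N"
  proof (intro subsetI)
    fix x assume "x \<in> {r \<odot>\<^bsub>K.\<Omega>\<^esub> dx j | r j. r \<in> coord_grade I (a - 1)}"
    then obtain f j where f: "f \<in> forms (a - 1)" "x = res f \<odot>\<^bsub>K.\<Omega>\<^esub> dx j"
      unfolding coord_grade_def by blast
    show "x \<in> ?N" unfolding f(2) lc_unit[symmetric] by (rule imageI) (simp add: f(1))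
  qed
  show "?N \<subseteq> carrier K.\<Omega>" using lc_closed by blast
  have "lc (\<lambda>j. 0) = \<zero>\<^bsub>K.\<Omega>\<^esub>"
    unfolding lc_def res_0_smult[OF dx_closed] E.M.l_zero[OF E.M.zero_closed] by (rule refl)
  then show "\<zero>\<^bsub>K.\<Omega>\<^esub> \<in> ?N" by (intro image_eqI[of _ _ "\<lambda>j. 0"]) (simp_all only: forms_0 mem_Collect_eq simp_thms)
  show "x \<oplus>\<^bsub>K.\<Omega>\<^esub> y \<in> ?N" if xy: "x \<in> ?N" "y \<in> ?N" for x y
  proof -
    obtain u v where "x = lc u" "y = lc v" "\<forall>j. u j \<in> forms (a - 1)" "\<forall>j. v j \<in> forms (a - 1)"
      using xy by blast
    then show ?thesis
      by (intro image_eqI[of _ _ "\<lambda>j. u j + v j"]) (simp_all add: lc_add forms_add)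
  qed
  show "scalar I c \<odot>\<^bsub>K.\<Omega>\<^esub> x \<in> ?N" if x: "x \<in> ?N" for c x
  proof -
    obtain u where "x = lc u" "\<forall>j. u j \<in> forms (a - 1)" using x by blast
    then show ?thesis
      by (intro image_eqI[of _ _ "\<lambda>j. const3 c * u j"]) (simp_all add: lc_smult scalar_def forms_const_mult)
  qed
qed

lemma Omega1_grade_superset: "f \<in> forms (a - 1) \<Longrightarrow> res f \<odot>\<^bsub>K.\<Omega>\<^esub> dx j \<in> Omega1_grade I a"
proof -
  assume f: "f \<in> forms (a - 1)"
  let ?A = "{r \<odot>\<^bsub>K.\<Omega>\<^esub> dx j | r j. r \<in> coord_grade I (a - 1)}"
  have "?A \<subseteq> carrier K.\<Omega>"
    unfolding coord_grade_def using E.M.smult_closed dx_closed res_closed by blast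
  from base_span_superset[OF K.\<Omega>_module this] show ?thesis
    unfolding Omega1_grade_def coord_grade_def using f by blast
qed

text \<open>Three differentials take up degree 3, so the coefficients contribute i - 3. Conversely
  the whole coefficient is put on the first factor, which then has degree i - 2 next to two factors
  of degree 1.\<close>

lemma Omega3_grade_eq: "Omega3_grade I i = \<psi> ` forms (i - 3)"
proof (rule subset_antisym)
  show "Omega3_grade I i \<subseteq> \<psi> ` forms (i - 3)"
    unfolding Omega3_grade_def
  proof (rule base_span_subset[OF E.E_module])
    show "{E.w u v w | u v w a b c. u \<in> Omega1_grade I a \<and> v \<in> Omega1_grade I b \<and> w \<in> Omega1_grade I c
        \<and> a + b + c = i} \<subseteq> \<psi> ` forms (i - 3)"
    proof (intro subsetI)
      fix x assume "x \<in> {E.w u v w | u v w a b c. u \<in> Omega1_grade I a \<and> v \<in> Omega1_grade I b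
        \<and> w \<in> Omega1_grade I c \<and> a + b + c = i}"
      then obtain u v w a b c where x: "x = E.w u v w" and g: "u \<in> Omega1_grade I a" "v \<in> Omega1_grade I b"
          "w \<in> Omega1_grade I c" and i: "a + b + c = i"
        by (elim CollectE exE conjE)
      obtain u' v' w' where "u = lc u'" "\<forall>j. u' j \<in> forms (a - 1)" "v = lc v'" "\<forall>j. v' j \<in> forms (b - 1)"
          "w = lc w'" "\<forall>j. w' j \<in> forms (c - 1)"
        using subsetD[OF Omega1_grade_subset g(1)] subsetD[OF Omega1_grade_subset g(2)]
          subsetD[OF Omega1_grade_subset g(3)] by (elim imageE CollectE)
      then have "x \<in> G (a - 1 + (b - 1 + (c - 1 + 0)))"
        unfolding x using w_lc3_G[of u' "a - 1" v' "b - 1" w' "c - 1"] by (simp only:)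
      moreover have "a - 1 + (b - 1 + (c - 1 + 0)) = i - 3" using i by simp
      ultimately show "x \<in> \<psi> ` forms (i - 3)" unfolding G_def by (simp only:)
    qed
    show "\<psi> ` forms (i - 3) \<subseteq> carrier E.E" using \<psi>_closed by blast
    show "\<zero>\<^bsub>E.E\<^esub> \<in> \<psi> ` forms (i - 3)" by (rule G_0[unfolded G_def])
    show "x \<oplus>\<^bsub>E.E\<^esub> y \<in> \<psi> ` forms (i - 3)" if "x \<in> \<psi> ` forms (i - 3)" "y \<in> \<psi> ` forms (i - 3)" for x y
      using that by (rule G_add[unfolded G_def])
    show "scalar I c \<odot>\<^bsub>E.E\<^esub> x \<in> \<psi> ` forms (i - 3)" if "x \<in> \<psi> ` forms (i - 3)" for c x
      using G_smult[unfolded G_def, OF forms_const that, of c, folded scalar_def] unfolding add_0 .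
  qed
next
  have c: "{E.w u v w | u v w a b c. u \<in> Omega1_grade I a \<and> v \<in> Omega1_grade I b \<and> w \<in> Omega1_grade I c
        \<and> a + b + c = i} \<subseteq> carrier E.E" (is "?A \<subseteq> _")
  proof (intro subsetI)
    fix x assume "x \<in> ?A"
    then obtain u v w a b c where x: "x = E.w u v w" and g: "u \<in> Omega1_grade I a" "v \<in> Omega1_grade I b"
          "w \<in> Omega1_grade I c"
      by (elim CollectE exE conjE)
    have "y \<in> carrier K.\<Omega>" if "y \<in> Omega1_grade I d" for y d
      using subsetD[OF Omega1_grade_subset that] lc_closed by blast
    from this[OF g(1)] this[OF g(2)] this[OF g(3)] show "x \<in> carrier E.E" unfolding x by (rule E.w_closed)
  qed
  show "\<psi> ` forms (i - 3) \<subseteq> Omega3_grade I i"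
  proof (intro subsetI)
    fix x assume "x \<in> \<psi> ` forms (i - 3)"
    then obtain f where f: "f \<in> forms (i - 3)" "x = \<psi> f" by blast
    have x: "x = E.w (res f \<odot>\<^bsub>K.\<Omega>\<^esub> dx 0) (dx 1) (dx 2)"
      unfolding f(2) \<psi>_def \<omega>_def by (rule E.w_smult(1)[OF dx_closed dx_closed dx_closed res_closed, symmetric])
    have 0: "res f \<odot>\<^bsub>K.\<Omega>\<^esub> dx 0 \<in> Omega1_grade I (i - 2)"
      by (rule Omega1_grade_superset) (use f(1) in \<open>simp add: diff_diff_eq\<close>)
    have 1: "dx j \<in> Omega1_grade I 1" for j
      using Omega1_grade_superset[of 1 1 j] unfolding res_1_smult[OF dx_closed] by simp
    have "i - 2 + 1 + 1 = i" by simp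
    with 0 1 have "x \<in> ?A" unfolding x by blast
    then show "x \<in> Omega3_grade I i"
      unfolding Omega3_grade_def using base_span_superset[OF E.E_module c] by blast
  qed
qed

lemma HF_Omega3_eq: "HF_Omega3 I i + pv.dim (forms (i - 3) \<inter> J) = pv.dim (forms (i - 3) :: 'k poly3 set)"
proof -
  obtain A where A: "finite A" "(forms (i - 3) :: 'k poly3 set) \<subseteq> pv.span A" using forms_fin by blast
  have "{f \<in> forms (i - 3). \<psi> f = \<zero>\<^bsub>E.E\<^esub>} = forms (i - 3) \<inter> J" unfolding \<psi>_zero_iff by blast
  then show ?thesis
    using base_dim_image[OF E.E_module forms_subspace A \<psi>_closed \<psi>_add \<psi>_mult[of "const3 _", folded scalar_def]]
    unfolding HF_Omega3_def Omega3_grade_eq by (simp only:)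
qed

lemma self_module_module: "module R (self_module R)"
proof (rule module_criteria[OF cring_R])
  show "\<forall>v\<in>carrier (self_module R). \<exists>w\<in>carrier (self_module R). v \<oplus>\<^bsub>self_module R\<^esub> w = \<zero>\<^bsub>self_module R\<^esub>"
    by (auto simp: self_module_def intro: R.r_neg bexI[of _ "\<ominus>\<^bsub>R\<^esub> _"])
qed (auto simp: self_module_def R.a_ac R.m_assoc R.l_distr R.r_distr)

lemma HF_coord_eq: "HF_coord I i + pv.dim (forms i \<inter> I) = pv.dim (forms i :: 'k poly3 set)"
proof -
  obtain A where A: "finite A" "(forms i :: 'k poly3 set) \<subseteq> pv.span A" using forms_fin by blast
  have "{f \<in> forms i. res f = \<zero>\<^bsub>self_module R\<^esub>} = forms i \<inter> I"
    using res_0_iff by (auto simp: self_module_def)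
  moreover have "base_dim (scalar I) (self_module R) (res ` forms i) + pv.dim {f \<in> forms i. res f = \<zero>\<^bsub>self_module R\<^esub>}
      = pv.dim (forms i :: 'k poly3 set)"
    by (rule base_dim_image[OF self_module_module forms_subspace A])
      (simp_all add: self_module_def res_add res_mult scalar_def)
  ultimately show ?thesis unfolding HF_coord_def coord_grade_def by (simp only:)
qed

section \<open>Graded pieces of the ideal of derivatives\<close>

lemma hcomp_pderiv: "hcomp d (pderiv3 j f) = pderiv3 j (hcomp (d + 1) f)" for f :: "'k poly3"
proof (induction f rule: poly3_additive_induct)
  case (single m c)
  have s: "Poly_Mapping.single m c \<in> forms (int (mdeg m))" by (simp add: forms_single)
  show ?case
    unfolding hcomp_of_form[OF s] hcomp_of_form[OF pderiv3_forms[OF s]]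
    by (cases "d + 1 = int (mdeg m)") (simp_all add: when_def)
qed (simp_all only: hcomp_0 pderiv3_0 hcomp_add pderiv3_add)

text \<open>For a partial derivative D one has h (D f) = D (h f) - (D h) f, and (D h) f lies in
  \<open>I\<close>, so it is a sum of derivatives by \<open>form_as_derivatives\<close>. Hence the
  spans are stable under products with forms, and the polynomials all of whose components lie in
  them form an ideal.\<close>

lemma J_forms: "forms d \<inter> J = pv.span {pderiv3 j f | j f. f \<in> I \<inter> forms (d + 1)}"
proof (rule subset_antisym)
  let ?D = "\<lambda>d. pv.span {pderiv3 j f | j f. f \<in> I \<inter> forms (d + 1)}"
  have base: "pderiv3 j f \<in> ?D d" if "f \<in> I" "f \<in> forms (d + 1)" for j f d
    using that by (intro pv.span_base) blast
  have ID: "f \<in> ?D d" if f: "f \<in> I" "f \<in> forms d" for f d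
  proof (cases "0 \<le> d")
    case True
    have "const3 (1 / of_int (d + 3)) * (var3 j * f) \<in> forms (0 + (1 + d))" for j
      by (intro forms_mult forms_const forms_var f(2))
    then have v: "const3 (1 / of_int (d + 3)) * (var3 j * f) \<in> forms (d + 1)" for j
      by (simp only: add_0 add.commute)
    show ?thesis
      by (subst form_as_derivatives[OF f(2) True])
        (intro pv.span_sum base class_ideal_mult[OF I] f(1) v)
  next
    case False
    then have "d < 0" by (simp only: not_le)
    then have "f = 0" using f(2) forms_neg by blast
    then show ?thesis using pv.span_zero by (simp only:)
  qed
  let ?M = "{f. \<forall>d. hcomp d f \<in> ?D d}"
  have scale: "h * x \<in> ?D (e + d)" if h: "h \<in> forms e" and x: "x \<in> ?D d" for h x e d
    using x
  proof (induction rule: pv.span_induct_alt)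
    case base
    show ?case using pv.span_zero by (simp only: mult_zero_right)
  next
    case (step c x y)
    then obtain j f where f: "x = pderiv3 j f" "f \<in> I" "f \<in> forms (d + 1)" by blast
    have "h * x = pderiv3 j (h * f) - pderiv3 j h * f" unfolding f(1) pderiv3_mult by (simp only: add_diff_cancel_left')
    moreover have "pderiv3 j (h * f) \<in> ?D (e + d)"
    proof (rule base[OF class_ideal_mult[OF I f(2)]])
      show "h * f \<in> forms (e + d + 1)" using forms_mult[OF h f(3)] by (simp only: add.assoc)
    qed
    moreover have "pderiv3 j h * f \<in> ?D (e + d)"
    proof (rule ID[OF class_ideal_mult[OF I f(2)]])
      have "e - 1 + (d + 1) = e + d" by simp
      then show "pderiv3 j h * f \<in> forms (e + d)" using forms_mult[OF pderiv3_forms[OF h] f(3), of j] by (simp only:)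
    qed
    ultimately have "h * x \<in> ?D (e + d)" by (simp only:) (rule pv.span_diff)
    then have "const3 c * (h * x) + h * y \<in> ?D (e + d)" by (intro pv.span_add pv.span_scale step.IH)
    then show ?case by (simp only: distrib_left mult.left_commute)
  qed
  have "ideal ?M S"
  proof (rule class_idealI)
    show "0 \<in> ?M" by (intro CollectI allI) (simp only: hcomp_0 pv.span_zero)
    show "a + b \<in> ?M" if "a \<in> ?M" "b \<in> ?M" for a b
      using that pv.span_add unfolding mem_Collect_eq hcomp_add by blast
    show "r * a \<in> ?M" if a: "a \<in> ?M" for r a
    proof (intro CollectI allI)
      fix d
      obtain E' where E': "finite E'" "r = (\<Sum>e\<in>E'. hcomp e r)" by (rule hcomp_expand)
      have "hcomp e r * hcomp (d - e) a \<in> ?D (e + (d - e))" for e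
        by (rule scale[OF hcomp_forms]) (use a in blast)
      moreover have "e + (d - e) = d" for e by simp
      ultimately have t: "hcomp (d - e) a * hcomp e r \<in> ?D d" for e by (simp only: mult.commute)
      show "hcomp d (r * a) \<in> ?D d"
        unfolding mult.commute[of r] hcomp_mult[OF E'] by (intro pv.span_sum t)
    qed
  qed
  moreover have "{pderiv3 j f | j f. f \<in> I} \<subseteq> ?M"
  proof (intro subsetI CollectI allI)
    fix x d assume "x \<in> {pderiv3 j f | j f. f \<in> I}"
    then obtain j f where f: "x = pderiv3 j f" "f \<in> I" by blast
    have "hcomp (d + 1) f \<in> I" using hom_I f(2) unfolding homogeneous_def by blast
    then show "hcomp d x \<in> ?D d" unfolding f(1) hcomp_pderiv by (rule base[OF _ hcomp_forms])
  qed
  ultimately have J: "J \<subseteq> ?M" unfolding J_def by (rule class_genideal_minimal)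
  show "forms d \<inter> J \<subseteq> ?D d"
  proof (intro subsetI)
    fix x assume x: "x \<in> forms d \<inter> J"
    then have "hcomp d x \<in> ?D d" using J by blast
    moreover have "hcomp d x = x" using x hcomp_of_form[of x d d] by simp
    ultimately show "x \<in> ?D d" by (simp only:)
  qed
  show "?D d \<subseteq> forms d \<inter> J"
  proof (rule pv.span_minimal)
    show "{pderiv3 j f | j f. f \<in> I \<inter> forms (d + 1)} \<subseteq> forms d \<inter> J"
    proof (intro subsetI IntI)
      fix x assume "x \<in> {pderiv3 j f | j f. f \<in> I \<inter> forms (d + 1)}"
      then obtain j f where f: "x = pderiv3 j f" "f \<in> I" "f \<in> forms (d + 1)" by blast
      show "x \<in> forms d" using pderiv3_forms[OF f(3), of j] unfolding f(1) by simp
      show "x \<in> J" unfolding f(1) by (rule pderiv_J[OF f(2)])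
    qed
    show "pv.subspace (forms d \<inter> J)"
      unfolding pv.subspace_def
      using class_ideal_0[OF J_ideal] class_ideal_add[OF J_ideal] class_ideal_mult[OF J_ideal]
      by (simp add: forms_add forms_const_mult)
  qed
qed

end

section \<open>The correction terms\<close>

text \<open>\<open>gap\<close> as a function of e alone. Its only nonzero values are 1 at -2 and 2
  at -1, and these are the building blocks of the correction terms.\<close>

definition defect :: "int \<Rightarrow> int" where
  "defect e = (if e < 0 then max 0 (e + 3) else 0)"

lemma defect_eq: "defect e = (if e = - 2 then 1 else 0) + (if e = - 1 then 2 else 0)"
  unfolding defect_def by auto

text \<open>As \<open>a\<close> is positive, at most one \<open>k\<close> in the range hits the
  value \<open>c\<close>.\<close>

lemma sum_indicator_linear:
  fixes a x v :: int
  assumes "0 < a"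
  shows "(\<Sum>k\<in>{2..<n}. if x - a * int k = c then v else 0) =
     (if \<exists>k. 2 \<le> k \<and> k \<le> int n - 1 \<and> a * k = x - c then v else 0)"
proof (cases "\<exists>k. 2 \<le> k \<and> k \<le> int n - 1 \<and> a * k = x - c")
  case True
  then obtain k where k: "2 \<le> k" "k \<le> int n - 1" "a * k = x - c" by blast
  define l where "l = nat k"
  have kl: "k = int l" and l: "l \<in> {2..<n}" using k unfolding l_def by auto
  have "x - a * int m = c \<longleftrightarrow> l = m" for m
  proof -
    have "x - a * int m = c \<longleftrightarrow> a * int l = a * int m" using k(3) unfolding kl by linarith
    then show ?thesis using assms by simp
  qed
  then have "(\<Sum>k\<in>{2..<n}. if x - a * int k = c then v else 0) = (\<Sum>k\<in>{2..<n}. if l = k then v else 0)"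
    by simp
  also have "\<dots> = v" using l by simp
  finally show ?thesis using True by simp
next
  case False
  have "x - a * int k \<noteq> c" if "k \<in> {2..<n}" for k
    using False that by (auto dest!: spec[of _ "int k"])
  then have "(\<Sum>k\<in>{2..<n}. if x - a * int k = c then v else 0) = (\<Sum>k\<in>{2..<n}. 0)"
    by (intro sum.cong) auto
  then show ?thesis unfolding if_not_P[OF False] by simp
qed

lemma sum_defect:
  fixes a x :: int
  assumes "0 < a"
  shows "(\<Sum>k\<in>{2..<n}. defect (x - a * int k)) =
     (if \<exists>k. 2 \<le> k \<and> k \<le> int n - 1 \<and> a * k = x + 2 then 1 else 0) +
     (if \<exists>k. 2 \<le> k \<and> k \<le> int n - 1 \<and> a * k = x + 1 then 2 else 0)"
  unfolding defect_eq sum.distrib sum_indicator_linear[OF assms] by simp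

text \<open>With s - 4 = 1 the values e are consecutive, so -2 and -1 can both occur in one sum and
  give 1 + 2 = 3. In the first relevant degree only -2 falls into the range of \<open>k\<close>, and
  for even \<open>n\<close> in the last one only -1. For \<open>n = 2\<close> the range is
  empty.\<close>

lemma sum_defect_5:
  assumes "n \<ge> 2"
  shows "(\<Sum>k\<in>{2..<n}. defect (2 * (i - 2) - 4 * int n - 1 * int k)) = delta5 n i"
proof -
  define N where "N = int n"
  have N: "2 \<le> N" and e: "even n \<longleftrightarrow> even N" and n2: "n = 2 \<longleftrightarrow> N = 2" using assms by (auto simp: N_def)
  have ex: "(\<exists>k. 2 \<le> k \<and> k \<le> N - 1 \<and> 1 * k = z) \<longleftrightarrow> 2 \<le> z \<and> z \<le> N - 1" for z :: int by auto
  let ?x = "2 * (i - 2) - 4 * N"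
  have 0: "(0::int) < 1" by simp
  have main: "(if 2 \<le> ?x + 2 \<and> ?x + 2 \<le> N - 1 then 1 else 0) + (if 2 \<le> ?x + 1 \<and> ?x + 1 \<le> N - 1 then 2 else 0)
    = (if N = 2 then 0 else if i = 2 * N + 2 then 1 else if odd N \<and> 2 * N + 3 \<le> i \<and> i \<le> (5 * N + 1) div 2 then 3
       else if even N \<and> 2 * N + 3 \<le> i \<and> i < (5 * N + 2) div 2 then 3
       else if even N \<and> i = (5 * N + 2) div 2 then 2 else (0::int))"
  proof (cases "even N")
    case True
    then obtain M where M: "N = 2 * M" by (rule evenE)
    have "(2 \<le> ?x + 2 \<and> ?x + 2 \<le> N - 1) = (4 * M + 2 \<le> i \<and> i \<le> 5 * M)"
      "(2 \<le> ?x + 1 \<and> ?x + 1 \<le> N - 1) = (4 * M + 3 \<le> i \<and> i \<le> 5 * M + 1)"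
      "(5 * N + 2) div 2 = 5 * M + 1" "2 * N + 2 = 4 * M + 2" "2 * N + 3 = 4 * M + 3" "(N = 2) = (M = 1)"
      "even N = True"
      unfolding M by auto
    moreover have "1 \<le> M" using N M by simp
    then have "(if 4 * M + 2 \<le> i \<and> i \<le> 5 * M then 1 else 0) + (if 4 * M + 3 \<le> i \<and> i \<le> 5 * M + 1 then 2 else 0)
      = (if M = 1 then 0 else if i = 4 * M + 2 then 1
         else if 4 * M + 3 \<le> i \<and> i < 5 * M + 1 then 3 else if i = 5 * M + 1 then 2 else (0::int))"
      by auto
    ultimately show ?thesis by (simp only: simp_thms if_False)
  next
    case False
    then obtain M where M: "N = 2 * M + 1" by (rule oddE)
    have "(2 \<le> ?x + 2 \<and> ?x + 2 \<le> N - 1) = (4 * M + 4 \<le> i \<and> i \<le> 5 * M + 3)"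
      "(2 \<le> ?x + 1 \<and> ?x + 1 \<le> N - 1) = (4 * M + 5 \<le> i \<and> i \<le> 5 * M + 3)"
      "(5 * N + 1) div 2 = 5 * M + 3" "2 * N + 2 = 4 * M + 4" "2 * N + 3 = 4 * M + 5" "(N = 2) = False"
      "even N = False"
      unfolding M by auto presburger
    moreover have "1 \<le> M" using N M by simp
    then have "(if 4 * M + 4 \<le> i \<and> i \<le> 5 * M + 3 then 1 else 0) + (if 4 * M + 5 \<le> i \<and> i \<le> 5 * M + 3 then 2 else 0)
      = (if i = 4 * M + 4 then 1 else if 4 * M + 5 \<le> i \<and> i \<le> 5 * M + 3 then 3 else (0::int))"
      by auto
    ultimately show ?thesis by (simp only: simp_thms if_False)
  qed
  show ?thesis
    unfolding sum_defect[OF 0] delta5_def Let_def N_def[symmetric] ex e n2 by (rule main)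
qed

text \<open>All values e are even, so only -2 can contribute.\<close>

lemma sum_defect_even:
  assumes s: "even s" "6 \<le> s"
  shows "(\<Sum>k\<in>{2..<n}. defect (2 * (i - 2) - 4 * int n - (int s - 4) * int k)) = delta6 s n i"
proof -
  obtain b where b: "int s = 2 * b + 4" "1 \<le> b"
  proof
    show "int s = 2 * (int s div 2 - 2) + 4" "1 \<le> int s div 2 - 2" using s by presburger+
  qed
  define N where "N = int n"
  have a: "0 < int s - 4" using s(2) by simp
  have 1: "(int s - 4) * k = 2 * (i - 2) - 4 * N + 2 \<longleftrightarrow> i = 2 * N - 2 * k + k * int s div 2 + 1" for k
  proof -
    have "k * int s = 2 * (b * k + 2 * k)" unfolding b(1) by (simp add: algebra_simps)
    then have "k * int s div 2 = b * k + 2 * k" by simp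
    moreover have "(int s - 4) * k = 2 * (b * k)" unfolding b(1) by (simp add: algebra_simps)
    ultimately show ?thesis by presburger
  qed
  have 2: "(int s - 4) * k \<noteq> 2 * (i - 2) - 4 * N + 1" for k
  proof -
    have "(int s - 4) * k = 2 * (b * k)" unfolding b(1) by (simp add: algebra_simps)
    then show ?thesis by presburger
  qed
  show ?thesis
    unfolding sum_defect[OF a] delta6_def Let_def N_def[symmetric] 1
    using s(1) 2 by auto
qed

text \<open>The value -2 requires an even \<open>k\<close> and -1 an odd one; halving
  \<open>k\<close> gives the two ranges in \<open>delta6\<close>.\<close>

lemma sum_defect_odd:
  assumes s: "odd s" "6 \<le> s"
  shows "(\<Sum>k\<in>{2..<n}. defect (2 * (i - 2) - 4 * int n - (int s - 4) * int k)) = delta6 s n i"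
proof -
  define N a where "N = int n" and "a = int s - 4"
  have a: "0 < a" "odd a" "3 \<le> a" using s unfolding a_def by auto presburger
  have s': "(int s + 1) div 2 = (a + 5) div 2" unfolding a_def by simp
  have 1: "(\<exists>k. 2 \<le> k \<and> k \<le> N - 1 \<and> a * k = 2 * (i - 2) - 4 * N + 2) \<longleftrightarrow>
      (\<exists>k. 1 \<le> k \<and> k \<le> (N - 1) div 2 \<and> i = 2 * N + k * a + 1)" (is "?L \<longleftrightarrow> ?R")
  proof
    assume ?L
    then obtain k where k: "2 \<le> k" "k \<le> N - 1" "a * k = 2 * (i - 2) - 4 * N + 2" by blast
    have "even (a * k)" unfolding k(3) by presburger
    then obtain l where l: "k = 2 * l" using a(2) by (auto elim: evenE)
    have "a * k = 2 * (l * a)" unfolding l by simp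
    then have "i = 2 * N + l * a + 1" using k(3) by presburger
    moreover have "1 \<le> l" "l \<le> (N - 1) div 2" using k(1,2) unfolding l by presburger+
    ultimately show ?R by blast
  next
    assume ?R
    then obtain l where l: "1 \<le> l" "l \<le> (N - 1) div 2" "i = 2 * N + l * a + 1" by blast
    have "2 \<le> 2 * l" "2 * l \<le> N - 1" using l(1,2) by presburger+
    moreover have "a * (2 * l) = 2 * (i - 2) - 4 * N + 2" unfolding l(3) by (simp add: algebra_simps)
    ultimately show ?L by blast
  qed
  have 2: "(\<exists>k. 2 \<le> k \<and> k \<le> N - 1 \<and> a * k = 2 * (i - 2) - 4 * N + 1) \<longleftrightarrow>
      (\<exists>k. 1 \<le> k \<and> k \<le> (N - 2) div 2 \<and> i = 2 * N + k * a + (a + 5) div 2 - 1)" (is "?L \<longleftrightarrow> ?R")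
  proof
    assume ?L
    then obtain k where k: "2 \<le> k" "k \<le> N - 1" "a * k = 2 * (i - 2) - 4 * N + 1" by blast
    have "odd (a * k)" unfolding k(3) by presburger
    then obtain l where l: "k = 2 * l + 1" by (auto elim: oddE)
    have "a * k = 2 * (l * a) + a" unfolding l by (simp add: algebra_simps)
    then have "i = 2 * N + l * a + (a + 5) div 2 - 1" using k(3) by presburger
    moreover have "1 \<le> l" "l \<le> (N - 2) div 2" using k(1,2) unfolding l by presburger+
    ultimately show ?R by blast
  next
    assume ?R
    then obtain l where l: "1 \<le> l" "l \<le> (N - 2) div 2" "i = 2 * N + l * a + (a + 5) div 2 - 1" by blast
    have "2 \<le> 2 * l + 1" "2 * l + 1 \<le> N - 1" using l(1,2) by presburger+
    moreover have "a * (2 * l + 1) = 2 * (l * a) + a" by (simp add: algebra_simps)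
    then have "a * (2 * l + 1) = 2 * (i - 2) - 4 * N + 1" using l(3) a(2) by presburger
    ultimately show ?L by blast
  qed
  \<comment> \<open>If both values occurred in one sum, s - 4 >= 3 would divide 1, so the cases of
    \<open>delta6\<close> exclude each other.\<close>
  have 3: "\<not> (\<exists>k. 2 \<le> k \<and> k \<le> N - 1 \<and> a * k = x + 1)"
    if x: "\<exists>k. 2 \<le> k \<and> k \<le> N - 1 \<and> a * k = x + 2" for x
  proof
    assume "\<exists>k. 2 \<le> k \<and> k \<le> N - 1 \<and> a * k = x + 1"
    then obtain l where "a * l = x + 1" by blast
    moreover obtain k where "a * k = x + 2" using x by blast
    ultimately have "a * k - a * l = 1" by simp
    then have "a * (k - l) = 1" unfolding right_diff_distrib .
    then have "a dvd 1" by (metis dvd_triv_left)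
    then show False using a(3) by (simp add: zdvd1_eq)
  qed
  have "(\<Sum>k\<in>{2..<n}. defect (2 * (i - 2) - 4 * N - a * int k)) =
    (if \<exists>k. 1 \<le> k \<and> k \<le> (N - 1) div 2 \<and> i = 2 * N + k * a + 1 then 1
     else if \<exists>k. 1 \<le> k \<and> k \<le> (N - 2) div 2 \<and> i = 2 * N + k * a + (a + 5) div 2 - 1 then 2 else 0)"
    unfolding sum_defect[OF a(1)] N_def[symmetric] using 3[of "2 * (i - 2) - 4 * N"] unfolding 1 2 by auto
  moreover have "even s = False" using s(1) by simp
  ultimately show ?thesis
    unfolding delta6_def Let_def s' N_def[symmetric] a_def[symmetric] by (simp only: simp_thms if_False)
qed

lemma sum_defect_delta:
  assumes "4 \<le> s" "2 \<le> n"
  shows "(\<Sum>k\<in>{2..<n}. defect (2 * (i - 2) - 4 * int n - (int s - 4) * int k)) = delta s n i"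
proof -
  consider "s = 4" | "s = 5" | "6 \<le> s" using assms(1) by linarith
  then show ?thesis
  proof cases
    case 1
    \<comment> \<open>For s = 4 the value e is the same for all \<open>k\<close>, so the sum
      consists of n - 2 equal terms.\<close>
    have "defect (2 * (i - 2) - 4 * int n) = (if i = 2 * int n + 1 then 1 else 0)"
      unfolding defect_eq by presburger
    then show ?thesis using assms(2) unfolding 1 delta_def delta4_def by (simp add: of_nat_diff)
  next
    case 2
    have "int s - 4 = 1" unfolding 2 by simp
    then show ?thesis using sum_defect_5[OF assms(2), of i] unfolding 2 delta_def by simp
  next
    case 3
    then have "delta s n i = delta6 s n i" unfolding delta_def by simp
    then show ?thesis using sum_defect_even[OF _ 3] sum_defect_odd[OF _ 3] by (cases "even s") simp_all
  qed
qed

section \<open>The Hilbert function\<close>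

context conic_points
begin

lemma gap_defect: "gap k m = defect (2 * m - int (k * card \<X>))"
  by (simp add: gap_def defect_def Let_def)

text \<open>One formula covers every degree; the first two cases of the theorem differ in how the
  codimension of \<open>W (n - 1) (i - 3)\<close> in the forms is expressed.\<close>

lemma HF_Omega3_fat:
  assumes n: "2 \<le> n" and B: "minimal_homogeneous_generators (fat_ideal 1 \<X>) B" "finite B"
  shows "int (HF_Omega3 (fat_ideal n \<X>) i) =
    int (pv.dim (forms (i - 3) :: 'k poly3 set)) - int (pv.dim (W (n - 1) (i - 3)))
    + int (gen_count B n i) + delta (card \<X>) n i"
proof -
  interpret cr: coordinate_ring "fat_ideal n \<X>"
    by (rule coordinate_ring.intro[OF fat_ideal_ideal fat_ideal_homogeneous])
  define N where "N = int n"
  have "forms (i - 3) \<inter> cr.J = D n 0 (i - 2)"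
  proof -
    have "i - 3 + 1 = i - 2" by simp
    then show ?thesis unfolding cr.J_forms D_def W_def power_0 mult_1_left by (simp only:)
  qed
  also have "\<dots> = D (n - 1) 1 (i - 4)"
  proof -
    have "Suc (n - 1) = n" "i - 2 - 2 = i - 4" using n by simp_all
    then show ?thesis using D_Suc_0[of "n - 1" "i - 2"] by (simp only:)
  qed
  finally have J: "forms (i - 3) \<inter> cr.J = D (n - 1) 1 (i - 4)" .
  \<comment> \<open>The gaps, renumbered by the order k of vanishing instead of the number of
    shifts. The argument is e = 2 (m - 2 (n - k)) - s k with m = i - 2.\<close>
  define g where "g k = defect (2 * (i - 2) - 4 * N - (int (card \<X>) - 4) * int k)" for k
  have gk: "gap k (i - 4 - 2 * int (n - 1 - k)) = g k" if "k \<le> n - 1" for k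
  proof -
    have e: "int (n - 1 - k) = N - 1 - int k" using that n unfolding N_def by simp
    show ?thesis unfolding gap_defect g_def e by (rule arg_cong[where f = defect]) (simp add: algebra_simps)
  qed
  have "(\<Sum>j\<le>n - 1. gap (n - 1 - j) (i - 4 - 2 * int j)) = (\<Sum>k\<le>n - 1. gap k (i - 4 - 2 * int (n - 1 - k)))"
  proof (rule sum.reindex_bij_witness[of _ "\<lambda>k. n - 1 - k" "\<lambda>k. n - 1 - k"])
    fix k assume "k \<in> {..n - 1}"
    then show "n - 1 - (n - 1 - k) = k" by simp
    then show "gap (n - 1 - k) (i - 4 - 2 * int (n - 1 - (n - 1 - k))) = gap (n - 1 - k) (i - 4 - 2 * int k)"
      by (simp only:)
  qed simp_all
  also have "\<dots> = (\<Sum>k\<le>n - 1. g k)" by (rule sum.cong[OF refl]) (rule gk, simp only: atMost_iff)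
  also have "\<dots> = (\<Sum>k<n. g k)" by (rule sum.cong) (use n in auto)
  \<comment> \<open>The orders 0 and 1 give the two gaps that count generators of degree i + 1 -
    2n.\<close>
  also have "\<dots> = g 0 + g 1 + (\<Sum>k\<in>{2..<n}. g k)"
  proof -
    have "{..<n} = insert 0 (insert 1 {2..<n})" using n by auto
    then show ?thesis by simp
  qed
  also have "g 0 = gap 0 (i + 1 - 2 * N - 3)" unfolding g_def gap_defect by (simp add: algebra_simps)
  also have "g 1 = gap 1 (i + 1 - 2 * N - 1)" unfolding g_def gap_defect by (simp add: algebra_simps)
  also have "(\<Sum>k\<in>{2..<n}. g k) = delta (card \<X>) n i"
    unfolding g_def N_def by (rule sum_defect_delta[OF cardX n])
  finally have S: "(\<Sum>j\<le>n - 1. gap (n - 1 - j) (i - 4 - 2 * int j)) = int (gen_count B n i) + delta (card \<X>) n i"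
    unfolding gen_count_def gen_count_gap[OF B] N_def by (simp only: add.commute)
  have "i - 4 + 1 = i - 3" by simp
  then have "int (pv.dim (W (n - 1) (i - 3))) = int (pv.dim (D (n - 1) 1 (i - 4)))
      + (\<Sum>j\<le>n - 1. gap (n - 1 - j) (i - 4 - 2 * int j))"
    using dim_D[of "n - 1" "i - 4" 0] unfolding One_nat_def by (simp only:)
  then show ?thesis
    using cr.HF_Omega3_eq[of i] unfolding J S by linarith
qed

text \<open>The bound on \<open>i\<close> means s (n - 1) <= 2 (i - 3) + 1, which is the range of
  \<open>codim_W\<close>. With k = n - 1 the codimension s k (k + 1) / 2 is s times n choose
  2.\<close>

lemma HF_Omega3_fat_large:
  assumes n: "2 \<le> n" and B: "minimal_homogeneous_generators (fat_ideal 1 \<X>) B" "finite B"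
    and i: "int (card \<X> * (n - 1) div 2) + 3 \<le> i"
  shows "int (HF_Omega3 (fat_ideal n \<X>) i) =
    int (card \<X> * (n choose 2)) + int (gen_count B n i) + delta (card \<X>) n i"
proof -
  define d where "d = nat (i - 3)"
  have d: "i - 3 = int d" using i unfolding d_def by linarith
  have "card \<X> * (n - 1) div 2 \<le> d" using i unfolding d_def by linarith
  then have "(n - 1) * card \<X> \<le> 2 * d + 1" unfolding mult.commute[of "n - 1"] by linarith
  then have "int ((n - 1) * card \<X>) \<le> 2 * int d + 1" by linarith
  note codim_W[OF this]
  also have "int (card \<X>) * int (n - 1) * (int (n - 1) + 1) = 2 * int (card \<X> * (n choose 2))"
  proof -
    have "even (n * (n - 1))" by (cases n) auto
    then have "2 * (n choose 2) = n * (n - 1)" unfolding choose_two by (rule dvd_mult_div_cancel)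
    then have "card \<X> * (n - 1) * ((n - 1) + 1) = 2 * (card \<X> * (n choose 2))" using n by simp
    from arg_cong[OF this, of int] show ?thesis by (simp only: of_nat_mult of_nat_add of_nat_1 of_nat_numeral)
  qed
  finally show ?thesis
    unfolding HF_Omega3_fat[OF n B] d by (simp only: mult_cancel_left zero_neq_numeral[symmetric] simp_thms)
qed

text \<open>In these degrees 2 (i - 1) < s n, so \<open>W n (i - 1)\<close> has the dimension of
  \<open>W (n - 1) (i - 3)\<close> and the codimension can be read off the Hilbert function of the
  scheme. The term 2i - 1 is dim S_(i-1) - dim S_(i-3).\<close>

lemma HF_Omega3_fat_medium:
  assumes n: "2 \<le> n" and B: "minimal_homogeneous_generators (fat_ideal 1 \<X>) B" "finite B"
    and i: "2 < i" "i < int (card \<X> * (n - 1) div 2) + 3"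
  shows "int (HF_Omega3 (fat_ideal n \<X>) i) =
    int (HF_coord (fat_ideal n \<X>) (i - 1)) - 2 * i + 1 + int (gen_count B n i) + delta (card \<X>) n i"
proof -
  interpret cr: coordinate_ring "fat_ideal n \<X>"
    by (rule coordinate_ring.intro[OF fat_ideal_ideal fat_ideal_homogeneous])
  have "2 * (i - 2) \<le> int K" if "i < int (K div 2) + 3" for K :: nat using that by presburger
  from this[OF i(2)] have "2 * (i - 2) \<le> int (card \<X> * (n - 1))" .
  moreover have "card \<X> * (n - 1) + card \<X> = n * card \<X>"
    using n by (cases n) (simp_all add: algebra_simps)
  then have "int (card \<X> * (n - 1)) + int (card \<X>) = int (n * card \<X>)" by (metis of_nat_add)
  moreover have "2 * (i - 1) - v + 1 \<le> 0" if "2 * (i - 2) \<le> u" "u + c = v" "4 \<le> c" for u v c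
    using that by presburger
  moreover have "4 \<le> int (card \<X>)" using cardX by simp
  ultimately have "2 * (i - 1) - int (n * card \<X>) + 1 \<le> 0" by blast
  then have "max 0 (2 * (i - 1) - int (n * card \<X>) + 1) = 0" by (rule max_absorb1)
  moreover have "i - 1 - 2 = i - 3" "0 \<le> i - 1" using i(1) by simp_all
  ultimately have W: "int (pv.dim (W n (i - 1))) = int (pv.dim (W (n - 1) (i - 3)))"
    using dim_W_int[of "i - 1" n] by (simp only: add_0_right)
  define d where "d = nat (i - 1)"
  have d: "int d = i - 1" "i - 1 - 2 = i - 3" using i(1) unfolding d_def by linarith+
  have F: "int (pv.dim (forms (i - 1) :: 'k poly3 set)) = int (pv.dim (forms (i - 3) :: 'k poly3 set)) + 2 * (i - 1) + 1"
    using dim_forms_step[of d] unfolding d .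
  have w: "forms (i - 1) \<inter> fat_ideal n \<X> = W n (i - 1)" unfolding W_def by blast
  have "int (HF_coord (fat_ideal n \<X>) (i - 1)) + int (pv.dim (W n (i - 1))) = int (pv.dim (forms (i - 1) :: 'k poly3 set))"
    using cr.HF_coord_eq[of "i - 1"] unfolding w of_nat_add[symmetric] by (simp only:)
  moreover have "f - v + g + e = h - 2 * i + 1 + g + e" if "h + v = f + 2 * (i - 1) + 1" for f g h v e
    using that by presburger
  ultimately show ?thesis unfolding HF_Omega3_fat[OF n B] W F by blast
qed

lemma HF_Omega3_fat_small:
  assumes "i \<le> 2"
  shows "HF_Omega3 (fat_ideal n \<X>) i = 0"
proof -
  interpret cr: coordinate_ring "fat_ideal n \<X>"
    by (rule coordinate_ring.intro[OF fat_ideal_ideal fat_ideal_homogeneous])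
  have "i - 3 < 0" using assms by simp
  then have "(forms (i - 3) :: 'k poly3 set) = {0}" by (rule forms_neg)
  then have "pv.dim (forms (i - 3) :: 'k poly3 set) = 0" using pv_dim_0 by (simp only:)
  then show ?thesis using cr.HF_Omega3_eq[of i] by simp
qed

end

theorem proposition9p7:
  fixes \<X> :: "(3 \<Rightarrow> 'k::field_char_0) set set"
    and C :: "'k poly3" and G :: "nat \<Rightarrow> 'k poly3"
    and s \<nu> t :: nat and d :: "nat \<Rightarrow> nat" and B\<^sub>1 :: "'k poly3 set" and i :: int
  assumes "s \<ge> 4" and "\<nu> \<ge> 2"
    and "\<X> \<subseteq> proj_plane" and "finite \<X>" and "card \<X> = s"
    and "\<forall>P\<in>\<X>. \<forall>v\<in>P. v 0 \<noteq> 0"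
    and "nonsingular_conic C" and "\<forall>P\<in>\<X>. vanishes_at C P"
    and "B\<^sub>1 = insert C (G ` {1..t})" and "inj_on G {1..t}" and "C \<notin> G ` {1..t}"
    and "minimal_homogeneous_generators (fat_ideal 1 \<X>) B\<^sub>1"
    and "\<forall>j\<in>{1..t}. d j = pdeg (G j)"
    and "\<forall>j\<in>{1..t}. \<forall>k\<in>{1..t}. j \<le> k \<longrightarrow> d j \<le> d k"
  shows "int (HF_Omega3 (fat_ideal \<nu> \<X>) i) =
    (if i \<ge> int (s * (\<nu> - 1) div 2) + 3
       then int (s * (\<nu> choose 2)) + int (gen_count B\<^sub>1 \<nu> i) + delta s \<nu> i
     else if 2 < i
       then int (HF_coord (fat_ideal \<nu> \<X>) (i - 1)) - 2 * i + 1 + int (gen_count B\<^sub>1 \<nu> i) + delta s \<nu> i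
     else 0)"
proof -
  have "\<X> \<noteq> {}" using assms(1,5) by auto
  then obtain q y \<tau> where q: "\<And>j. degree (q j) \<le> 2" "psubst (\<lambda>c. [:c:]) q C = 0"
    "\<And>i. i \<le> 2 \<Longrightarrow> (\<Sum>j\<in>UNIV. Polynomial.smult (y i j) (psubst (\<lambda>c. [:c:]) q (pderiv3 j C))) = monom 1 i"
    "\<And>P. P \<in> \<X> \<Longrightarrow> (\<lambda>j. poly (q j) (\<tau> P)) \<in> P"
    by (rule conic_parametrization[OF assms(7,3,4) _ assms(6,8)]) blast
  interpret conic_points C \<X> q y \<tau>
  proof
    show "C \<in> forms 2" using assms(7) by (simp add: nonsingular_conic_def)
    show "4 \<le> card \<X>" using assms(1,5) by simp
  qed (use assms(3,4,8) q in blast)+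
  have B: "minimal_homogeneous_generators (fat_ideal 1 \<X>) B\<^sub>1" "finite B\<^sub>1"
    using assms(9,12) by simp_all
  show ?thesis
    using HF_Omega3_fat_large[OF assms(2) B, of i] HF_Omega3_fat_medium[OF assms(2) B, of i]
      HF_Omega3_fat_small[of i \<nu>]
    unfolding assms(5) by simp
qed

end
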